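(* Assume the cyclic formality conjecture (CF) formulated in the context: for every smooth manifold $M$ there exists a natural $\mathbb{C}[[u]]$-linear quasi-isomorphism of $L_\infty$ modules over $\mathfrak{g}_S^\bullet(M)$ $$\phi: CC_\bullet^-(C^\infty(M))\to(\Omega^\bullet(M)[[u]],\,ud)$$ with $\phi_0=\mu$. Let $M$ be a smooth manifold, let $\pi$ be a formal Poisson structure on $M$, and let $A(\pi)=(C^\infty(M)[[t]],*_\pi)$ be the associated deformed algebra over $\mathbb{C}[[t]]$. Then the space of continuous $\mathbb{C}[[t]]$-valued traces on $A(\pi)$ (continuous $\mathbb{C}[[t]]$-linear maps $\tau:A(\pi)\to\mathbb{C}[[t]]$ with $\tau(a*_\pi b)=\tau(b*_\pi a)$ for all $a,b$) is isomorphic to the space of continuous $\mathbb{C}[[t]]$-linear $\mathbb{C}[[t]]$-valued functionals on $C^\infty(M)[[t]]$ which annihilate all Poisson brackets $\{f,g\}_\pi=\langle\pi,df\wedge dg\rangle$, $f,g\in C^\infty(M)$.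
   Context: $C^\infty(M)$ denotes complex-valued smooth functions, $T$ the tangent bundle, $\Omega^\bullet(M)$ differential forms; $t$ and $u$ are formal variables. Continuity refers to the natural topology on $C^\infty(M)[[t]]$ (coming from the Fréchet topology of $C^\infty(M)$ and formal power series in $t$) and likewise on $\mathbb{C}[[t]]$. **Multivector fields.** $\mathfrak{g}_S^\bullet(M)=\Gamma(M,\wedge^{\bullet+1}T)$ is the differential graded (dg) Lie algebra with zero differential and the Schouten–Nijenhuis bracket $[\,,]_S$. This is the unique bilinear operation making $\Gamma(M,\wedge^{\bullet+1}T)$ a graded Lie algebra and such that: $[X,\pi]_S=L_X\pi$ for vector fields $X$; $[f,g]_S=0$ for functions $f,g$; and $[\pi,\varphi\wedge\psi]_S=[\pi,\varphi]_S\wedge\psi+(-1)^{|\pi|(|\varphi|+1)}\varphi\wedge[\pi,\psi]_S$, where $|\pi|=n-1$ for $\pi\in\Gamma(M,\wedge^nT)$. A formal Poisson structure is a series $\pi=\sum_{m\ge0}t^{m+1}\pi_m$ with $\pi_m\in\Gamma(M,\wedge^2T)$ and $[\pi,\pi]_S=0$. For $\pi\in\Gamma(M,\wedge^dT)$ let $i_\pi:\Omega^\bullet(M)\to\Omega^{\bullet-d}(M)$ be contraction and $L_\pi=[d,i_\pi]$ (graded commutator). The operators $L_\pi$ make $(\Omega^\bullet(M)[[u]],ud)$ a dg module over $\mathfrak{g}_S^\bullet(M)$. **Hochschild cochains.** For a unital $k$-algebra $A$, let $\overline A=A/k1$, $C^n(A,A)=\mathrm{Hom}(\overline A^{\otimes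 n},A)$ (only multidifferential maps if $A=C^\infty(M)$), and $\mathfrak{g}_G^\bullet(A)=C^{\bullet+1}(A,A)$. For $D\in C^n(A,A)$, $E\in C^m(A,A)$ put $$(D\circ E)(a_1,\dots,a_{n+m-1})=\sum_{j=0}^{n-1}(-1)^{(m-1)j}D(a_1,\dots,a_j,E(a_{j+1},\dots,a_{j+m}),\dots),$$ $[D,E]_G=D\circ E-(-1)^{(n-1)(m-1)}E\circ D$. With $m(a,b)=ab$ and $\delta=[m,\cdot]_G$, $\mathfrak{g}_G^\bullet(A)$ is a dg Lie algebra. **Hochschild and cyclic chains.** $C_n(A,A)=A\otimes\overline A^{\otimes n}$, $$b(a_0\otimes\cdots\otimes a_n)=(-1)^na_na_0\otimes a_1\otimes\cdots\otimes a_{n-1}+\sum_{i=0}^{n-1}(-1)^ia_0\otimes\cdots\otimes a_ia_{i+1}\otimes\cdots\otimes a_n,$$ $$B(a_0\otimes\cdots\otimes a_n)=\sum_{i=0}^n(-1)^{ni}\,1\otimes a_i\otimes\cdots\otimes a_n\otimes a_0\otimes\cdots\otimes a_{i-1},$$ and $CC^-_\bullet(A)=(C_\bullet(A,A)[[u]],b+uB)$ with $u$ of homological degree $-2$. For $A=C^\infty(M)$, $A^{\otimes(n+1)}$ means one of $C^\infty(M^{n+1})$, germs of smooth functions on $M^{n+1}$ at the diagonal, or jets at the diagonal (fix one choice), and $A\otimes\overline A^{\otimes n}$ is defined accordingly. For $D\in C^d(A,A)$ put $$L_D(a_0\otimes\cdots\otimes a_n)=\sum_{i=0}^{n-d}(-1)^{(d-1)(i+1)}a_0\otimes\cdots\otimes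 a_i\otimes D(a_{i+1},\dots,a_{i+d})\otimes\cdots\otimes a_n+\sum_{j=n-d+1}^{n}(-1)^{n(j+1)}D(a_{j+1},\dots,a_n,a_0,\dots)\otimes a_{d+j-n}\otimes\cdots\otimes a_j.$$ The operators $L_D$ make $CC_\bullet^-(A)$ a dg module over $\mathfrak{g}_G^\bullet(A)$ (chains and forms of degree $n$ are placed in cohomological degree $-n$). Connes' quasi-isomorphism $\mu:CC_\bullet^-(C^\infty(M))\to(\Omega^\bullet(M)[[u]],ud)$ is the $\mathbb{C}[[u]]$-linear map $\mu(a_0\otimes\cdots\otimes a_n)=\frac1{n!}a_0\,da_1\cdots da_n$. **$L_\infty$ notions.** A dg Lie algebra $\mathfrak{g}^\bullet$ is encoded by a degree $1$, square-zero coderivation of the cofree cocommutative coalgebra $S(\mathfrak{g}^\bullet[1])$. An $L_\infty$ morphism $f:\mathfrak{g}^\bullet\to\mathfrak{h}^\bullet$ is a morphism of dg coalgebras $S(\mathfrak{g}^\bullet[1])\to S(\mathfrak{h}^\bullet[1])$; it is given by components $f_n:\wedge^n\mathfrak{g}^\bullet\to\mathfrak{h}^\bullet$ of degree $1-n$, $n\ge1$, and is a quasi-isomorphism if $f_1$ is. An $L_\infty$ module over $\mathfrak{g}^\bullet$ is a graded space $N^\bullet$ with a degree $1$ square-zero coderivation of the comodule $S(\mathfrak{g}^\bullet[1])\otimes N^\bullet$; equivalently, a differential $\delta_N$ on $N^\bullet$ and an $L_\infty$ morphism from $\mathfrak{g}^\bullet$ to the dg Lie algebra $\mathrm{Hom}(N^\bullet,N^\bullet)$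 with differential $[\delta_N,\cdot]$. A morphism of $L_\infty$ modules $\varphi:N^\bullet\to P^\bullet$ is a morphism of dg comodules $S(\mathfrak{g}^\bullet[1])\otimes N^\bullet\to S(\mathfrak{g}^\bullet[1])\otimes P^\bullet$; it has components $\varphi_n:\wedge^n\mathfrak{g}^\bullet\otimes N^\bullet\to P^\bullet$ of degree $-n$, $n\ge0$, and is a quasi-isomorphism if $\varphi_0$ is. **Kontsevich's theorem and star products.** By Kontsevich's theorem there is a natural $L_\infty$ quasi-isomorphism $K:\mathfrak{g}_S^\bullet(M)\to\mathfrak{g}_G^\bullet(C^\infty(M))$ with $K_1(\pi)(a_1,\dots,a_n)=\langle\pi,da_1\cdots da_n\rangle$; it is fixed. A star product on $C^\infty(M)$ is an associative $\mathbb{C}[[t]]$-bilinear product $a*b=ab+\sum_{m\ge1}t^mP_m(a,b)$ on $C^\infty(M)[[t]]$ with unit $1$ and $P_m$ bidifferential operators; an isomorphism of star products is a series $T=\mathrm{Id}+\sum_{m\ge1}t^mT_m$, with $T_m$ differential operators, intertwining the products. For a formal Poisson structure $\pi$, $*_\pi$ denotes a star product in the isomorphism class of $a*b=ab+\Pi(a,b)$, $\Pi=\sum_{n\ge1}\frac1{n!}K_n(\pi,\dots,\pi)$, and $A(\pi)=(C^\infty(M)[[t]],*_\pi)$. **Conjecture (CF).** Via $K$, $CC_\bullet^-(C^\infty(M))$ becomes an $L_\infty$ module over $\mathfrak{g}_S^\bullet(M)$ (compose $K$ with $D\mapsto L_D$). (CF) states: there exists a natural $\mathbb{C}[[u]]$-linear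 quasi-isomorphism $\phi:CC_\bullet^-(C^\infty(M))\to(\Omega^\bullet(M)[[u]],ud)$ of $L_\infty$ modules over $\mathfrak{g}_S^\bullet(M)$ such that $\phi_0=\mu$.
   Formalization: L_π on forms is taken as the graded commutator [i_π,d] instead of [d,i_π] (a sign for bivectors and functions), since with [d,i_π] the conjecture (CF) is false: on a function f it would give a_0 df = −a_0 df; ⟨π,da_1…da_n⟩ is normalised as i_π(da_1…da_n)/n!. *)

theory Defs
  imports "HOL-Analysis.Analysis" "HOL-Library.Function_Algebras"
    "HOL-Computational_Algebra.Formal_Power_Series"
begin

section \<open>Complex vector spaces of functions\<close>

class complex_vec = ab_group_add +
  fixes cscale :: "complex \<Rightarrow> 'a \<Rightarrow> 'a"  (infixr "*\<^sub>C" 75)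
  assumes cscale_add_right: "r *\<^sub>C (x + y) = r *\<^sub>C x + r *\<^sub>C y"
    and cscale_add_left: "(r + s) *\<^sub>C x = r *\<^sub>C x + s *\<^sub>C x"
    and cscale_cscale: "r *\<^sub>C (s *\<^sub>C x) = (r * s) *\<^sub>C x"
    and cscale_one: "1 *\<^sub>C x = x"

instantiation complex :: complex_vec
begin
definition cscale_complex :: "complex \<Rightarrow> complex \<Rightarrow> complex"
  where "cscale_complex r x = r * x"
instance
  by standard (simp_all add: cscale_complex_def algebra_simps)
end

instantiation "fun" :: (type, complex_vec) complex_vec
begin
definition cscale_fun :: "complex \<Rightarrow> ('a \<Rightarrow> 'b) \<Rightarrow> 'a \<Rightarrow> 'b"
  where "cscale_fun r f = (\<lambda>x. r *\<^sub>C f x)"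
instance
  by standard (simp_all add: cscale_fun_def fun_eq_iff cscale_add_right cscale_add_left
      cscale_cscale cscale_one)
end

definition clinear_on :: "'x::complex_vec set \<Rightarrow> ('x \<Rightarrow> 'y::complex_vec) \<Rightarrow> bool"
  where "clinear_on V f \<longleftrightarrow> (\<forall>x\<in>V. \<forall>y\<in>V. \<forall>r. f (r *\<^sub>C x + y) = r *\<^sub>C f x + f y)"


section \<open>Smooth functions of finitely many real variables\<close>

text \<open>Points of \<open>\<real>\<^sup>I\<close> are elements of \<open>topspace (powertop_real I)\<close>, i.e. extensional functions
  on the finite index set \<open>I\<close>.\<close>

definition coord_deriv :: "'i \<Rightarrow> (('i \<Rightarrow> real) \<Rightarrow> 'b::real_normed_vector) \<Rightarrow> ('i \<Rightarrow> real) \<Rightarrow> 'b"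
  where "coord_deriv i g x = vector_derivative (\<lambda>s. g (x(i := s))) (at (x i))"

fun Ck_on :: "nat \<Rightarrow> 'i set \<Rightarrow> ('i \<Rightarrow> real) set \<Rightarrow> (('i \<Rightarrow> real) \<Rightarrow> 'b::real_normed_vector) \<Rightarrow> bool"
  where
    "Ck_on 0 I S g \<longleftrightarrow> continuous_map (subtopology (powertop_real I) S) euclidean g"
  | "Ck_on (Suc k) I S g \<longleftrightarrow>
      continuous_map (subtopology (powertop_real I) S) euclidean g \<and>
      (\<forall>i\<in>I. (\<forall>x\<in>S. (\<lambda>s. g (x(i := s))) differentiable (at (x i))) \<and>
             Ck_on k I S (coord_deriv i g))"

definition smooth_on :: "'i set \<Rightarrow> ('i \<Rightarrow> real) set \<Rightarrow> (('i \<Rightarrow> real) \<Rightarrow> 'b::real_normed_vector) \<Rightarrow> bool"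
  where "smooth_on I S g \<longleftrightarrow> (\<forall>k. Ck_on k I S g)"


section \<open>Smooth manifolds\<close>

type_synonym 'a chart = "'a set \<times> ('a \<Rightarrow> nat \<Rightarrow> real)"

record 'a manifold =
  mtop :: "'a topology"
  mdim :: nat
  atlas :: "'a chart set"

abbreviation pts :: "'a manifold \<Rightarrow> 'a set"
  where "pts M \<equiv> topspace (mtop M)"

definition chart_inv :: "'a chart \<Rightarrow> (nat \<Rightarrow> real) \<Rightarrow> 'a"
  where "chart_inv c = inv_into (fst c) (snd c)"

definition smooth_manifold :: "'a manifold \<Rightarrow> bool"
  where "smooth_manifold M \<longleftrightarrow>
    Hausdorff_space (mtop M) \<and> second_countable (mtop M) \<and>
    (\<forall>c\<in>atlas M.
       openin (mtop M) (fst c) \<and>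
       openin (powertop_real {..<mdim M}) (snd c ` fst c) \<and>
       homeomorphic_map (subtopology (mtop M) (fst c))
         (subtopology (powertop_real {..<mdim M}) (snd c ` fst c)) (snd c)) \<and>
    (\<Union>c\<in>atlas M. fst c) = pts M \<and>
    (\<forall>c\<in>atlas M. \<forall>c'\<in>atlas M. \<forall>i<mdim M.
       smooth_on {..<mdim M} (snd c ` (fst c \<inter> fst c')) (\<lambda>x. snd c' (chart_inv c x) i))"

text \<open>\<open>cpd c i f p\<close> is \<open>\<partial>f/\<partial>x\<^sup>i\<close> at \<open>p\<close> in the chart \<open>c\<close>; \<open>jacobian c c' i j p\<close> is
  \<open>\<partial>x'\<^sup>i/\<partial>x\<^sup>j\<close> at \<open>p\<close>, where \<open>x\<close>, \<open>x'\<close> are the coordinates of \<open>c\<close>, \<open>c'\<close>.\<close>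

definition cpd :: "'a chart \<Rightarrow> nat \<Rightarrow> ('a \<Rightarrow> 'b::real_normed_vector) \<Rightarrow> 'a \<Rightarrow> 'b"
  where "cpd c i f p = coord_deriv i (\<lambda>x. f (chart_inv c x)) (snd c p)"

definition jacobian :: "'a chart \<Rightarrow> 'a chart \<Rightarrow> nat \<Rightarrow> nat \<Rightarrow> 'a \<Rightarrow> complex"
  where "jacobian c c' i j p = complex_of_real (cpd c j (\<lambda>q. snd c' q i) p)"


section \<open>Smooth functions on \<open>U\<close> and on \<open>U\<^sup>n\<close>\<close>

text \<open>Throughout, \<open>U\<close> is an open subset of \<open>M\<close>. Functions on \<open>U\<close> (on \<open>U\<^sup>n\<close>) are represented by
  functions that vanish outside \<open>U\<close> (outside the lists of length \<open>n\<close> with entries in \<open>U\<close>), so that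
  equality of functions is equality in HOL.\<close>

definition smooth_funs :: "'a manifold \<Rightarrow> 'a set \<Rightarrow> ('a \<Rightarrow> complex) set"
  where "smooth_funs M U = {f. (\<forall>p. p \<notin> U \<longrightarrow> f p = 0) \<and>
    (\<forall>c\<in>atlas M. smooth_on {..<mdim M} (snd c ` (fst c \<inter> U)) (\<lambda>x. f (chart_inv c x)))}"

text \<open>On a product of \<open>n\<close> charts the coordinates are indexed by pairs (slot, coordinate).\<close>

definition slot :: "nat \<Rightarrow> nat \<Rightarrow> (nat \<times> nat \<Rightarrow> real) \<Rightarrow> nat \<Rightarrow> real"
  where "slot m k y = restrict (\<lambda>i. y (k, i)) {..<m}"

definition smooth_funs_pow :: "'a manifold \<Rightarrow> 'a set \<Rightarrow> nat \<Rightarrow> ('a list \<Rightarrow> complex) set"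
  where "smooth_funs_pow M U n = {F.
    (\<forall>xs. \<not> (length xs = n \<and> set xs \<subseteq> U) \<longrightarrow> F xs = 0) \<and>
    (\<forall>cs. length cs = n \<and> set cs \<subseteq> atlas M \<longrightarrow>
       smooth_on ({..<n} \<times> {..<mdim M})
         {y \<in> extensional ({..<n} \<times> {..<mdim M}).
            \<forall>k<n. slot (mdim M) k y \<in> snd (cs ! k) ` (fst (cs ! k) \<inter> U)}
         (\<lambda>y. F (map (\<lambda>k. chart_inv (cs ! k) (slot (mdim M) k y)) [0..<n])))}"

definition tens :: "('a \<Rightarrow> complex) list \<Rightarrow> 'a list \<Rightarrow> complex"
  where "tens fs xs = (if length xs = length fs then \<Prod>i<length fs. (fs ! i) (xs ! i) else 0)"

definition indep_of :: "'a set \<Rightarrow> nat \<Rightarrow> nat \<Rightarrow> ('a list \<Rightarrow> complex) \<Rightarrow> bool"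
  where "indep_of U n i F \<longleftrightarrow>
    (\<forall>xs y. length xs = n \<and> set xs \<subseteq> U \<and> y \<in> U \<longrightarrow> F (xs[i := y]) = F xs)"

text \<open>Iterated partial derivative with respect to (slot, coordinate) pairs, all slots in the chart
  \<open>c\<close>.\<close>

fun jet :: "'a chart \<Rightarrow> (nat \<times> nat) list \<Rightarrow> ('a list \<Rightarrow> complex) \<Rightarrow> 'a list \<Rightarrow> complex"
  where
    "jet c [] F xs = F xs"
  | "jet c ((k, i) # \<alpha>) F xs = cpd c i (\<lambda>y. jet c \<alpha> F (xs[k := y])) (xs ! k)"


section \<open>Multivector fields and differential forms\<close>

text \<open>Multivector fields and forms (with complex coefficients) are sections of the exterior powers of
  the complexified tangent and cotangent bundles, given by their antisymmetric components
  \<open>T c p [i\<^sub>1, \<dots>, i\<^sub>d]\<close> in each chart \<open>c\<close> at each point \<open>p\<close>. Normalisation: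
  \<open>X\<^sub>1 \<and> \<dots> \<and> X\<^sub>d\<close> has components \<open>det (X\<^sub>r\<^sup>i\<^sup>s)\<close> and \<open>da\<^sub>1 \<dots> da\<^sub>n\<close> has components \<open>det (\<partial>\<^sub>i\<^sub>s a\<^sub>r)\<close>.\<close>

type_synonym 'a tensor = "'a chart \<Rightarrow> 'a \<Rightarrow> nat list \<Rightarrow> complex"

definition multi_idx :: "'a manifold \<Rightarrow> nat \<Rightarrow> nat list set"
  where "multi_idx M d = {I. length I = d \<and> set I \<subseteq> {..<mdim M}}"

definition in_range :: "'a manifold \<Rightarrow> 'a set \<Rightarrow> 'a chart \<Rightarrow> 'a \<Rightarrow> nat list \<Rightarrow> bool"
  where "in_range M U c p I \<longleftrightarrow> c \<in> atlas M \<and> p \<in> fst c \<inter> U \<and> set I \<subseteq> {..<mdim M}"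

definition alt_components :: "'a manifold \<Rightarrow> 'a set \<Rightarrow> nat \<Rightarrow> 'a tensor \<Rightarrow> bool"
  where "alt_components M U d T \<longleftrightarrow>
    (\<forall>c p I. \<not> (in_range M U c p I \<and> length I = d) \<longrightarrow> T c p I = 0) \<and>
    (\<forall>c\<in>atlas M. \<forall>I\<in>multi_idx M d.
       smooth_on {..<mdim M} (snd c ` (fst c \<inter> U)) (\<lambda>x. T c (chart_inv c x) I)) \<and>
    (\<forall>c p I r s. r < s \<and> s < length I \<longrightarrow> T c p (I[r := I ! s, s := I ! r]) = - T c p I)"

definition mvf :: "'a manifold \<Rightarrow> 'a set \<Rightarrow> nat \<Rightarrow> 'a tensor set"
  where "mvf M U d = {T. alt_components M U d T \<and>
    (\<forall>c\<in>atlas M. \<forall>c'\<in>atlas M. \<forall>p\<in>fst c \<inter> fst c' \<inter> U. \<forall>I\<in>multi_idx M d.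
       T c' p I = (\<Sum>J\<in>multi_idx M d. (\<Prod>r<d. jacobian c c' (I ! r) (J ! r) p) * T c p J))}"

definition forms :: "'a manifold \<Rightarrow> 'a set \<Rightarrow> nat \<Rightarrow> 'a tensor set"
  where "forms M U n = {T. alt_components M U n T \<and>
    (\<forall>c\<in>atlas M. \<forall>c'\<in>atlas M. \<forall>p\<in>fst c \<inter> fst c' \<inter> U. \<forall>I\<in>multi_idx M n.
       T c' p I = (\<Sum>J\<in>multi_idx M n. (\<Prod>r<n. jacobian c' c (J ! r) (I ! r) p) * T c p J))}"

text \<open>Sign of moving the entries at positions in \<open>S\<close> to the front, entry \<open>i\<close> having degree
  \<open>ds ! i\<close>; the wedge product is the signed sum over shuffles (all degrees 1).\<close>

definition koszul :: "nat list \<Rightarrow> nat set \<Rightarrow> complex"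
  where "koszul ds S = (-1) ^ (\<Sum>i\<in>S. \<Sum>j\<in>{..<i} - S. ds ! i * ds ! j)"

definition wedge :: "'a tensor \<Rightarrow> 'a tensor \<Rightarrow> 'a tensor"
  where "wedge A B = (\<lambda>c p I. \<Sum>S\<in>Pow {..<length I}.
    koszul (replicate (length I) 1) S * A c p (nths I S) * B c p (nths I (- S)))"

definition of_fun :: "'a manifold \<Rightarrow> 'a set \<Rightarrow> ('a \<Rightarrow> complex) \<Rightarrow> 'a tensor"
  where "of_fun M U f = (\<lambda>c p I. if in_range M U c p I \<and> I = [] then f p else 0)"

text \<open>The function underlying a 0-form (its component does not depend on the chart).\<close>

definition to_fun :: "'a manifold \<Rightarrow> 'a set \<Rightarrow> 'a tensor \<Rightarrow> 'a \<Rightarrow> complex"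
  where "to_fun M U T p = (if p \<in> U then T (SOME c. c \<in> atlas M \<and> p \<in> fst c) p [] else 0)"

definition dform :: "'a manifold \<Rightarrow> 'a set \<Rightarrow> 'a tensor \<Rightarrow> 'a tensor"
  where "dform M U \<omega> = (\<lambda>c p I. if in_range M U c p I
    then \<Sum>k<length I. (-1) ^ k * cpd c (I ! k) (\<lambda>q. \<omega> c q (take k I @ drop (Suc k) I)) p
    else 0)"

fun dprod :: "'a manifold \<Rightarrow> 'a set \<Rightarrow> ('a \<Rightarrow> complex) list \<Rightarrow> 'a tensor"
  where
    "dprod M U [] = of_fun M U (\<lambda>_. 1)"
  | "dprod M U (a # as) = wedge (dform M U (of_fun M U a)) (dprod M U as)"

text \<open>Contraction with \<open>i_{X\<^sub>1 \<and> \<dots> \<and> X\<^sub>d} = i_{X\<^sub>1} \<circ> \<dots> \<circ> i_{X\<^sub>d}\<close>.\<close>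

definition contract :: "'a manifold \<Rightarrow> nat \<Rightarrow> 'a tensor \<Rightarrow> 'a tensor \<Rightarrow> 'a tensor"
  where "contract M d \<pi> \<omega> = (\<lambda>c p J. (1 / fact d) *
    (\<Sum>I\<in>multi_idx M d. \<pi> c p I * \<omega> c p (rev I @ J)))"

text \<open>Pairing of \<open>\<and>\<^sup>d T\<close> with \<open>\<Omega>\<^sup>d\<close>, normalised by \<open>1/d!\<close>: with the Gerstenhaber bracket and the
  Schouten bracket below, the map \<open>\<pi> \<mapsto> \<langle>\<pi>, da\<^sub>1 \<dots> da\<^sub>d\<rangle>\<close> respects brackets in cohomology exactly
  for this order and normalisation.\<close>

definition pairing :: "'a manifold \<Rightarrow> 'a set \<Rightarrow> nat \<Rightarrow> 'a tensor \<Rightarrow> 'a tensor \<Rightarrow> 'a \<Rightarrow> complex"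
  where "pairing M U d \<pi> \<omega> = (1 / fact d) *\<^sub>C to_fun M U (contract M d \<pi> \<omega>)"

text \<open>The graded commutator of \<open>d\<close> and \<open>i\<^sub>\<pi>\<close>. Pitfall: for even \<open>d\<close> the two orders differ by a
  sign. The order must be \<open>[i\<^sub>\<pi>, d]\<close>: only then does \<open>\<mu>\<close> intertwine \<open>L\<^sub>D\<close> (with \<open>D = \<langle>\<pi>, -\<rangle>\<close>)
  and \<open>L\<^sub>\<pi>\<close> in Hochschild homology. E.g. for a function \<open>f\<close> one has \<open>L\<^sub>f (a\<^sub>0) = - a\<^sub>0 \<otimes> f\<close> on
  chains, so \<open>L\<^sub>f\<close> must be \<open>- df \<and>\<close> on forms.\<close>

definition lie_form :: "'a manifold \<Rightarrow> 'a set \<Rightarrow> nat \<Rightarrow> 'a tensor \<Rightarrow> 'a tensor \<Rightarrow> 'a tensor"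
  where "lie_form M U d \<pi> \<omega> = contract M d \<pi> (dform M U \<omega>)
    - (-1) ^ d *\<^sub>C dform M U (contract M d \<pi> \<omega>)"

definition lie_mvf :: "'a manifold \<Rightarrow> 'a set \<Rightarrow> 'a tensor \<Rightarrow> 'a tensor \<Rightarrow> 'a tensor"
  where "lie_mvf M U X \<pi> = (\<lambda>c p I. if in_range M U c p I
    then (\<Sum>k<mdim M. X c p [k] * cpd c k (\<lambda>q. \<pi> c q I) p)
       - (\<Sum>r<length I. \<Sum>k<mdim M. \<pi> c p (I[r := k]) * cpd c k (\<lambda>q. X c q [I ! r]) p)
    else 0)"

text \<open>These axioms determine the Schouten--Nijenhuis bracket uniquely. An element of
  \<open>\<Gamma>(\<and>\<^sup>d T)\<close> has degree \<open>d - 1\<close>, which has the parity of \<open>d + 1\<close>.\<close>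

definition is_schouten :: "'a manifold \<Rightarrow> 'a set \<Rightarrow> ('a tensor \<Rightarrow> 'a tensor \<Rightarrow> 'a tensor) \<Rightarrow> bool"
  where "is_schouten M U br \<longleftrightarrow>
    (\<forall>d e. \<forall>x\<in>mvf M U d. \<forall>y\<in>mvf M U e. d + e \<ge> 1 \<longrightarrow> br x y \<in> mvf M U (d + e - 1)) \<and>
    (\<forall>d e. \<forall>x\<in>mvf M U d. clinear_on (mvf M U e) (br x)) \<and>
    (\<forall>d e. \<forall>y\<in>mvf M U e. clinear_on (mvf M U d) (\<lambda>x. br x y)) \<and>
    (\<forall>d e. \<forall>x\<in>mvf M U d. \<forall>y\<in>mvf M U e.
       br x y = - ((-1) ^ ((d + 1) * (e + 1)) *\<^sub>C br y x)) \<and>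
    (\<forall>d e f. \<forall>x\<in>mvf M U d. \<forall>y\<in>mvf M U e. \<forall>z\<in>mvf M U f.
       br x (br y z) = br (br x y) z + (-1) ^ ((d + 1) * (e + 1)) *\<^sub>C br y (br x z)) \<and>
    (\<forall>d. \<forall>X\<in>mvf M U 1. \<forall>x\<in>mvf M U d. br X x = lie_mvf M U X x) \<and>
    (\<forall>f\<in>mvf M U 0. \<forall>g\<in>mvf M U 0. br f g = 0) \<and>
    (\<forall>d e f. \<forall>x\<in>mvf M U d. \<forall>y\<in>mvf M U e. \<forall>z\<in>mvf M U f.
       br x (wedge y z) = wedge (br x y) z + (-1) ^ ((d + 1) * e) *\<^sub>C wedge y (br x z))"


section \<open>Hochschild cochains\<close>

text \<open>Since \<open>A\<^sup>\<otimes>\<^sup>d\<close> means \<open>C\<^sup>\<infinity>(U\<^sup>d)\<close>, a multidifferential map of \<open>d\<close> arguments is represented by the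
  corresponding operator \<open>C\<^sup>\<infinity>(U\<^sup>d) \<rightarrow> C\<^sup>\<infinity>(U)\<close>, so that \<open>D (tens [a\<^sub>1, \<dots>, a\<^sub>d])\<close> is
  \<open>D(a\<^sub>1, \<dots>, a\<^sub>d)\<close>.\<close>

type_synonym 'a oper = "('a list \<Rightarrow> complex) \<Rightarrow> 'a \<Rightarrow> complex"

definition multidiff :: "'a manifold \<Rightarrow> 'a set \<Rightarrow> nat \<Rightarrow> 'a oper set"
  where "multidiff M U d = {D.
    (\<forall>F x. F \<notin> smooth_funs_pow M U d \<or> x \<notin> U \<longrightarrow> D F x = 0) \<and>
    (\<exists>N. \<forall>c\<in>atlas M. \<exists>a.
       (\<forall>\<alpha>. smooth_on {..<mdim M} (snd c ` (fst c \<inter> U)) (\<lambda>x. a \<alpha> (chart_inv c x))) \<and>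
       (\<forall>F\<in>smooth_funs_pow M U d. \<forall>x\<in>fst c \<inter> U.
          D F x = (\<Sum>\<alpha> | set \<alpha> \<subseteq> {..<d} \<times> {..<mdim M} \<and> length \<alpha> \<le> N.
                     a \<alpha> x * jet c \<alpha> F (replicate d x))))}"

definition cochains :: "'a manifold \<Rightarrow> 'a set \<Rightarrow> nat \<Rightarrow> 'a oper set"
  where "cochains M U d = {D \<in> multidiff M U d.
    \<forall>F\<in>smooth_funs_pow M U d. (\<exists>i<d. indep_of U d i F) \<longrightarrow> D F = 0}"

definition mult_op :: "'a manifold \<Rightarrow> 'a set \<Rightarrow> 'a oper"
  where "mult_op M U F x = (if F \<in> smooth_funs_pow M U 2 then F [x, x] else 0)"

text \<open>\<open>m - 1\<close> has the parity of \<open>m + 1\<close>; this is used for all signs below, as truncated subtraction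
  would be wrong for \<open>m = 0\<close>.\<close>

definition circ_op :: "'a manifold \<Rightarrow> 'a set \<Rightarrow> nat \<Rightarrow> nat \<Rightarrow> 'a oper \<Rightarrow> 'a oper \<Rightarrow> 'a oper"
  where "circ_op M U n m D E F x = (if F \<in> smooth_funs_pow M U (n + m - 1)
    then \<Sum>j<n. (-1) ^ ((m + 1) * j) *
      D (\<lambda>ys. if length ys = n
              then E (\<lambda>zs. F (take j ys @ zs @ drop (Suc j) ys)) (ys ! j) else 0) x
    else 0)"

definition gerst :: "'a manifold \<Rightarrow> 'a set \<Rightarrow> nat \<Rightarrow> nat \<Rightarrow> 'a oper \<Rightarrow> 'a oper \<Rightarrow> 'a oper"
  where "gerst M U n m D E =
    circ_op M U n m D E - (-1) ^ ((n + 1) * (m + 1)) *\<^sub>C circ_op M U m n E D"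

definition hoch_diff :: "'a manifold \<Rightarrow> 'a set \<Rightarrow> nat \<Rightarrow> 'a oper \<Rightarrow> 'a oper"
  where "hoch_diff M U d D = gerst M U 2 d (mult_op M U) D"


section \<open>Hochschild and negative cyclic chains\<close>

text \<open>Choice: \<open>A\<^sup>\<otimes>\<^sup>n\<^sup>+\<^sup>1\<close> is \<open>C\<^sup>\<infinity>(U\<^sup>n\<^sup>+\<^sup>1)\<close>. The quotient \<open>A \<otimes> (A/\<complex>)\<^sup>\<otimes>\<^sup>n\<close> is represented by the pair of
  \<open>chains\<close> and its subspace \<open>degenerate\<close>.\<close>

definition chains :: "'a manifold \<Rightarrow> 'a set \<Rightarrow> nat \<Rightarrow> ('a list \<Rightarrow> complex) set"
  where "chains M U n = smooth_funs_pow M U (n + 1)"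

definition degenerate :: "'a manifold \<Rightarrow> 'a set \<Rightarrow> nat \<Rightarrow> ('a list \<Rightarrow> complex) set"
  where "degenerate M U n = {\<Sum>i=1..n. G i | G.
    \<forall>i\<in>{1..n}. G i \<in> chains M U n \<and> indep_of U (n + 1) i (G i)}"

text \<open>In the operators below the arguments are the points \<open>xs\<close> of the resulting function; the degree
  \<open>n\<close> of the chain is recovered from \<open>length xs\<close>.\<close>

definition hoch_b :: "('a list \<Rightarrow> complex) \<Rightarrow> 'a list \<Rightarrow> complex"
  where "hoch_b h xs = (let n = length xs in if n = 0 then 0 else
    (-1) ^ n * h (xs @ [hd xs]) +
    (\<Sum>i<n. (-1) ^ i * h (take (Suc i) xs @ drop i xs)))"

definition connes_B :: "'a set \<Rightarrow> ('a list \<Rightarrow> complex) \<Rightarrow> 'a list \<Rightarrow> complex"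
  where "connes_B U h xs = (if length xs \<ge> 2 \<and> set xs \<subseteq> U then
    (let n = length xs - 2 in \<Sum>i\<le>n. (-1) ^ (n * i) * h (rotate (n + 1 - i) (tl xs))) else 0)"

definition lie_chain :: "nat \<Rightarrow> 'a oper \<Rightarrow> ('a list \<Rightarrow> complex) \<Rightarrow> 'a list \<Rightarrow> complex"
  where "lie_chain d D h xs = (if xs = [] then 0 else
    (let n = d + length xs - 2 in
      (\<Sum>i<length xs - 1. (-1) ^ ((d + 1) * (i + 1)) *
         D (\<lambda>ys. h (take (Suc i) xs @ ys @ drop (Suc (Suc i)) xs)) (xs ! Suc i)) +
      (\<Sum>j\<in>{n + 1 - d..n}. (-1) ^ (n * (j + 1)) *
         D (\<lambda>ys. if length ys = d then h (drop (n - j) ys @ tl xs @ take (n - j) ys) else 0)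
           (hd xs))))"

text \<open>\<open>V[[u]]\<close>: the coefficient of \<open>u\<^sup>k\<close> is \<open>v k\<close>. As \<open>u\<close> has homological degree \<open>-2\<close>, an element of
  homological degree \<open>n\<close> has \<open>v k\<close> of degree \<open>n + 2k\<close>.\<close>

definition int_graded :: "(nat \<Rightarrow> 'x::zero set) \<Rightarrow> int \<Rightarrow> 'x set"
  where "int_graded X p = (if p \<ge> 0 then X (nat p) else {0})"

definition u_series :: "(nat \<Rightarrow> 'x::zero set) \<Rightarrow> int \<Rightarrow> (nat \<Rightarrow> 'x) set"
  where "u_series X n = {v. \<forall>k. v k \<in> int_graded X (n + 2 * int k)}"

definition u_mult :: "(nat \<Rightarrow> 'x::zero) \<Rightarrow> nat \<Rightarrow> 'x"
  where "u_mult v k = (if k = 0 then 0 else v (k - 1))"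

definition CC_diff :: "'a set \<Rightarrow> (nat \<Rightarrow> 'a list \<Rightarrow> complex) \<Rightarrow> nat \<Rightarrow> 'a list \<Rightarrow> complex"
  where "CC_diff U v = (\<lambda>k. hoch_b (v k)) + u_mult (\<lambda>k. connes_B U (v k))"

definition ud :: "'a manifold \<Rightarrow> 'a set \<Rightarrow> (nat \<Rightarrow> 'a tensor) \<Rightarrow> nat \<Rightarrow> 'a tensor"
  where "ud M U v = u_mult (\<lambda>k. dform M U (v k))"

text \<open>Extension of \<open>a\<^sub>0 \<otimes> \<dots> \<otimes> a\<^sub>n \<mapsto> a\<^sub>0 da\<^sub>1 \<dots> da\<^sub>n / n!\<close> to \<open>C\<^sup>\<infinity>(U\<^sup>n\<^sup>+\<^sup>1)\<close>: antisymmetrised first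
  derivatives in the slots \<open>1, \<dots>, n\<close>, restricted to the diagonal.\<close>

definition connes_mu :: "'a manifold \<Rightarrow> 'a set \<Rightarrow> ('a list \<Rightarrow> complex) \<Rightarrow> 'a tensor"
  where "connes_mu M U h = (\<lambda>c p I. if in_range M U c p I then
    (let n = length I in (1 / fact n) * (\<Sum>\<sigma> | \<sigma> permutes {..<n}. of_int (sign \<sigma>) *
       jet c (map (\<lambda>k. (Suc k, I ! \<sigma> k)) [0..<n]) h (replicate (n + 1) p)))
    else 0)"


section \<open>\<open>L\<^sub>\<infinity>\<close> morphisms and modules\<close>

text \<open>A graded Lie algebra \<open>g\<close> is given by spaces \<open>G d\<close> in degree \<open>d - 1\<close> (\<open>d \<ge> 0\<close>). An element of
  \<open>G d\<close> has degree \<open>d - 2\<close> in \<open>g[1]\<close>, which has the parity of \<open>d\<close>. The coderivation of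
  \<open>S(g[1])\<close> that encodes a dg Lie algebra has Taylor components \<open>q\<^sub>1(x) = \<delta>x\<close> and
  \<open>q\<^sub>2(x, y) = (-1)\<^sup>d [x, y]\<close> for \<open>x \<in> G d\<close>. The components of coalgebra and comodule morphisms
  are given as graded symmetric multilinear maps on \<open>g[1]\<close>, as functions of the list of arguments;
  the equations below are the projections of \<open>F \<circ> Q = Q \<circ> F\<close> to the cogenerators, written as sums
  over subsets \<open>S\<close> of the set of argument positions.\<close>

definition homog :: "(nat \<Rightarrow> 'x set) \<Rightarrow> nat list \<Rightarrow> 'x list \<Rightarrow> bool"
  where "homog G ds xs \<longleftrightarrow> list_all2 (\<lambda>d x. x \<in> G d) ds xs"

definition shifted_degree :: "nat list \<Rightarrow> int"
  where "shifted_degree ds = (\<Sum>d\<leftarrow>ds. int d - 2)"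

text \<open>The index \<open>e\<close> for which a map of degree 0 on \<open>g[1]\<close> takes values in \<open>H e\<close>.\<close>

definition out_index :: "nat list \<Rightarrow> nat"
  where "out_index ds = nat (shifted_degree ds + 2)"

definition q2 :: "(nat \<Rightarrow> nat \<Rightarrow> 'x \<Rightarrow> 'x \<Rightarrow> 'x) \<Rightarrow> nat \<Rightarrow> nat \<Rightarrow> 'x \<Rightarrow> 'x \<Rightarrow> 'x::complex_vec"
  where "q2 br d e x y = (-1) ^ d *\<^sub>C br d e x y"

definition sym_multilinear :: "(nat \<Rightarrow> 'x::complex_vec set) \<Rightarrow> ('x list \<Rightarrow> 'y::complex_vec) \<Rightarrow> bool"
  where "sym_multilinear G f \<longleftrightarrow> (\<forall>ds xs. homog G ds xs \<longrightarrow>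
    (\<forall>i<length xs. clinear_on (G (ds ! i)) (\<lambda>x. f (xs[i := x]))) \<and>
    (\<forall>i. Suc i < length xs \<longrightarrow>
       f (xs[i := xs ! Suc i, Suc i := xs ! i]) = (-1) ^ (ds ! i * ds ! Suc i) *\<^sub>C f xs))"

text \<open>The part of the morphism equations coming from the coderivation of \<open>S(g[1])\<close>.\<close>

definition source_terms ::
    "(nat \<Rightarrow> 'x \<Rightarrow> 'x) \<Rightarrow> (nat \<Rightarrow> nat \<Rightarrow> 'x \<Rightarrow> 'x \<Rightarrow> 'x) \<Rightarrow> ('x::complex_vec list \<Rightarrow> 'y::complex_vec)
      \<Rightarrow> nat list \<Rightarrow> 'x list \<Rightarrow> 'y"
  where "source_terms dG bG f ds xs =
    (\<Sum>i<length xs. koszul ds {i} *\<^sub>C f (dG (ds ! i) (xs ! i) # nths xs (- {i}))) +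
    (\<Sum>j<length xs. \<Sum>i<j. koszul ds {i, j} *\<^sub>C
       f (q2 bG (ds ! i) (ds ! j) (xs ! i) (xs ! j) # nths xs (- {i, j})))"

definition linf_morphism ::
    "(nat \<Rightarrow> 'x::complex_vec set) \<Rightarrow> (nat \<Rightarrow> 'x \<Rightarrow> 'x) \<Rightarrow> (nat \<Rightarrow> nat \<Rightarrow> 'x \<Rightarrow> 'x \<Rightarrow> 'x) \<Rightarrow>
     (nat \<Rightarrow> 'y::complex_vec set) \<Rightarrow> (nat \<Rightarrow> 'y \<Rightarrow> 'y) \<Rightarrow> (nat \<Rightarrow> nat \<Rightarrow> 'y \<Rightarrow> 'y \<Rightarrow> 'y) \<Rightarrow>
     ('x list \<Rightarrow> 'y) \<Rightarrow> bool"
  where "linf_morphism G dG bG H dH bH f \<longleftrightarrow>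
    sym_multilinear G f \<and>
    (\<forall>ds xs. homog G ds xs \<and> xs \<noteq> [] \<longrightarrow>
       f xs \<in> int_graded H (shifted_degree ds + 2) \<and>
       dH (out_index ds) (f xs) +
         (1 / 2) *\<^sub>C (\<Sum>S\<in>Pow {..<length xs} - {{}, {..<length xs}}. koszul ds S *\<^sub>C
            q2 bH (out_index (nths ds S)) (out_index (nths ds (- S))) (f (nths xs S)) (f (nths xs (- S))))
       = source_terms dG bG f ds xs)"

text \<open>A chain map \<open>f\<close> induces an isomorphism in cohomology, where the source is \<open>A\<close> modulo the
  subspaces \<open>N\<close>; all gradings are cohomological.\<close>

definition quasi_iso ::
    "(int \<Rightarrow> 'x::complex_vec set) \<Rightarrow> (int \<Rightarrow> 'x set) \<Rightarrow> (int \<Rightarrow> 'x \<Rightarrow> 'x) \<Rightarrow>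
     (int \<Rightarrow> 'y::complex_vec set) \<Rightarrow> (int \<Rightarrow> 'y \<Rightarrow> 'y) \<Rightarrow> ('x \<Rightarrow> 'y) \<Rightarrow> bool"
  where "quasi_iso A N dA B dB f \<longleftrightarrow> (\<forall>p.
    (\<forall>y\<in>B p. dB p y = 0 \<longrightarrow>
       (\<exists>x\<in>A p. dA p x \<in> N (p + 1) \<and> (\<exists>z\<in>B (p - 1). y = f x + dB (p - 1) z))) \<and>
    (\<forall>x\<in>A p. dA p x \<in> N (p + 1) \<and> (\<exists>z\<in>B (p - 1). f x = dB (p - 1) z) \<longrightarrow>
       (\<exists>w\<in>A (p - 1). x - dA (p - 1) w \<in> N p)))"

text \<open>\<open>mN xs v\<close> and \<open>mP xs v\<close> are the components \<open>S\<^sup>n(g[1]) \<otimes> N \<rightarrow> N\<close> of degree 1 of the coderivation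
  of \<open>S(g[1]) \<otimes> N\<close>, the differential being the case \<open>xs = []\<close>. For a dg module, and more generally
  for an \<open>L\<^sub>\<infinity>\<close> morphism \<open>f\<close> followed by an action \<open>L\<close>, they are \<open>m(xs; v) = (-1)\<^sup>|\<^sup>x\<^sup>s\<^sup>| L\<^bsub>f xs\<^esub> v\<close>,
  where \<open>|xs|\<close> is the degree in \<open>S(g[1])\<close>; this is the sign for which the coderivation squares to
  zero when \<open>[L\<^sub>x, L\<^sub>y] = L\<^bsub>[x, y]\<^esub>\<close>. The spaces \<open>N n\<close> (modulo \<open>N0 n\<close>) and \<open>P n\<close> are in homological
  degree \<open>n\<close>.\<close>

definition linf_module_morphism ::
    "(nat \<Rightarrow> 'x::complex_vec set) \<Rightarrow> (nat \<Rightarrow> 'x \<Rightarrow> 'x) \<Rightarrow> (nat \<Rightarrow> nat \<Rightarrow> 'x \<Rightarrow> 'x \<Rightarrow> 'x) \<Rightarrow>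
     (int \<Rightarrow> 'v::complex_vec set) \<Rightarrow> (int \<Rightarrow> 'v set) \<Rightarrow> (nat list \<Rightarrow> 'x list \<Rightarrow> 'v \<Rightarrow> 'v) \<Rightarrow>
     (int \<Rightarrow> 'w::complex_vec set) \<Rightarrow> (nat list \<Rightarrow> 'x list \<Rightarrow> 'w \<Rightarrow> 'w) \<Rightarrow>
     ('x list \<Rightarrow> 'v \<Rightarrow> 'w) \<Rightarrow> bool"
  where "linf_module_morphism G dG bG N N0 mN P mP \<phi> \<longleftrightarrow>
    (\<forall>n. \<forall>v\<in>N n. sym_multilinear G (\<lambda>xs. \<phi> xs v)) \<and>
    (\<forall>ds xs n. homog G ds xs \<longrightarrow>
       clinear_on (N n) (\<phi> xs) \<and>
       (\<forall>v\<in>N0 n. \<phi> xs v = 0) \<and>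
       (\<forall>v\<in>N n. \<phi> xs v \<in> P (n - shifted_degree ds) \<and>
          (\<Sum>S\<in>Pow {..<length xs}. koszul ds S *\<^sub>C
             mP (nths ds S) (nths xs S) (\<phi> (nths xs (- S)) v))
          = source_terms dG bG (\<lambda>ys. \<phi> ys v) ds xs +
            (\<Sum>S\<in>Pow {..<length xs}. koszul ds S *\<^sub>C (-1) ^ sum_list (nths ds S) *\<^sub>C
               \<phi> (nths xs S) (mN (nths ds (- S)) (nths xs (- S)) v))))"


section \<open>Restriction to open subsets\<close>

definition res_tensor :: "'a set \<Rightarrow> 'a tensor \<Rightarrow> 'a tensor"
  where "res_tensor V T = (\<lambda>c p I. if p \<in> V then T c p I else 0)"

definition res_pow :: "'a set \<Rightarrow> ('a list \<Rightarrow> complex) \<Rightarrow> 'a list \<Rightarrow> complex"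
  where "res_pow V F = (\<lambda>xs. if set xs \<subseteq> V then F xs else 0)"


section \<open>Kontsevich's formality morphism\<close>

type_synonym 'a bracket_family = "'a set \<Rightarrow> 'a tensor \<Rightarrow> 'a tensor \<Rightarrow> 'a tensor"

text \<open>Naturality means compatibility with restriction to open subsets: the morphism on \<open>M\<close> is part of
  a family of morphisms on all open \<open>U \<subseteq> M\<close> that commutes with restrictions. Strict equivariance under
  all diffeomorphisms is not required: the globalised morphism depends on the choice of a
  connection.\<close>

definition kontsevich_formality ::
    "'a manifold \<Rightarrow> 'a bracket_family \<Rightarrow> ('a set \<Rightarrow> 'a tensor list \<Rightarrow> 'a oper) \<Rightarrow> bool"
  where "kontsevich_formality M SN K \<longleftrightarrow>
    (\<forall>U. openin (mtop M) U \<longrightarrow>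
       linf_morphism (mvf M U) (\<lambda>d x. 0) (\<lambda>d e. SN U)
         (cochains M U) (hoch_diff M U) (gerst M U) (K U) \<and>
       quasi_iso (int_graded (mvf M U)) (\<lambda>p. {0}) (\<lambda>p x. 0)
         (int_graded (cochains M U)) (\<lambda>p. hoch_diff M U (nat p)) (\<lambda>x. K U [x]) \<and>
       (\<forall>d. \<forall>x\<in>mvf M U d. \<forall>as. length as = d \<and> set as \<subseteq> smooth_funs M U \<longrightarrow>
          K U [x] (tens as) = pairing M U d x (dprod M U as))) \<and>
    (\<forall>U V ds xs F. openin (mtop M) U \<and> openin (mtop M) V \<and> V \<subseteq> U \<and> xs \<noteq> [] \<and>
       homog (mvf M U) ds xs \<and> F \<in> smooth_funs_pow M U (out_index ds) \<longrightarrow>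
       (\<forall>p\<in>V. K V (map (res_tensor V) xs) (res_pow V F) p = K U xs F p))"


section \<open>The cyclic formality conjecture\<close>

definition CC_action ::
    "'a set \<Rightarrow> ('a tensor list \<Rightarrow> 'a oper) \<Rightarrow> nat list \<Rightarrow> 'a tensor list \<Rightarrow>
     (nat \<Rightarrow> 'a list \<Rightarrow> complex) \<Rightarrow> nat \<Rightarrow> 'a list \<Rightarrow> complex"
  where "CC_action U KU ds xs v = (if xs = [] then CC_diff U v
    else (-1) ^ sum_list ds *\<^sub>C (\<lambda>k. lie_chain (out_index ds) (KU xs) (v k)))"

definition form_action ::
    "'a manifold \<Rightarrow> 'a set \<Rightarrow> nat list \<Rightarrow> 'a tensor list \<Rightarrow> (nat \<Rightarrow> 'a tensor) \<Rightarrow> nat \<Rightarrow> 'a tensor"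
  where "form_action M U ds xs v = (if xs = [] then ud M U v
    else if length xs = 1 then (-1) ^ hd ds *\<^sub>C (\<lambda>k. lie_form M U (hd ds) (hd xs) (v k))
    else 0)"

text \<open>For maps of \<open>u\<close>-adic power series, \<open>\<complex>\<close>-linearity together with commutation with \<open>u\<close> is
  \<open>\<complex>[[u]]\<close>-linearity.\<close>

definition cyclic_formality ::
    "'a manifold \<Rightarrow> 'a bracket_family \<Rightarrow> ('a set \<Rightarrow> 'a tensor list \<Rightarrow> 'a oper) \<Rightarrow> bool"
  where "cyclic_formality M SN K \<longleftrightarrow> (\<exists>\<phi>.
    (\<forall>U. openin (mtop M) U \<longrightarrow>
       linf_module_morphism (mvf M U) (\<lambda>d x. 0) (\<lambda>d e. SN U)
         (u_series (chains M U)) (u_series (degenerate M U)) (CC_action U (K U))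
         (u_series (forms M U)) (form_action M U) (\<phi> U) \<and>
       (\<forall>ds xs n. \<forall>v\<in>u_series (chains M U) n. homog (mvf M U) ds xs \<longrightarrow>
          \<phi> U xs (u_mult v) = u_mult (\<phi> U xs v)) \<and>
       quasi_iso (\<lambda>p. u_series (chains M U) (- p)) (\<lambda>p. u_series (degenerate M U) (- p))
         (\<lambda>p. CC_diff U) (\<lambda>p. u_series (forms M U) (- p)) (\<lambda>p. ud M U) (\<phi> U []) \<and>
       (\<forall>n. \<forall>v\<in>u_series (chains M U) n. \<phi> U [] v = (\<lambda>k. connes_mu M U (v k)))) \<and>
    (\<forall>U V ds xs n. \<forall>v\<in>u_series (chains M U) n.
       openin (mtop M) U \<and> openin (mtop M) V \<and> V \<subseteq> U \<and> homog (mvf M U) ds xs \<longrightarrow>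
       \<phi> V (map (res_tensor V) xs) (\<lambda>k. res_pow V (v k)) = (\<lambda>k. res_tensor V (\<phi> U xs v k))))"


section \<open>Formal Poisson structures and star products\<close>

text \<open>\<open>\<pi> m\<close> is the coefficient of \<open>t\<^sup>m\<^sup>+\<^sup>1\<close>.\<close>

definition formal_poisson ::
    "'a manifold \<Rightarrow> 'a bracket_family \<Rightarrow> (nat \<Rightarrow> 'a tensor) \<Rightarrow> bool"
  where "formal_poisson M SN \<pi> \<longleftrightarrow> (\<forall>m. \<pi> m \<in> mvf M (pts M) 2) \<and>
    (\<forall>n. (\<Sum>i\<le>n. SN (pts M) (\<pi> i) (\<pi> (n - i))) = 0)"

text \<open>\<open>C\<^sup>\<infinity>(M)[[t]]\<close>, with \<open>\<complex>[[t]]\<close> as \<open>complex fps\<close>.\<close>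

definition t_series :: "'a manifold \<Rightarrow> (nat \<Rightarrow> 'a \<Rightarrow> complex) set"
  where "t_series M = {a. \<forall>n. a n \<in> smooth_funs M (pts M)}"

definition t_scale :: "complex fps \<Rightarrow> (nat \<Rightarrow> 'a \<Rightarrow> complex) \<Rightarrow> nat \<Rightarrow> 'a \<Rightarrow> complex"
  where "t_scale r a n = (\<Sum>i\<le>n. fps_nth r i *\<^sub>C a (n - i))"

text \<open>A family \<open>P\<close> of bidifferential operators, \<open>P 0\<close> being the pointwise product, is identified with
  the product \<open>a * b = \<Sum> t\<^sup>m P\<^sub>m(a, b)\<close>.\<close>

definition star_mult ::
    "(nat \<Rightarrow> 'a oper) \<Rightarrow> (nat \<Rightarrow> 'a \<Rightarrow> complex) \<Rightarrow> (nat \<Rightarrow> 'a \<Rightarrow> complex) \<Rightarrow> nat \<Rightarrow> 'a \<Rightarrow> complex"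
  where "star_mult P a b n = (\<Sum>l\<le>n. \<Sum>i\<le>n - l. P l (tens [a i, b (n - l - i)]))"

definition t_one :: "'a manifold \<Rightarrow> nat \<Rightarrow> 'a \<Rightarrow> complex"
  where "t_one M n x = (if n = 0 \<and> x \<in> pts M then 1 else 0)"

definition star_product :: "'a manifold \<Rightarrow> (nat \<Rightarrow> 'a oper) \<Rightarrow> bool"
  where "star_product M P \<longleftrightarrow>
    P 0 = mult_op M (pts M) \<and> (\<forall>m\<ge>1. P m \<in> multidiff M (pts M) 2) \<and>
    (\<forall>a\<in>t_series M. \<forall>b\<in>t_series M. \<forall>c\<in>t_series M.
       star_mult P (star_mult P a b) c = star_mult P a (star_mult P b c)) \<and>
    (\<forall>a\<in>t_series M. star_mult P (t_one M) a = a \<and> star_mult P a (t_one M) = a)"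

definition apply_series ::
    "(nat \<Rightarrow> 'a oper) \<Rightarrow> (nat \<Rightarrow> 'a \<Rightarrow> complex) \<Rightarrow> nat \<Rightarrow> 'a \<Rightarrow> complex"
  where "apply_series T a n = (\<Sum>i\<le>n. T i (tens [a (n - i)]))"

definition star_isomorphic :: "'a manifold \<Rightarrow> (nat \<Rightarrow> 'a oper) \<Rightarrow> (nat \<Rightarrow> 'a oper) \<Rightarrow> bool"
  where "star_isomorphic M P Q \<longleftrightarrow> (\<exists>T.
    (\<forall>f\<in>smooth_funs M (pts M). T 0 (tens [f]) = f) \<and>
    (\<forall>m\<ge>1. T m \<in> multidiff M (pts M) 1) \<and>
    (\<forall>a\<in>t_series M. \<forall>b\<in>t_series M.
       apply_series T (star_mult P a b) = star_mult Q (apply_series T a) (apply_series T b)))"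

text \<open>\<open>ab + \<Sum>\<^sub>n K\<^sub>n(\<pi>, \<dots>, \<pi>)/n!\<close>; the coefficient of \<open>t\<^sup>m\<close> is the sum over
  \<open>(k\<^sub>1 + 1) + \<dots> + (k\<^sub>n + 1) = m\<close>.\<close>

definition kontsevich_star ::
    "'a manifold \<Rightarrow> ('a tensor list \<Rightarrow> 'a oper) \<Rightarrow> (nat \<Rightarrow> 'a tensor) \<Rightarrow> nat \<Rightarrow> 'a oper"
  where "kontsevich_star M KM \<pi> m = (if m = 0 then mult_op M (pts M) else
    (\<Sum>ks | sum_list (map Suc ks) = m. (1 / fact (length ks)) *\<^sub>C KM (map \<pi> ks)))"

definition is_deformation_star ::
    "'a manifold \<Rightarrow> ('a tensor list \<Rightarrow> 'a oper) \<Rightarrow> (nat \<Rightarrow> 'a tensor) \<Rightarrow> (nat \<Rightarrow> 'a oper) \<Rightarrow> bool"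
  where "is_deformation_star M KM \<pi> P \<longleftrightarrow>
    star_product M P \<and> star_isomorphic M (kontsevich_star M KM \<pi>) P"


section \<open>Continuous functionals\<close>

text \<open>The Frechet topology: uniform convergence of all derivatives on compact subsets of charts.\<close>

definition frechet_topology :: "'a manifold \<Rightarrow> ('a \<Rightarrow> complex) topology"
  where "frechet_topology M = topology_generated_by
    {{g \<in> smooth_funs M (pts M).
        \<forall>x\<in>C. cmod (foldr (cpd c) is g x - foldr (cpd c) is f x) < e} | f c C is e.
      f \<in> smooth_funs M (pts M) \<and> c \<in> atlas M \<and> compactin (mtop M) C \<and> C \<subseteq> fst c \<and>
      set is \<subseteq> {..<mdim M} \<and> e > 0}"

text \<open>\<open>\<complex>[[t]]\<close> carries the product topology (not the \<open>t\<close>-adic one), hence the passage to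
  coefficients. Functionals are taken to be 0 outside \<open>C\<^sup>\<infinity>(M)[[t]]\<close>.\<close>

definition continuous_functionals ::
    "'a manifold \<Rightarrow> ((nat \<Rightarrow> 'a \<Rightarrow> complex) \<Rightarrow> complex fps) set"
  where "continuous_functionals M = {\<tau>.
    (\<forall>a. a \<notin> t_series M \<longrightarrow> \<tau> a = 0) \<and>
    (\<forall>a\<in>t_series M. \<forall>b\<in>t_series M. \<forall>r. \<tau> (t_scale r a + b) = r * \<tau> a + \<tau> b) \<and>
    continuous_map (product_topology (\<lambda>_. frechet_topology M) UNIV)
      (product_topology (\<lambda>_. euclidean) UNIV) (\<lambda>a. fps_nth (\<tau> a))}"

definition continuous_traces ::
    "'a manifold \<Rightarrow> (nat \<Rightarrow> 'a oper) \<Rightarrow> ((nat \<Rightarrow> 'a \<Rightarrow> complex) \<Rightarrow> complex fps) set"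
  where "continuous_traces M P = {\<tau> \<in> continuous_functionals M.
    \<forall>a\<in>t_series M. \<forall>b\<in>t_series M. \<tau> (star_mult P a b) = \<tau> (star_mult P b a)}"

definition poisson_bracket ::
    "'a manifold \<Rightarrow> (nat \<Rightarrow> 'a tensor) \<Rightarrow> ('a \<Rightarrow> complex) \<Rightarrow> ('a \<Rightarrow> complex) \<Rightarrow> nat \<Rightarrow> 'a \<Rightarrow> complex"
  where "poisson_bracket M \<pi> f g n =
    (if n = 0 then 0 else pairing M (pts M) 2 (\<pi> (n - 1)) (dprod M (pts M) [f, g]))"

definition continuous_poisson_functionals ::
    "'a manifold \<Rightarrow> (nat \<Rightarrow> 'a tensor) \<Rightarrow> ((nat \<Rightarrow> 'a \<Rightarrow> complex) \<Rightarrow> complex fps) set"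
  where "continuous_poisson_functionals M \<pi> = {\<tau> \<in> continuous_functionals M.
    \<forall>f\<in>smooth_funs M (pts M). \<forall>g\<in>smooth_funs M (pts M). \<tau> (poisson_bracket M \<pi> f g) = 0}"

definition isomorphic_modules :: "('z \<Rightarrow> complex fps) set \<Rightarrow> ('z \<Rightarrow> complex fps) set \<Rightarrow> bool"
  where "isomorphic_modules A B \<longleftrightarrow> (\<exists>\<Phi>. bij_betw \<Phi> A B \<and>
    (\<forall>\<tau>\<in>A. \<forall>\<tau>'\<in>A. \<forall>r. \<Phi> (\<lambda>a. r * \<tau> a + \<tau>' a) = (\<lambda>a. r * \<Phi> \<tau> a + \<Phi> \<tau>' a)))"

end

theory Submission
  imports Defs
begin

text \<open>Let \<open>\<phi>\<close> be the morphism of \<open>L\<^sub>\<infinity>\<close> modules provided by cyclic formality. A formal Poisson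
  structure \<open>\<pi>\<close> is a Maurer--Cartan element, so the module equations, evaluated at \<open>(\<pi>, \<dots>, \<pi>)\<close>,
  divided by factorials and summed, say that \<open>\<Sum>\<^sub>n \<phi>\<^sub>n(\<pi>, \<dots>, \<pi>; -)/n!\<close> is a chain map from the
  cyclic chains with differential \<open>b + uB + L\<^sub>\<Pi>\<close>, the cyclic chains of the star product given by \<open>\<pi>\<close>, to the forms with
  differential \<open>ud + L\<^sub>\<pi>\<close>. Only chains of degree 0 and 1 modulo \<open>u\<close> matter for traces. Let \<open>\<Psi>\<close> be the
  summed map on functions and \<open>\<Omega>(f, g)\<close> the one-form which the summed map assigns to \<open>f \<otimes> g\<close>.
  As \<open>b(f \<otimes> g) = fg - gf = 0\<close>, the chain map equation becomes (\<open>Psi_star_comm\<close>)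
    \<open>\<Psi>(f * g - g * f) = L\<^sub>\<pi> \<Omega>(f, g)\<close>,
  where \<open>\<phi>\<^sub>0 = \<mu>\<close> gives \<open>\<Psi> = id + O(t)\<close> and \<open>\<Omega>(f, g) = f dg + O(t)\<close>, and where
  \<open>L\<^sub>\<pi>(f dg) = 2 {f, g}\<^sub>\<pi>\<close> (\<open>lie_one_mu\<close>).

  The map \<open>\<Psi>\<close> commutes with restriction to open subsets, so its coefficients do not increase
  supports. By Peetre's theorem, in the weak form that such linear maps are locally bounded in terms of
  finitely many derivatives (\<open>local_bound\<close>, \<open>local_op_bounded\<close>), they are continuous. As
  \<open>\<Psi> = id + O(t)\<close>, it is invertible on \<open>C\<^sup>\<infinity>(M)[[t]]\<close>, and its inverse is again a series of local operators
  (\<open>apply_ops_inverse_ops\<close>), hence continuous; so \<open>\<sigma> \<mapsto> \<sigma> \<circ> \<Psi>\<close> is a bijection of the continuous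
  \<open>\<complex>[[t]]\<close>-linear functionals. It remains to see that \<open>\<sigma>\<close> annihilates all Poisson brackets if
  and only if \<open>\<sigma> \<circ> \<Psi>\<close> is a trace.

  A coefficient of a continuous functional has compact support (\<open>fbounded_support\<close>), and near a compact set
  every one-form is a finite sum of forms \<open>f\<^sub>j dg\<^sub>j\<close> (\<open>exact_near_compact\<close>). Therefore \<open>\<sigma>(L\<^sub>\<pi> \<Omega>(f, g))\<close> is a
  combination of values of \<open>\<sigma>\<close> on Poisson brackets (\<open>functional_on_star_commutator\<close>): if \<open>\<sigma>\<close> annihilates
  brackets, then \<open>\<sigma> \<circ> \<Psi>\<close> annihilates commutators. Conversely, if it annihilates commutators, then in the
  coefficient of \<open>t\<^sup>n\<close> the leading term of \<open>\<Omega>(f, g)\<close> contributes twice the \<open>n\<close>-th coefficient of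
  \<open>\<sigma>({f, g}\<^sub>\<pi>)\<close>, and the other terms contribute lower coefficients of brackets, which vanish by induction on
  \<open>n\<close>. Finally, an isomorphism of star products is a series of differential operators, so it transports
  traces as well (\<open>isomorphic_stars\<close>).\<close>

section \<open>Smooth functions of several variables\<close>

lemma sum_fun_app: "(\<Sum>i\<in>A. f i) x = (\<Sum>i\<in>A. f i x)"
  for f :: "'i \<Rightarrow> 'x \<Rightarrow> 'y::comm_monoid_add"
  by (induction A rule: infinite_finite_induct) auto

text \<open>The relational form of \<open>coord_deriv\<close>: it asserts that the derivative exists as well.\<close>

definition pdiff :: "'i \<Rightarrow> (('i \<Rightarrow> real) \<Rightarrow> 'b::real_normed_vector) \<Rightarrow> 'b \<Rightarrow> ('i \<Rightarrow> real) \<Rightarrow> bool"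
  where "pdiff i g d x \<longleftrightarrow> ((\<lambda>s. g (x(i := s))) has_vector_derivative d) (at (x i))"

abbreviation Rspace :: "'i set \<Rightarrow> ('i \<Rightarrow> real) topology"
  where "Rspace I \<equiv> powertop_real I"

abbreviation cont_on :: "'i set \<Rightarrow> ('i \<Rightarrow> real) set \<Rightarrow> (('i \<Rightarrow> real) \<Rightarrow> 'b::topological_space) \<Rightarrow> bool"
  where "cont_on I S g \<equiv> continuous_map (subtopology (Rspace I) S) euclidean g"

lemma coord_deriv_pdiff: "pdiff i g d x \<Longrightarrow> coord_deriv i g x = d"
  unfolding pdiff_def coord_deriv_def by (rule vector_derivative_at)

lemma pdiff_coord_deriv:
  "(\<lambda>s. g (x(i := s))) differentiable (at (x i)) \<longleftrightarrow> pdiff i g (coord_deriv i g x) x"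
  unfolding pdiff_def coord_deriv_def
  using differentiableI_vector vector_derivative_works by blast

lemma Rspace_mem: "openin (Rspace I) S \<Longrightarrow> x \<in> S \<Longrightarrow> x \<in> extensional I"
  using openin_subset[of "Rspace I" S] by (auto simp: PiE_def)

lemma upd_cont:
  assumes "x \<in> extensional I" "i \<in> I"
  shows "continuous_map euclideanreal (Rspace I) (\<lambda>s. x(i := s))"
  using assms
  by (auto simp: continuous_map_componentwise extensional_def image_subset_iff fun_upd_def)

lemma open_slice:
  assumes "openin (Rspace I) S" "x \<in> S" "i \<in> I"
  shows "open {s. x(i := s) \<in> S}" "x i \<in> {s. x(i := s) \<in> S}"
proof -
  have "openin euclideanreal {s \<in> topspace euclideanreal. x(i := s) \<in> S}"
    by (rule openin_continuous_map_preimage[OF upd_cont assms(1)]) (use assms Rspace_mem in auto)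
  then show "open {s. x(i := s) \<in> S}" by simp
  show "x i \<in> {s. x(i := s) \<in> S}" using assms by simp
qed

lemma pdiff_cong:
  assumes S: "openin (Rspace I) S" "x \<in> S" "i \<in> I" and eq: "\<And>y. y \<in> S \<Longrightarrow> g y = h y"
  shows "pdiff i g d x \<longleftrightarrow> pdiff i h d x"
proof -
  have ev: "\<forall>\<^sub>F s in nhds (x i). g (x(i := s)) = h (x(i := s))"
    using open_slice[OF S] eq unfolding eventually_nhds by blast
  show ?thesis unfolding pdiff_def
    by (rule has_vector_derivative_cong_ev) (use ev in \<open>auto simp: assms\<close>)
qed

lemma coord_deriv_cong:
  assumes S: "openin (Rspace I) S" "x \<in> S" "i \<in> I" and eq: "\<And>y. y \<in> S \<Longrightarrow> g y = h y"
  shows "coord_deriv i g x = coord_deriv i h x"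
proof -
  have "\<And>d. pdiff i g d x = pdiff i h d x" by (rule pdiff_cong[OF S]) (use eq in auto)
  then show ?thesis unfolding coord_deriv_def pdiff_def vector_derivative_def by simp
qed

lemma cont_on_cong:
  assumes "\<And>y. y \<in> S \<Longrightarrow> g y = h y"
  shows "cont_on I S g \<longleftrightarrow> cont_on I S h"
proof
  assume "cont_on I S g" then show "cont_on I S h" by (rule continuous_map_eq) (use assms in auto)
next
  assume "cont_on I S h" then show "cont_on I S g" by (rule continuous_map_eq) (use assms in auto)
qed

lemma Ck_on_cong:
  assumes S: "openin (Rspace I) S" and eq: "\<And>y. y \<in> S \<Longrightarrow> g y = h y"
  shows "Ck_on k I S g \<longleftrightarrow> Ck_on k I S h"
  using eq
proof (induction k arbitrary: g h)
  case 0
  then show ?case using cont_on_cong[of S g h I] by simp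
next
  case (Suc k)
  have 1: "cont_on I S g \<longleftrightarrow> cont_on I S h" by (rule cont_on_cong) (use Suc.prems in auto)
  have 2: "coord_deriv i g x = coord_deriv i h x" if "i \<in> I" "x \<in> S" for i x
    by (rule coord_deriv_cong[OF S that(2,1)]) (use Suc.prems in auto)
  have 3: "Ck_on k I S (coord_deriv i g) \<longleftrightarrow> Ck_on k I S (coord_deriv i h)" if "i \<in> I" for i
    by (rule Suc.IH) (use 2 that in auto)
  have 4: "pdiff i g d x = pdiff i h d x" if "i \<in> I" "x \<in> S" for i x d
    by (rule pdiff_cong[OF S that(2,1)]) (use Suc.prems in auto)
  show ?case using 1 2 3 4 by (auto simp: pdiff_coord_deriv)
qed

lemma smooth_on_cong:
  assumes S: "openin (Rspace I) S" and eq: "\<And>y. y \<in> S \<Longrightarrow> g y = h y"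
  shows "smooth_on I S g \<longleftrightarrow> smooth_on I S h"
proof -
  have "\<And>k. Ck_on k I S g \<longleftrightarrow> Ck_on k I S h" by (rule Ck_on_cong[OF S]) (use eq in auto)
  then show ?thesis unfolding smooth_on_def by blast
qed

lemma Ck_on_mono: "Ck_on (Suc k) I S g \<Longrightarrow> Ck_on k I S g"
  by (induction k arbitrary: g) auto

lemma smooth_on_iff:
  "smooth_on I S g \<longleftrightarrow> cont_on I S g \<and>
    (\<forall>i\<in>I. (\<forall>x\<in>S. pdiff i g (coord_deriv i g x) x) \<and> smooth_on I S (coord_deriv i g))"
  (is "?l \<longleftrightarrow> ?r")
proof
  assume l: ?l
  show ?r using l unfolding smooth_on_def pdiff_coord_deriv[symmetric]
    by (metis Ck_on.simps(2))
next
  assume r: ?r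
  have "Ck_on k I S g" for k
    by (cases k) (use r in \<open>auto simp: smooth_on_def pdiff_coord_deriv\<close>)
  then show ?l by (auto simp: smooth_on_def)
qed

lemma smooth_on_cont: "smooth_on I S g \<Longrightarrow> cont_on I S g"
  using smooth_on_iff by blast
lemma smooth_on_pdiff: "smooth_on I S g \<Longrightarrow> i \<in> I \<Longrightarrow> x \<in> S \<Longrightarrow> pdiff i g (coord_deriv i g x) x"
  using smooth_on_iff by blast
lemma smooth_on_coord_deriv: "smooth_on I S g \<Longrightarrow> i \<in> I \<Longrightarrow> smooth_on I S (coord_deriv i g)"
  using smooth_on_iff by blast

lemma Ck_on_subset: "Ck_on k I S g \<Longrightarrow> T \<subseteq> S \<Longrightarrow> Ck_on k I T g"
proof (induction k arbitrary: g)
  case 0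
  then show ?case by (simp add: continuous_map_from_subtopology_mono)
next
  case (Suc k)
  then show ?case by (auto intro: continuous_map_from_subtopology_mono)
qed

lemma smooth_on_subset: "smooth_on I S g \<Longrightarrow> T \<subseteq> S \<Longrightarrow> smooth_on I T g"
  unfolding smooth_on_def using Ck_on_subset by blast

text \<open>Induction on the order of differentiability shows smoothness of all members of a class of continuous
  functions that is closed under partial derivatives. This avoids explicit formulas for iterated derivatives
  in later proofs.\<close>

lemma smooth_on_family:
  assumes S: "openin (Rspace I) S"
    and cont: "\<And>g. P g \<Longrightarrow> cont_on I S g"
    and deriv: "\<And>g i. P g \<Longrightarrow> i \<in> I \<Longrightarrow> \<exists>g'. P g' \<and> (\<forall>x\<in>S. pdiff i g (g' x) x)"
    and "P g"
  shows "smooth_on I S g"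
proof -
  have "Ck_on k I S g" if "P g" for k g
    using that
  proof (induction k arbitrary: g)
    case 0
    then show ?case using cont by simp
  next
    case (Suc k)
    have "(\<forall>x\<in>S. (\<lambda>s. g (x(i := s))) differentiable (at (x i))) \<and> Ck_on k I S (coord_deriv i g)"
      if i: "i \<in> I" for i
    proof -
      obtain g' where g': "P g'" "\<And>x. x \<in> S \<Longrightarrow> pdiff i g (g' x) x"
        using deriv[OF Suc.prems i] by blast
      have "Ck_on k I S (coord_deriv i g) \<longleftrightarrow> Ck_on k I S g'"
        by (rule Ck_on_cong[OF S]) (rule coord_deriv_pdiff[OF g'(2)])
      moreover have "pdiff i g (coord_deriv i g x) x" if "x \<in> S" for x
        using g'(2)[OF that] coord_deriv_pdiff[OF g'(2)[OF that]] by simp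
      ultimately show ?thesis using g' Suc.IH[OF g'(1)]
        by (auto simp: pdiff_coord_deriv)
    qed
    then show ?case using cont[OF Suc.prems] by simp
  qed
  then show ?thesis using assms(4) by (auto simp: smooth_on_def)
qed

text \<open>Locally smooth functions form a class as in \<open>smooth_on_family\<close>.\<close>

lemma smooth_on_local:
  assumes S: "openin (Rspace I) S"
    and loc: "\<And>x. x \<in> S \<Longrightarrow> \<exists>W. openin (Rspace I) W \<and> x \<in> W \<and> W \<subseteq> S \<and> smooth_on I W g"
  shows "smooth_on I S g"
proof (rule smooth_on_family[where P = "\<lambda>g. \<forall>x\<in>S. \<exists>W. openin (Rspace I) W \<and> x \<in> W \<and> W \<subseteq> S \<and> smooth_on I W g", OF S])
  fix g :: "('a \<Rightarrow> real) \<Rightarrow> 'b" assume g: "\<forall>x\<in>S. \<exists>W. openin (Rspace I) W \<and> x \<in> W \<and> W \<subseteq> S \<and> smooth_on I W g"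
  let ?J = "{W. openin (Rspace I) W \<and> W \<subseteq> S \<and> smooth_on I W g}"
  show "cont_on I S g"
  proof (rule pasting_lemma[where I = ?J and T = "\<lambda>W. W" and f = "\<lambda>_. g"])
    fix W assume W: "W \<in> ?J"
    then show "openin (subtopology (Rspace I) S) W"
      using S by (simp add: openin_open_subtopology)
    have "subtopology (subtopology (Rspace I) S) W = subtopology (Rspace I) W"
      using W by (simp add: subtopology_subtopology Int_absorb1)
    then show "continuous_map (subtopology (subtopology (Rspace I) S) W) euclidean g"
      using W smooth_on_cont by auto
  qed (use g in auto)
next
  fix g :: "('a \<Rightarrow> real) \<Rightarrow> 'b" and i assume g: "\<forall>x\<in>S. \<exists>W. openin (Rspace I) W \<and> x \<in> W \<and> W \<subseteq> S \<and> smooth_on I W g"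
    and i: "i \<in> I"
  show "\<exists>g'. (\<forall>x\<in>S. \<exists>W. openin (Rspace I) W \<and> x \<in> W \<and> W \<subseteq> S \<and> smooth_on I W g') \<and> (\<forall>x\<in>S. pdiff i g (g' x) x)"
  proof (intro exI[of _ "coord_deriv i g"] conjI ballI)
    fix x assume "x \<in> S"
    then obtain W where W: "openin (Rspace I) W" "x \<in> W" "W \<subseteq> S" "smooth_on I W g" using g by auto
    then show "pdiff i g (coord_deriv i g x) x" using smooth_on_pdiff[OF W(4) i W(2)] by simp
    show "\<exists>W. openin (Rspace I) W \<and> x \<in> W \<and> W \<subseteq> S \<and> smooth_on I W (coord_deriv i g)"
      using W smooth_on_coord_deriv[OF W(4) i] by auto
  qed
qed (intro ballI loc)

lemma pdiff_add: "pdiff i f a x \<Longrightarrow> pdiff i g b x \<Longrightarrow> pdiff i (\<lambda>x. f x + g x) (a + b) x"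
  unfolding pdiff_def by (rule has_vector_derivative_add)

lemma pdiff_const: "pdiff i (\<lambda>x. k) 0 x"
  unfolding pdiff_def by simp

lemma pdiff_mult:
  fixes f g :: "('i \<Rightarrow> real) \<Rightarrow> 'b::real_normed_algebra"
  shows "pdiff i f a x \<Longrightarrow> pdiff i g b x \<Longrightarrow> pdiff i (\<lambda>x. f x * g x) (f x * b + a * g x) x"
  unfolding pdiff_def using has_vector_derivative_mult[of "\<lambda>s. f (x(i := s))" a "x i" UNIV "\<lambda>s. g (x(i := s))" b]
  by simp

lemma pdiff_of_real: "pdiff i f a x \<Longrightarrow> pdiff i (\<lambda>x. complex_of_real (f x)) (of_real a) x"
  unfolding pdiff_def
  by (rule has_vector_derivative_of_real) (simp add: has_real_derivative_iff_has_vector_derivative)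

lemma Ck_on_const:
  fixes I :: "'i set" and c :: "'b::real_normed_vector"
  shows "Ck_on k I S (\<lambda>x. c)"
proof (induction k arbitrary: c)
  case (Suc k)
  have "coord_deriv i (\<lambda>x. c) = (\<lambda>x. 0)" for i :: 'i and c :: 'b
    using coord_deriv_pdiff[OF pdiff_const] by (intro ext)
  then show ?case using Suc by simp
qed simp

lemma smooth_on_const: "smooth_on I S (\<lambda>x. c)"
  by (simp add: smooth_on_def Ck_on_const)

lemma Ck_on_add:
  "openin (Rspace I) S \<Longrightarrow> Ck_on k I S f \<Longrightarrow> Ck_on k I S g \<Longrightarrow> Ck_on k I S (\<lambda>x. f x + g x)"
proof (induction k arbitrary: f g)
  case 0
  then show ?case by (auto intro: continuous_map_add)
next
  case (Suc k)
  have d: "pdiff i (\<lambda>x. f x + g x) (coord_deriv i f x + coord_deriv i g x) x" if "i \<in> I" "x \<in> S" for i x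
    using Suc.prems that by (auto intro!: pdiff_add simp: pdiff_coord_deriv)
  have "Ck_on k I S (coord_deriv i (\<lambda>x. f x + g x))" if i: "i \<in> I" for i
  proof -
    have "Ck_on k I S (\<lambda>x. coord_deriv i f x + coord_deriv i g x)"
      by (rule Suc.IH) (use Suc.prems i in auto)
    then show ?thesis
      by (subst Ck_on_cong[OF Suc.prems(1), where h = "\<lambda>x. coord_deriv i f x + coord_deriv i g x"])
        (use coord_deriv_pdiff[OF d[OF i]] in auto)
  qed
  moreover have "(\<lambda>s. f (x(i := s)) + g (x(i := s))) differentiable at (x i)" if "i \<in> I" "x \<in> S" for i x
    using d[OF that] unfolding pdiff_def by (rule differentiableI_vector)
  moreover have "cont_on I S (\<lambda>x. f x + g x)" using Suc.prems by (auto intro!: continuous_map_add)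
  ultimately show ?case by simp
qed

lemma cont_on_mult:
  fixes f g :: "('i \<Rightarrow> real) \<Rightarrow> 'b::real_normed_algebra"
  shows "cont_on I S f \<Longrightarrow> cont_on I S g \<Longrightarrow> cont_on I S (\<lambda>x. f x * g x)"
  unfolding continuous_map_atin by (auto intro: tendsto_mult)

lemma Ck_on_mult:
  fixes f g :: "('i \<Rightarrow> real) \<Rightarrow> 'b::real_normed_algebra"
  shows "openin (Rspace I) S \<Longrightarrow> Ck_on k I S f \<Longrightarrow> Ck_on k I S g \<Longrightarrow> Ck_on k I S (\<lambda>x. f x * g x)"
proof (induction k arbitrary: f g)
  case 0
  then show ?case by (auto intro: cont_on_mult)
next
  case (Suc k)
  let ?D = "\<lambda>i x. f x * coord_deriv i g x + coord_deriv i f x * g x"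
  have d: "pdiff i (\<lambda>x. f x * g x) (?D i x) x" if "i \<in> I" "x \<in> S" for i x
    using Suc.prems that by (auto intro!: pdiff_mult simp: pdiff_coord_deriv)
  have "Ck_on k I S (coord_deriv i (\<lambda>x. f x * g x))" if i: "i \<in> I" for i
  proof -
    have "Ck_on k I S (?D i)"
      by (rule Ck_on_add[OF Suc.prems(1)]; rule Suc.IH; use Suc.prems i Ck_on_mono in auto)
    then show ?thesis
      by (subst Ck_on_cong[OF Suc.prems(1), where h = "?D i"])
        (use coord_deriv_pdiff[OF d[OF i]] in auto)
  qed
  moreover have "(\<lambda>s. f (x(i := s)) * g (x(i := s))) differentiable at (x i)" if "i \<in> I" "x \<in> S" for i x
    using d[OF that] unfolding pdiff_def by (rule differentiableI_vector)
  moreover have "cont_on I S (\<lambda>x. f x * g x)" using Suc.prems by (auto intro!: cont_on_mult)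
  ultimately show ?case by simp
qed

lemma Ck_on_sum:
  assumes S: "openin (Rspace I) S" and "\<And>j. j \<in> J \<Longrightarrow> Ck_on k I S (f j)"
  shows "Ck_on k I S (\<lambda>x. \<Sum>j\<in>J. f j x)"
  using assms(2)
  by (induction J rule: infinite_finite_induct) (auto intro: Ck_on_const Ck_on_add[OF S])

lemma smooth_on_add:
  "openin (Rspace I) S \<Longrightarrow> smooth_on I S f \<Longrightarrow> smooth_on I S g \<Longrightarrow> smooth_on I S (\<lambda>x. f x + g x)"
  by (auto simp: smooth_on_def intro: Ck_on_add)

lemma smooth_on_sum:
  assumes S: "openin (Rspace I) S" and "\<And>j. j \<in> J \<Longrightarrow> smooth_on I S (f j)"
  shows "smooth_on I S (\<lambda>x. \<Sum>j\<in>J. f j x)"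
  using assms(2)
  by (induction J rule: infinite_finite_induct) (auto intro: smooth_on_const smooth_on_add[OF S])

lemma smooth_on_mult:
  fixes f g :: "('i \<Rightarrow> real) \<Rightarrow> 'b::real_normed_algebra"
  shows "openin (Rspace I) S \<Longrightarrow> smooth_on I S f \<Longrightarrow> smooth_on I S g \<Longrightarrow> smooth_on I S (\<lambda>x. f x * g x)"
  by (auto simp: smooth_on_def intro: Ck_on_mult)

lemma Ck_on_of_real:
  assumes S: "openin (Rspace I) S"
  shows "Ck_on k I S f \<Longrightarrow> Ck_on k I S (\<lambda>x. complex_of_real (f x))"
proof (induction k arbitrary: f)
  case 0
  then show ?case unfolding Ck_on.simps continuous_map_atin by (auto intro: tendsto_of_real)
next
  case (Suc k)
  have d: "pdiff i (\<lambda>x. complex_of_real (f x)) (of_real (coord_deriv i f x)) x" if "i \<in> I" "x \<in> S" for i x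
    using Suc.prems that by (auto intro!: pdiff_of_real simp: pdiff_coord_deriv)
  have "Ck_on k I S (coord_deriv i (\<lambda>x. complex_of_real (f x)))" if i: "i \<in> I" for i
    by (subst Ck_on_cong[OF S, where h = "\<lambda>x. complex_of_real (coord_deriv i f x)"])
      (use coord_deriv_pdiff[OF d[OF i]] Suc.IH Suc.prems i in auto)
  moreover have "(\<lambda>s. complex_of_real (f (x(i := s)))) differentiable at (x i)" if "i \<in> I" "x \<in> S" for i x
    using d[OF that] unfolding pdiff_def by (rule differentiableI_vector)
  moreover have "cont_on I S (\<lambda>x. complex_of_real (f x))"
    using Suc.prems unfolding Ck_on.simps continuous_map_atin by (auto intro: tendsto_of_real)
  ultimately show ?case by simp
qed

lemma smooth_on_of_real:
  "openin (Rspace I) S \<Longrightarrow> smooth_on I S f \<Longrightarrow> smooth_on I S (\<lambda>x. complex_of_real (f x))"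
  by (auto simp: smooth_on_def intro: Ck_on_of_real)

abbreviation obox :: "'i set \<Rightarrow> ('i \<Rightarrow> real) \<Rightarrow> real \<Rightarrow> ('i \<Rightarrow> real) set"
  where "obox I x r \<equiv> PiE I (\<lambda>i. ball (x i) r)"
abbreviation cbx :: "'i set \<Rightarrow> ('i \<Rightarrow> real) \<Rightarrow> real \<Rightarrow> ('i \<Rightarrow> real) set"
  where "cbx I x r \<equiv> PiE I (\<lambda>i. cball (x i) r)"

lemma open_obox: "finite I \<Longrightarrow> openin (Rspace I) (obox I x r)"
  by (simp add: openin_PiE)

lemma compact_cbx: "compactin (Rspace I) (cbx I x r)"
  by (simp add: compactin_PiE)

lemma cbx_nbhd:
  assumes "finite I" "openin (Rspace I) S" "x \<in> S"
  shows "\<exists>r>0. cbx I x r \<subseteq> S"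
proof -
  obtain U where U: "finite {i \<in> I. U i \<noteq> topspace euclideanreal}" "\<forall>i\<in>I. openin euclideanreal (U i)"
    "x \<in> PiE I U" "PiE I U \<subseteq> S"
    using assms(2,3) unfolding openin_product_topology_alt by metis
  have "\<forall>i\<in>I. \<exists>r>0. cball (x i) r \<subseteq> U i"
    using U by (metis PiE_mem open_contains_cball open_openin)
  then obtain r where r: "\<And>i. i \<in> I \<Longrightarrow> r i > 0 \<and> cball (x i) (r i) \<subseteq> U i" by metis
  define q where "q = Min (insert 1 (r ` I))"
  have q: "q > 0" "\<And>i. i \<in> I \<Longrightarrow> q \<le> r i" using assms(1) r by (auto simp: q_def)
  have "cbx I x q \<subseteq> PiE I U"
  proof (rule PiE_mono)
    fix i assume i: "i \<in> I"
    have "cball (x i) q \<subseteq> cball (x i) (r i)" using q(2)[OF i] by (rule subset_cball)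
    then show "cball (x i) q \<subseteq> U i" using r[OF i] by blast
  qed
  then have "cbx I x q \<subseteq> S" using U(4) by (rule subset_trans)
  then show ?thesis using q(1) by blast
qed

text \<open>On a box around \<open>x\<close> where every \<open>D i\<close> differs from \<open>D i x\<close> by at most \<open>e\<close>, move from \<open>x\<close> to \<open>y\<close> by
  changing one coordinate at a time; the mean value inequality bounds the error of each step.\<close>

lemma total_differential:
  fixes g :: "('i \<Rightarrow> real) \<Rightarrow> 'b::real_normed_vector"
  assumes I: "finite I" and S: "openin (Rspace I) S" "x \<in> S"
    and D: "\<And>i y. i \<in> I \<Longrightarrow> y \<in> S \<Longrightarrow> pdiff i g (D i y) y" "\<And>i. i \<in> I \<Longrightarrow> cont_on I S (D i)"
    and e: "e > 0"
  shows "\<exists>r>0. \<forall>y\<in>obox I x r. norm (g y - g x - (\<Sum>i\<in>I. (y i - x i) *\<^sub>R D i x)) \<le> e * (\<Sum>i\<in>I. \<bar>y i - x i\<bar>)"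
proof -
  have opn: "openin (Rspace I) {y \<in> S. D i y \<in> ball (D i x) e}" if "i \<in> I" for i
  proof -
    have "openin (subtopology (Rspace I) S) {y \<in> topspace (subtopology (Rspace I) S). D i y \<in> ball (D i x) e}"
      by (rule openin_continuous_map_preimage[OF D(2)[OF that]]) simp
    then have "openin (Rspace I) {y \<in> topspace (subtopology (Rspace I) S). D i y \<in> ball (D i x) e}"
      using S(1) openin_open_subtopology by blast
    moreover have "topspace (subtopology (Rspace I) S) = S" using S(1) openin_subset
      by (metis topspace_subtopology_subset)
    ultimately show ?thesis by (simp only:)
  qed
  have "openin (Rspace I) (S \<inter> (\<Inter>i\<in>I. {y \<in> S. D i y \<in> ball (D i x) e}))"
  proof (cases "I = {}")
    case False
    show ?thesis by (rule openin_Int[OF S(1) openin_INT2[OF I False opn]])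
  qed (use S in simp)
  moreover have "x \<in> S \<inter> (\<Inter>i\<in>I. {y \<in> S. D i y \<in> ball (D i x) e})" using S e by auto
  ultimately have "\<exists>r>0. cbx I x r \<subseteq> S \<inter> (\<Inter>i\<in>I. {y \<in> S. D i y \<in> ball (D i x) e})"
    by (rule cbx_nbhd[OF I])
  then obtain r where r: "r > 0" "cbx I x r \<subseteq> S \<inter> (\<Inter>i\<in>I. {y \<in> S. D i y \<in> ball (D i x) e})"
    by (elim exE conjE)
  have sub: "obox I x r \<subseteq> cbx I x r" by (rule PiE_mono) auto
  have sub': "y \<in> S \<inter> (\<Inter>i\<in>I. {y \<in> S. D i y \<in> ball (D i x) e})" if "y \<in> obox I x r" for y
    by (rule subsetD[OF r(2)], rule subsetD[OF sub that])
  have bS: "y \<in> S" if "y \<in> obox I x r" for y using sub'[OF that] by simp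
  have bD: "norm (D i y - D i x) \<le> e" if "y \<in> obox I x r" "i \<in> I" for y i
    using sub'[OF that(1)] that(2) by (simp add: dist_norm norm_minus_commute less_imp_le)
  have main: "norm (g y - g x - (\<Sum>i\<in>F. (y i - x i) *\<^sub>R D i x)) \<le> e * (\<Sum>i\<in>F. \<bar>y i - x i\<bar>)"
    if "F \<subseteq> I" "y \<in> obox I x r" "\<forall>i\<in>I - F. y i = x i" for F y
    using finite_subset[OF that(1) I] that
  proof (induction F arbitrary: y rule: finite_induct)
    case empty
    have "x \<in> extensional I" by (rule Rspace_mem[OF S])
    then have "y = x" using empty by (intro extensionalityI[of y I x]) (auto simp: PiE_iff)
    then show ?case by simp
  next
    case (insert j F)
    let ?y = "y(j := x j)"
    have j: "j \<in> I" using insert by auto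
    have yj: "y(j := s) \<in> obox I x r" if "s \<in> ball (x j) r" for s
      using insert.prems(2) that j by (auto simp: PiE_iff extensional_def)
    have IH: "norm (g ?y - g x - (\<Sum>i\<in>F. (?y i - x i) *\<^sub>R D i x)) \<le> e * (\<Sum>i\<in>F. \<bar>?y i - x i\<bar>)"
      by (rule insert.IH) (use insert.prems yj r in auto)
    have sum_eq: "(\<Sum>i\<in>F. (?y i - x i) *\<^sub>R D i x) = (\<Sum>i\<in>F. (y i - x i) *\<^sub>R D i x)"
      "(\<Sum>i\<in>F. \<bar>?y i - x i\<bar>) = (\<Sum>i\<in>F. \<bar>y i - x i\<bar>)"
      using insert.hyps by (auto intro!: sum.cong)
    let ?h = "\<lambda>s. g (y(j := s)) - s *\<^sub>R D j x"
    have step: "norm (?h (y j) - ?h (x j)) \<le> e * norm (y j - x j)"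
    proof (rule differentiable_bound[where S = "ball (x j) r" and f' = "\<lambda>s k. k *\<^sub>R (D j (y(j := s)) - D j x)"])
      fix s assume s: "s \<in> ball (x j) r"
      have "pdiff j g (D j (y(j := s))) (y(j := s))" using D(1)[OF j] bS[OF yj[OF s]] by blast
      then have "((\<lambda>s. g (y(j := s))) has_vector_derivative D j (y(j := s))) (at s)"
        by (simp add: pdiff_def)
      then have "(?h has_vector_derivative D j (y(j := s)) - 1 *\<^sub>R D j x) (at s)"
        by (intro has_vector_derivative_diff)
          (simp_all add: has_vector_derivative_def bounded_linear_imp_has_derivative bounded_linear_scaleR_left)
      then show "(?h has_derivative (\<lambda>k. k *\<^sub>R (D j (y(j := s)) - D j x))) (at s within ball (x j) r)"
        by (simp add: has_vector_derivative_def has_derivative_at_withinI)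
      show "onorm (\<lambda>k. k *\<^sub>R (D j (y(j := s)) - D j x)) \<le> e"
        by (rule onorm_le) (use bD[OF yj[OF s] j] in \<open>simp add: mult.commute[of e] mult_left_mono\<close>)
    qed (use insert.prems(2) j r in \<open>auto simp: PiE_iff\<close>)
    have eq: "g y - g x - (\<Sum>i\<in>insert j F. (y i - x i) *\<^sub>R D i x) =
        (?h (y j) - ?h (x j)) + (g ?y - g x - (\<Sum>i\<in>F. (?y i - x i) *\<^sub>R D i x))"
      unfolding sum_eq using insert.hyps by (simp add: scaleR_diff_left)
    have rhs: "e * norm (y j - x j) + e * (\<Sum>i\<in>F. \<bar>?y i - x i\<bar>) = e * (\<Sum>i\<in>insert j F. \<bar>y i - x i\<bar>)"
      unfolding sum_eq using insert.hyps by (simp add: distrib_left)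
    show ?case unfolding eq rhs[symmetric] by (rule norm_triangle_mono[OF step IH])
  qed
  have "\<forall>y\<in>obox I x r. norm (g y - g x - (\<Sum>i\<in>I. (y i - x i) *\<^sub>R D i x)) \<le> e * (\<Sum>i\<in>I. \<bar>y i - x i\<bar>)"
    by (intro ballI main) auto
  then show ?thesis using r(1) by (intro exI[of _ r] conjI)
qed

section \<open>The chain rule\<close>

text \<open>The linear approximation of \<open>g\<close> at \<open>\<gamma> s0\<close> has an error of \<open>e\<close> times the distance, and along a differentiable
  curve the distance is at most a constant times \<open>\<bar>s - s0\<bar>\<close>. So the remainder \<open>R\<close> has derivative 0.\<close>

lemma chain_rule_curve:
  fixes g :: "('i \<Rightarrow> real) \<Rightarrow> 'b::real_normed_vector"
  assumes I: "finite I" and S: "openin (Rspace I) S" "\<gamma> s0 \<in> S"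
    and D: "\<And>i y. i \<in> I \<Longrightarrow> y \<in> S \<Longrightarrow> pdiff i g (D i y) y" "\<And>i. i \<in> I \<Longrightarrow> cont_on I S (D i)"
    and ext: "\<forall>\<^sub>F s in nhds s0. \<gamma> s \<in> extensional I"
    and d\<gamma>: "\<And>i. i \<in> I \<Longrightarrow> ((\<lambda>s. \<gamma> s i) has_real_derivative \<gamma>' i) (at s0)"
  shows "((\<lambda>s. g (\<gamma> s)) has_vector_derivative (\<Sum>i\<in>I. \<gamma>' i *\<^sub>R D i (\<gamma> s0))) (at s0)"
proof -
  let ?x = "\<gamma> s0"
  define R where "R = (\<lambda>s. g (\<gamma> s) - (\<Sum>i\<in>I. (\<gamma> s i - ?x i) *\<^sub>R D i ?x))"
  define C where "C = 1 + (\<Sum>i\<in>I. \<bar>\<gamma>' i\<bar> + 1)"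
  have C: "C > 0" unfolding C_def by (intro add_pos_nonneg sum_nonneg) auto
  have lip: "\<forall>\<^sub>F s in nhds s0. \<bar>\<gamma> s i - ?x i\<bar> \<le> (\<bar>\<gamma>' i\<bar> + 1) * \<bar>s - s0\<bar>" if i: "i \<in> I" for i
  proof -
    have "((\<lambda>s. \<gamma> s i) has_derivative (\<lambda>h. \<gamma>' i * h)) (at s0)"
      using d\<gamma>[OF i] by (simp add: has_field_derivative_def)
    then obtain d where d: "d > 0" "\<And>s. norm (s - s0) < d \<Longrightarrow>
        norm (\<gamma> s i - ?x i - \<gamma>' i * (s - s0)) \<le> 1 * norm (s - s0)"
      unfolding has_derivative_at_alt using zero_less_one by metis
    have "\<bar>\<gamma> s i - ?x i\<bar> \<le> (\<bar>\<gamma>' i\<bar> + 1) * \<bar>s - s0\<bar>" if "norm (s - s0) < d" for s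
    proof -
      have "\<bar>\<gamma> s i - ?x i\<bar> \<le> \<bar>\<gamma>' i * (s - s0)\<bar> + \<bar>s - s0\<bar>" using d(2)[OF that] by (simp add: abs_if split: if_splits)
      then show ?thesis unfolding abs_mult by (simp add: distrib_right)
    qed
    then show ?thesis unfolding eventually_nhds_metric using d(1) by (auto simp: dist_norm)
  qed
  have bounded: "\<forall>\<^sub>F s in nhds s0. norm (R s - R s0) \<le> e * \<bar>s - s0\<bar>" if e: "e > 0" for e
  proof -
    obtain r where r: "r > 0" "\<forall>y\<in>obox I ?x r. norm (g y - g ?x - (\<Sum>i\<in>I. (y i - ?x i) *\<^sub>R D i ?x)) \<le> e / C * (\<Sum>i\<in>I. \<bar>y i - ?x i\<bar>)"
      using total_differential[OF I S D, of "e / C"] e C by fastforce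
    have "\<forall>\<^sub>F s in nhds s0. \<gamma> s i \<in> ball (?x i) r" if "i \<in> I" for i
    proof -
      have "isCont (\<lambda>s. \<gamma> s i) s0" using d\<gamma>[OF that] DERIV_isCont by blast
      then have "((\<lambda>s. \<gamma> s i) \<longlongrightarrow> ?x i) (nhds s0)"
        by (simp add: isCont_def tendsto_nhds_iff)
      then show ?thesis using r(1) by (auto dest!: tendstoD simp: dist_commute)
    qed
    then have "\<forall>\<^sub>F s in nhds s0. \<forall>i\<in>I. \<gamma> s i \<in> ball (?x i) r"
      by (simp add: I eventually_ball_finite_distrib)
    moreover have "\<forall>\<^sub>F s in nhds s0. \<forall>i\<in>I. \<bar>\<gamma> s i - ?x i\<bar> \<le> (\<bar>\<gamma>' i\<bar> + 1) * \<bar>s - s0\<bar>"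
      using lip by (simp add: I eventually_ball_finite_distrib)
    ultimately show ?thesis using ext
    proof eventually_elim
      case (elim s)
      then have "\<gamma> s \<in> obox I ?x r" by (simp add: PiE_iff)
      then have "norm (R s - R s0) \<le> e / C * (\<Sum>i\<in>I. \<bar>\<gamma> s i - ?x i\<bar>)"
        using r(2) by (simp add: R_def algebra_simps)
      also have "\<dots> \<le> e / C * (\<Sum>i\<in>I. (\<bar>\<gamma>' i\<bar> + 1) * \<bar>s - s0\<bar>)"
        using elim e C by (intro mult_left_mono sum_mono) auto
      also have "\<dots> = e / C * ((C - 1) * \<bar>s - s0\<bar>)" by (simp add: C_def sum_distrib_right)
      also have "\<dots> \<le> e / C * (C * \<bar>s - s0\<bar>)"
        using e C by (intro mult_left_mono mult_right_mono) auto
      also have "\<dots> = e * \<bar>s - s0\<bar>" using C by simp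
      finally show ?case .
    qed
  qed
  have "(R has_derivative (\<lambda>h. h *\<^sub>R 0)) (at s0)"
    unfolding has_derivative_at_alt
  proof (intro conjI allI impI)
    fix e :: real assume "0 < e"
    from bounded[OF this] show "\<exists>d>0. \<forall>y. norm (y - s0) < d \<longrightarrow> norm (R y - R s0 - (y - s0) *\<^sub>R 0) \<le> e * norm (y - s0)"
      unfolding eventually_nhds_metric by (simp add: dist_norm)
  qed (simp add: bounded_linear_zero)
  then have R: "(R has_vector_derivative 0) (at s0)" by (simp add: has_vector_derivative_def)
  have "((\<lambda>s. \<Sum>i\<in>I. (\<gamma> s i - ?x i) *\<^sub>R D i ?x) has_vector_derivative (\<Sum>i\<in>I. \<gamma>' i *\<^sub>R D i ?x)) (at s0)"
    by (intro has_vector_derivative_sum) (auto intro!: derivative_eq_intros d\<gamma>)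
  from has_vector_derivative_add[OF R this] show ?thesis by (simp add: R_def)
qed

lemma Ck_on_compose:
  fixes g :: "('j \<Rightarrow> real) \<Rightarrow> complex" and \<Phi> :: "('i \<Rightarrow> real) \<Rightarrow> 'j \<Rightarrow> real"
  assumes J: "finite J" and S: "openin (Rspace I) S" and T: "openin (Rspace J) T"
    and \<Phi>: "\<And>x. x \<in> S \<Longrightarrow> \<Phi> x \<in> T" "\<And>j. j \<in> J \<Longrightarrow> smooth_on I S (\<lambda>x. \<Phi> x j)"
  shows "Ck_on k J T g \<Longrightarrow> Ck_on k I S (\<lambda>x. g (\<Phi> x))"
proof (induction k arbitrary: g)
  have topS: "topspace (subtopology (Rspace I) S) = S" using S openin_subset
    by (metis topspace_subtopology_subset)
  have "continuous_map (subtopology (Rspace I) S) (Rspace J) \<Phi>"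
    unfolding continuous_map_componentwise topS
    using smooth_on_cont[OF \<Phi>(2)] Rspace_mem[OF T \<Phi>(1)] by (intro conjI image_subsetI ballI) simp_all
  then have c\<Phi>: "continuous_map (subtopology (Rspace I) S) (subtopology (Rspace J) T) \<Phi>"
    unfolding continuous_map_in_subtopology topS using \<Phi>(1) by (simp add: image_subset_iff)
  have cont: "cont_on I S (\<lambda>x. h (\<Phi> x))" if "cont_on J T h" for h :: "('j \<Rightarrow> real) \<Rightarrow> complex"
    using continuous_map_compose[OF c\<Phi> that] by (simp add: comp_def)
  {
    case 0
    then show ?case using cont by simp
  next
    case (Suc k)
    let ?D = "\<lambda>i x. \<Sum>j\<in>J. complex_of_real (coord_deriv i (\<lambda>x. \<Phi> x j) x) * coord_deriv j g (\<Phi> x)"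
    have d: "pdiff i (\<lambda>x. g (\<Phi> x)) (?D i x) x" if i: "i \<in> I" and x: "x \<in> S" for i x
    proof -
      have "((\<lambda>s. g (\<Phi> (x(i := s)))) has_vector_derivative
          (\<Sum>j\<in>J. coord_deriv i (\<lambda>x. \<Phi> x j) x *\<^sub>R coord_deriv j g (\<Phi> (x(i := x i))))) (at (x i))"
      proof (rule chain_rule_curve[OF J T, where \<gamma> = "\<lambda>s. \<Phi> (x(i := s))"])
        show "\<Phi> (x(i := x i)) \<in> T" using \<Phi> x by simp
        show "\<forall>\<^sub>F s in nhds (x i). \<Phi> (x(i := s)) \<in> extensional J"
          unfolding eventually_nhds
          by (rule exI[of _ "{s. x(i := s) \<in> S}"]) (use open_slice[OF S x i] Rspace_mem[OF T \<Phi>(1)] in simp)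
        fix j assume j: "j \<in> J"
        show "pdiff j g (coord_deriv j g y) y" if "y \<in> T" for y
          using Suc.prems j that by (simp add: pdiff_coord_deriv)
        show "cont_on J T (coord_deriv j g)" using Suc.prems j by (cases k) auto
        show "((\<lambda>s. \<Phi> (x(i := s)) j) has_real_derivative coord_deriv i (\<lambda>x. \<Phi> x j) x) (at (x i))"
          using smooth_on_pdiff[OF \<Phi>(2)[OF j] i x]
          by (simp add: pdiff_def has_real_derivative_iff_has_vector_derivative)
      qed
      then show ?thesis by (simp add: pdiff_def scaleR_conv_of_real)
    qed
    have "Ck_on k I S (coord_deriv i (\<lambda>x. g (\<Phi> x)))" if i: "i \<in> I" for i
    proof -
      have "Ck_on k I S (?D i)"
      proof (intro Ck_on_sum[OF S] Ck_on_mult[OF S] Ck_on_of_real[OF S])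
        fix j assume j: "j \<in> J"
        show "Ck_on k I S (coord_deriv i (\<lambda>x. \<Phi> x j))"
          using smooth_on_coord_deriv[OF \<Phi>(2)[OF j] i] by (simp add: smooth_on_def)
        show "Ck_on k I S (\<lambda>x. coord_deriv j g (\<Phi> x))" using Suc.IH Suc.prems j by simp
      qed
      then show ?thesis
        by (subst Ck_on_cong[OF S, where h = "?D i"]) (use coord_deriv_pdiff[OF d[OF i]] in auto)
    qed
    moreover have "(\<lambda>s. g (\<Phi> (x(i := s)))) differentiable at (x i)" if "i \<in> I" "x \<in> S" for i x
      using d[OF that] unfolding pdiff_def by (rule differentiableI_vector)
    moreover have "cont_on I S (\<lambda>x. g (\<Phi> x))" using Suc.prems cont by simp
    ultimately show ?case by simp
  }
qed

lemma smooth_on_compose: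
  fixes g :: "('j \<Rightarrow> real) \<Rightarrow> complex" and \<Phi> :: "('i \<Rightarrow> real) \<Rightarrow> 'j \<Rightarrow> real"
  assumes "finite J" "openin (Rspace I) S" "openin (Rspace J) T"
    and "\<And>x. x \<in> S \<Longrightarrow> \<Phi> x \<in> T" "\<And>j. j \<in> J \<Longrightarrow> smooth_on I S (\<lambda>x. \<Phi> x j)"
    and "smooth_on J T g"
  shows "smooth_on I S (\<lambda>x. g (\<Phi> x))"
  unfolding smooth_on_def
proof
  fix k
  have "Ck_on k J T g" using assms(6) by (simp add: smooth_on_def)
  then show "Ck_on k I S (\<lambda>x. g (\<Phi> x))" by (rule Ck_on_compose[OF assms(1-3), rotated 2]) (use assms(4,5) in auto)
qed

lemma pdiff_coordinate: "pdiff i (\<lambda>x. x j) (if i = j then 1 else 0) x"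
  by (auto simp: pdiff_def intro!: derivative_eq_intros)

lemma smooth_on_coordinate:
  assumes "j \<in> I"
  shows "smooth_on I S (\<lambda>x. x j :: real)"
proof (subst smooth_on_iff, intro conjI ballI)
  show "cont_on I S (\<lambda>x. x j)"
    using assms continuous_map_product_projection[of j I "\<lambda>_. euclideanreal"] by (blast intro: continuous_map_from_subtopology)
  fix i
  have eq: "coord_deriv i (\<lambda>x. x j) = (\<lambda>x. if i = j then 1 else 0)"
    by (intro ext coord_deriv_pdiff pdiff_coordinate)
  show "pdiff i (\<lambda>x. x j) (coord_deriv i (\<lambda>x. x j) x) x" for x :: "'a \<Rightarrow> real"
    unfolding eq by (rule pdiff_coordinate)
  show "smooth_on I S (coord_deriv i (\<lambda>x. x j))" unfolding eq by (rule smooth_on_const)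
qed

section \<open>Bump functions\<close>

text \<open>These functions are closed under differentiation and vanish to infinite order at 0; \<open>flat 1\<close> is the
  classical smooth function \<open>exp (-1/x)\<close> on the positive half-line.\<close>

definition flat :: "real poly \<Rightarrow> real \<Rightarrow> real"
  where "flat p x = (if x > 0 then poly p (1 / x) * exp (- (1 / x)) else 0)"

lemma poly_exp_tendsto_0:
  fixes p :: "real poly"
  shows "((\<lambda>y. poly p y * exp (- y)) \<longlongrightarrow> 0) at_top"
proof -
  have "((\<lambda>y. \<Sum>k\<le>degree p. coeff p k * (y ^ k / exp y)) \<longlongrightarrow> (\<Sum>k\<le>degree p. coeff p k * 0)) at_top"
    by (intro tendsto_sum tendsto_mult tendsto_const tendsto_power_div_exp_0)
  then show ?thesis
    by (simp add: poly_altdef exp_minus divide_inverse sum_distrib_right mult.assoc)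
qed

lemma flat_has_derivative:
  "(flat p has_real_derivative flat ([:0, 0, 1:] * (p - pderiv p)) x) (at x)"
proof (cases x "0::real" rule: linorder_cases)
  case less
  have "((\<lambda>_. 0) has_real_derivative 0) (at x)" by simp
  moreover have "\<forall>\<^sub>F y in nhds x. flat p y = 0"
    using eventually_nhds_in_open[of "{..<0}" x] less by (auto simp: flat_def elim: eventually_mono)
  ultimately have "(flat p has_real_derivative 0) (at x)"
    by (subst DERIV_cong_ev[where g = "\<lambda>_. 0"]) auto
  then show ?thesis using less by (simp add: flat_def)
next
  case greater
  have "((\<lambda>y. poly p (1 / y) * exp (- (1 / y))) has_real_derivative
      poly ([:0, 0, 1:] * (p - pderiv p)) (1 / x) * exp (- (1 / x))) (at x)"
    using greater by (auto intro!: derivative_eq_intros simp: field_simps power2_eq_square)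
  moreover have "\<forall>\<^sub>F y in nhds x. flat p y = poly p (1 / y) * exp (- (1 / y))"
    using eventually_nhds_in_open[of "{0<..}" x] greater by (auto simp: flat_def elim: eventually_mono)
  ultimately have "(flat p has_real_derivative poly ([:0, 0, 1:] * (p - pderiv p)) (1 / x) * exp (- (1 / x))) (at x)"
    by (subst DERIV_cong_ev[where g = "\<lambda>y. poly p (1 / y) * exp (- (1 / y))"]) auto
  then show ?thesis using greater by (simp add: flat_def)
next
  case equal
  have r: "((\<lambda>h. flat p h / h) \<longlongrightarrow> 0) (at_right 0)"
  proof -
    have "((\<lambda>h. poly (pCons 0 p) (inverse h) * exp (- inverse h)) \<longlongrightarrow> 0) (at_right (0::real))"
      by (rule filterlim_compose[OF poly_exp_tendsto_0 filterlim_inverse_at_top_right])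
    moreover have "\<forall>\<^sub>F h in at_right 0. poly (pCons 0 p) (inverse h) * exp (- inverse h) = flat p h / h"
      unfolding eventually_at_right_field by (auto simp: flat_def field_simps intro!: exI[of _ 1])
    ultimately show ?thesis by (rule Lim_transform_eventually)
  qed
  have l: "((\<lambda>h. flat p h / h) \<longlongrightarrow> 0) (at_left 0)"
    by (rule Lim_transform_eventually[OF tendsto_const])
      (auto simp: eventually_at_left_field flat_def intro!: exI[of _ "-1"])
  have "((\<lambda>h. flat p h / h) \<longlongrightarrow> 0) (at 0)"
    by (rule filterlim_split_at[OF l r])
  then show ?thesis using equal by (simp add: has_field_derivative_iff flat_def)
qed

text \<open>Functions of one real variable are treated as functions on the product indexed by the unit type,
  so that the results on several variables apply to them.\<close>

abbreviation smooth1 :: "(real \<Rightarrow> real) \<Rightarrow> bool"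
  where "smooth1 F \<equiv> smooth_on {()} (topspace (Rspace {()})) (\<lambda>y. complex_of_real (F (y ())))"

lemma pdiff_smooth1:
  assumes "(F has_real_derivative d) (at (y ()))"
  shows "pdiff () (\<lambda>y. complex_of_real (F (y ()))) (complex_of_real d) y"
  unfolding pdiff_def
  by (simp, rule has_vector_derivative_of_real) (use assms in simp)

lemma cont_on_smooth1:
  assumes "\<And>x. isCont F x"
  shows "cont_on {()} S (\<lambda>y. complex_of_real (F (y ())))"
proof -
  have "continuous_map (Rspace {()}) euclideanreal (\<lambda>y. y ())"
    by (rule continuous_map_product_projection) simp
  moreover have "continuous_map euclideanreal euclidean (\<lambda>x. complex_of_real (F x))"
    using assms by (auto simp: continuous_on_eq_continuous_at intro!: continuous_intros)
  ultimately have "continuous_map (Rspace {()}) euclidean ((\<lambda>x. complex_of_real (F x)) \<circ> (\<lambda>y. y ()))"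
    by (rule continuous_map_compose)
  then show ?thesis by (simp add: comp_def continuous_map_from_subtopology)
qed

text \<open>For families in which every derivative is again a member, such as \<open>flat\<close>.\<close>

lemma smooth1_tower:
  assumes "\<And>n x. (T n has_real_derivative T (f n) x) (at x)"
  shows "smooth1 (T n)"
proof (rule smooth_on_family[where P = "\<lambda>g. \<exists>n. g = (\<lambda>y. complex_of_real (T n (y ())))"])
  fix g assume "\<exists>n. g = (\<lambda>y. complex_of_real (T n (y ())))"
  then obtain n where g: "g = (\<lambda>y. complex_of_real (T n (y ())))" by auto
  show "cont_on {()} (topspace (Rspace {()})) g" unfolding g
    by (rule cont_on_smooth1) (use assms DERIV_isCont in blast)
  fix i :: unit
  show "\<exists>g'. (\<exists>n. g' = (\<lambda>y. complex_of_real (T n (y ())))) \<and> (\<forall>x\<in>topspace (Rspace {()}). pdiff i g (g' x) x)"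
    unfolding g by (rule exI[of _ "\<lambda>y. complex_of_real (T (f n) (y ()))"])
      (use pdiff_smooth1[OF assms] in auto)
qed (blast intro: openin_topspace)+

lemma smooth1_antiderivative:
  assumes "\<And>x. (F has_real_derivative F' x) (at x)" "smooth1 F'"
  shows "smooth1 F"
proof (subst smooth_on_iff, intro conjI ballI)
  show "cont_on {()} (topspace (Rspace {()})) (\<lambda>y. complex_of_real (F (y ())))"
    by (rule cont_on_smooth1) (use assms DERIV_isCont in blast)
  fix i :: unit
  have eq: "coord_deriv i (\<lambda>y. complex_of_real (F (y ()))) = (\<lambda>y. complex_of_real (F' (y ())))"
    using coord_deriv_pdiff[OF pdiff_smooth1[OF assms(1)]] by (intro ext) simp
  show "smooth_on {()} (topspace (Rspace {()})) (coord_deriv i (\<lambda>y. complex_of_real (F (y ()))))"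
    unfolding eq by (rule assms(2))
  show "pdiff i (\<lambda>y. complex_of_real (F (y ()))) (coord_deriv i (\<lambda>y. complex_of_real (F (y ()))) x) x" for x
    unfolding eq using pdiff_smooth1[OF assms(1), of x] by simp
qed

text \<open>The normalised antiderivative of the bump \<open>flat 1 x * flat 1 (1 - x)\<close>.\<close>

lemma smooth_step_exists:
  "\<exists>\<theta>. smooth1 \<theta> \<and> (\<forall>x\<le>0. \<theta> x = 0) \<and> (\<forall>x\<ge>1. \<theta> x = 1)"
proof -
  let ?o = "topspace (Rspace {()})"
  define b where "b x = flat 1 x * flat 1 (1 - x)" for x
  have "smooth1 ((\<lambda>(p, s) x. s * flat p (1 - x)) (1, 1))"
  proof (rule smooth1_tower[where f = "\<lambda>(p, s). ([:0, 0, 1:] * (p - pderiv p), - s)"])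
    fix n :: "real poly \<times> real" and x :: real
    obtain p s where n: "n = (p, s)" by (cases n)
    have "((\<lambda>x. flat p (1 - x)) has_real_derivative flat ([:0, 0, 1:] * (p - pderiv p)) (1 - x) * (0 - 1)) (at x)"
      by (rule DERIV_chain2[OF flat_has_derivative]) (intro DERIV_diff DERIV_const DERIV_ident)
    from DERIV_cmult[OF this, of s]
    show "((case n of (p, s) \<Rightarrow> \<lambda>x. s * flat p (1 - x)) has_real_derivative
        (case case n of (p, s) \<Rightarrow> ([:0, 0, 1:] * (p - pderiv p), - s) of (p, s) \<Rightarrow> \<lambda>x. s * flat p (1 - x)) x) (at x)"
      unfolding n by simp
  qed
  then have "smooth1 (\<lambda>x. flat 1 (1 - x))" by (simp only: prod.case mult_1)
  moreover have "smooth1 (flat 1)" by (rule smooth1_tower[where T = flat, OF flat_has_derivative])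
  ultimately have "smooth_on {()} ?o (\<lambda>y. complex_of_real (flat 1 (1 - y ())) * complex_of_real (flat 1 (y ())))"
    by (rule smooth_on_mult[OF openin_topspace])
  then have smb: "smooth1 b" by (simp add: b_def mult.commute)
  have b0: "b x = 0" if "x \<le> 0 \<or> x \<ge> 1" for x using that by (auto simp: b_def flat_def)
  have bpos: "b x > 0" if "0 < x" "x < 1" for x using that by (auto simp: b_def flat_def)
  have "isCont b x" for x unfolding b_def
    by (intro continuous_intros DERIV_isCont[OF flat_has_derivative] isCont_o2[of x "\<lambda>x. 1 - x" "flat 1"])
  then have "continuous_on {-1..2} b" by (simp add: continuous_at_imp_continuous_on)
  then obtain g where g: "\<And>x. x \<in> {-1..2} \<Longrightarrow> (g has_vector_derivative b x) (at x within {-1..2})"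
    using antiderivative_continuous[of "-1" 2 b] by blast
  have g': "(g has_real_derivative b x) (at x)" if "-1 < x" "x < 2" for x
    using g[of x] that at_within_interior[of x "{-1..2}"]
    by (simp add: has_real_derivative_iff_has_vector_derivative)
  have gc: "g x = g 0" if "-1 < x" "x \<le> 0" for x
  proof (cases "x = 0")
    case False
    have "\<exists>z>x. z < 0 \<and> g 0 - g x = (0 - x) * b z"
      by (rule MVT2) (use that False g' in auto)
    then show ?thesis using b0 by auto
  qed simp
  have gc1: "g x = g 1" if "1 \<le> x" "x < 2" for x
  proof (cases "x = 1")
    case False
    have "\<exists>z>1. z < x \<and> g x - g 1 = (x - 1) * b z"
      by (rule MVT2) (use that False g' in auto)
    then show ?thesis using b0 by auto
  qed simp
  have "\<exists>z>0. z < 1 \<and> g 1 - g 0 = (1 - 0) * b z"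
    by (rule MVT2) (use g' in auto)
  then have c: "g 1 - g 0 > 0" using bpos by fastforce
  define \<theta> where "\<theta> x = (if x \<le> 0 then 0 else if x \<ge> 1 then 1 else (g x - g 0) / (g 1 - g 0))" for x
  have \<theta>eq: "\<theta> x = (g x - g 0) / (g 1 - g 0)" if "-1 < x" "x < 2" for x
    using gc[of x] gc1[of x] that c by (auto simp: \<theta>_def)
  have "(\<theta> has_real_derivative b x / (g 1 - g 0)) (at x)" for x
  proof -
    consider "x < 0" | "-1 < x \<and> x < 2" | "x > 1" by linarith
    then show ?thesis
    proof cases
      case 1
      have "\<forall>\<^sub>F y in nhds x. \<theta> y = 0"
        using eventually_nhds_in_open[of "{..<0}" x] 1 by (auto simp: \<theta>_def elim: eventually_mono)
      then show ?thesis using 1 b0 by (subst DERIV_cong_ev[where g = "\<lambda>_. 0"]) auto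
    next
      case 2
      have "\<forall>\<^sub>F y in nhds x. \<theta> y = (g y - g 0) / (g 1 - g 0)"
        using eventually_nhds_in_open[of "{-1<..<2}" x] 2 \<theta>eq by (auto elim: eventually_mono)
      moreover have "((\<lambda>y. (g y - g 0) / (g 1 - g 0)) has_real_derivative b x / (g 1 - g 0)) (at x)"
        using g'[of x] 2 c by (auto intro!: derivative_eq_intros)
      ultimately show ?thesis by (subst DERIV_cong_ev[where g = "\<lambda>y. (g y - g 0) / (g 1 - g 0)"]) auto
    next
      case 3
      have "\<forall>\<^sub>F y in nhds x. \<theta> y = 1"
        using eventually_nhds_in_open[of "{1<..}" x] 3 by (auto simp: \<theta>_def elim: eventually_mono)
      then show ?thesis using 3 b0 by (subst DERIV_cong_ev[where g = "\<lambda>_. 1"]) auto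
    qed
  qed
  moreover have "smooth1 (\<lambda>x. b x / (g 1 - g 0))"
  proof -
    have "smooth_on {()} ?o (\<lambda>y. complex_of_real (b (y ())) * complex_of_real (1 / (g 1 - g 0)))"
      by (intro smooth_on_mult smb smooth_on_const openin_topspace)
    then show ?thesis by simp
  qed
  ultimately have "smooth1 \<theta>" by (rule smooth1_antiderivative)
  then show ?thesis by (intro exI[of _ \<theta>]) (auto simp: \<theta>_def)
qed

lemma bump_exists:
  fixes p :: "'i \<Rightarrow> real"
  assumes I: "finite I" and r: "r > 0"
  shows "\<exists>h. smooth_on I (topspace (Rspace I)) h \<and> (\<forall>x. (\<forall>i\<in>I. \<bar>x i - p i\<bar> \<le> r) \<longrightarrow> h x = (1::complex)) \<and>
    (\<forall>x. (\<exists>i\<in>I. \<bar>x i - p i\<bar> \<ge> 2 * r) \<longrightarrow> h x = 0)"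
proof -
  let ?o = "topspace (Rspace I)"
  have o: "openin (Rspace I) ?o" by (rule openin_topspace)
  obtain \<theta> where \<theta>: "smooth1 \<theta>" "\<And>x. x \<le> 0 \<Longrightarrow> \<theta> x = 0" "\<And>x. x \<ge> 1 \<Longrightarrow> \<theta> x = 1"
    using smooth_step_exists by blast
  \<comment> \<open>For \<open>s = \<plusminus>1\<close> these factors are 1 if the coordinate is within
    \<open>r\<close> of \<open>p i\<close>, and one of them vanishes if it is at distance at least
    \<open>2 * r\<close>.\<close>
  define f where "f i s x = complex_of_real (\<theta> (2 + s * (x i - p i) / r))" for i and s :: real and x :: "'i \<Rightarrow> real"
  have "smooth_on I ?o (f i s)" if i: "i \<in> I" for i s
  proof -
    have "smooth_on I ?o (\<lambda>x. (2 - s * p i / r) + (s / r) * x i)"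
      by (intro smooth_on_add[OF o] smooth_on_mult[OF o] smooth_on_const smooth_on_coordinate[OF i])
    moreover have "(\<lambda>x. (2 - s * p i / r) + (s / r) * x i) = (\<lambda>x. 2 + s * (x i - p i) / r)" for s and x :: "'i \<Rightarrow> real"
      by (simp add: fun_eq_iff field_simps diff_divide_distrib)
    ultimately have sm: "smooth_on I ?o (\<lambda>x. 2 + s * (x i - p i) / r)" by simp
    have "smooth_on I ?o (\<lambda>x. (\<lambda>y. complex_of_real (\<theta> (y ()))) ((\<lambda>x (_::unit). 2 + s * (x i - p i) / r) x))"
      by (rule smooth_on_compose[OF _ o openin_topspace _ _ \<theta>(1)]) (use sm in auto)
    then show ?thesis by (simp add: f_def[abs_def])
  qed
  then have sm: "smooth_on I ?o (\<lambda>x. f i 1 x * f i (-1) x)" if "i \<in> I" for i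
    using that by (intro smooth_on_mult[OF o])
  have "smooth_on I ?o (\<lambda>x. \<Prod>i\<in>J. f i 1 x * f i (-1) x)" if "J \<subseteq> I" for J
    using finite_subset[OF that I] that
  proof (induction J rule: finite_induct)
    case empty
    then show ?case by (simp add: smooth_on_const)
  next
    case (insert j J)
    have "smooth_on I ?o (\<lambda>x. (f j 1 x * f j (-1) x) * (\<Prod>i\<in>J. f i 1 x * f i (-1) x))"
      by (rule smooth_on_mult[OF o sm]) (use insert in auto)
    then show ?case using insert.hyps by simp
  qed
  moreover have "(\<Prod>i\<in>I. f i 1 x * f i (-1) x) = 1" if "\<forall>i\<in>I. \<bar>x i - p i\<bar> \<le> r" for x
  proof (rule prod.neutral, rule ballI)
    fix i assume "i \<in> I"
    then have "\<bar>(x i - p i) / r\<bar> \<le> 1" using that r by simp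
    then show "f i 1 x * f i (-1) x = 1" unfolding f_def by (subst \<theta>(3), linarith)+ simp
  qed
  moreover have "(\<Prod>i\<in>I. f i 1 x * f i (-1) x) = 0" if ex: "\<exists>i\<in>I. \<bar>x i - p i\<bar> \<ge> 2 * r" for x
  proof -
    obtain i where i: "i \<in> I" "\<bar>x i - p i\<bar> \<ge> 2 * r" using ex by auto
    then have "\<bar>(x i - p i) / r\<bar> \<ge> 2" using r by (simp add: pos_le_divide_eq)
    then have "2 + 1 * (x i - p i) / r \<le> 0 \<or> 2 + (-1) * (x i - p i) / r \<le> 0" by linarith
    then have "f i 1 x * f i (-1) x = 0" unfolding f_def using \<theta>(2) by fastforce
    then show ?thesis using I i by (intro prod_zero) auto
  qed
  ultimately show ?thesis by (intro exI[of _ "\<lambda>x. \<Prod>i\<in>I. f i 1 x * f i (-1) x"]) blast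
qed

section \<open>Series of smooth functions\<close>

abbreviation pderivs :: "'i list \<Rightarrow> (('i \<Rightarrow> real) \<Rightarrow> 'b::real_normed_vector) \<Rightarrow> ('i \<Rightarrow> real) \<Rightarrow> 'b"
  where "pderivs \<equiv> foldr coord_deriv"

lemma smooth_on_pderivs: "smooth_on I S g \<Longrightarrow> set is \<subseteq> I \<Longrightarrow> smooth_on I S (pderivs is g)"
  by (induction "is") (auto intro: smooth_on_coord_deriv)

lemma cont_on_series:
  fixes G :: "nat \<Rightarrow> ('i \<Rightarrow> real) \<Rightarrow> 'b::{banach}"
  assumes cont: "\<And>j. cont_on I S (G j)" and M: "summable M" "\<And>j x. x \<in> S \<Longrightarrow> norm (G j x) \<le> M j"
  shows "cont_on I S (\<lambda>x. \<Sum>j. G j x)"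
proof -
  have ul: "uniform_limit S (\<lambda>n x. \<Sum>j<n. G j x) (\<lambda>x. \<Sum>j. G j x) sequentially"
    by (rule Weierstrass_m_test[OF M(2,1)])
  have "continuous_map (subtopology (Rspace I) S) Met_TC.mtopology (\<lambda>x. \<Sum>j. G j x)"
  proof (rule Met_TC.continuous_map_uniform_limit[where F = sequentially and f = "\<lambda>n x. \<Sum>j<n. G j x"])
    show "\<forall>\<^sub>F n in sequentially. continuous_map (subtopology (Rspace I) S) Met_TC.mtopology (\<lambda>x. \<Sum>j<n. G j x)"
      unfolding mtopology_is_euclidean by (intro always_eventually allI continuous_map_sum cont) auto
    show "\<forall>\<^sub>F n in sequentially. \<forall>x\<in>topspace (subtopology (Rspace I) S). (\<Sum>j. G j x) \<in> UNIV \<and> dist (\<Sum>j<n. G j x) (\<Sum>j. G j x) < \<epsilon>"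
      if "\<epsilon> > 0" for \<epsilon>
      using uniform_limitD[OF ul that] by eventually_elim auto
  qed simp
  then show ?thesis by (simp add: mtopology_is_euclidean)
qed

lemma pdiff_series:
  fixes G :: "nat \<Rightarrow> ('i \<Rightarrow> real) \<Rightarrow> 'b::{banach}"
  assumes S: "openin (Rspace I) S" and x: "x \<in> S" and i: "i \<in> I"
    and d: "\<And>j y. y \<in> S \<Longrightarrow> pdiff i (G j) (D j y) y"
    and N: "summable N" "\<And>j x. x \<in> S \<Longrightarrow> norm (G j x) \<le> N j"
    and M: "summable M" "\<And>j x. x \<in> S \<Longrightarrow> norm (D j x) \<le> M j"
  shows "pdiff i (\<lambda>x. \<Sum>j. G j x) (\<Sum>j. D j x) x"
proof -
  obtain r where r: "r > 0" "\<And>s. s \<in> ball (x i) r \<Longrightarrow> x(i := s) \<in> S"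
    using open_slice[OF S x i] unfolding open_contains_ball by blast
  let ?B = "ball (x i) r"
  have ul: "uniform_limit ?B (\<lambda>n s. \<Sum>j<n. D j (x(i := s))) (\<lambda>s. \<Sum>j. D j (x(i := s))) sequentially"
    by (rule Weierstrass_m_test[OF _ M(1)]) (use M(2) r(2) in auto)
  have sumG: "summable (\<lambda>j. G j y)" if "y \<in> S" for y
    by (rule summable_comparison_test'[OF N(1), of 0]) (use N(2)[OF that] in auto)
  have "\<exists>g. \<forall>s\<in>?B. (\<lambda>j. G j (x(i := s))) sums g s \<and>
      (g has_derivative (\<lambda>h. h *\<^sub>R (\<Sum>j. D j (x(i := s))))) (at s within ?B)"
  proof (rule has_derivative_series[where f' = "\<lambda>j s h. h *\<^sub>R D j (x(i := s))" and x = "x i" and l = "\<Sum>j. G j (x(i := x i))"])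
    show "((\<lambda>s. G j (x(i := s))) has_derivative (\<lambda>h. h *\<^sub>R D j (x(i := s)))) (at s within ?B)" if "s \<in> ?B" for j s
      using d[OF r(2)[OF that], of j] unfolding pdiff_def
      by (simp add: has_vector_derivative_def has_derivative_at_withinI)
    show "\<forall>\<^sub>F n in sequentially. \<forall>s\<in>?B. \<forall>h. norm ((\<Sum>j<n. h *\<^sub>R D j (x(i := s))) - h *\<^sub>R (\<Sum>j. D j (x(i := s)))) \<le> e * norm h"
      if e: "e > 0" for e
      using uniform_limitD[OF ul e]
    proof eventually_elim
      case (elim n)
      show ?case
      proof (intro ballI allI)
        fix s h assume s: "s \<in> ?B"
        have "norm ((\<Sum>j<n. D j (x(i := s))) - (\<Sum>j. D j (x(i := s)))) \<le> e"
          using bspec[OF elim s] by (simp add: dist_norm)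
        then have "\<bar>h\<bar> * norm ((\<Sum>j<n. D j (x(i := s))) - (\<Sum>j. D j (x(i := s)))) \<le> \<bar>h\<bar> * e"
          by (rule mult_left_mono) simp
        then show "norm ((\<Sum>j<n. h *\<^sub>R D j (x(i := s))) - h *\<^sub>R (\<Sum>j. D j (x(i := s)))) \<le> e * norm h"
          by (simp add: scaleR_sum_right[symmetric] scaleR_diff_right[symmetric] mult.commute)
      qed
    qed
    show "(\<lambda>j. G j (x(i := x i))) sums (\<Sum>j. G j (x(i := x i)))"
      by (rule summable_sums[OF sumG]) (use x in simp)
  qed (use r in auto)
  then obtain g where g: "\<And>s. s \<in> ?B \<Longrightarrow> (\<lambda>j. G j (x(i := s))) sums g s"
      "\<And>s. s \<in> ?B \<Longrightarrow> (g has_derivative (\<lambda>h. h *\<^sub>R (\<Sum>j. D j (x(i := s))))) (at s within ?B)"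
    by blast
  have "(g has_derivative (\<lambda>h. h *\<^sub>R (\<Sum>j. D j (x(i := x i))))) (at (x i))"
    using g(2)[of "x i"] r(1) by (simp add: at_within_open[OF _ open_ball])
  then have 1: "(g has_vector_derivative (\<Sum>j. D j x)) (at (x i))" by (simp add: has_vector_derivative_def)
  have "((\<lambda>s. \<Sum>j. G j (x(i := s))) has_vector_derivative (\<Sum>j. D j x)) (at (x i))"
    by (rule has_vector_derivative_transform_within_open[OF 1, of ?B]) (use r g(1) sums_unique in auto)
  then show ?thesis by (simp add: pdiff_def)
qed

text \<open>Termwise differentiation by the Weierstrass test; the series of derivatives are closed under
  differentiation.\<close>

lemma smooth_on_series:
  fixes G :: "nat \<Rightarrow> ('i \<Rightarrow> real) \<Rightarrow> 'b::{banach}"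
  assumes S: "openin (Rspace I) S" and sm: "\<And>j. smooth_on I S (G j)"
    and M: "\<And>is. set is \<subseteq> I \<Longrightarrow> summable (M is) \<and> (\<forall>j. \<forall>x\<in>S. norm (pderivs is (G j) x) \<le> M is j)"
  shows "smooth_on I S (\<lambda>x. \<Sum>j. G j x)"
    and "set is \<subseteq> I \<Longrightarrow> x \<in> S \<Longrightarrow> pderivs is (\<lambda>x. \<Sum>j. G j x) x = (\<Sum>j. pderivs is (G j) x)"
proof -
  have d: "pdiff i (\<lambda>x. \<Sum>j. pderivs is (G j) x) (\<Sum>j. pderivs (i # is) (G j) x) x"
    if "set is \<subseteq> I" "i \<in> I" "x \<in> S" for "is" i x
  proof (rule pdiff_series[OF S that(3,2), where N = "M is" and M = "M (i # is)"])
    show "pdiff i (pderivs is (G j)) (pderivs (i # is) (G j) y) y" if "y \<in> S" for j y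
      using smooth_on_pdiff[OF smooth_on_pderivs[OF sm \<open>set is \<subseteq> I\<close>] \<open>i \<in> I\<close> that] by simp
  qed (use M[of "is"] M[of "i # is"] that in auto)
  show "smooth_on I S (\<lambda>x. \<Sum>j. G j x)"
  proof (rule smooth_on_family[where P = "\<lambda>g. \<exists>is. set is \<subseteq> I \<and> g = (\<lambda>x. \<Sum>j. pderivs is (G j) x)", OF S])
    fix g :: "('i \<Rightarrow> real) \<Rightarrow> 'b" assume "\<exists>is. set is \<subseteq> I \<and> g = (\<lambda>x. \<Sum>j. pderivs is (G j) x)"
    then obtain "is" where g: "set is \<subseteq> I" "g = (\<lambda>x. \<Sum>j. pderivs is (G j) x)" by auto
    show "cont_on I S g" unfolding g(2)
      by (rule cont_on_series[where M = "M is"])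
        (use M[OF g(1)] smooth_on_cont[OF smooth_on_pderivs[OF sm g(1)]] in auto)
    fix i assume i: "i \<in> I"
    show "\<exists>g'. (\<exists>is. set is \<subseteq> I \<and> g' = (\<lambda>x. \<Sum>j. pderivs is (G j) x)) \<and> (\<forall>x\<in>S. pdiff i g (g' x) x)"
    proof (intro exI[of _ "\<lambda>x. \<Sum>j. pderivs (i # is) (G j) x"] conjI ballI)
      show "\<exists>js. set js \<subseteq> I \<and> (\<lambda>x. \<Sum>j. pderivs (i # is) (G j) x) = (\<lambda>x. \<Sum>j. pderivs js (G j) x)"
        by (rule exI[of _ "i # is"]) (use g i in simp)
    qed (use d[OF g(1) i] g(2) in simp)
  qed (rule exI[of _ "[]"], simp)
  show "set is \<subseteq> I \<Longrightarrow> x \<in> S \<Longrightarrow> pderivs is (\<lambda>x. \<Sum>j. G j x) x = (\<Sum>j. pderivs is (G j) x)"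
  proof (induction "is" arbitrary: x)
    case (Cons i "is")
    have "coord_deriv i (pderivs is (\<lambda>x. \<Sum>j. G j x)) x = coord_deriv i (\<lambda>x. \<Sum>j. pderivs is (G j) x) x"
      by (rule coord_deriv_cong[OF S]) (use Cons in auto)
    also have "\<dots> = (\<Sum>j. pderivs (i # is) (G j) x)"
      by (rule coord_deriv_pdiff[OF d]) (use Cons in auto)
    finally show ?case by simp
  qed simp
qed

section \<open>Charts\<close>

lemma topspace_sub_open: "openin X S \<Longrightarrow> topspace (subtopology X S) = S"
  by (rule topspace_subtopology_subset[OF openin_subset])

locale smfd =
  fixes M :: "'a manifold"
  assumes smfd: "smooth_manifold M"
begin

abbreviation I where "I \<equiv> {..<mdim M}"
abbreviation cimg :: "'a chart \<Rightarrow> 'a set \<Rightarrow> (nat \<Rightarrow> real) set"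
  where "cimg c V \<equiv> snd c ` (fst c \<inter> V)"

lemma dom_open: "c \<in> atlas M \<Longrightarrow> openin (mtop M) (fst c)"
  and chart_homeo: "c \<in> atlas M \<Longrightarrow> homeomorphic_map (subtopology (mtop M) (fst c))
         (subtopology (Rspace I) (snd c ` fst c)) (snd c)"
  and full_img_open: "c \<in> atlas M \<Longrightarrow> openin (Rspace I) (snd c ` fst c)"
  and hausdorff: "Hausdorff_space (mtop M)"
  and atlas_cover: "p \<in> pts M \<Longrightarrow> \<exists>c\<in>atlas M. p \<in> fst c"
  and transition: "c \<in> atlas M \<Longrightarrow> c' \<in> atlas M \<Longrightarrow> i < mdim M \<Longrightarrow>
     smooth_on I (snd c ` (fst c \<inter> fst c')) (\<lambda>x. snd c' (chart_inv c x) i)"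
  using smfd unfolding smooth_manifold_def by blast+

lemma dom_pts: "c \<in> atlas M \<Longrightarrow> p \<in> fst c \<Longrightarrow> p \<in> pts M"
  using openin_subset[OF dom_open] by blast

lemma chart_inj: "c \<in> atlas M \<Longrightarrow> inj_on (snd c) (fst c)"
  using homeomorphic_imp_injective_map[OF chart_homeo] topspace_sub_open[OF dom_open] by simp

lemma chart_inv_snd [simp]: "c \<in> atlas M \<Longrightarrow> p \<in> fst c \<Longrightarrow> chart_inv c (snd c p) = p"
  unfolding chart_inv_def by (rule inv_into_f_f[OF chart_inj])

lemma img_open:
  assumes c: "c \<in> atlas M" and V: "openin (mtop M) V"
  shows "openin (Rspace I) (cimg c V)"
proof -
  have "open_map (subtopology (mtop M) (fst c)) (subtopology (Rspace I) (snd c ` fst c)) (snd c)"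
    using homeomorphic_imp_open_map[OF chart_homeo[OF c]] .
  moreover have "openin (subtopology (mtop M) (fst c)) (fst c \<inter> V)"
    using dom_open[OF c] V by (simp add: openin_open_subtopology openin_Int)
  ultimately have "openin (subtopology (Rspace I) (snd c ` fst c)) (cimg c V)"
    by (auto simp: open_map_def)
  then show ?thesis using full_img_open[OF c] by (simp add: openin_open_subtopology)
qed

lemma chart_cont: "c \<in> atlas M \<Longrightarrow> continuous_map (subtopology (mtop M) (fst c)) (Rspace I) (snd c)"
  using homeomorphic_imp_continuous_map[OF chart_homeo] by (simp add: continuous_map_in_subtopology)

lemma chart_inv_cont:
  assumes c: "c \<in> atlas M"
  shows "continuous_map (subtopology (Rspace I) (snd c ` fst c)) (mtop M) (chart_inv c)"
proof -
  obtain g where g: "homeomorphic_maps (subtopology (mtop M) (fst c)) (subtopology (Rspace I) (snd c ` fst c)) (snd c) g"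
    using chart_homeo[OF c] homeomorphic_map_maps by blast
  have eq: "g x = chart_inv c x" if "x \<in> snd c ` fst c" for x
    using g that c topspace_sub_open[OF dom_open[OF c]] by (auto simp: homeomorphic_maps_def)
  have "continuous_map (subtopology (Rspace I) (snd c ` fst c)) (mtop M) g"
    using g by (simp add: homeomorphic_maps_def continuous_map_in_subtopology)
  then show ?thesis
    by (rule continuous_map_eq) (use eq topspace_sub_open[OF full_img_open[OF c]] in auto)
qed

text \<open>Smoothness on \<open>fst c \<inter> V\<close>, tested in the single chart \<open>c\<close>.\<close>

definition chart_smooth :: "'a chart \<Rightarrow> 'a set \<Rightarrow> ('a \<Rightarrow> 'b::real_normed_vector) \<Rightarrow> bool"
  where "chart_smooth c V f \<longleftrightarrow> smooth_on I (cimg c V) (\<lambda>x. f (chart_inv c x))"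

lemma chart_smooth_cong:
  assumes "c \<in> atlas M" "openin (mtop M) V" "\<And>p. p \<in> fst c \<inter> V \<Longrightarrow> f p = g p"
  shows "chart_smooth c V f \<longleftrightarrow> chart_smooth c V g"
  unfolding chart_smooth_def by (rule smooth_on_cong[OF img_open]) (use assms in auto)

lemma chart_smooth_const: "chart_smooth c V (\<lambda>_. k)"
  by (simp add: chart_smooth_def smooth_on_const)

lemma chart_smooth_add: "c \<in> atlas M \<Longrightarrow> openin (mtop M) V \<Longrightarrow> chart_smooth c V f \<Longrightarrow> chart_smooth c V g \<Longrightarrow> chart_smooth c V (\<lambda>p. f p + g p)"
  unfolding chart_smooth_def by (rule smooth_on_add[OF img_open])

lemma chart_smooth_mult:
  fixes f g :: "'a \<Rightarrow> 'b::real_normed_algebra"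
  shows "c \<in> atlas M \<Longrightarrow> openin (mtop M) V \<Longrightarrow> chart_smooth c V f \<Longrightarrow> chart_smooth c V g \<Longrightarrow> chart_smooth c V (\<lambda>p. f p * g p)"
  unfolding chart_smooth_def by (rule smooth_on_mult[OF img_open])

lemma chart_smooth_sum: "c \<in> atlas M \<Longrightarrow> openin (mtop M) V \<Longrightarrow> (\<And>j. j \<in> J \<Longrightarrow> chart_smooth c V (f j)) \<Longrightarrow> chart_smooth c V (\<lambda>p. \<Sum>j\<in>J. f j p)"
  unfolding chart_smooth_def by (rule smooth_on_sum[OF img_open])

lemma chart_smooth_of_real: "c \<in> atlas M \<Longrightarrow> openin (mtop M) V \<Longrightarrow> chart_smooth c V f \<Longrightarrow> chart_smooth c V (\<lambda>p. complex_of_real (f p))"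
  unfolding chart_smooth_def by (rule smooth_on_of_real[OF img_open])

lemma chart_smooth_cpd:
  assumes "c \<in> atlas M" "openin (mtop M) V" "chart_smooth c V f" "i < mdim M"
  shows "chart_smooth c V (cpd c i f)"
proof -
  have "smooth_on I (cimg c V) (coord_deriv i (\<lambda>x. f (chart_inv c x)))"
    using assms by (auto simp: chart_smooth_def intro: smooth_on_coord_deriv)
  then show ?thesis unfolding chart_smooth_def
    by (subst smooth_on_cong[OF img_open[OF assms(1,2)], where h = "coord_deriv i (\<lambda>x. f (chart_inv c x))"])
      (use assms in \<open>auto simp: cpd_def\<close>)
qed

abbreviation cpds :: "'a chart \<Rightarrow> nat list \<Rightarrow> ('a \<Rightarrow> 'b::real_normed_vector) \<Rightarrow> 'a \<Rightarrow> 'b"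
  where "cpds c is f \<equiv> foldr (cpd c) is f"

lemma chart_smooth_cpds:
  assumes "c \<in> atlas M" "openin (mtop M) V" "chart_smooth c V f" "set is \<subseteq> I"
  shows "chart_smooth c V (cpds c is f)"
  using assms(4) by (induction "is") (auto intro: chart_smooth_cpd assms)

lemma cpd_cong:
  assumes c: "c \<in> atlas M" and V: "openin (mtop M) V" and p: "p \<in> fst c" "p \<in> V" and i: "i < mdim M"
    and eq: "\<And>q. q \<in> fst c \<inter> V \<Longrightarrow> f q = g q"
  shows "cpd c i f p = cpd c i g p"
  unfolding cpd_def
  by (rule coord_deriv_cong[OF img_open[OF c V]]) (use assms in auto)

lemma cpds_cong:
  assumes c: "c \<in> atlas M" and V: "openin (mtop M) V" and p: "p \<in> fst c" "p \<in> V" and i: "set is \<subseteq> I"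
    and eq: "\<And>q. q \<in> fst c \<inter> V \<Longrightarrow> f q = g q"
  shows "cpds c is f p = cpds c is g p"
  using i p
proof (induction "is" arbitrary: p)
  case (Cons i "is")
  have "cpd c i (cpds c is f) p = cpd c i (cpds c is g) p"
    by (rule cpd_cong[OF c V]) (use Cons in auto)
  then show ?case by simp
qed (use eq in auto)

lemma cpds_pderivs:
  assumes c: "c \<in> atlas M" and "set is \<subseteq> I" "p \<in> fst c"
  shows "cpds c is f p = pderivs is (\<lambda>x. f (chart_inv c x)) (snd c p)"
  using assms(2,3)
proof (induction "is" arbitrary: p)
  case (Cons i "is")
  have "cpd c i (cpds c is f) p = coord_deriv i (pderivs is (\<lambda>x. f (chart_inv c x))) (snd c p)"
    unfolding cpd_def[of c i] by (rule coord_deriv_cong[OF full_img_open[OF c]]) (use Cons c in auto)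
  then show ?case by simp
qed (use c in simp)

lemma chart_smooth_pdiff:
  assumes "c \<in> atlas M" "chart_smooth c V f" "i < mdim M" "p \<in> fst c" "p \<in> V"
  shows "pdiff i (\<lambda>x. f (chart_inv c x)) (cpd c i f p) (snd c p)"
  unfolding cpd_def by (rule smooth_on_pdiff) (use assms in \<open>auto simp: chart_smooth_def\<close>)

lemma cpd_add:
  assumes "c \<in> atlas M" "chart_smooth c V f" "chart_smooth c V g" "i < mdim M" "p \<in> fst c" "p \<in> V"
  shows "cpd c i (\<lambda>p. f p + g p) p = cpd c i f p + cpd c i g p"
  using coord_deriv_pdiff[OF pdiff_add[OF chart_smooth_pdiff[OF assms(1,2,4-6)] chart_smooth_pdiff[OF assms(1,3,4-6)]]]
  by (simp add: cpd_def)

lemma cpd_const: "cpd c i (\<lambda>_. k) p = 0"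
  unfolding cpd_def by (rule coord_deriv_pdiff[OF pdiff_const])

lemma cpd_mult:
  fixes f g :: "'a \<Rightarrow> 'b::real_normed_algebra"
  assumes "c \<in> atlas M" "chart_smooth c V f" "chart_smooth c V g" "i < mdim M" "p \<in> fst c" "p \<in> V"
  shows "cpd c i (\<lambda>p. f p * g p) p = f p * cpd c i g p + cpd c i f p * g p"
  using coord_deriv_pdiff[OF pdiff_mult[OF chart_smooth_pdiff[OF assms(1,2,4-6)] chart_smooth_pdiff[OF assms(1,3,4-6)]]] assms
  by (simp add: cpd_def)

lemma cpd_cmult:
  fixes f :: "'a \<Rightarrow> 'b::real_normed_algebra"
  assumes "c \<in> atlas M" "chart_smooth c V f" "i < mdim M" "p \<in> fst c" "p \<in> V"
  shows "cpd c i (\<lambda>p. k * f p) p = k * cpd c i f p"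
  using cpd_mult[OF assms(1) chart_smooth_const assms(2-)] by (simp add: cpd_const)

lemma cpd_sum:
  assumes "c \<in> atlas M" "openin (mtop M) V" "\<And>j. j \<in> J \<Longrightarrow> chart_smooth c V (f j)" "i < mdim M" "p \<in> fst c" "p \<in> V"
  shows "cpd c i (\<lambda>p. \<Sum>j\<in>J. f j p) p = (\<Sum>j\<in>J. cpd c i (f j) p)"
  using assms(3)
proof (induction J rule: infinite_finite_induct)
  case (insert j J)
  then show ?case
    using cpd_add[OF assms(1) _ chart_smooth_sum[OF assms(1,2)] assms(4-6), of "f j" J f] by simp
qed (simp_all add: cpd_const)

lemma cpd_of_real:
  assumes "c \<in> atlas M" "chart_smooth c V f" "i < mdim M" "p \<in> fst c" "p \<in> V"
  shows "cpd c i (\<lambda>p. complex_of_real (f p)) p = of_real (cpd c i f p)"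
  using coord_deriv_pdiff[OF pdiff_of_real[OF chart_smooth_pdiff[OF assms]]] by (simp add: cpd_def)

lemma cpds_add:
  assumes "c \<in> atlas M" "openin (mtop M) V" "chart_smooth c V f" "chart_smooth c V g" "set is \<subseteq> I" "p \<in> fst c" "p \<in> V"
  shows "cpds c is (\<lambda>p. f p + g p) p = cpds c is f p + cpds c is g p"
  using assms(5-7)
proof (induction "is" arbitrary: p)
  case (Cons i "is")
  have "cpd c i (cpds c is (\<lambda>p. f p + g p)) p = cpd c i (\<lambda>p. cpds c is f p + cpds c is g p) p"
    by (rule cpd_cong[OF assms(1,2)]) (use Cons in auto)
  also have "\<dots> = cpd c i (cpds c is f) p + cpd c i (cpds c is g) p"
    by (rule cpd_add[OF assms(1) chart_smooth_cpds[OF assms(1-3)] chart_smooth_cpds[OF assms(1,2,4)]]) (use Cons in auto)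
  finally show ?case by simp
qed simp

lemma cpds_cmult:
  fixes f :: "'a \<Rightarrow> 'b::real_normed_algebra"
  assumes "c \<in> atlas M" "openin (mtop M) V" "chart_smooth c V f" "set is \<subseteq> I" "p \<in> fst c" "p \<in> V"
  shows "cpds c is (\<lambda>p. k * f p) p = k * cpds c is f p"
  using assms(4-6)
proof (induction "is" arbitrary: p)
  case (Cons i "is")
  have "cpd c i (cpds c is (\<lambda>p. k * f p)) p = cpd c i (\<lambda>p. k * cpds c is f p) p"
    by (rule cpd_cong[OF assms(1,2)]) (use Cons in auto)
  also have "\<dots> = k * cpd c i (cpds c is f) p"
    by (rule cpd_cmult[OF assms(1) chart_smooth_cpds[OF assms(1-3)]]) (use Cons in auto)
  finally show ?case by simp
qed simp

lemma chart_smooth_cont: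
  assumes c: "c \<in> atlas M" and V: "openin (mtop M) V" and f: "chart_smooth c V f"
  shows "continuous_map (subtopology (mtop M) (fst c \<inter> V)) euclidean f"
proof -
  have "continuous_map (subtopology (mtop M) (fst c \<inter> V)) (Rspace I) (snd c)"
    using continuous_map_from_subtopology_mono[OF chart_cont[OF c]] by auto
  then have 1: "continuous_map (subtopology (mtop M) (fst c \<inter> V)) (subtopology (Rspace I) (cimg c V)) (snd c)"
    by (auto simp: continuous_map_in_subtopology)
  have "continuous_map (subtopology (mtop M) (fst c \<inter> V)) euclidean ((\<lambda>x. f (chart_inv c x)) \<circ> snd c)"
    by (rule continuous_map_compose[OF 1]) (use f smooth_on_cont in \<open>auto simp: chart_smooth_def\<close>)
  then show ?thesis
    by (rule continuous_map_eq) (use c in auto)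
qed

end

context smfd
begin

section \<open>Smooth functions on the manifold\<close>

abbreviation X :: "('a \<Rightarrow> complex) set"
  where "X \<equiv> smooth_funs M (pts M)"

lemma pts_open: "openin (mtop M) (pts M)" by (rule openin_topspace)

lemma X_iff: "f \<in> X \<longleftrightarrow> (\<forall>p. p \<notin> pts M \<longrightarrow> f p = 0) \<and> (\<forall>c\<in>atlas M. chart_smooth c (pts M) f)"
  by (simp add: smooth_funs_def chart_smooth_def)

lemma X_chart_smooth: "f \<in> X \<Longrightarrow> c \<in> atlas M \<Longrightarrow> chart_smooth c V f"
proof -
  assume "f \<in> X" "c \<in> atlas M"
  then have "chart_smooth c (pts M) f" by (simp add: X_iff)
  moreover have "cimg c V \<subseteq> cimg c (pts M)" using dom_pts[OF \<open>c \<in> atlas M\<close>] by auto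
  ultimately show "chart_smooth c V f" unfolding chart_smooth_def by (rule smooth_on_subset)
qed

lemma X_off: "f \<in> X \<Longrightarrow> p \<notin> pts M \<Longrightarrow> f p = 0"
  by (simp add: X_iff)

lemma X_add: "f \<in> X \<Longrightarrow> g \<in> X \<Longrightarrow> (\<lambda>p. f p + g p) \<in> X"
  unfolding X_iff by (auto intro: chart_smooth_add pts_open)

lemma X_mult: "f \<in> X \<Longrightarrow> g \<in> X \<Longrightarrow> (\<lambda>p. f p * g p) \<in> X"
  unfolding X_iff by (auto intro: chart_smooth_mult pts_open)

lemma X_cmult: "f \<in> X \<Longrightarrow> (\<lambda>p. k * f p) \<in> X"
  unfolding X_iff by (auto intro: chart_smooth_mult chart_smooth_const pts_open)

lemma X_zero: "(\<lambda>p. 0) \<in> X"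
  unfolding X_iff by (auto intro: chart_smooth_const)

lemma X_diff: "f \<in> X \<Longrightarrow> g \<in> X \<Longrightarrow> (\<lambda>p. f p - g p) \<in> X"
  using X_add[of f "\<lambda>p. (-1) * g p"] X_cmult[of g "-1"] by simp

lemma X_sum: "(\<And>j. j \<in> J \<Longrightarrow> f j \<in> X) \<Longrightarrow> (\<lambda>p. \<Sum>j\<in>J. f j p) \<in> X"
  by (induction J rule: infinite_finite_induct) (auto intro: X_zero X_add)

lemma sub_compact_closed: "compactin (mtop M) K \<Longrightarrow> openin (mtop M) (pts M - K)"
  using compactin_imp_closedin[OF hausdorff] by (simp add: openin_diff)

text \<open>A function that is smooth in one chart and supported in a compact subset of its domain is smooth on the
  whole manifold. Compact sets are closed because the manifold is Hausdorff, so away from the chart the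
  function vanishes on an open set.\<close>

lemma X_extend:
  assumes c: "c \<in> atlas M" and K: "compactin (mtop M) K" "K \<subseteq> fst c"
    and f: "chart_smooth c (pts M) f" "\<And>p. p \<notin> K \<Longrightarrow> f p = 0"
  shows "f \<in> X"
  unfolding X_iff
proof (intro conjI allI impI ballI)
  fix p assume "p \<notin> pts M"
  then show "f p = 0" using f(2) K(2) dom_pts[OF c] by blast
next
  fix c' assume c': "c' \<in> atlas M"
  show "chart_smooth c' (pts M) f" unfolding chart_smooth_def
  proof (rule smooth_on_local[OF img_open[OF c' pts_open]])
    fix x assume "x \<in> cimg c' (pts M)"
    then obtain p where p: "x = snd c' p" "p \<in> fst c'" "p \<in> pts M" by auto
    show "\<exists>W. openin (Rspace I) W \<and> x \<in> W \<and> W \<subseteq> cimg c' (pts M) \<and> smooth_on I W (\<lambda>x. f (chart_inv c' x))"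
    proof (cases "p \<in> fst c")
      case True
      let ?W = "cimg c' (fst c)"
      have W: "openin (Rspace I) ?W" by (rule img_open[OF c' dom_open[OF c]])
      have "smooth_on I ?W (\<lambda>x. (\<lambda>x. f (chart_inv c x)) ((\<lambda>x. snd c (chart_inv c' x)) x))"
      proof (rule smooth_on_compose[OF _ W img_open[OF c pts_open]])
        show "smooth_on I (cimg c (pts M)) (\<lambda>x. f (chart_inv c x))" using f(1) by (simp add: chart_smooth_def)
        show "snd c (chart_inv c' x) \<in> cimg c (pts M)" if "x \<in> ?W" for x
          using that c' dom_pts[OF c] by auto
        show "smooth_on I ?W (\<lambda>x. snd c (chart_inv c' x) j)" if "j \<in> I" for j
          by (rule transition[OF c' c]) (use that in simp)
      qed simp
      moreover have "smooth_on I ?W (\<lambda>x. f (chart_inv c (snd c (chart_inv c' x)))) \<longleftrightarrow> smooth_on I ?W (\<lambda>x. f (chart_inv c' x))"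
        by (rule smooth_on_cong[OF W]) (use c c' in auto)
      moreover have "?W \<subseteq> cimg c' (pts M)" using dom_pts[OF c] by auto
      ultimately show ?thesis using W p True by (intro exI[of _ ?W]) auto
    next
      case False
      let ?W = "cimg c' (pts M - K)"
      have W: "openin (Rspace I) ?W" by (rule img_open[OF c' sub_compact_closed[OF K(1)]])
      have "smooth_on I ?W (\<lambda>x. f (chart_inv c' x)) \<longleftrightarrow> smooth_on I ?W (\<lambda>x. 0 :: complex)"
        by (rule smooth_on_cong[OF W]) (use c' f(2) in auto)
      then have "smooth_on I ?W (\<lambda>x. f (chart_inv c' x))" by (simp add: smooth_on_const)
      then show ?thesis using W p False K(2) by (intro exI[of _ ?W]) auto
    qed
  qed
qed

lemma sub_preimage_open:
  assumes "openin (mtop M) V" "continuous_map (subtopology (mtop M) V) euclidean f" "open T"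
  shows "openin (mtop M) {q \<in> V. f q \<in> T}"
proof -
  have "openin (subtopology (mtop M) V) {q \<in> topspace (subtopology (mtop M) V). f q \<in> T}"
    by (rule openin_continuous_map_preimage[OF assms(2)]) (use assms(3) in simp)
  then show ?thesis unfolding topspace_sub_open[OF assms(1)] using openin_open_subtopology[OF assms(1)] by simp
qed

lemma box_preimage:
  assumes c: "c \<in> atlas M" and sub: "cbx I x r \<subseteq> snd c ` fst c"
  shows "openin (mtop M) {q \<in> fst c. \<forall>i\<in>I. \<bar>snd c q i - x i\<bar> < s}" (is ?t1)
    and "compactin (mtop M) {q \<in> fst c. \<forall>i\<in>I. \<bar>snd c q i - x i\<bar> \<le> r}" (is ?t2)
proof -
  have ext: "snd c q \<in> extensional I" if "q \<in> fst c" for q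
    using Rspace_mem[OF full_img_open[OF c], of "snd c q"] that by auto
  have "openin (subtopology (mtop M) (fst c)) {q \<in> topspace (subtopology (mtop M) (fst c)). snd c q \<in> obox I x s}"
    by (rule openin_continuous_map_preimage[OF chart_cont[OF c] open_obox]) simp
  then have "openin (mtop M) {q \<in> fst c. snd c q \<in> obox I x s}"
    unfolding topspace_sub_open[OF dom_open[OF c]] using openin_open_subtopology[OF dom_open[OF c]] by simp
  moreover have "{q \<in> fst c. snd c q \<in> obox I x s} = {q \<in> fst c. \<forall>i\<in>I. \<bar>snd c q i - x i\<bar> < s}"
    using ext by (auto simp: PiE_iff dist_real_def abs_minus_commute)
  ultimately show ?t1 by simp
  have "compactin (subtopology (Rspace I) (snd c ` fst c)) (cbx I x r)"
    using compact_cbx sub by (simp add: compactin_subtopology)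
  then have "compactin (mtop M) (chart_inv c ` cbx I x r)"
    by (rule image_compactin[OF _ chart_inv_cont[OF c]])
  moreover have "chart_inv c ` cbx I x r = {q \<in> fst c. \<forall>i\<in>I. \<bar>snd c q i - x i\<bar> \<le> r}"
  proof (intro set_eqI iffI)
    fix q assume "q \<in> chart_inv c ` cbx I x r"
    then obtain y where y: "y \<in> cbx I x r" "q = chart_inv c y" by auto
    then obtain q' where "q' \<in> fst c" "y = snd c q'" using sub by blast
    then show "q \<in> {q \<in> fst c. \<forall>i\<in>I. \<bar>snd c q i - x i\<bar> \<le> r}"
      using y c by (auto simp: PiE_iff dist_real_def abs_minus_commute)
  next
    fix q assume q: "q \<in> {q \<in> fst c. \<forall>i\<in>I. \<bar>snd c q i - x i\<bar> \<le> r}"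
    then have "snd c q \<in> cbx I x r" using ext by (auto simp: PiE_iff dist_real_def abs_minus_commute)
    then show "q \<in> chart_inv c ` cbx I x r" using q c by (intro image_eqI[of _ _ "snd c q"]) auto
  qed
  ultimately show ?t2 by simp
qed

lemma bump:
  assumes c: "c \<in> atlas M" and p: "p \<in> fst c" "p \<in> V" and V: "openin (mtop M) V"
  obtains h W K where "h \<in> X" "openin (mtop M) W" "p \<in> W" "W \<subseteq> K" "compactin (mtop M) K" "K \<subseteq> fst c \<inter> V"
    "\<And>q. q \<in> W \<Longrightarrow> h q = 1" "\<And>q. q \<notin> K \<Longrightarrow> h q = 0"
proof -
  let ?x = "snd c p"
  obtain r where r: "r > 0" "cbx I ?x r \<subseteq> cimg c V"
    using cbx_nbhd[OF _ img_open[OF c V], of ?x] p by auto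
  then have sub: "cbx I ?x r \<subseteq> snd c ` fst c" by auto
  define K where "K = {q \<in> fst c. \<forall>i\<in>I. \<bar>snd c q i - ?x i\<bar> \<le> r}"
  define W where "W = {q \<in> fst c. \<forall>i\<in>I. \<bar>snd c q i - ?x i\<bar> < r / 2}"
  obtain g where g: "smooth_on I (topspace (Rspace I)) g" "\<And>x. (\<forall>i\<in>I. \<bar>x i - ?x i\<bar> \<le> r / 2) \<Longrightarrow> g x = (1::complex)"
    "\<And>x. (\<exists>i\<in>I. \<bar>x i - ?x i\<bar> \<ge> 2 * (r / 2)) \<Longrightarrow> g x = 0"
    using bump_exists[of I "r / 2" ?x] r(1) by auto
  define h where "h = (\<lambda>q. if q \<in> fst c then g (snd c q) else 0)"
  have KV: "K \<subseteq> fst c \<inter> V"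
  proof
    fix q assume q: "q \<in> K"
    then have qc: "q \<in> fst c" by (simp add: K_def)
    then have "snd c q \<in> extensional I" using Rspace_mem[OF full_img_open[OF c], of "snd c q"] by auto
    then have "snd c q \<in> cbx I ?x r" using q by (auto simp: K_def PiE_iff dist_real_def abs_minus_commute)
    then obtain q' where "q' \<in> fst c" "q' \<in> V" "snd c q = snd c q'" using r(2) by auto
    then have "q = q'" using inj_onD[OF chart_inj[OF c]] qc by auto
    then show "q \<in> fst c \<inter> V" using qc \<open>q' \<in> V\<close> by simp
  qed
  have Kc: "compactin (mtop M) K" unfolding K_def by (rule box_preimage(2)[OF c sub])
  have h0: "h q = 0" if "q \<notin> K" for q
  proof (cases "q \<in> fst c")
    case True
    then have "\<not> (\<forall>i\<in>I. \<bar>snd c q i - ?x i\<bar> \<le> r)" using that by (simp add: K_def)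
    then obtain i where "i \<in> I" "\<bar>snd c q i - ?x i\<bar> > r" by (meson not_le)
    then have "g (snd c q) = 0" by (intro g(3) bexI[of _ i]) auto
    then show ?thesis by (simp add: h_def)
  qed (simp add: h_def)
  have "smooth_on I (cimg c (pts M)) (\<lambda>x. h (chart_inv c x)) \<longleftrightarrow> smooth_on I (cimg c (pts M)) g"
    by (rule smooth_on_cong[OF img_open[OF c pts_open]]) (use c in \<open>auto simp: h_def\<close>)
  moreover have "smooth_on I (cimg c (pts M)) g"
    by (rule smooth_on_subset[OF g(1)]) (rule openin_subset[OF img_open[OF c pts_open]])
  ultimately have "chart_smooth c (pts M) h" by (simp add: chart_smooth_def)
  then have "h \<in> X" using X_extend[OF c Kc _ _ h0] KV by auto
  moreover have "openin (mtop M) W" unfolding W_def by (rule box_preimage(1)[OF c sub])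
  moreover have "p \<in> W" using p r(1) by (simp add: W_def)
  moreover have "W \<subseteq> K"
  proof
    fix q assume q: "q \<in> W"
    have "\<bar>snd c q i - ?x i\<bar> \<le> r" if "i \<in> I" for i
    proof -
      have "\<bar>snd c q i - ?x i\<bar> < r / 2" using q that unfolding W_def by blast
      then show ?thesis using r(1) by linarith
    qed
    then show "q \<in> K" using q by (simp add: W_def K_def)
  qed
  moreover have "h q = 1" if "q \<in> W" for q
    using that g(2)[of "snd c q"] by (auto simp: W_def h_def less_imp_le)
  ultimately show ?thesis using that Kc KV h0 by blast
qed

lemma chart_smooth_bounded:
  assumes c: "c \<in> atlas M" and f: "chart_smooth c (pts M) f" and K: "compactin (mtop M) K" "K \<subseteq> fst c"
  shows "\<exists>B. \<forall>q\<in>K. norm (f q) \<le> B"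
proof -
  have "fst c \<inter> pts M = fst c" using dom_pts[OF c] by auto
  then have "continuous_map (subtopology (mtop M) (fst c)) euclidean f"
    using chart_smooth_cont[OF c pts_open f] by simp
  moreover have "compactin (subtopology (mtop M) (fst c)) K" using K by (simp add: compactin_subtopology)
  ultimately have "compactin euclidean (f ` K)" by (rule image_compactin[rotated])
  then have "bounded (f ` K)" by (simp add: compact_imp_bounded)
  then show ?thesis by (auto simp: bounded_iff)
qed

section \<open>Bounds on derivatives and completeness\<close>

definition derivs_le :: "'a chart \<Rightarrow> 'a set \<Rightarrow> nat \<Rightarrow> ('a \<Rightarrow> complex) \<Rightarrow> real \<Rightarrow> bool"
  where "derivs_le c K N f B \<longleftrightarrow> (\<forall>is. length is \<le> N \<and> set is \<subseteq> I \<longrightarrow> (\<forall>q\<in>K. cmod (cpds c is f q) \<le> B))"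

lemma derivs_le_mono: "derivs_le c K N f B \<Longrightarrow> N' \<le> N \<Longrightarrow> B \<le> B' \<Longrightarrow> derivs_le c K N' f B'"
  unfolding derivs_le_def by (meson order_trans)

lemma derivs_le_cmult:
  assumes "c \<in> atlas M" "K \<subseteq> fst c" "chart_smooth c (pts M) f" "derivs_le c K N f B"
  shows "derivs_le c K N (\<lambda>q. k * f q) (cmod k * B)"
  unfolding derivs_le_def
proof (intro allI impI ballI, elim conjE)
  fix "is" q assume h: "length is \<le> N" "set is \<subseteq> I" "q \<in> K"
  then have q: "q \<in> fst c" "q \<in> pts M" using assms(2) dom_pts[OF assms(1)] by auto
  have "cpds c is (\<lambda>q. k * f q) q = k * cpds c is f q"
    by (rule cpds_cmult[OF assms(1) pts_open assms(3) h(2) q])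
  moreover have "cmod (cpds c is f q) \<le> B" using assms(4) h by (auto simp: derivs_le_def)
  ultimately show "cmod (cpds c is (\<lambda>q. k * f q) q) \<le> cmod k * B"
    by (simp add: norm_mult mult_left_mono)
qed

text \<open>Induction on the number of derivatives by the product rule. The induction removes the innermost
  derivative, as \<open>cpd c i (h * f)\<close> is a sum of two products of smooth functions.\<close>

lemma leibniz_bound1:
  assumes c: "c \<in> atlas M" and K: "compactin (mtop M) K" "K \<subseteq> fst c"
  shows "chart_smooth c (pts M) h \<Longrightarrow> set is \<subseteq> I \<Longrightarrow>
    \<exists>A\<ge>0. \<forall>f. chart_smooth c (pts M) f \<and> derivs_le c K (length is) f 1 \<longrightarrow> (\<forall>q\<in>K. cmod (cpds c is (\<lambda>q. h q * f q) q) \<le> A)"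
proof (induction "is" arbitrary: h rule: rev_induct)
  case Nil
  obtain B where B: "\<forall>q\<in>K. cmod (h q) \<le> B" using chart_smooth_bounded[OF c Nil(1) K] by auto
  show ?case
  proof (intro exI[of _ "\<bar>B\<bar>"] conjI allI impI ballI)
    fix f q assume f: "chart_smooth c (pts M) f \<and> derivs_le c K (length ([] :: nat list)) f 1" and q: "q \<in> K"
    have "cmod (f q) \<le> 1"
      using f[THEN conjunct2, unfolded derivs_le_def, rule_format, of "[]" q] q by simp
    moreover have "cmod (h q) \<le> \<bar>B\<bar>" using bspec[OF B q] by linarith
    ultimately have "cmod (h q) * cmod (f q) \<le> \<bar>B\<bar> * 1" by (intro mult_mono) auto
    then show "cmod (cpds c [] (\<lambda>q. h q * f q) q) \<le> \<bar>B\<bar>" by (simp add: norm_mult)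
  qed simp
next
  case (snoc i "is")
  have i: "i < mdim M" and s: "set is \<subseteq> I" using snoc.prems by auto
  have dh: "chart_smooth c (pts M) (cpd c i h)" by (rule chart_smooth_cpd[OF c pts_open snoc.prems(1) i])
  obtain A1 where A1: "A1 \<ge> 0" "\<And>f q. chart_smooth c (pts M) f \<Longrightarrow> derivs_le c K (length is) f 1 \<Longrightarrow> q \<in> K \<Longrightarrow> cmod (cpds c is (\<lambda>q. h q * f q) q) \<le> A1"
    using snoc.IH[OF snoc.prems(1) s] by blast
  obtain A2 where A2: "A2 \<ge> 0" "\<And>f q. chart_smooth c (pts M) f \<Longrightarrow> derivs_le c K (length is) f 1 \<Longrightarrow> q \<in> K \<Longrightarrow> cmod (cpds c is (\<lambda>q. cpd c i h q * f q) q) \<le> A2"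
    using snoc.IH[OF dh s] by blast
  show ?case
  proof (intro exI[of _ "A1 + A2"] conjI allI impI ballI, use A1(1) A2(1) in simp, elim conjE)
    fix f q assume f: "chart_smooth c (pts M) f" "derivs_le c K (length (is @ [i])) f 1" and q: "q \<in> K"
    have qc: "q \<in> fst c" "q \<in> pts M" using q K dom_pts[OF c] by auto
    have df: "chart_smooth c (pts M) (cpd c i f)" by (rule chart_smooth_cpd[OF c pts_open f(1) i])
    have "derivs_le c K (length is) (cpd c i f) 1"
      unfolding derivs_le_def
    proof (intro allI impI ballI, elim conjE)
      fix js q assume "length js \<le> length is" "set js \<subseteq> I" "q \<in> K"
      then have "cmod (cpds c (js @ [i]) f q) \<le> 1"
        using f(2)[unfolded derivs_le_def, rule_format, of "js @ [i]" q] i by simp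
      then show "cmod (cpds c js (cpd c i f) q) \<le> 1" by simp
    qed
    then have b1: "cmod (cpds c is (\<lambda>q. h q * cpd c i f q) q) \<le> A1" by (rule A1(2)[OF df _ q])
    have "derivs_le c K (length is) f 1" by (rule derivs_le_mono[OF f(2)]) auto
    then have b2: "cmod (cpds c is (\<lambda>q. cpd c i h q * f q) q) \<le> A2" by (rule A2(2)[OF f(1) _ q])
    have "cpds c (is @ [i]) (\<lambda>q. h q * f q) q = cpds c is (cpd c i (\<lambda>q. h q * f q)) q" by simp
    also have "\<dots> = cpds c is (\<lambda>q. h q * cpd c i f q + cpd c i h q * f q) q"
      by (rule cpds_cong[OF c pts_open qc s]) (use cpd_mult[OF c snoc.prems(1) f(1) i] in auto)
    also have "\<dots> = cpds c is (\<lambda>q. h q * cpd c i f q) q + cpds c is (\<lambda>q. cpd c i h q * f q) q"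
      by (rule cpds_add[OF c pts_open _ _ s qc]; intro chart_smooth_mult[OF c pts_open] snoc.prems(1) df dh f(1))
    finally have eq: "cpds c (is @ [i]) (\<lambda>q. h q * f q) q =
      cpds c is (\<lambda>q. h q * cpd c i f q) q + cpds c is (\<lambda>q. cpd c i h q * f q) q" .
    show "cmod (cpds c (is @ [i]) (\<lambda>q. h q * f q) q) \<le> A1 + A2"
      unfolding eq by (rule norm_triangle_mono[OF b1 b2])
  qed
qed

lemma leibniz_bound:
  assumes c: "c \<in> atlas M" and K: "compactin (mtop M) K" "K \<subseteq> fst c" and h: "chart_smooth c (pts M) h"
  shows "\<exists>A>0. \<forall>f. chart_smooth c (pts M) f \<and> derivs_le c K N f 1 \<longrightarrow> derivs_le c K N (\<lambda>q. h q * f q) A"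
proof -
  have "\<forall>is\<in>{is. set is \<subseteq> I \<and> length is \<le> N}. \<exists>A\<ge>0. \<forall>f. chart_smooth c (pts M) f \<and> derivs_le c K (length is) f 1 \<longrightarrow>
      (\<forall>q\<in>K. cmod (cpds c is (\<lambda>q. h q * f q) q) \<le> A)"
    using leibniz_bound1[OF c K h] by simp
  then obtain A where A: "\<forall>is\<in>{is. set is \<subseteq> I \<and> length is \<le> N}. A is \<ge> 0 \<and> (\<forall>f. chart_smooth c (pts M) f \<and> derivs_le c K (length is) f 1 \<longrightarrow>
      (\<forall>q\<in>K. cmod (cpds c is (\<lambda>q. h q * f q) q) \<le> A is))"
    by (rule bchoice[THEN exE])
  then have A: "\<And>is. set is \<subseteq> I \<Longrightarrow> length is \<le> N \<Longrightarrow> A is \<ge> 0 \<and> (\<forall>f. chart_smooth c (pts M) f \<and> derivs_le c K (length is) f 1 \<longrightarrow>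
      (\<forall>q\<in>K. cmod (cpds c is (\<lambda>q. h q * f q) q) \<le> A is))"
    by auto
  let ?L = "{is. set is \<subseteq> I \<and> length is \<le> N}"
  have fin: "finite ?L" by (rule finite_lists_length_le) simp
  show ?thesis
  proof (intro exI[of _ "1 + sum A ?L"] conjI allI impI)
    show "1 + sum A ?L > 0" using A by (intro add_pos_nonneg sum_nonneg) auto
    fix f assume "chart_smooth c (pts M) f \<and> derivs_le c K N f 1"
    then have f: "chart_smooth c (pts M) f" "derivs_le c K N f 1" by auto
    show "derivs_le c K N (\<lambda>q. h q * f q) (1 + sum A ?L)" unfolding derivs_le_def
    proof (intro allI impI ballI, elim conjE)
      fix "is" q assume i: "length is \<le> N" "set is \<subseteq> I" and q: "q \<in> K"
      have "derivs_le c K (length is) f 1" by (rule derivs_le_mono[OF f(2) i(1)]) simp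
      then have "cmod (cpds c is (\<lambda>q. h q * f q) q) \<le> A is" using A[OF i(2,1)] f(1) q by blast
      also have "A is \<le> sum A ?L" by (rule member_le_sum) (use i A fin in auto)
      finally show "cmod (cpds c is (\<lambda>q. h q * f q) q) \<le> 1 + sum A ?L" by simp
    qed
  qed
qed

text \<open>Smooth functions supported in \<open>K\<close>. For compact \<open>K\<close> inside a chart this is a Frechet space, whose seminorms
  are bounded by \<open>derivs_le\<close>; the lemmas below are the form of its completeness that is used.\<close>

definition supported :: "'a set \<Rightarrow> ('a \<Rightarrow> complex) set"
  where "supported K = {f \<in> X. \<forall>q. q \<notin> K \<longrightarrow> f q = 0}"

lemma cpds_zero_off:
  assumes c: "c \<in> atlas M" and K: "compactin (mtop M) K" and f: "f \<in> supported K"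
    and q: "q \<in> fst c" "q \<notin> K" "set is \<subseteq> I"
  shows "cpds c is f q = 0"
proof -
  have "cpds c is f q = cpds c is (\<lambda>_. 0) q"
    by (rule cpds_cong[OF c sub_compact_closed[OF K]]) (use q f dom_pts[OF c] in \<open>auto simp: supported_def\<close>)
  also have "\<dots> = 0"
    using cpds_cmult[OF c pts_open chart_smooth_const q(3) q(1), of 0 0] dom_pts[OF c q(1)] by simp
  finally show ?thesis .
qed

text \<open>The condition on \<open>h j\<close> concerns derivatives up to order \<open>j\<close> only, so that for a fixed derivative it bounds
  all but finitely many terms; the others are bounded by compactness of \<open>K\<close>.\<close>

lemma supported_series:
  assumes c: "c \<in> atlas M" and K: "compactin (mtop M) K" "K \<subseteq> fst c"
    and h: "\<And>j. h j \<in> supported K" "\<And>j. derivs_le c K j (h j) ((1 / 2) ^ j)"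
  shows "(\<lambda>q. \<Sum>j. h j q) \<in> supported K"
    and "set is \<subseteq> I \<Longrightarrow> q \<in> fst c \<Longrightarrow>
      summable (\<lambda>j. cpds c is (h j) q) \<and> cpds c is (\<lambda>q. \<Sum>j. h j q) q = (\<Sum>j. cpds c is (h j) q)"
proof -
  have hX: "h j \<in> X" and h0: "q \<notin> K \<Longrightarrow> h j q = 0" for j q using h(1) by (auto simp: supported_def)
  have hc: "chart_smooth c (pts M) (h j)" for j using hX c by (simp add: X_iff)
  have "\<exists>B. \<forall>q\<in>K. cmod (cpds c is (h j) q) \<le> B" if "set is \<subseteq> I" for "is" j
    by (rule chart_smooth_bounded[OF c chart_smooth_cpds[OF c pts_open hc that] K])
  then obtain B where B: "\<And>is j q. set is \<subseteq> I \<Longrightarrow> q \<in> K \<Longrightarrow> cmod (cpds c is (h j) q) \<le> B is j" by metis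
  define N where "N is j = (if length is \<le> j then (1 / 2) ^ j else \<bar>B is j\<bar>)" for "is" :: "nat list" and j
  have N0: "N is j \<ge> 0" for "is" j by (simp add: N_def)
  have Nb: "cmod (cpds c is (h j) q) \<le> N is j" if "set is \<subseteq> I" "q \<in> fst c" for "is" j q
  proof (cases "q \<in> K")
    case True
    then show ?thesis using B[OF that(1) True, of j] h(2)[of j] that(1) unfolding N_def derivs_le_def by auto
  next
    case False
    then show ?thesis using cpds_zero_off[OF c K(1) h(1) that(2) False that(1)] N0 by simp
  qed
  have Ns: "summable (N is)" for "is"
  proof -
    have "\<forall>\<^sub>F j in sequentially. N is j = (1 / 2) ^ j"
      using eventually_ge_at_top[of "length is"] by eventually_elim (simp add: N_def)
    then show ?thesis by (subst summable_cong) (auto intro: summable_geometric)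
  qed
  let ?G = "\<lambda>j x. h j (chart_inv c x)"
  have Mb: "summable (N is) \<and> (\<forall>j. \<forall>x\<in>cimg c (pts M). norm (pderivs is (?G j) x) \<le> N is j)" if "set is \<subseteq> I" for "is"
  proof (intro conjI allI ballI Ns)
    fix j x assume "x \<in> cimg c (pts M)"
    then obtain q where q: "q \<in> fst c" "x = snd c q" by auto
    show "norm (pderivs is (?G j) x) \<le> N is j"
      using Nb[OF that q(1), of j] unfolding q(2) cpds_pderivs[OF c that q(1), of "h j"] .
  qed
  have S: "openin (Rspace I) (cimg c (pts M))" by (rule img_open[OF c pts_open])
  have sm: "smooth_on I (cimg c (pts M)) (?G j)" for j using hc by (simp add: chart_smooth_def)
  have "chart_smooth c (pts M) (\<lambda>q. \<Sum>j. h j q)"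
    unfolding chart_smooth_def by (rule smooth_on_series(1)[OF S sm Mb])
  then have "(\<lambda>q. \<Sum>j. h j q) \<in> X"
    by (rule X_extend[OF c K]) (simp add: h0)
  then show "(\<lambda>q. \<Sum>j. h j q) \<in> supported K" by (simp add: supported_def h0)
  assume i: "set is \<subseteq> I" and q: "q \<in> fst c"
  have "summable (\<lambda>j. cpds c is (h j) q)"
    by (rule summable_comparison_test'[OF Ns[of "is"], of 0]) (use Nb[OF i q] in auto)
  moreover have "pderivs is (\<lambda>x. \<Sum>j. ?G j x) (snd c q) = (\<Sum>j. pderivs is (?G j) (snd c q))"
    by (rule smooth_on_series(2)[OF S sm Mb i]) (use q dom_pts[OF c] in auto)
  ultimately show "summable (\<lambda>j. cpds c is (h j) q) \<and> cpds c is (\<lambda>q. \<Sum>j. h j q) q = (\<Sum>j. cpds c is (h j) q)"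
    unfolding cpds_pderivs[OF c i q, of "\<lambda>q. \<Sum>j. h j q"] cpds_pderivs[OF c i q, of "h _"] by simp
qed

lemma cpds_sum:
  fixes f :: "'j \<Rightarrow> 'a \<Rightarrow> complex"
  assumes "c \<in> atlas M" "openin (mtop M) V" "\<And>j. j \<in> J \<Longrightarrow> chart_smooth c V (f j)" "set is \<subseteq> I" "p \<in> fst c" "p \<in> V"
  shows "cpds c is (\<lambda>p. \<Sum>j\<in>J. f j p) p = (\<Sum>j\<in>J. cpds c is (f j) p)"
  using assms(3)
proof (induction J rule: infinite_finite_induct)
  case (insert j J)
  then show ?case
    using cpds_add[OF assms(1,2) _ chart_smooth_sum[OF assms(1,2)] assms(4-6), of "f j" J f] by simp
next
  case empty
  show ?case using cpds_cmult[OF assms(1) assms(2) chart_smooth_const assms(4-6), of 0 0] by simp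
next
  case (infinite J)
  then show ?case using cpds_cmult[OF assms(1) assms(2) chart_smooth_const assms(4-6), of 0 0] by simp
qed

lemma supported_series_tail:
  assumes c: "c \<in> atlas M" and K: "compactin (mtop M) K" "K \<subseteq> fst c"
    and h: "\<And>j. h j \<in> supported K" "\<And>j. derivs_le c K j (h j) ((1 / 2) ^ j)"
    and tail: "\<And>j. derivs_le c K N (h (n + j)) (e * (1 / 2) ^ Suc j)"
  shows "derivs_le c K N (\<lambda>q. (\<Sum>j. h j q) - (\<Sum>j<n. h j q)) e"
  unfolding derivs_le_def
proof (intro allI impI ballI, elim conjE)
  fix "is" q assume i: "length is \<le> N" "set is \<subseteq> I" and q: "q \<in> K"
  have qc: "q \<in> fst c" "q \<in> pts M" using q K dom_pts[OF c] by auto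
  let ?f = "\<lambda>q. \<Sum>j. h j q" and ?g = "\<lambda>q. \<Sum>j<n. h j q"
  have fX: "?f \<in> X" using supported_series(1)[OF c K h] by (simp add: supported_def)
  have hX: "h j \<in> X" for j using h(1) by (simp add: supported_def)
  have gX: "?g \<in> X" by (rule X_sum) (rule hX)
  note cs = X_chart_smooth[OF _ c]
  have "cpds c is (\<lambda>q. ?f q - ?g q) q = cpds c is (\<lambda>q. ?f q + (-1) * ?g q) q" by simp
  also have "\<dots> = cpds c is ?f q + cpds c is (\<lambda>q. (-1) * ?g q) q"
    by (rule cpds_add[OF c pts_open cs[OF fX] cs[OF X_cmult[OF gX]] i(2) qc])
  also have "cpds c is (\<lambda>q. (-1) * ?g q) q = (-1) * cpds c is ?g q"
    by (rule cpds_cmult[OF c pts_open cs[OF gX] i(2) qc])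
  also have "cpds c is ?g q = (\<Sum>j<n. cpds c is (h j) q)"
    by (rule cpds_sum[OF c pts_open cs[OF hX] i(2) qc])
  also have "cpds c is ?f q = (\<Sum>j. cpds c is (h j) q)" using supported_series(2)[OF c K h i(2) qc(1)] by simp
  also have "\<dots> = (\<Sum>j. cpds c is (h (j + n)) q) + (\<Sum>j<n. cpds c is (h j) q)"
    using supported_series(2)[OF c K h i(2) qc(1)] by (intro suminf_split_initial_segment) simp
  finally have eq: "cpds c is (\<lambda>q. ?f q - ?g q) q = (\<Sum>j. cpds c is (h (j + n)) q)" by simp
  have le: "cmod (cpds c is (h (j + n)) q) \<le> e * (1 / 2) ^ Suc j" for j
    using tail[of j] i q unfolding derivs_le_def by (simp add: add.commute)
  have s: "(\<lambda>j. e * (1 / 2) ^ Suc j) sums e" using sums_mult[OF power_half_series, of e] by simp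
  have sn: "summable (\<lambda>j. cmod (cpds c is (h (j + n)) q))"
    by (rule summable_comparison_test'[OF sums_summable[OF s], of 0]) (use le in auto)
  have "cmod (\<Sum>j. cpds c is (h (j + n)) q) \<le> (\<Sum>j. cmod (cpds c is (h (j + n)) q))"
    by (rule summable_norm[OF sn])
  also have "\<dots> \<le> (\<Sum>j. e * (1 / 2) ^ Suc j)" by (rule suminf_le[OF le sn sums_summable[OF s]])
  also have "\<dots> = e" using s by (simp add: sums_iff)
  finally show "cmod (cpds c is (\<lambda>q. ?f q - ?g q) q) \<le> e" unfolding eq .
qed

end

section \<open>Peetre's theorem\<close>

text \<open>A linear map from smooth functions to continuous functions on a chart domain that does not increase
  supports. For a local operator \<open>D\<close> and a derivative of multi-index \<open>is\<close>, the map
  \<open>f \<mapsto> cpds c is (D f)\<close> has this form.\<close>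

locale local_map = smfd M for M :: "'a manifold" +
  fixes c :: "'a chart" and E :: "('a \<Rightarrow> complex) \<Rightarrow> 'a \<Rightarrow> complex"
  assumes c: "c \<in> atlas M"
    and E_add: "\<And>f g q. f \<in> smooth_funs M (pts M) \<Longrightarrow> g \<in> smooth_funs M (pts M) \<Longrightarrow> q \<in> fst c \<Longrightarrow>
      E (\<lambda>p. f p + g p) q = E f q + E g q"
    and E_cmult: "\<And>f k q. f \<in> smooth_funs M (pts M) \<Longrightarrow> q \<in> fst c \<Longrightarrow> E (\<lambda>p. k * f p) q = k * E f q"
    and E_local: "\<And>f g V q. f \<in> smooth_funs M (pts M) \<Longrightarrow> g \<in> smooth_funs M (pts M) \<Longrightarrow>
      openin (mtop M) V \<Longrightarrow> q \<in> V \<Longrightarrow> q \<in> fst c \<Longrightarrow> (\<And>p. p \<in> V \<Longrightarrow> f p = g p) \<Longrightarrow> E f q = E g q"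
    and E_cont: "\<And>f. f \<in> smooth_funs M (pts M) \<Longrightarrow> continuous_map (subtopology (mtop M) (fst c)) euclidean (E f)"
begin

definition bounded_at :: "'a set \<Rightarrow> 'a \<Rightarrow> bool"
  where "bounded_at K x \<longleftrightarrow> (\<exists>N A. \<forall>f\<in>supported K. derivs_le c K N f 1 \<longrightarrow> cmod (E f x) \<le> A)"

lemma E_diff: "f \<in> X \<Longrightarrow> g \<in> X \<Longrightarrow> q \<in> fst c \<Longrightarrow> E (\<lambda>p. f p - g p) q = E f q - E g q"
  using E_add[of f "\<lambda>p. (-1) * g p" q] E_cmult[of g q "-1"] X_cmult[of g "-1"] by simp

lemma E_open: "f \<in> X \<Longrightarrow> open T \<Longrightarrow> openin (mtop M) {q \<in> fst c. E f q \<in> T}"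
  by (rule sub_preimage_open[OF dom_open[OF c] E_cont])

lemma E_bounded:
  assumes "f \<in> X" "compactin (mtop M) L" "L \<subseteq> fst c"
  shows "\<exists>B. \<forall>q\<in>L. cmod (E f q) \<le> B"
proof -
  have "compactin (subtopology (mtop M) (fst c)) L" using assms by (simp add: compactin_subtopology)
  then have "compactin euclidean (E f ` L)" by (rule image_compactin[OF _ E_cont[OF assms(1)]])
  then have "bounded (E f ` L)" by (simp add: compact_imp_bounded)
  then show ?thesis by (auto simp: bounded_iff)
qed

lemma bounded_at_scale:
  assumes K: "K \<subseteq> fst c" and x: "x \<in> fst c" and b: "\<forall>f\<in>supported K. derivs_le c K N f 1 \<longrightarrow> cmod (E f x) \<le> A"
    and f: "f \<in> supported K" "derivs_le c K N f e" "e > 0"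
  shows "cmod (E f x) \<le> A * e"
proof -
  have fX: "f \<in> X" using f by (simp add: supported_def)
  let ?k = "complex_of_real (1 / e)"
  have "(\<lambda>q. ?k * f q) \<in> supported K" using f(1) X_cmult[OF fX, of ?k] unfolding supported_def by auto
  moreover have "derivs_le c K N (\<lambda>q. ?k * f q) 1"
    using derivs_le_cmult[OF c K X_chart_smooth[OF fX c] f(2), of ?k] f(3) by (simp add: norm_divide)
  ultimately have "cmod (E (\<lambda>q. ?k * f q) x) \<le> A" using b by blast
  then show ?thesis unfolding E_cmult[OF fX x] using f(3) by (simp add: norm_mult norm_divide field_simps)
qed

text \<open>A distance on the chart domain, which serves to separate the points in the gliding hump argument.\<close>

definition d0 :: "'a \<Rightarrow> 'a \<Rightarrow> real"
  where "d0 p q = (\<Sum>i\<in>I. \<bar>snd c q i - snd c p i\<bar>)"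

lemma d0_pos: assumes "p \<in> fst c" "q \<in> fst c" "q \<noteq> p" shows "d0 p q > 0"
proof -
  have e: "snd c q \<in> extensional I" "snd c p \<in> extensional I"
    using Rspace_mem[OF full_img_open[OF c]] assms by auto
  have "snd c q \<noteq> snd c p" using inj_onD[OF chart_inj[OF c]] assms by blast
  then obtain i where i: "i \<in> I" "snd c q i \<noteq> snd c p i"
    using extensionalityI[OF e] by blast
  have "\<bar>snd c q i - snd c p i\<bar> \<le> d0 p q" unfolding d0_def by (rule member_le_sum) (use i in auto)
  then show ?thesis using i by auto
qed

lemma d0_open: "open T \<Longrightarrow> openin (mtop M) {q \<in> fst c. d0 p q \<in> T}"
proof (rule sub_preimage_open[OF dom_open[OF c]])
  have "continuous_map (subtopology (mtop M) (fst c)) euclideanreal (\<lambda>q. snd c q i)" if "i \<in> I" for i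
    using continuous_map_compose[OF chart_cont[OF c] continuous_map_product_projection[OF that]] by (simp add: comp_def)
  then show "continuous_map (subtopology (mtop M) (fst c)) euclideanreal (d0 p)"
    unfolding d0_def[abs_def] by (intro continuous_map_sum continuous_map_real_abs continuous_map_diff) auto
qed

lemma d0_nbhd:
  assumes p: "p \<in> fst c" "p \<in> V" and V: "openin (mtop M) V"
  shows "\<exists>\<delta>>0. \<forall>q\<in>fst c. d0 p q < \<delta> \<longrightarrow> q \<in> V"
proof -
  obtain r where r: "r > 0" "cbx I (snd c p) r \<subseteq> cimg c V"
    using cbx_nbhd[OF _ img_open[OF c V], of "snd c p"] p by auto
  show ?thesis
  proof (intro exI[of _ r] conjI ballI impI r(1))
    fix q assume q: "q \<in> fst c" "d0 p q < r"
    have "\<bar>snd c q i - snd c p i\<bar> \<le> r" if "i \<in> I" for i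
    proof -
      have "\<bar>snd c q i - snd c p i\<bar> \<le> d0 p q" unfolding d0_def by (rule member_le_sum) (use that in auto)
      then show ?thesis using q(2) by simp
    qed
    moreover have "snd c q \<in> extensional I" using Rspace_mem[OF full_img_open[OF c]] q by auto
    ultimately have "snd c q \<in> cbx I (snd c p) r" by (auto simp: PiE_iff dist_real_def abs_minus_commute)
    then obtain q' where "q' \<in> fst c" "q' \<in> V" "snd c q = snd c q'" using r(2) by auto
    then show "q \<in> V" using inj_onD[OF chart_inj[OF c]] q(1) by metis
  qed
qed

text \<open>A gliding hump argument. If points \<open>x n\<close> at which \<open>E\<close> is unbounded accumulated at \<open>p\<close>, one could choose
  functions \<open>f n\<close> with disjoint supports near \<open>x n\<close>, with small derivatives up to order \<open>n\<close>, and with \<open>E (f n) (x n)\<close>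
  larger than \<open>n\<close>. The sum of all \<open>f n\<close> is smooth, and by locality \<open>E\<close> takes the values
  \<open>E (f n) (x n)\<close> on it at \<open>x n\<close>, which contradicts continuity at \<open>p\<close>.\<close>

lemma unbounded_points_isolated:
  assumes K: "compactin (mtop M) K" "K \<subseteq> fst c" and p: "p \<in> fst c"
  shows "\<exists>V. openin (mtop M) V \<and> p \<in> V \<and> V \<subseteq> fst c \<and> (\<forall>x\<in>V. x \<noteq> p \<longrightarrow> bounded_at K x)"
proof (rule ccontr)
  assume no: "\<not> ?thesis"
  have ex: "\<exists>x\<in>fst c. 0 < d0 p x \<and> d0 p x < \<delta> \<and> \<not> bounded_at K x" if "\<delta> > 0" for \<delta>
  proof -
    let ?V = "{q \<in> fst c. d0 p q \<in> {..<\<delta>}}"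
    have "openin (mtop M) ?V" by (rule d0_open) simp
    moreover have "p \<in> ?V" using p that by (simp add: d0_def)
    moreover have "?V \<subseteq> fst c" by auto
    ultimately obtain x where "x \<in> ?V" "x \<noteq> p" "\<not> bounded_at K x" using no by blast
    then show ?thesis using d0_pos[OF p] by auto
  qed
  let ?P = "\<lambda>x. x \<in> fst c \<and> 0 < d0 p x \<and> \<not> bounded_at K x"
  have "\<exists>x. \<forall>n. ?P (x n) \<and> d0 p (x (Suc n)) < d0 p (x n) / 2"
  proof (rule dependent_nat_choice)
    show "\<exists>x. ?P x" using ex[of 1] by auto
    show "\<exists>y. ?P y \<and> d0 p y < d0 p x / 2" if "?P x" for x using ex[of "d0 p x / 2"] that by auto
  qed
  then obtain x where x: "\<And>n. x n \<in> fst c" "\<And>n. 0 < d0 p (x n)" "\<And>n. \<not> bounded_at K (x n)"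
    and dx: "\<And>n. d0 p (x (Suc n)) < d0 p (x n) / 2" by blast
  let ?d = "\<lambda>n. d0 p (x n)"
  have dpow: "?d (n + k) \<le> ?d n / 2 ^ k" for n k
  proof (induction k)
    case (Suc k)
    have "?d (n + Suc k) \<le> ?d (n + k) / 2" using dx[of "n + k"] by simp
    also have "\<dots> \<le> (?d n / 2 ^ k) / 2" using Suc by simp
    finally show ?case by (simp add: field_simps)
  qed simp
  \<comment> \<open>The distances to \<open>p\<close> at least halve in each step, so these shells are
    pairwise disjoint.\<close>
  define V where "V n = {q \<in> fst c. d0 p q \<in> {3 / 4 * ?d n<..<5 / 4 * ?d n}}" for n
  have Vo: "openin (mtop M) (V n)" for n unfolding V_def by (rule d0_open) simp
  have xV: "x n \<in> V n" for n using x(1,2)[of n] by (simp add: V_def)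
  have disj1: "V n \<inter> V (n + Suc k) = {}" for n k
  proof -
    have "?d (n + Suc k) \<le> ?d n / 2"
    proof -
      have "?d (n + Suc k) \<le> ?d n / 2 ^ Suc k" by (rule dpow)
      also have "\<dots> \<le> ?d n / 2" using x(2)[of n] by (simp add: field_simps)
      finally show ?thesis .
    qed
    then show ?thesis using x(2)[of n] by (auto simp: V_def)
  qed
  have disj: "V j \<inter> V k = {}" if "j \<noteq> k" for j k
  proof (cases "j < k")
    case True
    then obtain i where "k = j + Suc i" using less_imp_Suc_add[OF True] by auto
    then show ?thesis using disj1 by simp
  next
    case False
    then have "k < j" using that by simp
    then obtain i where "j = k + Suc i" using less_imp_Suc_add[of k j] by auto
    then show ?thesis using disj1[of k i] by auto
  qed
  have "\<exists>f. f \<in> supported K \<and> derivs_le c K n f ((1 / 2) ^ n) \<and> cmod (E f (x n)) > n \<and> (\<forall>q. q \<notin> V n \<longrightarrow> f q = 0)" for n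
  proof -
    obtain h W L where h: "h \<in> X" "openin (mtop M) W" "x n \<in> W" "W \<subseteq> L" "L \<subseteq> fst c \<inter> V n"
        "\<And>q. q \<in> W \<Longrightarrow> h q = 1" "\<And>q. q \<notin> L \<Longrightarrow> h q = 0"
      using bump[OF c x(1) xV Vo] by metis
    obtain A where A: "A > 0" "\<And>f. chart_smooth c (pts M) f \<Longrightarrow> derivs_le c K n f 1 \<Longrightarrow> derivs_le c K n (\<lambda>q. h q * f q) A"
      using leibniz_bound[OF c K X_chart_smooth[OF h(1) c]] by blast
    define s where "s = (1 / 2) ^ n / A"
    have s: "s > 0" using A(1) by (simp add: s_def)
    obtain f where f: "f \<in> supported K" "derivs_le c K n f 1" "cmod (E f (x n)) > n / s"
      using x(3)[of n] unfolding bounded_at_def by (meson not_le)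
    have fX: "f \<in> X" using f(1) by (simp add: supported_def)
    have hf: "(\<lambda>q. h q * f q) \<in> X" by (rule X_mult[OF h(1) fX])
    let ?g = "\<lambda>q. complex_of_real s * (h q * f q)"
    have "?g \<in> supported K" using X_cmult[OF hf] f(1) by (simp add: supported_def)
    moreover have "derivs_le c K n ?g ((1 / 2) ^ n)"
      using derivs_le_cmult[OF c K(2) X_chart_smooth[OF hf c] A(2)[OF X_chart_smooth[OF fX c] f(2)], of "complex_of_real s"] s A(1)
      by (simp add: s_def norm_divide norm_power)
    moreover have "E ?g (x n) = complex_of_real s * E f (x n)"
    proof -
      have "E (\<lambda>q. h q * f q) (x n) = E f (x n)"
        by (rule E_local[OF hf fX h(2,3) x(1)]) (simp add: h(6))
      then show ?thesis by (simp add: E_cmult[OF hf x(1)])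
    qed
    then have "cmod (E ?g (x n)) > n" using f(3) s by (simp add: norm_mult field_simps)
    moreover have "?g q = 0" if "q \<notin> V n" for q using h(5,7) that by auto
    ultimately show ?thesis by blast
  qed
  then obtain f where f: "\<And>n. f n \<in> supported K" "\<And>n. derivs_le c K n (f n) ((1 / 2) ^ n)" "\<And>n. cmod (E (f n) (x n)) > real n"
    "\<And>n q. q \<notin> V n \<Longrightarrow> f n q = 0" by metis
  define F where "F q = (\<Sum>n. f n q)" for q
  have FX: "F \<in> X" using supported_series(1)[OF c K f(1,2)] by (simp add: F_def[abs_def] supported_def)
  have EF: "E F (x n) = E (f n) (x n)" for n
  proof (rule E_local[OF FX _ Vo xV x(1)])
    show "f n \<in> X" using f(1) by (simp add: supported_def)
    fix q assume q: "q \<in> V n"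
    have "f j q = 0" if "j \<noteq> n" for j using f(4)[of q j] disj[OF that] q by blast
    then have "F q = (\<Sum>j\<in>{n}. f j q)" unfolding F_def by (intro suminf_finite) auto
    then show "F q = f n q" by simp
  qed
  let ?U = "{q \<in> fst c. E F q \<in> ball (E F p) 1}"
  have "openin (mtop M) ?U" by (rule E_open[OF FX]) simp
  then obtain \<delta> where \<delta>: "\<delta> > 0" "\<And>q. q \<in> fst c \<Longrightarrow> d0 p q < \<delta> \<Longrightarrow> q \<in> ?U"
    using d0_nbhd[OF p, of ?U] p by auto
  have "(\<lambda>n. ?d 0 * (1 / 2) ^ n) \<longlonglongrightarrow> ?d 0 * 0"
    by (intro tendsto_mult tendsto_const LIMSEQ_power_zero) simp
  then have "\<forall>\<^sub>F n in sequentially. ?d 0 * (1 / 2) ^ n < \<delta>" using \<delta>(1) by (intro order_tendstoD(2)) auto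
  moreover have "\<forall>\<^sub>F n in sequentially. real n > cmod (E F p) + 1"
    using filterlim_real_sequentially by (simp add: filterlim_at_top_dense)
  ultimately have "\<forall>\<^sub>F n in sequentially. ?d 0 * (1 / 2) ^ n < \<delta> \<and> real n > cmod (E F p) + 1"
    by eventually_elim simp
  then obtain n where n: "?d 0 * (1 / 2) ^ n < \<delta>" "real n > cmod (E F p) + 1"
    by (metis (no_types, lifting) eventually_happens' sequentially_bot)
  have "?d n < \<delta>" using dpow[of 0 n] n(1) by (simp add: power_divide)
  then have "x n \<in> ?U" by (rule \<delta>(2)[OF x(1)])
  then have "cmod (E F (x n) - E F p) < 1" by (simp add: dist_norm norm_minus_commute)
  then have "cmod (E F (x n)) < cmod (E F p) + 1" using norm_triangle_sub[of "E F (x n)" "E F p"] by linarith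
  then show False using f(3)[of n] n(2) unfolding EF by linarith
qed

text \<open>The uniform boundedness principle for evaluations of \<open>E\<close> at the points of \<open>A\<close>: every function \<open>E f\<close> is bounded on
  the compact set \<open>L\<close>, and the Frechet space \<open>supported K\<close> is complete. If the conclusion fails, one builds
  partial sums \<open>g n\<close> with \<open>E (g n) (x n)\<close> at least \<open>n\<close>, adding in each step a correction so small that the
  evaluations chosen before change by at most 1 altogether; on the limit \<open>E\<close> is unbounded.\<close>

lemma uniform_bound:
  assumes K: "compactin (mtop M) K" "K \<subseteq> fst c" and L: "compactin (mtop M) L" "L \<subseteq> fst c"
    and A: "A \<subseteq> L" "\<And>x. x \<in> A \<Longrightarrow> bounded_at K x"
  shows "\<exists>N B. \<forall>f\<in>supported K. derivs_le c K N f 1 \<longrightarrow> (\<forall>x\<in>A. cmod (E f x) \<le> B)"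
proof (rule ccontr)
  assume no: "\<not> ?thesis"
  have Ac: "x \<in> fst c" if "x \<in> A" for x using that A(1) L(2) by blast
  have big: "\<exists>f\<in>supported K. derivs_le c K N f e \<and> (\<exists>x\<in>A. cmod (E f x) > B)" if e: "e > 0" for N e B
  proof -
    obtain f x where f: "f \<in> supported K" "derivs_le c K N f 1" "x \<in> A" "cmod (E f x) > B / e"
      using no by (meson not_le)
    have fX: "f \<in> X" using f(1) by (simp add: supported_def)
    let ?g = "\<lambda>q. complex_of_real e * f q"
    have "?g \<in> supported K" using f(1) X_cmult[OF fX] by (simp add: supported_def)
    moreover have "derivs_le c K N ?g e"
      using derivs_le_cmult[OF c K(2) X_chart_smooth[OF fX c] f(2), of "complex_of_real e"] e by simp
    moreover have "cmod (E ?g x) > B"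
      using f(4) e by (simp add: E_cmult[OF fX Ac[OF f(3)]] norm_mult field_simps)
    ultimately show ?thesis using f(3) by blast
  qed
  \<comment> \<open>The state \<open>(g, x, N, e)\<close>: a partial sum \<open>g\<close>, a point
    \<open>x\<close> at which \<open>E g\<close> is large, and a neighbourhood of 0, given by \<open>N\<close>
    and \<open>e\<close>, on which evaluation at \<open>x\<close> is at most 1. Corrections of size
    \<open>e / 2\<close>, \<open>e / 4\<close>, \<open>\<dots>\<close> stay inside it.\<close>
  define P where "P n s = (case s of (g, x, N, e) \<Rightarrow> g \<in> supported K \<and> x \<in> A \<and> N \<ge> n \<and> 0 < e \<and> e \<le> (1 / 2) ^ n \<and>
      cmod (E g x) \<ge> real n \<and> (\<forall>r\<in>supported K. derivs_le c K N r e \<longrightarrow> cmod (E r x) \<le> 1))"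
    for n :: nat and s :: "('a \<Rightarrow> complex) \<times> 'a \<times> nat \<times> real"
  define Q where "Q s s' = (case s of (g, x, N, e) \<Rightarrow> case s' of (g', x', N', e') \<Rightarrow>
      N' \<ge> N \<and> e' \<le> e / 2 \<and> derivs_le c K N (\<lambda>q. g' q - g q) (e / 2))"
    for s s' :: "('a \<Rightarrow> complex) \<times> 'a \<times> nat \<times> real"
  have small: "\<exists>N' e'. N' \<ge> N \<and> 0 < e' \<and> e' \<le> e \<and> (\<forall>r\<in>supported K. derivs_le c K N' r e' \<longrightarrow> cmod (E r x) \<le> 1)"
    if x: "x \<in> A" and e: "e > 0" for x N e
  proof -
    obtain N1 B where b: "\<forall>f\<in>supported K. derivs_le c K N1 f 1 \<longrightarrow> cmod (E f x) \<le> B"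
      using A(2)[OF x] unfolding bounded_at_def by blast
    define e' where "e' = min e (1 / (\<bar>B\<bar> + 1))"
    have e': "e' > 0" using e by (simp add: e'_def)
    show ?thesis
    proof (intro exI[of _ "max N N1"] exI[of _ e'] conjI ballI impI e')
      fix r assume r: "r \<in> supported K" "derivs_le c K (max N N1) r e'"
      have "derivs_le c K N1 r e'" by (rule derivs_le_mono[OF r(2)]) auto
      then have "cmod (E r x) \<le> B * e'" using bounded_at_scale[OF K(2) Ac[OF x] b r(1)] e' by blast
      also have "\<dots> \<le> (\<bar>B\<bar> + 1) * e'" using e' by (intro mult_right_mono) auto
      also have "\<dots> \<le> (\<bar>B\<bar> + 1) * (1 / (\<bar>B\<bar> + 1))" unfolding e'_def by (intro mult_left_mono) auto
      also have "\<dots> = 1" by simp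
      finally show "cmod (E r x) \<le> 1" .
    qed (auto simp: e'_def)
  qed
  have "\<exists>s. \<forall>n. P n (s n) \<and> Q (s n) (s (Suc n))"
  proof (rule dependent_nat_choice)
    obtain x where x: "x \<in> A" using big[of 1] by fastforce
    obtain N e where "0 < e" "e \<le> 1" "\<forall>r\<in>supported K. derivs_le c K N r e \<longrightarrow> cmod (E r x) \<le> 1"
      using small[OF x, of 1 0] by auto
    moreover have "(\<lambda>_. 0) \<in> supported K" using X_zero by (simp add: supported_def)
    ultimately show "\<exists>s. P 0 s" using x by (intro exI[of _ "(\<lambda>_. 0, x, N, e)"]) (simp add: P_def)
  next
    fix s n assume "P n s"
    then obtain g x N e where s: "s = (g, x, N, e)" and g: "g \<in> supported K" and N: "N \<ge> n" and e: "0 < e" "e \<le> (1 / 2) ^ n"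
      unfolding P_def by (auto split: prod.splits)
    obtain f y where f: "f \<in> supported K" "derivs_le c K N f (e / 2)" "y \<in> A" "cmod (E f y) > real (Suc n)"
      using big[of "e / 2" N "real (Suc n)"] e by auto
    have gX: "g \<in> X" and fX: "f \<in> X" using g f(1) by (auto simp: supported_def)
    have y: "y \<in> fst c" by (rule Ac[OF f(3)])
    \<comment> \<open>The values at \<open>g + f\<close> and \<open>g - f\<close> differ by twice the value at \<open>f\<close>, so one of them is large, whatever the value at \<open>g\<close> is.\<close>
    have "\<exists>k. cmod k = 1 \<and> cmod (E (\<lambda>q. g q + k * f q) y) \<ge> real (Suc n)"
    proof (rule ccontr)
      assume "\<not> ?thesis"
      then have nk: "cmod (E (\<lambda>q. g q + k * f q) y) < real (Suc n)" if "cmod k = 1" for k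
        using that not_le by blast
      have "cmod (E g y + E f y) < real (Suc n)"
        using nk[of 1] E_add[OF gX fX y] by simp
      moreover have "cmod (E g y - E f y) < real (Suc n)"
        using nk[of "-1"] E_diff[OF gX fX y] by simp
      moreover have "cmod (2 * E f y) \<le> cmod (E g y + E f y) + cmod (E g y - E f y)"
        using norm_triangle_ineq4[of "E g y + E f y" "E g y - E f y"] by simp
      then have "2 * cmod (E f y) \<le> cmod (E g y + E f y) + cmod (E g y - E f y)"
        by (simp add: norm_mult)
      ultimately show False using f(4) by linarith
    qed
    then obtain k where k: "cmod k = 1" "cmod (E (\<lambda>q. g q + k * f q) y) \<ge> real (Suc n)" by blast
    have e2: "e / 2 > 0" using e by simp
    obtain N' e' where N': "N' \<ge> max N (Suc n)" "0 < e'" "e' \<le> e / 2" "\<forall>r\<in>supported K. derivs_le c K N' r e' \<longrightarrow> cmod (E r y) \<le> 1"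
      using small[OF f(3) e2, of "max N (Suc n)"] by blast
    let ?s = "(\<lambda>q. g q + k * f q, y, N', e')"
    have "(\<lambda>q. g q + k * f q) \<in> supported K" using g f(1) X_add[OF gX X_cmult[OF fX]] by (simp add: supported_def)
    then have "P (Suc n) ?s" using N' k(2) f(3) e by (simp add: P_def)
    moreover have "derivs_le c K N (\<lambda>q. k * f q) (e / 2)"
      using derivs_le_cmult[OF c K(2) X_chart_smooth[OF fX c] f(2), of k] k(1) by simp
    then have "Q s ?s" using N' s by (simp add: Q_def)
    ultimately show "\<exists>s'. P (Suc n) s' \<and> Q s s'" by blast
  qed
  then obtain s where s: "\<And>n. P n (s n)" "\<And>n. Q (s n) (s (Suc n))" by blast
  define g x N e where "g = (\<lambda>n. fst (s n))" and "x = (\<lambda>n. fst (snd (s n)))"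
    and "N = (\<lambda>n. fst (snd (snd (s n))))" and "e = (\<lambda>n. snd (snd (snd (s n))))"
  have sn: "s n = (g n, x n, N n, e n)" for n by (simp add: g_def x_def N_def e_def)
  have P: "g n \<in> supported K" "x n \<in> A" "N n \<ge> n" "0 < e n" "e n \<le> (1 / 2) ^ n" "cmod (E (g n) (x n)) \<ge> real n"
    "\<And>r. r \<in> supported K \<Longrightarrow> derivs_le c K (N n) r (e n) \<Longrightarrow> cmod (E r (x n)) \<le> 1" for n
    using s(1)[of n] unfolding P_def sn by auto
  have Q: "N (Suc n) \<ge> N n" "e (Suc n) \<le> e n / 2" "derivs_le c K (N n) (\<lambda>q. g (Suc n) q - g n q) (e n / 2)" for n
    using s(2)[of n] unfolding Q_def sn by auto
  have gX: "g n \<in> X" for n using P(1) by (simp add: supported_def)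
  define h where "h n = (\<lambda>q. g (Suc n) q - g n q)" for n
  have Nmono: "N n \<le> N (n + j)" for n j by (rule lift_Suc_mono_le[of N]) (use Q(1) in auto)
  have ehalf: "e (n + j) \<le> e n * (1 / 2) ^ j" for n j
  proof (induction j)
    case (Suc j)
    have "e (n + Suc j) \<le> e (n + j) / 2" using Q(2)[of "n + j"] by simp
    also have "\<dots> \<le> (e n * (1 / 2) ^ j) / 2" using Suc by simp
    finally show ?case by simp
  qed simp
  have hK: "h n \<in> supported K" for n using P(1)[of n] P(1)[of "Suc n"] X_diff[OF gX gX] by (simp add: h_def supported_def)
  have hb: "derivs_le c K n (h n) ((1 / 2) ^ n)" for n
    by (rule derivs_le_mono[OF Q(3)[of n, folded h_def]]) (use P(3,4,5)[of n] in auto)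
  have tail: "derivs_le c K (N n) (h (n + j)) (e n * (1 / 2) ^ Suc j)" for n j
    by (rule derivs_le_mono[OF Q(3)[of "n + j", folded h_def]]) (use Nmono ehalf[of n j] in auto)
  define F where "F q = (\<Sum>j. h j q)" for q
  have FK: "F \<in> supported K" using supported_series(1)[OF c K hK hb] by (simp add: F_def[abs_def])
  then have FX: "F \<in> X" by (simp add: supported_def)
  have tele: "(\<Sum>j<n. h j q) = g n q - g 0 q" for n q
    unfolding h_def by (induction n) auto
  obtain B where B: "\<And>q. q \<in> L \<Longrightarrow> cmod (E F q) \<le> B" using E_bounded[OF FX L] by blast
  obtain B0 where B0: "\<And>q. q \<in> L \<Longrightarrow> cmod (E (g 0) q) \<le> B0" using E_bounded[OF gX L] by blast
  obtain n :: nat where n: "real n > B + B0 + 1" using reals_Archimedean2 by blast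
  have xc: "x n \<in> fst c" "x n \<in> L" using P(2)[of n] Ac A(1) by auto
  let ?G = "\<lambda>q. F q - (g n q - g 0 q)"
  have gg: "(\<lambda>q. g n q - g 0 q) \<in> X" by (rule X_diff[OF gX gX])
  have "derivs_le c K (N n) ?G (e n)"
    using supported_series_tail[OF c K hK hb tail] unfolding tele F_def[symmetric] .
  moreover have "?G \<in> supported K" using FK P(1)[of n] P(1)[of 0] X_diff[OF FX gg] by (simp add: supported_def)
  ultimately have "cmod (E ?G (x n)) \<le> 1" by (intro P(7))
  then have "cmod (E F (x n) - (E (g n) (x n) - E (g 0) (x n))) \<le> 1"
    by (simp add: E_diff[OF FX gg xc(1)] E_diff[OF gX gX xc(1)])
  then have "cmod (E (g n) (x n)) \<le> cmod (E F (x n)) + cmod (E (g 0) (x n)) + 1"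
    by (smt (verit) norm_triangle_ineq4 norm_minus_commute norm_triangle_sub)
  then show False using P(6)[of n] B[OF xc(2)] B0[OF xc(2)] n by linarith
qed

lemma not_isolated:
  assumes m: "mdim M > 0" and p: "p \<in> fst c" "p \<in> U" and U: "openin (mtop M) U"
  shows "\<exists>q\<in>U. q \<noteq> p"
proof -
  obtain r where r: "r > 0" "cbx I (snd c p) r \<subseteq> cimg c U"
    using cbx_nbhd[OF _ img_open[OF c U], of "snd c p"] p by auto
  let ?y = "(snd c p)(0 := snd c p 0 + r)"
  have "snd c p \<in> extensional I" using Rspace_mem[OF full_img_open[OF c]] p by auto
  then have "?y \<in> cbx I (snd c p) r" using m r(1) by (auto simp: PiE_iff extensional_def dist_real_def)
  then obtain q where q: "q \<in> U" "?y = snd c q" using r(2) by auto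
  have "?y \<noteq> snd c p" using r(1) by (metis fun_upd_same less_add_same_cancel1 less_irrefl)
  then show ?thesis using q by metis
qed

text \<open>Near \<open>p\<close> all points except possibly \<open>p\<close> satisfy a common bound, by the two preceding results. If the
  dimension is positive, \<open>p\<close> is a limit of such points and continuity of \<open>E f\<close> extends the bound to \<open>p\<close>; in
  dimension 0 the chart is a point and \<open>E\<close> is multiplication by a number.\<close>

lemma local_bound:
  assumes p: "p \<in> fst c"
  shows "\<exists>W K N B. openin (mtop M) W \<and> p \<in> W \<and> W \<subseteq> fst c \<and> compactin (mtop M) K \<and> K \<subseteq> fst c \<and>
    (\<forall>f\<in>X. derivs_le c K N f 1 \<longrightarrow> (\<forall>x\<in>W. cmod (E f x) \<le> B))"
proof -
  obtain h W0 K where h: "h \<in> X" "openin (mtop M) W0" "p \<in> W0" "W0 \<subseteq> K" "compactin (mtop M) K" "K \<subseteq> fst c"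
      "\<And>q. q \<in> W0 \<Longrightarrow> h q = 1" "\<And>q. q \<notin> K \<Longrightarrow> h q = 0"
    using bump[OF c p p dom_open[OF c]] by (metis Int_absorb)
  have hK: "h \<in> supported K" using h by (simp add: supported_def)
  have "\<exists>W N B. openin (mtop M) W \<and> p \<in> W \<and> W \<subseteq> W0 \<and> (\<forall>f\<in>supported K. derivs_le c K N f 1 \<longrightarrow> (\<forall>x\<in>W. cmod (E f x) \<le> B))"
  proof (cases "mdim M > 0")
    case True
    obtain V where V: "openin (mtop M) V" "p \<in> V" "\<And>x. x \<in> V \<Longrightarrow> x \<noteq> p \<Longrightarrow> bounded_at K x"
      using unbounded_points_isolated[OF h(5,6) p] by blast
    let ?W = "W0 \<inter> V"
    have W: "openin (mtop M) ?W" using h(2) V(1) by (rule openin_Int)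
    have "\<exists>N B. \<forall>f\<in>supported K. derivs_le c K N f 1 \<longrightarrow> (\<forall>x\<in>?W - {p}. cmod (E f x) \<le> B)"
      by (rule uniform_bound[OF h(5,6) h(5,6)]) (use h(4) V(3) in auto)
    then obtain N B where b: "\<And>f x. f \<in> supported K \<Longrightarrow> derivs_le c K N f 1 \<Longrightarrow> x \<in> ?W - {p} \<Longrightarrow> cmod (E f x) \<le> B" by blast
    have "cmod (E f p) \<le> B" if f: "f \<in> supported K" "derivs_le c K N f 1" for f
    proof (rule ccontr)
      assume nb: "\<not> cmod (E f p) \<le> B"
      have fX: "f \<in> X" using f by (simp add: supported_def)
      let ?U = "?W \<inter> {q \<in> fst c. E f q \<in> - cball 0 B}"
      have "openin (mtop M) ?U" by (intro openin_Int W E_open[OF fX]) auto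
      moreover have "p \<in> ?U" using nb h(3) V(2) p by simp
      ultimately obtain q where "q \<in> ?U" "q \<noteq> p" using not_isolated[OF True p, of ?U] by auto
      then show False using b[OF f, of q] by auto
    qed
    then have "\<forall>f\<in>supported K. derivs_le c K N f 1 \<longrightarrow> (\<forall>x\<in>?W. cmod (E f x) \<le> B)" using b by blast
    then show ?thesis using W h(3) V(2) by (intro exI[of _ ?W] exI[of _ N] exI[of _ B]) auto
  next
    case False
    then have I0: "I = {}" by simp
    have "q = p" if "q \<in> fst c" for q
    proof -
      have "snd c q \<in> extensional I" "snd c p \<in> extensional I"
        using Rspace_mem[OF full_img_open[OF c]] p that by auto
      then have "snd c q = snd c p" unfolding I0 by simp
      then show ?thesis using inj_onD[OF chart_inj[OF c]] p that by blast
    qed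
    then have W0: "W0 = {p}" using h(3,4,6) by blast
    have "cmod (E f p) \<le> cmod (E h p)" if f: "f \<in> supported K" "derivs_le c K 0 f 1" for f
    proof -
      have fX: "f \<in> X" using f by (simp add: supported_def)
      have "E f p = E (\<lambda>q. f p * h q) p"
        by (rule E_local[OF fX X_cmult[OF h(1)] h(2,3) p]) (use W0 h(7) in auto)
      then have eq: "E f p = f p * E h p" by (simp add: E_cmult[OF h(1) p])
      have "cmod (f p) \<le> 1" using f(2)[unfolded derivs_le_def, rule_format, of "[]" p] h(3,4) by auto
      then show ?thesis unfolding eq by (simp add: norm_mult mult_left_le_one_le)
    qed
    then have "\<forall>f\<in>supported K. derivs_le c K 0 f 1 \<longrightarrow> (\<forall>x\<in>W0. cmod (E f x) \<le> cmod (E h p))" using W0 by simp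
    then show ?thesis using h(2,3) by blast
  qed
  then obtain W N B where W: "openin (mtop M) W" "p \<in> W" "W \<subseteq> W0"
    and b: "\<forall>f\<in>supported K. derivs_le c K N f 1 \<longrightarrow> (\<forall>x\<in>W. cmod (E f x) \<le> B)" by blast
  obtain A where A: "A > 0" "\<And>f. chart_smooth c (pts M) f \<Longrightarrow> derivs_le c K N f 1 \<Longrightarrow> derivs_le c K N (\<lambda>q. h q * f q) A"
    using leibniz_bound[OF c h(5,6) X_chart_smooth[OF h(1) c]] by blast
  have "cmod (E f x) \<le> B * A" if f: "f \<in> X" "derivs_le c K N f 1" and x: "x \<in> W" for f x
  proof -
    have hf: "(\<lambda>q. h q * f q) \<in> X" by (rule X_mult[OF h(1) f(1)])
    have xc: "x \<in> fst c" using x W(3) h(4,6) by blast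
    have "E f x = E (\<lambda>q. h q * f q) x"
      by (rule E_local[OF f(1) hf W(1) x xc]) (use W(3) h(7) in auto)
    moreover have "cmod (E (\<lambda>q. h q * f q) x) \<le> B * A"
    proof (rule bounded_at_scale[OF h(6) xc, of N])
      show "(\<lambda>q. h q * f q) \<in> supported K" using hf h(8) by (simp add: supported_def)
      show "derivs_le c K N (\<lambda>q. h q * f q) A" by (rule A(2)[OF X_chart_smooth[OF f(1) c] f(2)])
    qed (use b x A(1) in auto)
    ultimately show ?thesis by simp
  qed
  then have "\<forall>f\<in>X. derivs_le c K N f 1 \<longrightarrow> (\<forall>x\<in>W. cmod (E f x) \<le> B * A)" by blast
  moreover have "W \<subseteq> fst c" using W(3) h(4,6) by blast
  ultimately show ?thesis using W(1,2) h(5,6) by blast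
qed

end

section \<open>Bounded functionals and local operators\<close>

context smfd
begin

text \<open>A triple \<open>(c, K, is)\<close> stands for the seminorm \<open>sup\<^sub>K \<bar>\<partial>\<^sup>i\<^sup>s f\<bar>\<close> in the chart \<open>c\<close>. The relation \<open>seminorms_le Q f B\<close> bounds
  seminorms without mentioning suprema.\<close>

type_synonym 'b seminorm_index = "'b chart \<times> 'b set \<times> nat list"

definition admissible :: "'a seminorm_index \<Rightarrow> bool"
  where "admissible q \<longleftrightarrow> (case q of (c, K, is) \<Rightarrow> c \<in> atlas M \<and> compactin (mtop M) K \<and> K \<subseteq> fst c \<and> set is \<subseteq> I)"

definition seminorms_le :: "'a seminorm_index set \<Rightarrow> ('a \<Rightarrow> complex) \<Rightarrow> real \<Rightarrow> bool"
  where "seminorms_le Q f B \<longleftrightarrow> (\<forall>q\<in>Q. case q of (c, K, is) \<Rightarrow> \<forall>x\<in>K. cmod (cpds c is f x) \<le> B)"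

text \<open>For linear functionals this is continuity in the Frechet topology.\<close>

definition fbounded :: "(('a \<Rightarrow> complex) \<Rightarrow> complex) \<Rightarrow> bool"
  where "fbounded \<sigma> \<longleftrightarrow> (\<exists>Q B. finite Q \<and> (\<forall>q\<in>Q. admissible q) \<and> (\<forall>f\<in>X. seminorms_le Q f 1 \<longrightarrow> cmod (\<sigma> f) \<le> B))"

definition linfun :: "(('a \<Rightarrow> complex) \<Rightarrow> complex) \<Rightarrow> bool"
  where "linfun \<sigma> \<longleftrightarrow> (\<forall>f\<in>X. \<forall>g\<in>X. \<sigma> (\<lambda>p. f p + g p) = \<sigma> f + \<sigma> g) \<and> (\<forall>f\<in>X. \<forall>k. \<sigma> (\<lambda>p. k * f p) = k * \<sigma> f)"

text \<open>Linear maps of \<open>X\<close> to itself that do not increase supports. Differential operators are examples, and so are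
  the components of a morphism that commutes with restrictions.\<close>

definition local_op :: "(('a \<Rightarrow> complex) \<Rightarrow> 'a \<Rightarrow> complex) \<Rightarrow> bool"
  where "local_op D \<longleftrightarrow> (\<forall>f\<in>X. D f \<in> X) \<and>
    (\<forall>f\<in>X. \<forall>g\<in>X. D (\<lambda>p. f p + g p) = (\<lambda>p. D f p + D g p)) \<and>
    (\<forall>f\<in>X. \<forall>k. D (\<lambda>p. k * f p) = (\<lambda>p. k * D f p)) \<and>
    (\<forall>f\<in>X. \<forall>g\<in>X. \<forall>V. openin (mtop M) V \<and> (\<forall>p\<in>V. f p = g p) \<longrightarrow> (\<forall>p\<in>V. D f p = D g p))"

lemma local_op_rules:
  assumes "local_op D"
  shows local_op_X: "f \<in> X \<Longrightarrow> D f \<in> X"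
    and local_op_add: "f \<in> X \<Longrightarrow> g \<in> X \<Longrightarrow> D (\<lambda>p. f p + g p) = (\<lambda>p. D f p + D g p)"
    and local_op_cmult: "f \<in> X \<Longrightarrow> D (\<lambda>p. k * f p) = (\<lambda>p. k * D f p)"
    and local_op_local: "f \<in> X \<Longrightarrow> g \<in> X \<Longrightarrow> openin (mtop M) V \<Longrightarrow> (\<And>p. p \<in> V \<Longrightarrow> f p = g p) \<Longrightarrow> p \<in> V \<Longrightarrow> D f p = D g p"
  using assms unfolding local_op_def by blast+

lemma seminorms_le_scale:
  assumes Q: "\<forall>q\<in>Q. admissible q" and f: "f \<in> X" "seminorms_le Q f B"
  shows "seminorms_le Q (\<lambda>p. k * f p) (cmod k * B)"
  unfolding seminorms_le_def
proof (intro ballI, clarify)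
  fix c K "is" x assume q: "(c, K, is) \<in> Q" and x: "x \<in> K"
  then have a: "c \<in> atlas M" "K \<subseteq> fst c" "set is \<subseteq> I" using Q by (auto simp: admissible_def)
  have xc: "x \<in> fst c" "x \<in> pts M" using x a dom_pts[OF a(1)] by auto
  have "cmod (cpds c is f x) \<le> B" using f(2) q x by (auto simp: seminorms_le_def)
  then show "cmod (cpds c is (\<lambda>p. k * f p) x) \<le> cmod k * B"
    unfolding cpds_cmult[OF a(1) pts_open X_chart_smooth[OF f(1) a(1)] a(3) xc] by (simp add: norm_mult mult_left_mono)
qed

lemma linfun_scaled_bound:
  assumes \<sigma>: "linfun \<sigma>" and Q: "\<forall>q\<in>Q. admissible q" "\<forall>f\<in>X. seminorms_le Q f e \<longrightarrow> cmod (\<sigma> f) \<le> B" "e > 0"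
    and f: "f \<in> X" "seminorms_le Q f B'" and B': "B' > 0"
  shows "cmod (\<sigma> f) \<le> B * B' / e"
proof -
  let ?k = "complex_of_real (e / B')"
  have "seminorms_le Q (\<lambda>p. ?k * f p) (cmod ?k * B')" by (rule seminorms_le_scale[OF Q(1) f])
  moreover have "cmod ?k * B' = e" using B' Q(3) by (simp only: norm_of_real) simp
  ultimately have "cmod (\<sigma> (\<lambda>p. ?k * f p)) \<le> B" using Q(2) X_cmult[OF f(1), of ?k] by simp
  moreover have "\<sigma> (\<lambda>p. ?k * f p) = ?k * \<sigma> f"
    using conjunct2[OF \<sigma>[unfolded linfun_def], rule_format, OF f(1)] .
  ultimately have "(e / B') * cmod (\<sigma> f) \<le> B" using B' Q(3) by (simp only: norm_mult norm_of_real) simp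
  then show ?thesis using B' Q(3) by (simp add: field_simps)
qed

text \<open>Cover the compact set by finitely many of the neighbourhoods of \<open>local_bound\<close>.\<close>

lemma local_op_bounded:
  assumes D: "local_op D" and q: "admissible (c, K, is)"
  shows "\<exists>Q B. finite Q \<and> (\<forall>q\<in>Q. admissible q) \<and> (\<forall>f\<in>X. seminorms_le Q f 1 \<longrightarrow> (\<forall>x\<in>K. cmod (cpds c is (D f) x) \<le> B))"
proof -
  have c: "c \<in> atlas M" and K: "compactin (mtop M) K" "K \<subseteq> fst c" and i: "set is \<subseteq> I"
    using q by (auto simp: admissible_def)
  have cp: "fst c \<inter> pts M = fst c" using dom_pts[OF c] by auto
  interpret L: local_map M c "\<lambda>f. cpds c is (D f)"
  proof
    show "c \<in> atlas M" by (rule c)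
    fix f g :: "'a \<Rightarrow> complex" and q assume f: "f \<in> X"
    note Df = X_chart_smooth[OF local_op_X[OF D f] c, of "pts M"]
    show "continuous_map (subtopology (mtop M) (fst c)) euclidean (cpds c is (D f))"
      using chart_smooth_cont[OF c pts_open chart_smooth_cpds[OF c pts_open Df i]] unfolding cp .
    show "cpds c is (D (\<lambda>p. k * f p)) q = k * cpds c is (D f) q" if "q \<in> fst c" for k q
      unfolding local_op_cmult[OF D f] by (rule cpds_cmult[OF c pts_open Df i that dom_pts[OF c that]])
    assume g: "g \<in> X"
    note Dg = X_chart_smooth[OF local_op_X[OF D g] c, of "pts M"]
    show "cpds c is (D (\<lambda>p. f p + g p)) q = cpds c is (D f) q + cpds c is (D g) q" if "q \<in> fst c"
      unfolding local_op_add[OF D f g] by (rule cpds_add[OF c pts_open Df Dg i that dom_pts[OF c that]])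
    show "cpds c is (D f) q = cpds c is (D g) q"
      if "openin (mtop M) V" "q \<in> V" "q \<in> fst c" "\<And>p. p \<in> V \<Longrightarrow> f p = g p" for V
      by (rule cpds_cong[OF c that(1,3,2) i]) (use local_op_local[OF D f g that(1,4)] in auto)
  qed
  have "\<forall>p\<in>K. \<exists>t. case t of (W, L, N, B) \<Rightarrow> openin (mtop M) W \<and> p \<in> W \<and> compactin (mtop M) L \<and> L \<subseteq> fst c \<and>
      (\<forall>f\<in>X. derivs_le c L N f 1 \<longrightarrow> (\<forall>x\<in>W. cmod (cpds c is (D f) x) \<le> B))"
  proof
    fix p assume "p \<in> K"
    then have "p \<in> fst c" using K(2) by blast
    from L.local_bound[OF this] show "\<exists>t. case t of (W, L, N, B) \<Rightarrow> openin (mtop M) W \<and> p \<in> W \<and> compactin (mtop M) L \<and> L \<subseteq> fst c \<and>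
      (\<forall>f\<in>X. derivs_le c L N f 1 \<longrightarrow> (\<forall>x\<in>W. cmod (cpds c is (D f) x) \<le> B))" by simp blast
  qed
  from bchoice[OF this] obtain t where t: "\<forall>p\<in>K. case t p of (W, L, N, B) \<Rightarrow> openin (mtop M) W \<and> p \<in> W \<and> compactin (mtop M) L \<and> L \<subseteq> fst c \<and>
      (\<forall>f\<in>X. derivs_le c L N f 1 \<longrightarrow> (\<forall>x\<in>W. cmod (cpds c is (D f) x) \<le> B))" by blast
  define W L N B where "W = (\<lambda>p. fst (t p))" and "L = (\<lambda>p. fst (snd (t p)))"
    and "N = (\<lambda>p. fst (snd (snd (t p))))" and "B = (\<lambda>p. snd (snd (snd (t p))))"
  have WB: "openin (mtop M) (W p)" "p \<in> W p" "compactin (mtop M) (L p)" "L p \<subseteq> fst c"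
    "\<And>f x. f \<in> X \<Longrightarrow> derivs_le c (L p) (N p) f 1 \<Longrightarrow> x \<in> W p \<Longrightarrow> cmod (cpds c is (D f) x) \<le> B p" if "p \<in> K" for p
    using bspec[OF t that] by (auto simp: W_def L_def N_def B_def split: prod.splits)
  have "\<exists>\<F>. finite \<F> \<and> \<F> \<subseteq> W ` K \<and> K \<subseteq> \<Union>\<F>"
  proof -
    have "\<forall>U\<in>W ` K. openin (mtop M) U" using WB(1) by auto
    moreover have "K \<subseteq> \<Union>(W ` K)" using WB(2) by auto
    ultimately show ?thesis using K(1) unfolding compactin_def by simp
  qed
  then obtain \<F> where "finite \<F>" "\<F> \<subseteq> W ` K" "K \<subseteq> \<Union>\<F>" by auto
  then obtain F where F: "finite F" "F \<subseteq> K" "K \<subseteq> (\<Union>p\<in>F. W p)"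
    using finite_subset_image[of \<F> W K] by auto
  define Q where "Q = (\<Union>p\<in>F. (\<lambda>js. (c, L p, js)) ` {js. set js \<subseteq> I \<and> length js \<le> N p})"
  have "finite Q" unfolding Q_def using F(1) by (intro finite_UN_I finite_imageI finite_lists_length_le) auto
  moreover have "\<forall>q\<in>Q. admissible q" unfolding Q_def admissible_def using WB(3,4) F(2) c by auto
  moreover have "cmod (cpds c is (D f) x) \<le> (\<Sum>p\<in>F. \<bar>B p\<bar>)" if f: "f \<in> X" "seminorms_le Q f 1" and x: "x \<in> K" for f x
  proof -
    obtain p where p: "p \<in> F" "x \<in> W p" using x F(3) by blast
    have pK: "p \<in> K" using p F by blast
    have "derivs_le c (L p) (N p) f 1" unfolding derivs_le_def
    proof (intro allI impI ballI, elim conjE)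
      fix js y assume "length js \<le> N p" "set js \<subseteq> I" "y \<in> L p"
      then have "(c, L p, js) \<in> Q" unfolding Q_def using p(1) by blast
      then show "cmod (cpds c js f y) \<le> 1" using f(2) \<open>y \<in> L p\<close> unfolding seminorms_le_def by blast
    qed
    then have "cmod (cpds c is (D f) x) \<le> B p" by (rule WB(5)[OF pK f(1) _ p(2)])
    also have "\<dots> \<le> \<bar>B p\<bar>" by simp
    also have "\<dots> \<le> (\<Sum>p\<in>F. \<bar>B p\<bar>)" by (rule member_le_sum) (use p F in auto)
    finally show ?thesis .
  qed
  ultimately show ?thesis by blast
qed

lemma fbounded_local_op:
  assumes \<sigma>: "linfun \<sigma>" "fbounded \<sigma>" and D: "local_op D"
  shows "fbounded (\<lambda>f. \<sigma> (D f))"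
proof -
  obtain Q B where Q: "finite Q" "\<forall>q\<in>Q. admissible q" "\<forall>f\<in>X. seminorms_le Q f 1 \<longrightarrow> cmod (\<sigma> f) \<le> B"
    using \<sigma>(2) unfolding fbounded_def by blast
  have "\<forall>q\<in>Q. \<exists>t. finite (fst t) \<and> (\<forall>q\<in>fst t. admissible q) \<and>
      (\<forall>f\<in>X. seminorms_le (fst t) f 1 \<longrightarrow> (case q of (c, K, is) \<Rightarrow> \<forall>x\<in>K. cmod (cpds c is (D f) x) \<le> snd t))"
  proof
    fix q assume q: "q \<in> Q"
    obtain c K "is" where qe: "q = (c, K, is)" by (cases q) auto
    have "admissible (c, K, is)" using Q(2) q unfolding qe by (rule bspec)
    from local_op_bounded[OF D this]
    obtain Q' B' where "finite Q'" "\<forall>q\<in>Q'. admissible q" "\<forall>f\<in>X. seminorms_le Q' f 1 \<longrightarrow> (\<forall>x\<in>K. cmod (cpds c is (D f) x) \<le> B')"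
      by (elim exE conjE)
    then show "\<exists>t. finite (fst t) \<and> (\<forall>q\<in>fst t. admissible q) \<and>
      (\<forall>f\<in>X. seminorms_le (fst t) f 1 \<longrightarrow> (case q of (c, K, is) \<Rightarrow> \<forall>x\<in>K. cmod (cpds c is (D f) x) \<le> snd t))"
      unfolding qe by (intro exI[of _ "(Q', B')"]) simp
  qed
  from bchoice[OF this] obtain t where t0: "\<forall>q\<in>Q. finite (fst (t q)) \<and> (\<forall>q\<in>fst (t q). admissible q) \<and>
      (\<forall>f\<in>X. seminorms_le (fst (t q)) f 1 \<longrightarrow> (case q of (c, K, is) \<Rightarrow> \<forall>x\<in>K. cmod (cpds c is (D f) x) \<le> snd (t q)))"
    by (rule exE)
  have t: "finite (fst (t q))" "\<forall>q'\<in>fst (t q). admissible q'" if "q \<in> Q" for q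
    using t0[THEN bspec, OF that, THEN conjunct1] t0[THEN bspec, OF that, THEN conjunct2, THEN conjunct1] by simp_all
  have t3: "case q of (c, K, is) \<Rightarrow> \<forall>x\<in>K. cmod (cpds c is (D f) x) \<le> snd (t q)"
    if "q \<in> Q" "f \<in> X" "seminorms_le (fst (t q)) f 1" for q f
    by (rule t0[THEN bspec, OF that(1), THEN conjunct2, THEN conjunct2, THEN bspec, OF that(2), THEN mp, OF that(3)])
  define Q' where "Q' = (\<Union>q\<in>Q. fst (t q))"
  define B' where "B' = 1 + (\<Sum>q\<in>Q. \<bar>snd (t q)\<bar>)"
  have B': "B' > 0" unfolding B'_def by (intro add_pos_nonneg sum_nonneg) auto
  have "finite Q'" "\<forall>q\<in>Q'. admissible q" using Q t(1,2) by (auto simp: Q'_def)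
  moreover have "cmod (\<sigma> (D f)) \<le> B * B' / 1" if f: "f \<in> X" "seminorms_le Q' f 1" for f
  proof (rule linfun_scaled_bound[OF \<sigma>(1) Q(2,3) _ local_op_X[OF D f(1)] _ B'])
    show "seminorms_le Q (D f) B'" unfolding seminorms_le_def
    proof
      fix q assume q: "q \<in> Q"
      have "seminorms_le (fst (t q)) f 1" using f(2) q by (auto simp: seminorms_le_def Q'_def)
      from t3[OF q f(1) this] have 1: "case q of (c, K, is) \<Rightarrow> \<forall>x\<in>K. cmod (cpds c is (D f) x) \<le> snd (t q)" .
      have "snd (t q) \<le> \<bar>snd (t q)\<bar>" by simp
      also have "\<dots> \<le> (\<Sum>q\<in>Q. \<bar>snd (t q)\<bar>)" by (rule member_le_sum) (use q Q in auto)
      finally have "snd (t q) \<le> B'" by (simp add: B'_def)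
      then show "case q of (c, K, is) \<Rightarrow> \<forall>x\<in>K. cmod (cpds c is (D f) x) \<le> B'" using 1 by fastforce
    qed
  qed simp
  ultimately show ?thesis unfolding fbounded_def by blast
qed

lemma fbounded_sum:
  assumes "finite J" "\<And>j. j \<in> J \<Longrightarrow> fbounded (\<sigma> j)"
  shows "fbounded (\<lambda>f. \<Sum>j\<in>J. \<sigma> j f)"
  using assms
proof (induction J rule: finite_induct)
  case empty
  show ?case unfolding fbounded_def by (intro exI[of _ "{}"] exI[of _ 0]) auto
next
  case (insert j J)
  obtain Q B where Q: "finite Q" "\<forall>q\<in>Q. admissible q" "\<And>f. f \<in> X \<Longrightarrow> seminorms_le Q f 1 \<Longrightarrow> cmod (\<sigma> j f) \<le> B"
    using insert.prems[of j] unfolding fbounded_def by blast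
  have "fbounded (\<lambda>f. \<Sum>j\<in>J. \<sigma> j f)" using insert by blast
  then obtain Q' B' where Q': "finite Q'" "\<forall>q\<in>Q'. admissible q" "\<And>f. f \<in> X \<Longrightarrow> seminorms_le Q' f 1 \<Longrightarrow> cmod (\<Sum>j\<in>J. \<sigma> j f) \<le> B'"
    unfolding fbounded_def by blast
  show ?case unfolding fbounded_def
  proof (intro exI[of _ "Q \<union> Q'"] exI[of _ "B + B'"] conjI ballI impI)
    fix f assume f: "f \<in> X" "seminorms_le (Q \<union> Q') f 1"
    then have "seminorms_le Q f 1" "seminorms_le Q' f 1" by (auto simp: seminorms_le_def)
    then have "cmod (\<sigma> j f + (\<Sum>j\<in>J. \<sigma> j f)) \<le> B + B'"
      by (intro norm_triangle_mono Q(3) Q'(3) f)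
    then show "cmod (\<Sum>j\<in>insert j J. \<sigma> j f) \<le> B + B'" using insert.hyps by simp
  qed (use Q Q' in auto)
qed

text \<open>The support is contained in the union of the compact sets of the seminorms that bound the functional: if
  \<open>f\<close> vanishes near it, all multiples of \<open>f\<close> satisfy the bound.\<close>

lemma fbounded_support:
  assumes \<sigma>: "linfun \<sigma>" "fbounded \<sigma>"
  shows "\<exists>K. compactin (mtop M) K \<and> (\<forall>f\<in>X. \<forall>W. openin (mtop M) W \<and> K \<subseteq> W \<and> (\<forall>p\<in>W. f p = 0) \<longrightarrow> \<sigma> f = 0)"
proof -
  obtain Q B where Q: "finite Q" "\<forall>q\<in>Q. admissible q" "\<forall>f\<in>X. seminorms_le Q f 1 \<longrightarrow> cmod (\<sigma> f) \<le> B"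
    using \<sigma>(2) unfolding fbounded_def by blast
  let ?K = "\<Union>q\<in>Q. fst (snd q)"
  have "compactin (mtop M) ?K"
    by (rule compactin_Union) (use Q in \<open>auto simp: admissible_def\<close>)
  moreover have "\<sigma> f = 0" if f: "f \<in> X" and W: "openin (mtop M) W" "?K \<subseteq> W" "\<forall>p\<in>W. f p = 0" for f W
  proof -
    have z: "cpds c is f x = 0" if "(c, K, is) \<in> Q" "x \<in> K" for c K "is" x
    proof -
      have a: "c \<in> atlas M" "K \<subseteq> fst c" "set is \<subseteq> I" using that Q(2) by (auto simp: admissible_def)
      have x: "x \<in> fst c" "x \<in> W" "x \<in> pts M" using that a W(2) dom_pts[OF a(1)] by force+
      have "cpds c is f x = cpds c is (\<lambda>p. 0 * f p) x"
        by (rule cpds_cong[OF a(1) W(1) x(1,2) a(3)]) (use W(3) in auto)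
      then show ?thesis using cpds_cmult[OF a(1) pts_open X_chart_smooth[OF f a(1)] a(3) x(1,3), of 0] by simp
    qed
    have "cmod (\<sigma> f) \<le> B * e / 1" if "e > 0" for e
      by (rule linfun_scaled_bound[OF \<sigma>(1) Q(2,3) _ f _ that]) (use z that in \<open>auto simp: seminorms_le_def\<close>)
    then have le: "cmod (\<sigma> f) \<le> B * e" if "e > 0" for e using that by simp
    show ?thesis
    proof (rule ccontr)
      assume "\<sigma> f \<noteq> 0"
      then have s: "cmod (\<sigma> f) > 0" by simp
      have "B > 0" using le[of 1] s by linarith
      then show False using le[of "cmod (\<sigma> f) / (2 * B)"] s by (simp add: field_simps)
    qed
  qed
  ultimately show ?thesis by blast
qed

section \<open>Functionals on power series\<close>

definition const_series :: "('a \<Rightarrow> complex) \<Rightarrow> nat \<Rightarrow> 'a \<Rightarrow> complex"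
  where "const_series f n = (if n = 0 then f else (\<lambda>_. 0))"

abbreviation TS :: "(nat \<Rightarrow> 'a \<Rightarrow> complex) set" where "TS \<equiv> t_series M"

lemma TS_iff: "a \<in> TS \<longleftrightarrow> (\<forall>n. a n \<in> X)" by (simp add: t_series_def)

lemma const_series_TS: "f \<in> X \<Longrightarrow> const_series f \<in> TS"
  by (simp add: TS_iff const_series_def X_zero)

definition tlinear :: "((nat \<Rightarrow> 'a \<Rightarrow> complex) \<Rightarrow> complex fps) \<Rightarrow> bool"
  where "tlinear \<tau> \<longleftrightarrow> (\<forall>a\<in>TS. \<forall>b\<in>TS. \<forall>r. \<tau> (t_scale r a + b) = r * \<tau> a + \<tau> b)"

text \<open>The coefficients of \<open>\<tau>\<close> as functionals on \<open>X\<close>, which determine \<open>\<tau>\<close> by \<open>tl_coeff\<close>.\<close>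

abbreviation coeff_fun :: "((nat \<Rightarrow> 'a \<Rightarrow> complex) \<Rightarrow> complex fps) \<Rightarrow> nat \<Rightarrow> ('a \<Rightarrow> complex) \<Rightarrow> complex"
  where "coeff_fun \<tau> n f \<equiv> fps_nth (\<tau> (const_series f)) n"

lemma t_scale_apply: "t_scale r a n p = (\<Sum>i\<le>n. fps_nth r i * a (n - i) p)"
  by (simp add: t_scale_def sum_fun_app cscale_fun_def cscale_complex_def)

lemma TS_add: "a \<in> TS \<Longrightarrow> b \<in> TS \<Longrightarrow> a + b \<in> TS"
  by (simp add: TS_iff plus_fun_def X_add)

lemma TS_zero: "0 \<in> TS"
  by (simp add: TS_iff zero_fun_def X_zero)

lemma TS_scale: "a \<in> TS \<Longrightarrow> t_scale r a \<in> TS"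
proof -
  assume a: "a \<in> TS"
  have "t_scale r a n = (\<lambda>p. \<Sum>i\<le>n. fps_nth r i * a (n - i) p)" for n
    by (rule ext) (rule t_scale_apply)
  then show ?thesis using a by (simp add: TS_iff X_sum X_cmult)
qed

lemma t_scale_1: "t_scale 1 a = a"
proof (intro ext)
  fix n p
  have "t_scale 1 a n p = (\<Sum>i\<le>n. if i = 0 then a (n - i) p else 0)"
    unfolding t_scale_apply by (intro sum.cong) auto
  then show "t_scale 1 a n p = a n p" by simp
qed

lemma t_scale_const:
  "t_scale (fps_const k) a = (\<lambda>n p. k * a n p)"
proof (intro ext)
  fix n p
  have "t_scale (fps_const k) a n p = (\<Sum>i\<le>n. if i = 0 then k * a (n - i) p else 0)"
    unfolding t_scale_apply by (intro sum.cong) auto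
  then show "t_scale (fps_const k) a n p = k * a n p" by simp
qed

lemma t_scale_X: "t_scale fps_X a = (\<lambda>n p. if n = 0 then 0 else a (n - 1) p)"
proof (intro ext)
  fix n p
  have "t_scale fps_X a n p = (\<Sum>i\<le>n. if i = 1 then a (n - 1) p else 0)"
    unfolding t_scale_apply by (intro sum.cong) auto
  then show "t_scale fps_X a n p = (if n = 0 then 0 else a (n - 1) p)" by (cases n) auto
qed

context
  fixes \<tau> :: "(nat \<Rightarrow> 'a \<Rightarrow> complex) \<Rightarrow> complex fps"
  assumes \<tau>: "tlinear \<tau>"
begin

lemma tl_add: "a \<in> TS \<Longrightarrow> b \<in> TS \<Longrightarrow> \<tau> (a + b) = \<tau> a + \<tau> b"
  using \<tau>[unfolded tlinear_def, rule_format, of a b 1] by (simp add: t_scale_1)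

lemma tl_zero: "\<tau> 0 = 0"
  using tl_add[OF TS_zero TS_zero] by simp

lemma tl_scale: "a \<in> TS \<Longrightarrow> \<tau> (t_scale r a) = r * \<tau> a"
  using \<tau>[unfolded tlinear_def, rule_format, of a 0 r] TS_zero tl_zero by simp

text \<open>Splitting off the constant term writes \<open>a\<close> as \<open>t b\<close> plus a constant series, and
  \<open>\<tau> (t b) = t \<tau> b\<close> by \<open>\<complex>[[t]]\<close>-linearity, so that the \<open>n\<close>-th coefficient involves only finitely many
  terms.\<close>

lemma tl_coeff:
  assumes "a \<in> TS"
  shows "fps_nth (\<tau> a) n = (\<Sum>i\<le>n. coeff_fun \<tau> (n - i) (a i))"
  using assms
proof (induction n arbitrary: a)
  case n: (0 a)
  let ?b = "\<lambda>n. a (Suc n)"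
  have b: "?b \<in> TS" using n by (simp add: TS_iff)
  have "a = t_scale fps_X ?b + const_series (a 0)"
    by (auto simp: fun_eq_iff t_scale_X const_series_def)
  then have "\<tau> a = fps_X * \<tau> ?b + \<tau> (const_series (a 0))"
    using tl_add[OF TS_scale[OF b] const_series_TS, of "a 0" fps_X] tl_scale[OF b, of fps_X] n[unfolded TS_iff] by simp
  then show ?case by simp
next
  case (Suc n)
  let ?b = "\<lambda>n. a (Suc n)"
  have b: "?b \<in> TS" using Suc.prems by (simp add: TS_iff)
  have "a = t_scale fps_X ?b + const_series (a 0)"
    by (auto simp: fun_eq_iff t_scale_X const_series_def)
  then have "\<tau> a = fps_X * \<tau> ?b + \<tau> (const_series (a 0))"
    using tl_add[OF TS_scale[OF b] const_series_TS, of "a 0" fps_X] tl_scale[OF b, of fps_X] Suc.prems[unfolded TS_iff] by simp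
  then have "fps_nth (\<tau> a) (Suc n) = fps_nth (\<tau> ?b) n + coeff_fun \<tau> (Suc n) (a 0)" by simp
  also have "\<dots> = (\<Sum>i\<le>n. coeff_fun \<tau> (n - i) (a (Suc i))) + coeff_fun \<tau> (Suc n) (a 0)"
    using Suc.IH[OF b] by simp
  also have "\<dots> = (\<Sum>i\<le>Suc n. coeff_fun \<tau> (Suc n - i) (a i))"
    by (subst sum.atMost_Suc_shift) (simp add: add.commute)
  finally show ?case .
qed

lemma coeff_fun_linfun: "linfun (coeff_fun \<tau> n)"
  unfolding linfun_def
proof (intro conjI ballI allI)
  fix f g assume f: "f \<in> X" and g: "g \<in> X"
  have "const_series (\<lambda>p. f p + g p) = const_series f + const_series g"
    by (auto simp: fun_eq_iff const_series_def)
  then show "coeff_fun \<tau> n (\<lambda>p. f p + g p) = coeff_fun \<tau> n f + coeff_fun \<tau> n g"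
    using tl_add[OF const_series_TS[OF f] const_series_TS[OF g]] by simp
next
  fix f k assume f: "f \<in> X"
  have "const_series (\<lambda>p. k * f p) = t_scale (fps_const k) (const_series f)"
    by (auto simp: fun_eq_iff const_series_def t_scale_const)
  then show "coeff_fun \<tau> n (\<lambda>p. k * f p) = k * coeff_fun \<tau> n f"
    using tl_scale[OF const_series_TS[OF f]] by simp
qed

end

lemma linfun_add: "linfun \<sigma> \<Longrightarrow> f \<in> X \<Longrightarrow> g \<in> X \<Longrightarrow> \<sigma> (\<lambda>p. f p + g p) = \<sigma> f + \<sigma> g"
  by (simp add: linfun_def)

lemma linfun_cmult: "linfun \<sigma> \<Longrightarrow> f \<in> X \<Longrightarrow> \<sigma> (\<lambda>p. k * f p) = k * \<sigma> f"
  by (simp add: linfun_def)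

lemma linfun_zero: "linfun \<sigma> \<Longrightarrow> \<sigma> (\<lambda>p. 0) = 0"
  using linfun_cmult[of \<sigma> "\<lambda>_. 0" 0] X_zero by simp

lemma linfun_diff:
  assumes \<sigma>: "linfun \<sigma>" and f: "f \<in> X" and g: "g \<in> X"
  shows "\<sigma> (\<lambda>p. f p - g p) = \<sigma> f - \<sigma> g"
  using linfun_add[OF \<sigma> f X_cmult[OF g], of "-1"] linfun_cmult[OF \<sigma> g, of "-1"] by simp

lemma linfun_sum:
  assumes \<sigma>: "linfun \<sigma>" and "\<And>j. j \<in> J \<Longrightarrow> f j \<in> X"
  shows "\<sigma> (\<lambda>p. \<Sum>j\<in>J. f j p) = (\<Sum>j\<in>J. \<sigma> (f j))"
  using assms(2)
proof (induction J rule: infinite_finite_induct)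
  case (insert j J)
  have "\<sigma> (\<lambda>p. f j p + (\<Sum>j\<in>J. f j p)) = \<sigma> (f j) + \<sigma> (\<lambda>p. \<Sum>j\<in>J. f j p)"
    by (rule linfun_add[OF \<sigma>]) (use insert.prems X_sum[of J f] in auto)
  then show ?case using insert by simp
qed (simp_all add: linfun_zero[OF \<sigma>])

end

section \<open>Rearranging triangular sums\<close>

lemma sum_triangle:
  fixes g :: "nat \<Rightarrow> nat \<Rightarrow> 'z::comm_monoid_add"
  shows "(\<Sum>i\<le>n. \<Sum>j\<le>n - i. g i j) = (\<Sum>k\<le>n. \<Sum>i\<le>k. g i (k - i))"
  unfolding sum.triangle_reindex_eq[symmetric]
  by (subst sum.Sigma) (auto intro!: sum.cong)

lemma sum_triangle_swap:
  fixes g :: "nat \<Rightarrow> nat \<Rightarrow> 'z::comm_monoid_add"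
  shows "(\<Sum>i\<le>n. \<Sum>j\<le>n - i. g i j) = (\<Sum>j\<le>n. \<Sum>i\<le>n - j. g i j)"
proof -
  have "(\<Sum>i\<le>n. \<Sum>j\<le>n - i. g i j) = (\<Sum>i\<le>n. \<Sum>j\<in>{j. j \<le> n \<and> i + j \<le> n}. g i j)"
    by (intro sum.cong) auto
  also have "\<dots> = (\<Sum>j\<le>n. \<Sum>i\<in>{i. i \<le> n \<and> i + j \<le> n}. g i j)"
    using sum.swap_restrict[of "{..n}" "{..n}" g "\<lambda>i j. i + j \<le> n"] by simp
  also have "\<dots> = (\<Sum>j\<le>n. \<Sum>i\<le>n - j. g i j)"
    by (intro sum.cong) auto
  finally show ?thesis .
qed

context smfd
begin

section \<open>The Frechet topology\<close>

definition fball :: "'a seminorm_index set \<Rightarrow> ('a \<Rightarrow> complex) \<Rightarrow> real \<Rightarrow> ('a \<Rightarrow> complex) set"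
  where "fball Q f e = {g \<in> X. \<forall>q\<in>Q. case q of (c, K, is) \<Rightarrow> \<forall>x\<in>K. cmod (cpds c is g x - cpds c is f x) < e}"

abbreviation fbasis :: "('a \<Rightarrow> complex) set set"
  where "fbasis \<equiv> {fball {q} f e | f q e. f \<in> X \<and> admissible q \<and> e > 0}"

lemma frechet_alt: "frechet_topology M = topology_generated_by fbasis"
  unfolding frechet_topology_def
proof (rule arg_cong[where f = topology_generated_by], intro set_eqI iffI)
  fix s assume "s \<in> {{g \<in> X. \<forall>x\<in>C. cmod (cpds c is g x - cpds c is f x) < e} |f c C is e.
        f \<in> X \<and> c \<in> atlas M \<and> compactin (mtop M) C \<and> C \<subseteq> fst c \<and> set is \<subseteq> I \<and> 0 < e}"
  then obtain f c C "is" e where s: "s = {g \<in> X. \<forall>x\<in>C. cmod (cpds c is g x - cpds c is f x) < e}" "f \<in> X" "0 < e"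
    "c \<in> atlas M \<and> compactin (mtop M) C \<and> C \<subseteq> fst c \<and> set is \<subseteq> I"
    by (elim CollectE exE conjE) simp
  have "s = fball {(c, C, is)} f e" "admissible (c, C, is)" using s by (simp_all add: fball_def admissible_def)
  then show "s \<in> fbasis" using s(2,3) by (intro CollectI exI conjI)
next
  fix s assume "s \<in> fbasis"
  then obtain f q e where s: "s = fball {q} f e" "f \<in> X" "admissible q" "0 < e" by (elim CollectE exE conjE)
  obtain c C "is" where q: "q = (c, C, is)" by (cases q)
  show "s \<in> {{g \<in> X. \<forall>x\<in>C. cmod (cpds c is g x - cpds c is f x) < e} |f c C is e.
        f \<in> X \<and> c \<in> atlas M \<and> compactin (mtop M) C \<and> C \<subseteq> fst c \<and> set is \<subseteq> I \<and> 0 < e}"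
    by (intro CollectI exI[of _ f] exI[of _ c] exI[of _ C] exI[of _ "is"] exI[of _ e])
      (use s q in \<open>simp add: fball_def admissible_def\<close>)
qed

lemma frechet_topspace_sub: "topspace (frechet_topology M) \<subseteq> X"
  unfolding frechet_alt topology_generated_by_topspace by (auto simp: fball_def)

lemma frechet_subbasic_open:
  assumes f: "f \<in> X" and q: "admissible q" and e: "e > 0"
  shows "openin (frechet_topology M) (fball {q} f e)"
  unfolding frechet_alt by (rule topology_generated_by_Basis) (rule CollectI, rule exI[of _ f], rule exI[of _ q], rule exI[of _ e], use assms in simp)

lemma frechet_topspace:
  assumes "atlas M \<noteq> {}"
  shows "topspace (frechet_topology M) = X"
proof
  obtain c where c: "c \<in> atlas M" using assms by blast
  then have "admissible (c, {}, [])" by (simp add: admissible_def)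
  then have "fball {(c, {}, [])} (\<lambda>_. 0) 1 \<subseteq> topspace (frechet_topology M)"
    by (intro openin_subset frechet_subbasic_open X_zero) auto
  then show "X \<subseteq> topspace (frechet_topology M)" by (simp add: fball_def)
qed (rule frechet_topspace_sub)

lemma frechet_empty: "atlas M = {} \<Longrightarrow> topspace (frechet_topology M) = {}"
  unfolding frechet_alt topology_generated_by_topspace by (auto simp: admissible_def)

text \<open>In a generated topology the finite intersections of generators are basic; on a generator around another
  function \<open>f\<close>, compactness of \<open>K\<close> leaves a margin \<open>\<delta>\<close> around \<open>g\<close>.\<close>

lemma frechet_nbhd:
  assumes "openin (frechet_topology M) T" "g \<in> T" "g \<in> X"
  shows "\<exists>Q e. finite Q \<and> (\<forall>q\<in>Q. admissible q) \<and> e > 0 \<and> fball Q g e \<subseteq> T"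
  using openin_topology_generated_by[OF assms(1)[unfolded frechet_alt]] assms(2)
proof (induction rule: generate_topology_on.induct)
  case (Int a b)
  have ga: "g \<in> a" "g \<in> b" using Int.prems by auto
  obtain Q1 e1 where 1: "finite Q1" "\<forall>q\<in>Q1. admissible q" "e1 > 0" "fball Q1 g e1 \<subseteq> a"
    using Int.IH(1)[OF ga(1)] by (elim exE conjE)
  obtain Q2 e2 where 2: "finite Q2" "\<forall>q\<in>Q2. admissible q" "e2 > 0" "fball Q2 g e2 \<subseteq> b"
    using Int.IH(2)[OF ga(2)] by (elim exE conjE)
  have mono: "fball (Q1 \<union> Q2) g (min e1 e2) \<subseteq> fball Q g e" if "Q \<subseteq> Q1 \<union> Q2" "min e1 e2 \<le> e" for Q e
  proof
    fix h assume h: "h \<in> fball (Q1 \<union> Q2) g (min e1 e2)"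
    show "h \<in> fball Q g e" unfolding fball_def
    proof (intro CollectI conjI ballI)
      show "h \<in> X" using h by (simp add: fball_def)
      fix q assume "q \<in> Q"
      then have "q \<in> Q1 \<union> Q2" using that(1) by blast
      moreover have "\<forall>q\<in>Q1 \<union> Q2. case q of (c, K, is) \<Rightarrow> \<forall>x\<in>K. cmod (cpds c is h x - cpds c is g x) < min e1 e2"
        using h unfolding fball_def by blast
      ultimately have "case q of (c, K, is) \<Rightarrow> \<forall>x\<in>K. cmod (cpds c is h x - cpds c is g x) < min e1 e2"
        by (rule bspec[rotated])
      then show "case q of (c, K, is) \<Rightarrow> \<forall>x\<in>K. cmod (cpds c is h x - cpds c is g x) < e"
        using that(2) by (auto split: prod.splits intro: less_le_trans simp del: min_less_iff_conj)
    qed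
  qed
  have "fball (Q1 \<union> Q2) g (min e1 e2) \<subseteq> fball Q1 g e1" "fball (Q1 \<union> Q2) g (min e1 e2) \<subseteq> fball Q2 g e2"
    by (rule mono; simp)+
  then have "fball (Q1 \<union> Q2) g (min e1 e2) \<subseteq> a \<inter> b" using 1(4) 2(4) by (meson Int_greatest order_trans)
  moreover have "finite (Q1 \<union> Q2)" "\<forall>q\<in>Q1 \<union> Q2. admissible q" "min e1 e2 > 0" using 1 2 by auto
  ultimately show ?case by (intro exI conjI)
next
  case (UN A)
  then obtain a where a: "a \<in> A" "g \<in> a" by blast
  obtain Q e where 1: "finite Q" "\<forall>q\<in>Q. admissible q" "e > 0" "fball Q g e \<subseteq> a"
    using UN.IH[OF a] by (elim exE conjE)
  have "fball Q g e \<subseteq> \<Union>A" using 1(4) a(1) by blast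
  then show ?case using 1 by (intro exI conjI)
next
  case (Basis s)
  then obtain f q e where s0: "s = fball {q} f e" and f: "f \<in> X" and q: "admissible q" and e: "e > 0"
    by (elim CollectE exE conjE)
  obtain c K "is" where qe: "q = (c, K, is)" by (cases q)
  have s: "s = {g \<in> X. \<forall>x\<in>K. cmod (cpds c is g x - cpds c is f x) < e}" by (simp add: s0 qe fball_def)
  have c: "c \<in> atlas M" and K: "compactin (mtop M) K" "K \<subseteq> fst c" and i: "set is \<subseteq> I"
    using q by (auto simp: qe admissible_def)
  have g: "\<forall>x\<in>K. cmod (cpds c is g x - cpds c is f x) < e" using Basis(2) s by blast
  have cp: "fst c \<inter> pts M = fst c" using dom_pts[OF c] by auto
  have ct: "continuous_map (subtopology (mtop M) (fst c)) euclidean (cpds c is h)" if "h \<in> X" for h :: "'a \<Rightarrow> complex"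
    using chart_smooth_cont[OF c pts_open chart_smooth_cpds[OF c pts_open X_chart_smooth[OF that c] i]] unfolding cp .
  have "continuous_map (subtopology (mtop M) (fst c)) euclideanreal (\<lambda>x. cmod (cpds c is g x - cpds c is f x))"
    by (intro continuous_map_norm continuous_map_diff ct f assms(3))
  moreover have "compactin (subtopology (mtop M) (fst c)) K" using K by (simp add: compactin_subtopology)
  ultimately have "compactin euclideanreal ((\<lambda>x. cmod (cpds c is g x - cpds c is f x)) ` K)"
    by (rule image_compactin[rotated])
  then have cc: "compact ((\<lambda>x. cmod (cpds c is g x - cpds c is f x)) ` K)" by simp
  obtain \<delta> where \<delta>: "\<delta> > 0" "\<And>x. x \<in> K \<Longrightarrow> cmod (cpds c is g x - cpds c is f x) \<le> e - \<delta>"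
  proof (cases "K = {}")
    case True
    then show ?thesis using that[of 1] by simp
  next
    case False
    then obtain y where y: "y \<in> K" "\<And>x. x \<in> K \<Longrightarrow> cmod (cpds c is g x - cpds c is f x) \<le> cmod (cpds c is g y - cpds c is f y)"
      using compact_attains_sup[OF cc] by auto
    show ?thesis
      by (rule that[of "e - cmod (cpds c is g y - cpds c is f y)"]) (use y g in auto)
  qed
  have "fball {(c, K, is)} g \<delta> \<subseteq> s"
  proof
    fix h assume h: "h \<in> fball {(c, K, is)} g \<delta>"
    have "cmod (cpds c is h x - cpds c is f x) < e" if x: "x \<in> K" for x
    proof -
      have "cmod (cpds c is h x - cpds c is g x) < \<delta>" using h x by (simp add: fball_def)
      then have "cmod ((cpds c is h x - cpds c is g x) + (cpds c is g x - cpds c is f x)) < \<delta> + (e - \<delta>)"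
        using \<delta>(2)[OF x] norm_triangle_ineq[of "cpds c is h x - cpds c is g x" "cpds c is g x - cpds c is f x"] by linarith
      then show ?thesis by simp
    qed
    then show "h \<in> s" using h s by (simp add: fball_def)
  qed
  then show ?case using c K i \<delta>(1) by (intro exI[of _ "{(c, K, is)}"] exI[of _ \<delta>]) (simp add: admissible_def)
qed auto

lemma fbounded_continuous:
  assumes \<sigma>: "linfun \<sigma>" "fbounded \<sigma>"
  shows "continuous_map (frechet_topology M) euclidean \<sigma>"
  unfolding continuous_map
proof (intro conjI allI impI)
  fix U :: "complex set" assume "openin euclidean U"
  then have U: "open U" by simp
  obtain Q B where Q: "finite Q" "\<forall>q\<in>Q. admissible q" "\<forall>f\<in>X. seminorms_le Q f 1 \<longrightarrow> cmod (\<sigma> f) \<le> B"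
    using \<sigma>(2) unfolding fbounded_def by blast
  let ?F = "frechet_topology M"
  show "openin ?F {f \<in> topspace ?F. \<sigma> f \<in> U}"
  proof (subst openin_subopen, rule ballI)
    fix f assume f: "f \<in> {f \<in> topspace ?F. \<sigma> f \<in> U}"
    then have fX: "f \<in> X" using frechet_topspace_sub by blast
    obtain e where e: "e > 0" "ball (\<sigma> f) e \<subseteq> U" using f U open_contains_ball by blast
    define e' where "e' = e / (2 * (\<bar>B\<bar> + 1))"
    have e': "e' > 0" using e(1) by (simp add: e'_def)
    let ?T = "(\<Inter>q\<in>Q. fball {q} f e') \<inter> topspace ?F"
    have "openin ?F ?T" by (rule openin_INT[OF Q(1)]) (rule frechet_subbasic_open[OF fX _ e'], use Q(2) in blast)
    moreover have "f \<in> ?T" using f fX e' by (auto simp: fball_def)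
    moreover have "\<sigma> g \<in> U" if g: "g \<in> ?T" for g
    proof -
      have gX: "g \<in> X" using g frechet_topspace_sub by blast
      have "seminorms_le Q (\<lambda>p. g p - f p) e'" unfolding seminorms_le_def
      proof (intro ballI, clarify)
        fix c K "is" x assume q: "(c, K, is) \<in> Q" and x: "x \<in> K"
        then have a: "c \<in> atlas M" "K \<subseteq> fst c" "set is \<subseteq> I" using Q by (auto simp: admissible_def)
        have xc: "x \<in> fst c" "x \<in> pts M" using x a dom_pts[OF a(1)] by auto
        have "cpds c is (\<lambda>p. g p + (-1) * f p) x = cpds c is g x + cpds c is (\<lambda>p. (-1) * f p) x"
          by (rule cpds_add[OF a(1) pts_open X_chart_smooth[OF gX a(1)] X_chart_smooth[OF X_cmult[OF fX] a(1)] a(3) xc])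
        also have "cpds c is (\<lambda>p. (-1) * f p) x = (-1) * cpds c is f x"
          by (rule cpds_cmult[OF a(1) pts_open X_chart_smooth[OF fX a(1)] a(3) xc])
        finally have eq: "cpds c is (\<lambda>p. g p - f p) x = cpds c is g x - cpds c is f x" by simp
        have "g \<in> fball {(c, K, is)} f e'" using g q by blast
        then have "cmod (cpds c is g x - cpds c is f x) < e'" using x by (simp add: fball_def)
        then show "cmod (cpds c is (\<lambda>p. g p - f p) x) \<le> e'" unfolding eq by simp
      qed
      then have "cmod (\<sigma> (\<lambda>p. g p - f p)) \<le> B * e' / 1"
        by (intro linfun_scaled_bound[OF \<sigma>(1) Q(2,3) _ X_diff[OF gX fX] _ e']) auto
      also have "\<dots> \<le> (\<bar>B\<bar> + 1) * e'" using e' by (simp add: mult_right_mono)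
      also have "\<dots> = e / 2" 
      proof -
        have "\<bar>B\<bar> + 1 \<noteq> 0" by linarith
        then show ?thesis unfolding e'_def by (simp add: divide_simps)
      qed
      also have "\<dots> < e" using e(1) by simp
      finally have "\<sigma> g \<in> ball (\<sigma> f) e" unfolding linfun_diff[OF \<sigma>(1) gX fX] by (simp add: dist_norm norm_minus_commute)
      then show ?thesis using e(2) by blast
    qed
    ultimately show "\<exists>T. openin ?F T \<and> f \<in> T \<and> T \<subseteq> {f \<in> topspace ?F. \<sigma> f \<in> U}" by blast
  qed
qed simp

text \<open>If the atlas is empty, the topology generated by the empty family has empty carrier, while \<open>X\<close> consists of
  the zero function; hence the case distinction.\<close>

lemma continuous_fbounded:
  assumes \<sigma>: "linfun \<sigma>" and ct: "continuous_map (frechet_topology M) euclidean \<sigma>"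
  shows "fbounded \<sigma>"
proof (cases "atlas M = {}")
  case True
  then have p: "pts M = {}" using atlas_cover by blast
  have "f = (\<lambda>_. 0)" if "f \<in> X" for f using X_off[OF that] unfolding p by auto
  then have "\<forall>f\<in>X. cmod (\<sigma> f) \<le> 0" using linfun_zero[OF \<sigma>] by fastforce
  then show ?thesis unfolding fbounded_def by (intro exI[of _ "{}"] exI[of _ 0]) simp
next
  case False
  let ?F = "frechet_topology M"
  have ts: "topspace ?F = X" by (rule frechet_topspace[OF False])
  have o1: "openin ?F {f \<in> topspace ?F. \<sigma> f \<in> ball 0 1}"
    by (rule openin_continuous_map_preimage[OF ct]) simp
  have o2: "(\<lambda>_. 0) \<in> {f \<in> topspace ?F. \<sigma> f \<in> ball 0 1}" using ts X_zero linfun_zero[OF \<sigma>] by simp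
  obtain Q e where Q: "finite Q" "\<forall>q\<in>Q. admissible q" "e > 0" "fball Q (\<lambda>_. 0) e \<subseteq> {f \<in> topspace ?F. \<sigma> f \<in> ball 0 1}"
    using frechet_nbhd[OF o1 o2 X_zero] by (elim exE conjE)
  have b: "\<forall>f\<in>X. seminorms_le Q f (e / 2) \<longrightarrow> cmod (\<sigma> f) \<le> 1"
  proof (intro ballI impI)
    fix f assume f: "f \<in> X" "seminorms_le Q f (e / 2)"
    have "f \<in> fball Q (\<lambda>_. 0) e" unfolding fball_def
    proof (intro CollectI conjI ballI f(1), clarify)
      fix c K "is" x assume q: "(c, K, is) \<in> Q" and x: "x \<in> K"
      then have a: "c \<in> atlas M" "K \<subseteq> fst c" "set is \<subseteq> I" using Q by (auto simp: admissible_def)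
      have xc: "x \<in> fst c" "x \<in> pts M" using x a dom_pts[OF a(1)] by auto
      have "cpds c is (\<lambda>_. 0 :: complex) x = 0"
        using cpds_cmult[OF a(1) pts_open chart_smooth_const a(3) xc, of 0 0] by simp
      moreover have "cmod (cpds c is f x) \<le> e / 2" using f(2) q x by (auto simp: seminorms_le_def)
      ultimately show "cmod (cpds c is f x - cpds c is (\<lambda>_. 0) x) < e" using Q(3) by simp
    qed
    then have "\<sigma> f \<in> ball 0 1" using Q(4) by blast
    then show "cmod (\<sigma> f) \<le> 1" by simp
  qed
  have "cmod (\<sigma> f) \<le> 1 * 1 / (e / 2)" if "f \<in> X" "seminorms_le Q f 1" for f
    by (rule linfun_scaled_bound[OF \<sigma> Q(2) b _ that]) (use Q(3) in auto)
  then show ?thesis unfolding fbounded_def using Q(1,2) by blast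
qed

abbreviation CF :: "((nat \<Rightarrow> 'a \<Rightarrow> complex) \<Rightarrow> complex fps) set"
  where "CF \<equiv> continuous_functionals M"

text \<open>Continuity for the product topologies amounts to continuity of every coefficient functional, because
  each coefficient of \<open>\<tau> a\<close> is a finite sum of such functionals.\<close>

lemma CF_iff:
  "\<tau> \<in> CF \<longleftrightarrow> (\<forall>a. a \<notin> TS \<longrightarrow> \<tau> a = 0) \<and> tlinear \<tau> \<and> (\<forall>n. fbounded (coeff_fun \<tau> n))"
proof -
  let ?P = "product_topology (\<lambda>_. frechet_topology M) (UNIV :: nat set)"
  have top: "topspace ?P \<subseteq> TS"
  proof
    fix a assume "a \<in> topspace ?P"
    then have "a n \<in> topspace (frechet_topology M)" for n by (simp add: PiE_iff)
    then show "a \<in> TS" using frechet_topspace_sub unfolding TS_iff by blast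
  qed
  have "continuous_map ?P (product_topology (\<lambda>_. euclidean) UNIV) (\<lambda>a. fps_nth (\<tau> a)) \<longleftrightarrow> (\<forall>n. fbounded (coeff_fun \<tau> n))"
    if \<tau>: "tlinear \<tau>"
  proof
    assume ct: "continuous_map ?P (product_topology (\<lambda>_. euclidean) UNIV) (\<lambda>a. fps_nth (\<tau> a))"
    show "\<forall>n. fbounded (coeff_fun \<tau> n)"
    proof
      fix n
      have 1: "continuous_map ?P euclidean (\<lambda>a. fps_nth (\<tau> a) n)"
        using ct by (simp add: continuous_map_componentwise_UNIV)
      have 2: "continuous_map (frechet_topology M) ?P const_series"
        unfolding continuous_map_componentwise_UNIV
      proof
        fix k
        show "continuous_map (frechet_topology M) (frechet_topology M) (\<lambda>f. const_series f k)"
        proof (cases "k = 0")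
          case True
          then show ?thesis by (simp add: const_series_def)
        next
          case False
          have "topspace (frechet_topology M) = {} \<or> (\<lambda>_. 0) \<in> topspace (frechet_topology M)"
          proof (cases "atlas M = {}")
            case True
            then show ?thesis by (simp add: frechet_empty)
          next
            case False
            then show ?thesis using frechet_topspace X_zero by simp
          qed
          then show ?thesis using False by (simp add: const_series_def continuous_map_const)
        qed
      qed
      have "continuous_map (frechet_topology M) euclidean ((\<lambda>a. fps_nth (\<tau> a) n) \<circ> const_series)"
        by (rule continuous_map_compose[OF 2 1])
      then show "fbounded (coeff_fun \<tau> n)"
        by (intro continuous_fbounded[OF coeff_fun_linfun[OF \<tau>]]) (simp add: comp_def)
    qed
  next
    assume b: "\<forall>n. fbounded (coeff_fun \<tau> n)"
    show "continuous_map ?P (product_topology (\<lambda>_. euclidean) UNIV) (\<lambda>a. fps_nth (\<tau> a))"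
      unfolding continuous_map_componentwise_UNIV
    proof
      fix n
      have "continuous_map ?P euclidean (\<lambda>a. \<Sum>i\<le>n. coeff_fun \<tau> (n - i) (a i))"
      proof (intro continuous_map_sum)
        fix i
        have "continuous_map ?P (frechet_topology M) (\<lambda>a. a i)" by (rule continuous_map_product_projection) simp
        from continuous_map_compose[OF this fbounded_continuous[OF coeff_fun_linfun[OF \<tau>] b[rule_format]]]
        show "continuous_map ?P euclidean (\<lambda>a. coeff_fun \<tau> (n - i) (a i))" by (simp add: comp_def)
      qed simp
      then show "continuous_map ?P euclidean (\<lambda>a. fps_nth (\<tau> a) n)"
        by (rule continuous_map_eq) (use tl_coeff[OF \<tau>] top in auto)
    qed
  qed
  then show ?thesis unfolding continuous_functionals_def tlinear_def[symmetric] by auto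
qed

section \<open>Series of local operators\<close>

text \<open>The action of \<open>\<Sum>\<^sub>i t\<^sup>i D i\<close> on power series.\<close>

definition apply_ops :: "(nat \<Rightarrow> ('a \<Rightarrow> complex) \<Rightarrow> 'a \<Rightarrow> complex) \<Rightarrow> (nat \<Rightarrow> 'a \<Rightarrow> complex) \<Rightarrow> nat \<Rightarrow> 'a \<Rightarrow> complex"
  where "apply_ops D a n = (\<lambda>p. \<Sum>i\<le>n. D i (a (n - i)) p)"

definition op_series :: "(nat \<Rightarrow> ('a \<Rightarrow> complex) \<Rightarrow> 'a \<Rightarrow> complex) \<Rightarrow> bool"
  where "op_series D \<longleftrightarrow> (\<forall>i. local_op (D i)) \<and> (\<forall>f\<in>X. D 0 f = f)"

lemma local_op_zero: "local_op D \<Longrightarrow> D (\<lambda>_. 0) = (\<lambda>_. 0)"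
  using local_op_cmult[of D "\<lambda>_. 0" 0] X_zero by simp

lemma local_op_sum:
  assumes D: "local_op D" and "\<And>j. j \<in> J \<Longrightarrow> f j \<in> X"
  shows "D (\<lambda>p. \<Sum>j\<in>J. f j p) = (\<lambda>p. \<Sum>j\<in>J. D (f j) p)"
  using assms(2)
proof (induction J rule: infinite_finite_induct)
  case (insert j J)
  have "D (\<lambda>p. f j p + (\<Sum>j\<in>J. f j p)) = (\<lambda>p. D (f j) p + D (\<lambda>p. \<Sum>j\<in>J. f j p) p)"
    by (rule local_op_add[OF D]) (use insert.prems X_sum[of J f] in auto)
  then show ?case using insert by simp
qed (simp_all add: local_op_zero[OF D])

lemma apply_ops_TS: "op_series D \<Longrightarrow> a \<in> TS \<Longrightarrow> apply_ops D a \<in> TS"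
proof -
  assume D: "op_series D" and a: "a \<in> TS"
  have "D i (a j) \<in> X" for i j
    by (rule local_op_X) (use D a in \<open>simp_all add: op_series_def TS_iff\<close>)
  then show ?thesis unfolding TS_iff apply_ops_def by (intro allI X_sum)
qed

lemma apply_ops_linear:
  assumes D: "op_series D" and a: "a \<in> TS" and b: "b \<in> TS"
  shows "apply_ops D (t_scale r a + b) = t_scale r (apply_ops D a) + apply_ops D b"
proof (intro ext)
  fix n p
  have L: "local_op (D i)" for i using D by (simp add: op_series_def)
  have aX: "a i \<in> X" "b i \<in> X" for i using a b by (auto simp: TS_iff)
  have 1: "D i ((t_scale r a + b) k) p = (\<Sum>j\<le>k. fps_nth r j * D i (a (k - j)) p) + D i (b k) p" for i k
  proof -
    have "(t_scale r a + b) k = (\<lambda>p. (\<Sum>j\<le>k. fps_nth r j * a (k - j) p) + b k p)"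
      by (simp add: fun_eq_iff t_scale_apply)
    then have "D i ((t_scale r a + b) k) = (\<lambda>p. D i (\<lambda>p. \<Sum>j\<le>k. fps_nth r j * a (k - j) p) p + D i (b k) p)"
      by (simp add: local_op_add[OF L X_sum[OF X_cmult[OF aX(1)]] aX(2)])
    then show ?thesis by (simp add: local_op_sum[OF L X_cmult[OF aX(1)]] local_op_cmult[OF L aX(1)])
  qed
  have "apply_ops D (t_scale r a + b) n p = (\<Sum>i\<le>n. \<Sum>j\<le>n - i. fps_nth r j * D i (a (n - i - j)) p) + apply_ops D b n p"
    by (simp only: apply_ops_def 1 sum.distrib)
  also have "(\<Sum>i\<le>n. \<Sum>j\<le>n - i. fps_nth r j * D i (a (n - i - j)) p) = (\<Sum>j\<le>n. \<Sum>i\<le>n - j. fps_nth r j * D i (a (n - i - j)) p)"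
    by (rule sum_triangle_swap)
  also have "\<dots> = t_scale r (apply_ops D a) n p"
    unfolding t_scale_apply apply_ops_def
    by (intro sum.cong refl) (simp add: sum_distrib_left add.commute)
  finally have "apply_ops D (t_scale r a + b) n p = t_scale r (apply_ops D a) n p + apply_ops D b n p" .
  then show "apply_ops D (t_scale r a + b) n p = (t_scale r (apply_ops D a) + apply_ops D b) n p" unfolding plus_fun_apply .
qed

text \<open>The geometric series for the inverse of \<open>id + O(t)\<close>, solved coefficient by coefficient.\<close>

fun inverse_ops :: "(nat \<Rightarrow> ('a \<Rightarrow> complex) \<Rightarrow> 'a \<Rightarrow> complex) \<Rightarrow> nat \<Rightarrow> ('a \<Rightarrow> complex) \<Rightarrow> 'a \<Rightarrow> complex"
  where "inverse_ops D n f = (if n = 0 then f else (\<lambda>p. - (\<Sum>i<n. D (n - i) (inverse_ops D i f) p)))"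

declare inverse_ops.simps [simp del]

lemma local_op_id: "local_op (\<lambda>f. f)"
  by (simp add: local_op_def)

lemma local_op_compose: "local_op D \<Longrightarrow> local_op E \<Longrightarrow> local_op (\<lambda>f. D (E f))"
  unfolding local_op_def[of "\<lambda>f. D (E f)"]
proof (intro conjI ballI allI impI)
  assume D: "local_op D" and E: "local_op E"
  fix f g assume f: "f \<in> X" and g: "g \<in> X"
  note Ef = local_op_X[OF E f] and Eg = local_op_X[OF E g]
  show "D (E f) \<in> X" by (rule local_op_X[OF D Ef])
  show "D (E (\<lambda>p. f p + g p)) = (\<lambda>p. D (E f) p + D (E g) p)"
    unfolding local_op_add[OF E f g] by (rule local_op_add[OF D Ef Eg])
  show "D (E (\<lambda>p. k * f p)) = (\<lambda>p. k * D (E f) p)" for k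
    unfolding local_op_cmult[OF E f] by (rule local_op_cmult[OF D Ef])
  fix V p assume V: "openin (mtop M) V \<and> (\<forall>p\<in>V. f p = g p)" "p \<in> V"
  show "D (E f) p = D (E g) p"
    by (rule local_op_local[OF D Ef Eg _ _ V(2)]) (use V local_op_local[OF E f g] in auto)
qed

lemma local_op_lincomb:
  assumes "\<And>j. j \<in> J \<Longrightarrow> local_op (D j)"
  shows "local_op (\<lambda>f p. k * (\<Sum>j\<in>J. D j f p))"
  unfolding local_op_def
proof (intro conjI ballI allI impI)
  fix f g assume f: "f \<in> X" and g: "g \<in> X"
  show "(\<lambda>p. k * (\<Sum>j\<in>J. D j f p)) \<in> X" by (intro X_cmult X_sum local_op_X[OF assms] f)
  show "(\<lambda>p. k * (\<Sum>j\<in>J. D j (\<lambda>p. f p + g p) p)) = (\<lambda>p. k * (\<Sum>j\<in>J. D j f p) + k * (\<Sum>j\<in>J. D j g p))"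
    by (simp add: local_op_add[OF assms f g] sum.distrib distrib_left cong: sum.cong)
  show "(\<lambda>p. k * (\<Sum>j\<in>J. D j (\<lambda>p. l * f p) p)) = (\<lambda>p. l * (k * (\<Sum>j\<in>J. D j f p)))" for l
    by (simp add: local_op_cmult[OF assms f] sum_distrib_left mult_ac cong: sum.cong)
  show "k * (\<Sum>j\<in>J. D j f p) = k * (\<Sum>j\<in>J. D j g p)"
    if "openin (mtop M) V \<and> (\<forall>p\<in>V. f p = g p)" "p \<in> V" for V p
    using local_op_local[OF assms f g, of _ V p] that by simp
qed

lemma local_op_inverse_ops:
  assumes D: "op_series D"
  shows "local_op (inverse_ops D n)"
proof (induction n rule: less_induct)
  case (less n)
  show ?case
  proof (cases "n = 0")
    case True
    then have "inverse_ops D n = (\<lambda>f. f)" by (simp add: fun_eq_iff inverse_ops.simps)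
    then show ?thesis by (simp add: local_op_id)
  next
    case False
    then have "inverse_ops D n = (\<lambda>f p. (-1) * (\<Sum>i<n. D (n - i) (inverse_ops D i f) p))"
      by (simp add: fun_eq_iff inverse_ops.simps[of D n])
    moreover have "local_op (\<lambda>f p. (-1) * (\<Sum>i<n. D (n - i) (inverse_ops D i f) p))"
      by (rule local_op_lincomb, rule local_op_compose) (use D less in \<open>auto simp: op_series_def\<close>)
    ultimately show ?thesis by simp
  qed
qed

lemma op_series_inverse_ops: "op_series D \<Longrightarrow> op_series (inverse_ops D)"
  unfolding op_series_def[of "inverse_ops D"] using local_op_inverse_ops by (simp add: inverse_ops.simps)

lemma apply_ops_inverse_ops:
  assumes D: "op_series D" and a: "a \<in> TS"
  shows "apply_ops D (apply_ops (inverse_ops D) a) = a"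
proof (intro ext)
  fix n p
  have aX: "a i \<in> X" for i using a by (simp add: TS_iff)
  have L: "local_op (D i)" and L': "local_op (inverse_ops D i)" for i using D local_op_inverse_ops[OF D] by (auto simp: op_series_def)
  have "apply_ops D (apply_ops (inverse_ops D) a) n p = (\<Sum>i\<le>n. \<Sum>j\<le>n - i. D i (inverse_ops D j (a (n - (i + j)))) p)"
    by (simp add: apply_ops_def local_op_sum[OF L local_op_X[OF L' aX]])
  also have "\<dots> = (\<Sum>k\<le>n. \<Sum>i\<le>k. D i (inverse_ops D (k - i) (a (n - (i + (k - i))))) p)"
    by (rule sum_triangle)
  also have "\<dots> = (\<Sum>k\<le>n. \<Sum>i\<le>k. D i (inverse_ops D (k - i) (a (n - k))) p)"
    by (intro sum.cong) auto
  also have "\<dots> = (\<Sum>k\<le>n. if k = 0 then a n p else 0)"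
  proof (intro sum.cong refl)
    fix k
    show "(\<Sum>i\<le>k. D i (inverse_ops D (k - i) (a (n - k))) p) = (if k = 0 then a n p else 0)"
    proof (cases "k = 0")
      case True
      then show ?thesis using D aX by (simp add: op_series_def inverse_ops.simps)
    next
      case False
      have "(\<Sum>i\<le>k. D i (inverse_ops D (k - i) (a (n - k))) p) = (\<Sum>i\<le>k. D (k - i) (inverse_ops D i (a (n - k))) p)"
        by (rule sum.reindex_bij_witness[of _ "\<lambda>i. k - i" "\<lambda>i. k - i"]) auto
      also have "\<dots> = inverse_ops D k (a (n - k)) p + (\<Sum>i<k. D (k - i) (inverse_ops D i (a (n - k))) p)"
        using D local_op_X[OF L' aX] by (simp add: lessThan_Suc_atMost[symmetric] op_series_def)
      also have "\<dots> = 0" using False by (simp add: inverse_ops.simps[of D k])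
      finally show ?thesis using False by simp
    qed
  qed
  also have "\<dots> = a n p" by simp
  finally show "apply_ops D (apply_ops (inverse_ops D) a) n p = a n p" .
qed

text \<open>A right inverse that itself has a right inverse is a two-sided inverse.\<close>

lemma apply_ops_inverse_ops':
  assumes D: "op_series D" and a: "a \<in> TS"
  shows "apply_ops (inverse_ops D) (apply_ops D a) = a"
proof -
  let ?E = "inverse_ops D"
  have E: "op_series ?E" by (rule op_series_inverse_ops[OF D])
  have "apply_ops ?E (apply_ops D (apply_ops ?E (apply_ops (inverse_ops ?E) a))) = apply_ops ?E (apply_ops (inverse_ops ?E) a)"
    by (subst apply_ops_inverse_ops[OF D]) (use apply_ops_TS[OF op_series_inverse_ops[OF E] a] in auto)
  then show ?thesis using apply_ops_inverse_ops[OF E a] by simp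
qed

text \<open>Functionals are 0 outside the power series with smooth coefficients, a convention that composition with
  \<open>apply_ops D\<close> alone would not preserve.\<close>

definition pullback :: "(nat \<Rightarrow> ('a \<Rightarrow> complex) \<Rightarrow> 'a \<Rightarrow> complex) \<Rightarrow> ((nat \<Rightarrow> 'a \<Rightarrow> complex) \<Rightarrow> complex fps) \<Rightarrow>
    (nat \<Rightarrow> 'a \<Rightarrow> complex) \<Rightarrow> complex fps"
  where "pullback D \<tau> a = (if a \<in> TS then \<tau> (apply_ops D a) else 0)"

text \<open>Linearity is inherited from \<open>apply_ops D\<close>; for continuity, Peetre's theorem enters through \<open>fbounded_local_op\<close>.\<close>

lemma pullback_CF:
  assumes D: "op_series D" and \<tau>: "\<tau> \<in> CF"
  shows "pullback D \<tau> \<in> CF"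
  unfolding CF_iff
proof (intro conjI allI impI)
  have l: "tlinear \<tau>" and b: "fbounded (coeff_fun \<tau> n)" for n using \<tau> by (auto simp: CF_iff)
  show "pullback D \<tau> a = 0" if "a \<notin> TS" for a using that by (simp add: pullback_def)
  show "tlinear (pullback D \<tau>)" unfolding tlinear_def
  proof (intro ballI allI)
    fix a b r assume a: "a \<in> TS" and b: "b \<in> TS"
    then show "pullback D \<tau> (t_scale r a + b) = r * pullback D \<tau> a + pullback D \<tau> b"
      using l apply_ops_TS[OF D a] apply_ops_TS[OF D b] TS_add[OF TS_scale[OF a] b]
      by (simp add: pullback_def apply_ops_linear[OF D] tlinear_def)
  qed
  fix n
  have L: "local_op (D i)" for i using D by (simp add: op_series_def)
  have eq: "coeff_fun (pullback D \<tau>) n f = (\<Sum>i\<le>n. coeff_fun \<tau> (n - i) (D i f))" if f: "f \<in> X" for f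
  proof -
    have "apply_ops D (const_series f) i = D i f" for i
    proof
      fix p
      have "apply_ops D (const_series f) i p = (\<Sum>j\<le>i. if j = i then D i f p else 0)"
        unfolding apply_ops_def by (intro sum.cong) (auto simp: const_series_def local_op_zero[OF L])
      then show "apply_ops D (const_series f) i p = D i f p" by simp
    qed
    then show ?thesis using tl_coeff[OF l apply_ops_TS[OF D const_series_TS[OF f]], of n] const_series_TS[OF f]
      by (simp add: pullback_def)
  qed
  have "fbounded (\<lambda>f. \<Sum>i\<le>n. coeff_fun \<tau> (n - i) (D i f))"
  proof (rule fbounded_sum)
    show "fbounded (\<lambda>f. coeff_fun \<tau> (n - i) (D i f))" for i
      by (rule fbounded_local_op[where \<sigma> = "coeff_fun \<tau> (n - i)", OF coeff_fun_linfun[OF l] b L])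
  qed simp
  then obtain Q B where Q: "finite Q" "\<forall>q\<in>Q. admissible q"
      "\<forall>f\<in>X. seminorms_le Q f 1 \<longrightarrow> cmod (\<Sum>i\<le>n. coeff_fun \<tau> (n - i) (D i f)) \<le> B"
    unfolding fbounded_def by (elim exE conjE)
  have "\<forall>f\<in>X. seminorms_le Q f 1 \<longrightarrow> cmod (coeff_fun (pullback D \<tau>) n f) \<le> B"
    using Q(3) by (intro ballI impI) (simp only: eq)
  then show "fbounded (coeff_fun (pullback D \<tau>) n)" unfolding fbounded_def using Q(1,2) by (intro exI conjI)
qed

lemma pullback_inverse:
  assumes D: "op_series D" and E: "op_series E" and inv: "\<And>a. a \<in> TS \<Longrightarrow> apply_ops E (apply_ops D a) = a" and \<tau>: "\<tau> \<in> CF"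
  shows "pullback D (pullback E \<tau>) = \<tau>"
proof
  fix a
  show "pullback D (pullback E \<tau>) a = \<tau> a"
  proof (cases "a \<in> TS")
    case True
    then show ?thesis using apply_ops_TS[OF D] by (simp add: pullback_def inv)
  next
    case False
    then show ?thesis using \<tau> by (simp add: pullback_def CF_iff)
  qed
qed

lemma pullback_isomorphic:
  assumes D: "op_series D" and E: "op_series E" and inv: "\<And>a. a \<in> TS \<Longrightarrow> apply_ops E (apply_ops D a) = a" "\<And>a. a \<in> TS \<Longrightarrow> apply_ops D (apply_ops E a) = a"
    and A: "A \<subseteq> CF" "B \<subseteq> CF" "\<And>\<tau>. \<tau> \<in> A \<Longrightarrow> pullback D \<tau> \<in> B" "\<And>\<tau>. \<tau> \<in> B \<Longrightarrow> pullback E \<tau> \<in> A"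
  shows "isomorphic_modules A B"
  unfolding isomorphic_modules_def
proof (intro exI[of _ "pullback D"] conjI ballI allI)
  show "bij_betw (pullback D) A B"
  proof (rule bij_betw_byWitness[where f' = "pullback E"])
    show "\<forall>\<tau>\<in>A. pullback E (pullback D \<tau>) = \<tau>"
      using pullback_inverse[OF E D inv(2)] A(1) by blast
    show "\<forall>\<tau>\<in>B. pullback D (pullback E \<tau>) = \<tau>"
      using pullback_inverse[OF D E inv(1)] A(2) by blast
  qed (use A(3,4) in auto)
  show "pullback D (\<lambda>a. r * \<tau> a + \<tau>' a) = (\<lambda>a. r * pullback D \<tau> a + pullback D \<tau>' a)" for \<tau> \<tau>' r
    by (auto simp: pullback_def fun_eq_iff)
qed

end

section \<open>Multidifferential operators on products of functions\<close>

lemma smooth_on_prod: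
  fixes f :: "'j \<Rightarrow> ('i \<Rightarrow> real) \<Rightarrow> complex"
  assumes S: "openin (Rspace I) S" and "\<And>j. j \<in> J \<Longrightarrow> smooth_on I S (f j)"
  shows "smooth_on I S (\<lambda>x. \<Prod>j\<in>J. f j x)"
  using assms(2)
proof (induction J rule: infinite_finite_induct)
  case (insert j J)
  have "smooth_on I S (\<lambda>x. f j x * (\<Prod>j\<in>J. f j x))"
    by (rule smooth_on_mult[OF S]) (use insert in auto)
  then show ?case using insert.hyps by simp
qed (simp_all add: smooth_on_const)

context smfd
begin

lemma chart_smooth_prod:
  fixes f :: "'j \<Rightarrow> 'a \<Rightarrow> complex"
  shows "c \<in> atlas M \<Longrightarrow> openin (mtop M) V \<Longrightarrow> (\<And>j. j \<in> J \<Longrightarrow> chart_smooth c V (f j)) \<Longrightarrow> chart_smooth c V (\<lambda>p. \<Prod>j\<in>J. f j p)"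
  unfolding chart_smooth_def by (rule smooth_on_prod[OF img_open])

lemma slot_apply: "i < m \<Longrightarrow> slot m k y i = y (k, i)"
  by (simp add: slot_def)

lemma slot_cont:
  assumes "k < n"
  shows "continuous_map (Rspace ({..<n} \<times> I)) (Rspace I) (slot (mdim M) k)"
  unfolding continuous_map_componentwise
proof (intro conjI ballI)
  show "slot (mdim M) k ` topspace (Rspace ({..<n} \<times> I)) \<subseteq> extensional I" by (auto simp: slot_def)
  fix i assume i: "i \<in> I"
  have "continuous_map (Rspace ({..<n} \<times> I)) euclideanreal (\<lambda>y. y (k, i))"
    by (rule continuous_map_product_projection) (use assms i in simp)
  then show "continuous_map (Rspace ({..<n} \<times> I)) euclideanreal (\<lambda>y. slot (mdim M) k y i)"
    using i by (simp add: slot_apply)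
qed

abbreviation prod_domain :: "nat \<Rightarrow> 'a chart list \<Rightarrow> (nat \<times> nat \<Rightarrow> real) set"
  where "prod_domain n cs \<equiv> {y \<in> extensional ({..<n} \<times> I). \<forall>k<n. slot (mdim M) k y \<in> cimg (cs ! k) (pts M)}"

lemma prod_domain_open:
  assumes cs: "length cs = n \<and> set cs \<subseteq> atlas M"
  shows "openin (Rspace ({..<n} \<times> I)) (prod_domain n cs)"
proof -
  let ?J = "{..<n} \<times> I"
  have ck: "cs ! k \<in> atlas M" if "k < n" for k using cs that by auto
  have o: "openin (Rspace ?J) {y \<in> topspace (Rspace ?J). slot (mdim M) k y \<in> cimg (cs ! k) (pts M)}" if "k \<in> {..<n}" for k
    by (rule openin_continuous_map_preimage[OF slot_cont img_open[OF ck pts_open]]) (use that in auto)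
  have "openin (Rspace ?J) ((\<Inter>k\<in>{..<n}. {y \<in> topspace (Rspace ?J). slot (mdim M) k y \<in> cimg (cs ! k) (pts M)}) \<inter> topspace (Rspace ?J))"
    by (rule openin_INT[OF _ o]) simp
  moreover have "(\<Inter>k\<in>{..<n}. {y \<in> topspace (Rspace ?J). slot (mdim M) k y \<in> cimg (cs ! k) (pts M)}) \<inter> topspace (Rspace ?J) = prod_domain n cs"
    by (auto simp: PiE_def)
  ultimately show ?thesis by simp
qed

lemma pow_lincomb:
  assumes F: "F \<in> smooth_funs_pow M (pts M) n" and G: "G \<in> smooth_funs_pow M (pts M) n"
  shows "r *\<^sub>C F + G \<in> smooth_funs_pow M (pts M) n"
  unfolding smooth_funs_pow_def
proof (intro CollectI conjI allI impI)
  fix xs assume "\<not> (length xs = n \<and> set xs \<subseteq> pts M)"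
  then have "F xs = 0" "G xs = 0" using F G by (auto simp: smooth_funs_pow_def)
  then show "(r *\<^sub>C F + G) xs = 0" by (simp add: cscale_fun_def cscale_complex_def)
next
  fix cs assume cs: "length cs = n \<and> set cs \<subseteq> atlas M"
  have "smooth_on ({..<n} \<times> I) (prod_domain n cs) (\<lambda>y. r * F (map (\<lambda>k. chart_inv (cs ! k) (slot (mdim M) k y)) [0..<n])
      + G (map (\<lambda>k. chart_inv (cs ! k) (slot (mdim M) k y)) [0..<n]))"
    by (intro smooth_on_add smooth_on_mult smooth_on_const prod_domain_open[OF cs])
      (use F G cs in \<open>simp_all add: smooth_funs_pow_def\<close>)
  then show "smooth_on ({..<n} \<times> I) (prod_domain n cs)
      (\<lambda>y. (r *\<^sub>C F + G) (map (\<lambda>k. chart_inv (cs ! k) (slot (mdim M) k y)) [0..<n]))"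
    by (simp add: cscale_fun_def cscale_complex_def)
qed

lemma pow_zero: "0 \<in> smooth_funs_pow M (pts M) n"
  by (simp add: smooth_funs_pow_def smooth_on_const)

lemma tens_smooth:
  assumes fs: "set fs \<subseteq> X"
  shows "tens fs \<in> smooth_funs_pow M (pts M) (length fs)"
  unfolding smooth_funs_pow_def
proof (intro CollectI conjI allI impI)
  have fX: "fs ! i \<in> X" if "i < length fs" for i using fs that by auto
  fix xs assume xs: "\<not> (length xs = length fs \<and> set xs \<subseteq> pts M)"
  show "tens fs xs = 0"
  proof (cases "length xs = length fs")
    case True
    then obtain i where i: "i < length fs" "xs ! i \<notin> pts M" using xs by (metis in_set_conv_nth subsetI)
    then have "(fs ! i) (xs ! i) = 0" using X_off[OF fX[OF i(1)]] by blast
    then show ?thesis using i(1) True by (auto simp: tens_def intro!: prod_zero)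
  qed (simp add: tens_def)
next
  have fX: "fs ! i \<in> X" if "i < length fs" for i using fs that by auto
  fix cs assume cs: "length cs = length fs \<and> set cs \<subseteq> atlas M"
  let ?n = "length fs" and ?J = "{..<length fs} \<times> I"
  let ?T = "{y \<in> extensional ?J. \<forall>k<?n. slot (mdim M) k y \<in> cimg (cs ! k) (pts M)}"
  have ck: "cs ! k \<in> atlas M" if "k < ?n" for k using cs that by auto
  have T: "openin (Rspace ?J) ?T" by (rule prod_domain_open) (use cs in auto)
  have "smooth_on ?J ?T (\<lambda>y. \<Prod>k\<in>{..<?n}. (\<lambda>x. (fs ! k) (chart_inv (cs ! k) x)) (slot (mdim M) k y))"
  proof (rule smooth_on_prod[OF T])
    fix k assume "k \<in> {..<?n}"
    then have k: "k < ?n" by simp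
    show "smooth_on ?J ?T (\<lambda>y. (\<lambda>x. (fs ! k) (chart_inv (cs ! k) x)) (slot (mdim M) k y))"
    proof (rule smooth_on_compose[OF _ T img_open[OF ck[OF k] pts_open]])
      show "slot (mdim M) k y \<in> cimg (cs ! k) (pts M)" if "y \<in> ?T" for y using that k by blast
      show "smooth_on ?J ?T (\<lambda>y. slot (mdim M) k y j)" if j: "j \<in> I" for j
      proof -
        have "smooth_on ?J ?T (\<lambda>y. y (k, j))" by (rule smooth_on_coordinate) (use k j in simp)
        then show ?thesis using j by (simp add: slot_apply)
      qed
      show "smooth_on I (cimg (cs ! k) (pts M)) (\<lambda>x. (fs ! k) (chart_inv (cs ! k) x))"
        using X_chart_smooth[OF fX[OF k] ck[OF k], of "pts M"] by (simp add: chart_smooth_def)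
    qed simp
  qed
  then show "smooth_on ?J {y \<in> extensional ?J. \<forall>k<?n. slot (mdim M) k y \<in> snd (cs ! k) ` (fst (cs ! k) \<inter> pts M)}
     (\<lambda>y. tens fs (map (\<lambda>k. chart_inv (cs ! k) (slot (mdim M) k y)) [0..<?n]))"
    by (simp add: tens_def)
qed

text \<open>The derivatives in \<open>\<alpha>\<close> that belong to the slot \<open>k\<close>.\<close>

definition sub_idx :: "nat \<Rightarrow> (nat \<times> nat) list \<Rightarrow> nat list"
  where "sub_idx k \<alpha> = map snd (filter (\<lambda>q. fst q = k) \<alpha>)"

lemma sub_idx_set: "set \<alpha> \<subseteq> {..<d} \<times> I \<Longrightarrow> set (sub_idx k \<alpha>) \<subseteq> I"
  by (auto simp: sub_idx_def)

text \<open>A derivative in the slot \<open>k\<close> acts on the \<open>k\<close>-th factor only.\<close>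

lemma jet_tens:
  assumes c: "c \<in> atlas M" and fs: "set fs \<subseteq> X"
  shows "set \<alpha> \<subseteq> {..<length fs} \<times> I \<Longrightarrow> length xs = length fs \<Longrightarrow> set xs \<subseteq> fst c \<Longrightarrow>
    jet c \<alpha> (tens fs) xs = (\<Prod>k<length fs. cpds c (sub_idx k \<alpha>) (fs ! k) (xs ! k))"
proof (induction \<alpha> arbitrary: xs)
  case Nil
  then show ?case by (simp add: tens_def sub_idx_def)
next
  case (Cons q \<alpha>)
  obtain k i where q: "q = (k, i)" by (cases q)
  have k: "k < length fs" and i: "i < mdim M" and \<alpha>: "set \<alpha> \<subseteq> {..<length fs} \<times> I" using Cons.prems(1) q by auto
  have xk: "xs ! k \<in> fst c" using Cons.prems k by auto
  have fk: "fs ! k \<in> X" using fs k by auto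
  let ?A = "\<Prod>j\<in>{..<length fs} - {k}. cpds c (sub_idx j \<alpha>) (fs ! j) (xs ! j)"
  let ?g = "cpds c (sub_idx k \<alpha>) (fs ! k)"
  have eq: "jet c \<alpha> (tens fs) (xs[k := y]) = ?A * ?g y" if y: "y \<in> fst c" for y
  proof -
    have "jet c \<alpha> (tens fs) (xs[k := y]) = (\<Prod>j<length fs. cpds c (sub_idx j \<alpha>) (fs ! j) (xs[k := y] ! j))"
      by (rule Cons.IH[OF \<alpha>]) (use Cons.prems y set_update_subset_insert[of xs k y] in auto)
    also have "\<dots> = cpds c (sub_idx k \<alpha>) (fs ! k) (xs[k := y] ! k) * (\<Prod>j\<in>{..<length fs} - {k}. cpds c (sub_idx j \<alpha>) (fs ! j) (xs[k := y] ! j))"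
      by (rule prod.remove) (use k in auto)
    also have "\<dots> = ?g y * ?A" using k Cons.prems(2) by (auto intro!: arg_cong2[where f = "(*)"] prod.cong)
    finally show ?thesis by (simp add: mult.commute)
  qed
  have "jet c (q # \<alpha>) (tens fs) xs = cpd c i (\<lambda>y. jet c \<alpha> (tens fs) (xs[k := y])) (xs ! k)" by (simp add: q)
  also have "\<dots> = cpd c i (\<lambda>y. ?A * ?g y) (xs ! k)"
    by (rule cpd_cong[OF c pts_open xk dom_pts[OF c xk] i]) (use eq in auto)
  also have "\<dots> = ?A * cpd c i ?g (xs ! k)"
    by (rule cpd_cmult[OF c chart_smooth_cpds[OF c pts_open X_chart_smooth[OF fk c] sub_idx_set[OF \<alpha>]] i xk dom_pts[OF c xk]])
  also have "\<dots> = (\<Prod>j<length fs. cpds c (sub_idx j (q # \<alpha>)) (fs ! j) (xs ! j))"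
  proof -
    have "(\<Prod>j<length fs. cpds c (sub_idx j (q # \<alpha>)) (fs ! j) (xs ! j)) = cpds c (sub_idx k (q # \<alpha>)) (fs ! k) (xs ! k) *
        (\<Prod>j\<in>{..<length fs} - {k}. cpds c (sub_idx j (q # \<alpha>)) (fs ! j) (xs ! j))"
      by (rule prod.remove) (use k in auto)
    also have "(\<Prod>j\<in>{..<length fs} - {k}. cpds c (sub_idx j (q # \<alpha>)) (fs ! j) (xs ! j)) = ?A"
      by (intro prod.cong) (auto simp: sub_idx_def q)
    also have "cpds c (sub_idx k (q # \<alpha>)) (fs ! k) (xs ! k) = cpd c i ?g (xs ! k)" by (simp add: sub_idx_def q)
    finally show ?thesis by (simp add: mult.commute)
  qed
  finally show ?case .
qed

lemma multidiff_local_formula: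
  assumes D: "D \<in> multidiff M (pts M) d" and c: "c \<in> atlas M"
  shows "\<exists>N a. (\<forall>\<alpha>. chart_smooth c (pts M) (a \<alpha>)) \<and>
    (\<forall>fs x. set fs \<subseteq> X \<longrightarrow> length fs = d \<longrightarrow> x \<in> fst c \<longrightarrow> D (tens fs) x =
      (\<Sum>\<alpha> | set \<alpha> \<subseteq> {..<d} \<times> I \<and> length \<alpha> \<le> N. a \<alpha> x * (\<Prod>k<d. cpds c (sub_idx k \<alpha>) (fs ! k) x)))"
proof -
  obtain N where N: "\<forall>c\<in>atlas M. \<exists>a. (\<forall>\<alpha>. smooth_on I (cimg c (pts M)) (\<lambda>x. a \<alpha> (chart_inv c x))) \<and>
       (\<forall>F\<in>smooth_funs_pow M (pts M) d. \<forall>x\<in>fst c \<inter> pts M.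
          D F x = (\<Sum>\<alpha> | set \<alpha> \<subseteq> {..<d} \<times> I \<and> length \<alpha> \<le> N. a \<alpha> x * jet c \<alpha> F (replicate d x)))"
    using D unfolding multidiff_def by (elim CollectE conjE exE)
  obtain a where a: "\<forall>\<alpha>. smooth_on I (cimg c (pts M)) (\<lambda>x. a \<alpha> (chart_inv c x))"
       "\<forall>F\<in>smooth_funs_pow M (pts M) d. \<forall>x\<in>fst c \<inter> pts M.
          D F x = (\<Sum>\<alpha> | set \<alpha> \<subseteq> {..<d} \<times> I \<and> length \<alpha> \<le> N. a \<alpha> x * jet c \<alpha> F (replicate d x))"
    using bspec[OF N c] by (elim exE conjE)
  show ?thesis
  proof (intro exI[of _ N] exI[of _ a] conjI allI impI)
    show "chart_smooth c (pts M) (a \<alpha>)" for \<alpha> using a(1) by (simp add: chart_smooth_def)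
    fix fs x assume fs: "set fs \<subseteq> X" "length fs = d" and x: "x \<in> fst c"
    have "D (tens fs) x = (\<Sum>\<alpha> | set \<alpha> \<subseteq> {..<d} \<times> I \<and> length \<alpha> \<le> N. a \<alpha> x * jet c \<alpha> (tens fs) (replicate d x))"
      using a(2) tens_smooth[OF fs(1)] fs(2) x dom_pts[OF c x] by auto
    also have "\<dots> = (\<Sum>\<alpha> | set \<alpha> \<subseteq> {..<d} \<times> I \<and> length \<alpha> \<le> N. a \<alpha> x * (\<Prod>k<d. cpds c (sub_idx k \<alpha>) (fs ! k) x))"
    proof (intro sum.cong refl)
      fix \<alpha> assume "\<alpha> \<in> {\<alpha>. set \<alpha> \<subseteq> {..<d} \<times> I \<and> length \<alpha> \<le> N}"
      then have \<alpha>: "set \<alpha> \<subseteq> {..<length fs} \<times> I" using fs(2) by simp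
      have "jet c \<alpha> (tens fs) (replicate d x) = (\<Prod>k<length fs. cpds c (sub_idx k \<alpha>) (fs ! k) (replicate d x ! k))"
        by (rule jet_tens[OF c fs(1) \<alpha>]) (use x fs(2) in auto)
      then show "a \<alpha> x * jet c \<alpha> (tens fs) (replicate d x) = a \<alpha> x * (\<Prod>k<d. cpds c (sub_idx k \<alpha>) (fs ! k) x)"
        using fs(2) by simp
    qed
    finally show "D (tens fs) x = (\<Sum>\<alpha> | set \<alpha> \<subseteq> {..<d} \<times> I \<and> length \<alpha> \<le> N. a \<alpha> x * (\<Prod>k<d. cpds c (sub_idx k \<alpha>) (fs ! k) x))" .
  qed
qed

lemma multidiff_off: "D \<in> multidiff M (pts M) d \<Longrightarrow> x \<notin> pts M \<Longrightarrow> D F x = 0"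
  and multidiff_off': "D \<in> multidiff M (pts M) d \<Longrightarrow> F \<notin> smooth_funs_pow M (pts M) d \<Longrightarrow> D F x = 0"
  unfolding multidiff_def by auto

lemma multidiff_X:
  assumes D: "D \<in> multidiff M (pts M) d" and fs: "set fs \<subseteq> X" "length fs = d"
  shows "D (tens fs) \<in> X"
  unfolding X_iff
proof (intro conjI allI impI ballI)
  show "D (tens fs) p = 0" if "p \<notin> pts M" for p using multidiff_off[OF D that] .
  fix c assume c: "c \<in> atlas M"
  obtain N a where a0: "\<forall>\<alpha>. chart_smooth c (pts M) (a \<alpha>)"
      "\<forall>fs x. set fs \<subseteq> X \<longrightarrow> length fs = d \<longrightarrow> x \<in> fst c \<longrightarrow> D (tens fs) x =
      (\<Sum>\<alpha> | set \<alpha> \<subseteq> {..<d} \<times> I \<and> length \<alpha> \<le> N. a \<alpha> x * (\<Prod>k<d. cpds c (sub_idx k \<alpha>) (fs ! k) x))"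
    using multidiff_local_formula[OF D c] by (elim exE conjE)
  note a = a0[rule_format]
  have "chart_smooth c (pts M) (\<lambda>x. \<Sum>\<alpha> | set \<alpha> \<subseteq> {..<d} \<times> I \<and> length \<alpha> \<le> N. a \<alpha> x * (\<Prod>k<d. cpds c (sub_idx k \<alpha>) (fs ! k) x))"
  proof (intro chart_smooth_sum[OF c pts_open] chart_smooth_mult[OF c pts_open] chart_smooth_prod[OF c pts_open] a(1))
    fix \<alpha> k assume "\<alpha> \<in> {\<alpha>. set \<alpha> \<subseteq> {..<d} \<times> I \<and> length \<alpha> \<le> N}" "k \<in> {..<d}"
    then have "set \<alpha> \<subseteq> {..<d} \<times> I" "fs ! k \<in> X" using fs by auto
    then show "chart_smooth c (pts M) (cpds c (sub_idx k \<alpha>) (fs ! k))"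
      by (intro chart_smooth_cpds[OF c pts_open] X_chart_smooth[OF _ c] sub_idx_set[of \<alpha> d])
  qed
  then show "chart_smooth c (pts M) (D (tens fs))"
    by (subst chart_smooth_cong[OF c pts_open]) (use a(2)[OF fs] in auto)
qed

lemma multidiff_zero:
  assumes D: "D \<in> multidiff M (pts M) d" and fs: "set fs \<subseteq> X" "length fs = d" and z: "(\<lambda>_. 0) \<in> set fs"
  shows "D (tens fs) = (\<lambda>_. 0)"
proof
  fix x
  show "D (tens fs) x = 0"
  proof (cases "x \<in> pts M")
    case True
    then obtain c where c: "c \<in> atlas M" "x \<in> fst c" using atlas_cover by blast
    obtain k where k: "k < d" "fs ! k = (\<lambda>_. 0)" using z fs(2) by (metis in_set_conv_nth)
    obtain N a where a0: "\<forall>\<alpha>. chart_smooth c (pts M) (a \<alpha>)"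
      "\<forall>fs x. set fs \<subseteq> X \<longrightarrow> length fs = d \<longrightarrow> x \<in> fst c \<longrightarrow> D (tens fs) x =
        (\<Sum>\<alpha> | set \<alpha> \<subseteq> {..<d} \<times> I \<and> length \<alpha> \<le> N. a \<alpha> x * (\<Prod>k<d. cpds c (sub_idx k \<alpha>) (fs ! k) x))"
      using multidiff_local_formula[OF D c(1)] by (elim exE conjE)
    note a = a0[rule_format]
    show ?thesis unfolding a(2)[OF fs c(2)]
    proof (intro sum.neutral ballI)
      fix \<alpha> assume "\<alpha> \<in> {\<alpha>. set \<alpha> \<subseteq> {..<d} \<times> I \<and> length \<alpha> \<le> N}"
      then have "set (sub_idx k \<alpha>) \<subseteq> I" using sub_idx_set[of \<alpha> d k] by simp
      then have "cpds c (sub_idx k \<alpha>) (fs ! k) x = 0"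
        using cpds_cmult[OF c(1) pts_open chart_smooth_const _ c(2) True, of "sub_idx k \<alpha>" 0 0] k(2) by simp
      then show "a \<alpha> x * (\<Prod>k<d. cpds c (sub_idx k \<alpha>) (fs ! k) x) = 0" using k(1) by (auto intro!: prod_zero)
    qed
  next
    case False
    then show ?thesis by (rule multidiff_off[OF D])
  qed
qed

lemma multidiff_local_op:
  assumes D: "D \<in> multidiff M (pts M) 1"
  shows "local_op (\<lambda>f. D (tens [f]))"
  unfolding local_op_def
proof (intro conjI ballI allI impI)
  fix f g assume f: "f \<in> X" and g: "g \<in> X"
  show "D (tens [f]) \<in> X" by (rule multidiff_X[OF D]) (use f in auto)
  have ex: "\<exists>N a. \<forall>f\<in>X. \<forall>x\<in>fst c. D (tens [f]) x =
      (\<Sum>\<alpha> | set \<alpha> \<subseteq> {..<1} \<times> I \<and> length \<alpha> \<le> N. a \<alpha> x * cpds c (sub_idx 0 \<alpha>) f x)" if c: "c \<in> atlas M" for c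
  proof -
    obtain N a where a0: "\<forall>\<alpha>. chart_smooth c (pts M) (a \<alpha>)"
      "\<forall>fs x. set fs \<subseteq> X \<longrightarrow> length fs = 1 \<longrightarrow> x \<in> fst c \<longrightarrow> D (tens fs) x =
        (\<Sum>\<alpha> | set \<alpha> \<subseteq> {..<1} \<times> I \<and> length \<alpha> \<le> N. a \<alpha> x * (\<Prod>k<1. cpds c (sub_idx k \<alpha>) (fs ! k) x))"
    using multidiff_local_formula[OF D c] by (elim exE conjE)
  note a = a0[rule_format]
    show ?thesis
    proof (intro exI[of _ N] exI[of _ a] ballI)
      fix f x assume "f \<in> X" "x \<in> fst c"
      then show "D (tens [f]) x = (\<Sum>\<alpha> | set \<alpha> \<subseteq> {..<1} \<times> I \<and> length \<alpha> \<le> N. a \<alpha> x * cpds c (sub_idx 0 \<alpha>) f x)"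
        using a(2)[of "[f]" x] by (simp add: lessThan_Suc)
    qed
  qed
  show "D (tens [\<lambda>p. f p + g p]) = (\<lambda>p. D (tens [f]) p + D (tens [g]) p)"
  proof
    fix x
    show "D (tens [\<lambda>p. f p + g p]) x = D (tens [f]) x + D (tens [g]) x"
    proof (cases "x \<in> pts M")
      case True
      then obtain c where c: "c \<in> atlas M" "x \<in> fst c" using atlas_cover by blast
      obtain N a where a: "\<forall>f\<in>X. \<forall>x\<in>fst c. D (tens [f]) x = (\<Sum>\<alpha> | set \<alpha> \<subseteq> {..<1} \<times> I \<and> length \<alpha> \<le> N. a \<alpha> x * cpds c (sub_idx 0 \<alpha>) f x)"
        using ex[OF c(1)] by (elim exE)
      have "cpds c (sub_idx 0 \<alpha>) (\<lambda>p. f p + g p) x = cpds c (sub_idx 0 \<alpha>) f x + cpds c (sub_idx 0 \<alpha>) g x"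
        if "set \<alpha> \<subseteq> {..<1} \<times> I" for \<alpha>
        by (rule cpds_add[OF c(1) pts_open X_chart_smooth[OF f c(1)] X_chart_smooth[OF g c(1)] sub_idx_set[OF that] c(2) True])
      then show ?thesis
        unfolding a[rule_format, OF f c(2)] a[rule_format, OF g c(2)] a[rule_format, OF X_add[OF f g] c(2)] sum.distrib[symmetric]
        by (intro sum.cong refl) (simp add: distrib_left)
    qed (simp add: multidiff_off[OF D])
  qed
  show "D (tens [\<lambda>p. k * f p]) = (\<lambda>p. k * D (tens [f]) p)" for k
  proof
    fix x
    show "D (tens [\<lambda>p. k * f p]) x = k * D (tens [f]) x"
    proof (cases "x \<in> pts M")
      case True
      then obtain c where c: "c \<in> atlas M" "x \<in> fst c" using atlas_cover by blast
      obtain N a where a: "\<forall>f\<in>X. \<forall>x\<in>fst c. D (tens [f]) x = (\<Sum>\<alpha> | set \<alpha> \<subseteq> {..<1} \<times> I \<and> length \<alpha> \<le> N. a \<alpha> x * cpds c (sub_idx 0 \<alpha>) f x)"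
        using ex[OF c(1)] by (elim exE)
      have "cpds c (sub_idx 0 \<alpha>) (\<lambda>p. k * f p) x = k * cpds c (sub_idx 0 \<alpha>) f x"
        if "set \<alpha> \<subseteq> {..<1} \<times> I" for \<alpha>
        by (rule cpds_cmult[OF c(1) pts_open X_chart_smooth[OF f c(1)] sub_idx_set[OF that] c(2) True])
      then show ?thesis
        unfolding a[rule_format, OF f c(2)] a[rule_format, OF X_cmult[OF f] c(2)] sum_distrib_left
        by (intro sum.cong refl) simp
    qed (simp add: multidiff_off[OF D])
  qed
  fix V x assume V: "openin (mtop M) V \<and> (\<forall>p\<in>V. f p = g p)" and x: "x \<in> V"
  have xp: "x \<in> pts M" using V x openin_subset by blast
  then obtain c where c: "c \<in> atlas M" "x \<in> fst c" using atlas_cover by blast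
  obtain N a where a: "\<forall>f\<in>X. \<forall>x\<in>fst c. D (tens [f]) x = (\<Sum>\<alpha> | set \<alpha> \<subseteq> {..<1} \<times> I \<and> length \<alpha> \<le> N. a \<alpha> x * cpds c (sub_idx 0 \<alpha>) f x)"
    using ex[OF c(1)] by (elim exE)
  have "cpds c (sub_idx 0 \<alpha>) f x = cpds c (sub_idx 0 \<alpha>) g x" if "set \<alpha> \<subseteq> {..<1} \<times> I" for \<alpha>
    by (rule cpds_cong[OF c(1) conjunct1[OF V] c(2) x sub_idx_set[OF that]]) (use V in auto)
  then show "D (tens [f]) x = D (tens [g]) x"
    unfolding a[rule_format, OF f c(2)] a[rule_format, OF g c(2)] by (intro sum.cong refl) simp
qed

end

section \<open>Sums over compositions\<close>

text \<open>The coefficient of \<open>t\<^sup>m\<close> in an expression \<open>\<Sum>\<^sub>n g\<^sub>n(\<pi>, \<dots>, \<pi>)/n!\<close> with \<open>\<pi> = \<Sum>\<^sub>k t\<^sup>k\<^sup>+\<^sup>1 \<pi>\<^sub>k\<close> is a sum over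
  the lists \<open>ks\<close> with \<open>(k\<^sub>1 + 1) + \<dots> + (k\<^sub>n + 1) = m\<close>. There are finitely many of them, since each entry
  contributes at least 1.\<close>

definition weight :: "nat list \<Rightarrow> nat" where "weight ks = sum_list (map Suc ks)"

definition compositions :: "nat \<Rightarrow> nat list set" where "compositions m = {ks. weight ks = m}"

lemma weight_simps [simp]: "weight [] = 0" "weight (k # ks) = Suc k + weight ks"
  by (simp_all add: weight_def)

lemma length_le_weight: "length ks \<le> weight ks"
  by (induction ks) auto

lemma set_lt_weight: "k \<in> set ks \<Longrightarrow> k < weight ks"
  by (induction ks) auto

text \<open>Lists with bounded entries, for inductions on the length which the weight alone would not allow.\<close>

definition nlists :: "nat \<Rightarrow> nat \<Rightarrow> nat list set"
  where "nlists N n = {ks. set ks \<subseteq> {..<N} \<and> length ks = n}"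

lemma finite_nlists: "finite (nlists N n)"
  unfolding nlists_def by (rule finite_lists_length_eq) simp

lemma finite_compositions: "finite (compositions m)"
proof (rule finite_subset)
  show "compositions m \<subseteq> (\<Union>n\<le>m. nlists m n)"
  proof
    fix ks assume "ks \<in> compositions m"
    then have ks: "weight ks = m" by (simp add: compositions_def)
    then have "set ks \<subseteq> {..<m}" "length ks \<le> m"
      using set_lt_weight[of _ ks] length_le_weight[of ks] by auto
    then show "ks \<in> (\<Union>n\<le>m. nlists m n)" by (auto simp: nlists_def)
  qed
qed (simp add: finite_nlists)

lemma compositions_0: "compositions 0 = {[]}"
proof -
  have "weight ks = 0 \<longleftrightarrow> ks = []" for ks by (cases ks) auto
  then show ?thesis by (simp add: compositions_def)
qed

lemma sum_nlists_Suc: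
  fixes g :: "nat list \<Rightarrow> 'z::comm_monoid_add"
  shows "(\<Sum>ks\<in>nlists N (Suc n). g ks) = (\<Sum>x<N. \<Sum>ks\<in>nlists N n. g (x # ks))"
proof -
  have "nlists N (Suc n) = (\<lambda>(x, ks). x # ks) ` ({..<N} \<times> nlists N n)"
    by (force simp: nlists_def length_Suc_conv image_iff)
  then have "(\<Sum>ks\<in>nlists N (Suc n). g ks) = (\<Sum>(x, ks)\<in>{..<N} \<times> nlists N n. g (x # ks))"
    by (simp add: sum.reindex inj_on_def case_prod_unfold)
  then show ?thesis by (simp add: sum.cartesian_product)
qed

lemma sum_Pow_Suc:
  fixes h :: "nat set \<Rightarrow> 'z::comm_monoid_add"
  shows "(\<Sum>S\<in>Pow {..<Suc n}. h S) = (\<Sum>S\<in>Pow {..<n}. h (Suc ` S) + h (insert 0 (Suc ` S)))"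
proof -
  let ?A = "(\<lambda>S. Suc ` S) ` Pow {..<n}" and ?B = "(\<lambda>S. insert 0 (Suc ` S)) ` Pow {..<n}"
  have "Pow {..<Suc n} = insert 0 ` ((`) Suc ` Pow {..<n}) \<union> (`) Suc ` Pow {..<n}"
    unfolding lessThan_Suc_eq_insert_0 Pow_insert image_Pow_surj[OF refl] by (auto simp: Un_commute)
  then have P: "Pow {..<Suc n} = ?A \<union> ?B" by (simp add: image_image Un_commute)
  have d: "?A \<inter> ?B = {}" by auto
  have iA: "inj_on (\<lambda>S. Suc ` S) (Pow {..<n})" by (simp add: inj_on_def inj_image_eq_iff)
  have iB: "inj_on (\<lambda>S. insert 0 (Suc ` S)) (Pow {..<n})"
  proof (rule inj_onI)
    fix S T assume "insert 0 (Suc ` S) = insert 0 (Suc ` T)"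
    then have "Suc ` S = Suc ` T" by (metis Diff_insert_absorb imageE nat.distinct(1))
    then show "S = T" by (simp add: inj_image_eq_iff)
  qed
  show ?thesis unfolding P
    by (subst sum.union_disjoint) (use d in \<open>auto simp: sum.reindex[OF iA] sum.reindex[OF iB] sum.distrib\<close>)
qed

text \<open>Distributing the entries of \<open>ks\<close> over two lists: a pair \<open>(k1, k2)\<close> arises once for each choice of the
  positions of \<open>k1\<close>.\<close>

lemma sum_split_lists:
  fixes H :: "nat list \<Rightarrow> nat list \<Rightarrow> complex"
  shows "(\<Sum>ks\<in>nlists N n. \<Sum>S\<in>Pow {..<n}. H (nths ks S) (nths ks (- S))) =
    (\<Sum>p\<le>n. of_nat (n choose p) * (\<Sum>k1\<in>nlists N p. \<Sum>k2\<in>nlists N (n - p). H k1 k2))"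
proof (induction n arbitrary: H)
  case 0
  have "nlists N 0 = {[]}" by (auto simp: nlists_def)
  then show ?case by simp
next
  case (Suc n)
  define A where "A p q = (\<Sum>k1\<in>nlists N p. \<Sum>k2\<in>nlists N q. H k1 k2)" for p q
  have s1: "{j. Suc j \<in> Suc ` S} = S" "{j. Suc j \<notin> Suc ` S} = - S" for S :: "nat set" by auto
  have "(\<Sum>ks\<in>nlists N (Suc n). \<Sum>S\<in>Pow {..<Suc n}. H (nths ks S) (nths ks (- S))) =
     (\<Sum>x<N. \<Sum>ks\<in>nlists N n. \<Sum>S\<in>Pow {..<n}. H (nths ks S) (x # nths ks (- S)) + H (x # nths ks S) (nths ks (- S)))"
    unfolding sum_nlists_Suc sum_Pow_Suc
    by (intro sum.cong refl) (simp add: nths_Cons s1)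
  also have "\<dots> = (\<Sum>x<N. (\<Sum>p\<le>n. of_nat (n choose p) * (\<Sum>k1\<in>nlists N p. \<Sum>k2\<in>nlists N (n - p). H k1 (x # k2))) +
     (\<Sum>p\<le>n. of_nat (n choose p) * (\<Sum>k1\<in>nlists N p. \<Sum>k2\<in>nlists N (n - p). H (x # k1) k2)))"
    unfolding sum.distrib Suc.IH[of "\<lambda>a b. H a (_ # b)"] Suc.IH[of "\<lambda>a b. H (_ # a) b"] ..
  also have "\<dots> = (\<Sum>p\<le>n. of_nat (n choose p) * (\<Sum>x<N. \<Sum>k1\<in>nlists N p. \<Sum>k2\<in>nlists N (n - p). H k1 (x # k2))) +
     (\<Sum>p\<le>n. of_nat (n choose p) * (\<Sum>x<N. \<Sum>k1\<in>nlists N p. \<Sum>k2\<in>nlists N (n - p). H (x # k1) k2))"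
    unfolding sum.distrib by (subst (1 2) sum.swap) (simp add: sum_distrib_left)
  also have "\<dots> = (\<Sum>p\<le>n. of_nat (n choose p) * A p (Suc n - p)) + (\<Sum>p\<le>n. of_nat (n choose p) * A (Suc p) (n - p))"
  proof -
    have "(\<Sum>x<N. \<Sum>k1\<in>nlists N p. \<Sum>k2\<in>nlists N (n - p). H k1 (x # k2)) = A p (Suc n - p)" if "p \<le> n" for p
      unfolding A_def using that by (subst sum.swap) (simp add: Suc_diff_le sum_nlists_Suc)
    moreover have "(\<Sum>x<N. \<Sum>k1\<in>nlists N p. \<Sum>k2\<in>nlists N (n - p). H (x # k1) k2) = A (Suc p) (n - p)" for p
      unfolding A_def by (simp add: sum_nlists_Suc)
    ultimately show ?thesis by simp
  qed
  also have "\<dots> = (\<Sum>p\<le>Suc n. of_nat (Suc n choose p) * A p (Suc n - p))"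
  proof -
    have "(\<Sum>p\<le>n. of_nat (n choose p) * A p (Suc n - p)) = (\<Sum>p\<le>Suc n. of_nat (n choose p) * A p (Suc n - p))"
      by simp
    also have "\<dots> = A 0 (Suc n) + (\<Sum>p\<le>n. of_nat (n choose Suc p) * A (Suc p) (n - p))"
      by (subst sum.atMost_Suc_shift) simp
    finally have lhs: "(\<Sum>p\<le>n. of_nat (n choose p) * A p (Suc n - p)) =
      A 0 (Suc n) + (\<Sum>p\<le>n. of_nat (n choose Suc p) * A (Suc p) (n - p))" .
    have "(\<Sum>p\<le>Suc n. of_nat (Suc n choose p) * A p (Suc n - p)) =
        A 0 (Suc n) + (\<Sum>p\<le>n. of_nat (Suc n choose Suc p) * A (Suc p) (n - p))"
      by (subst sum.atMost_Suc_shift) simp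
    then show ?thesis unfolding lhs by (simp add: sum.distrib distrib_right)
  qed
  finally show ?case by (simp add: A_def)
qed

definition comp_sum :: "nat \<Rightarrow> (nat list \<Rightarrow> complex) \<Rightarrow> complex"
  where "comp_sum m g = (\<Sum>ks\<in>compositions m. g ks / fact (length ks))"

lemma comp_sum_larger:
  assumes "m \<le> N"
  shows "comp_sum m g = (\<Sum>n\<le>N. \<Sum>ks\<in>nlists N n. if weight ks = m then g ks / fact n else 0)"
proof -
  have eq: "compositions m = (\<Union>n\<in>{..N}. {ks \<in> nlists N n. weight ks = m})"
  proof (intro set_eqI iffI)
    fix ks assume "ks \<in> compositions m"
    then have ks: "weight ks = m" by (simp add: compositions_def)
    then have "set ks \<subseteq> {..<N}" "length ks \<le> N"
      using set_lt_weight[of _ ks] length_le_weight[of ks] assms by (auto intro: less_le_trans)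
    then show "ks \<in> (\<Union>n\<in>{..N}. {ks \<in> nlists N n. weight ks = m})" using ks by (auto simp: nlists_def)
  qed (auto simp: compositions_def)
  have "comp_sum m g = (\<Sum>n\<le>N. \<Sum>ks\<in>{ks \<in> nlists N n. weight ks = m}. g ks / fact (length ks))"
    unfolding comp_sum_def eq by (rule sum.UNION_disjoint) (auto simp: finite_nlists, auto simp: nlists_def)
  also have "\<dots> = (\<Sum>n\<le>N. \<Sum>ks\<in>nlists N n. if weight ks = m then g ks / fact n else 0)"
  proof (rule sum.cong[OF refl])
    fix n
    show "(\<Sum>ks\<in>{ks \<in> nlists N n. weight ks = m}. g ks / fact (length ks)) = (\<Sum>ks\<in>nlists N n. if weight ks = m then g ks / fact n else 0)"
      unfolding sum.inter_filter[OF finite_nlists] by (intro sum.cong refl) (auto simp: nlists_def)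
  qed
  finally show ?thesis .
qed

lemmas comp_sum_nlists = comp_sum_larger[OF order_refl]

lemma weight_nths: "weight (nths ks S) + weight (nths ks (- S)) = weight ks"
proof (induction ks arbitrary: S)
  case (Cons k ks)
  have "{j. Suc j \<notin> S} = - {j. Suc j \<in> S}" by auto
  then show ?case using Cons[of "{j. Suc j \<in> S}"] by (simp add: nths_Cons)
qed simp

text \<open>The factor \<open>n choose p\<close> turns \<open>1/n!\<close> into \<open>1/(p! (n - p)!)\<close>. This is multiplicativity of the exponential
  series: it turns a sum over subsets of the arguments, as in the \<open>L\<^sub>\<infinity>\<close> equations, into a product of
  generating functions.\<close>

lemma comp_sum_split:
  fixes H :: "nat list \<Rightarrow> nat list \<Rightarrow> complex"
  shows "comp_sum m (\<lambda>ks. \<Sum>S\<in>Pow {..<length ks}. H (nths ks S) (nths ks (- S))) =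
    (\<Sum>i\<le>m. comp_sum i (\<lambda>k1. comp_sum (m - i) (H k1)))"
proof -
  define G where "G k1 k2 = (if weight k1 + weight k2 = m then H k1 k2 else 0)" for k1 k2
  have "comp_sum m (\<lambda>ks. \<Sum>S\<in>Pow {..<length ks}. H (nths ks S) (nths ks (- S))) =
      (\<Sum>n\<le>m. \<Sum>ks\<in>nlists m n. (\<Sum>S\<in>Pow {..<n}. G (nths ks S) (nths ks (- S))) / fact n)"
    unfolding comp_sum_nlists
    by (intro sum.cong refl) (auto simp: G_def weight_nths nlists_def)
  also have "\<dots> = (\<Sum>n\<le>m. (\<Sum>ks\<in>nlists m n. \<Sum>S\<in>Pow {..<n}. G (nths ks S) (nths ks (- S))) / fact n)"
    by (simp add: sum_divide_distrib)
  also have "\<dots> = (\<Sum>n\<le>m. \<Sum>p\<le>n. (\<Sum>k1\<in>nlists m p. \<Sum>k2\<in>nlists m (n - p). G k1 k2) / (fact p * fact (n - p)))"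
  proof (rule sum.cong[OF refl])
    fix n
    have "of_nat (n choose p) * x / fact n = x / (fact p * fact (n - p))" if "p \<le> n" for p and x :: complex
    proof -
      have "of_nat (n choose p) = (fact n / (fact p * fact (n - p)) :: complex)"
        using that by (rule binomial_fact)
      then show ?thesis by simp
    qed
    then have "(\<Sum>p\<le>n. of_nat (n choose p) * x p / fact n) = (\<Sum>p\<le>n. x p / (fact p * fact (n - p)))"
      for x :: "nat \<Rightarrow> complex"
      by (intro sum.cong refl) auto
    then show "(\<Sum>ks\<in>nlists m n. \<Sum>S\<in>Pow {..<n}. G (nths ks S) (nths ks (- S))) / fact n =
        (\<Sum>p\<le>n. (\<Sum>k1\<in>nlists m p. \<Sum>k2\<in>nlists m (n - p). G k1 k2) / (fact p * fact (n - p)))"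
      unfolding sum_split_lists by (subst sum_divide_distrib)
  qed
  also have "\<dots> = (\<Sum>p\<le>m. \<Sum>q\<le>m - p. (\<Sum>k1\<in>nlists m p. \<Sum>k2\<in>nlists m q. G k1 k2) / (fact p * fact q))"
    by (rule sum_triangle[symmetric])
  also have "\<dots> = (\<Sum>p\<le>m. \<Sum>q\<le>m. (\<Sum>k1\<in>nlists m p. \<Sum>k2\<in>nlists m q. G k1 k2) / (fact p * fact q))"
  proof (rule sum.cong[OF refl], rule sum.mono_neutral_left; (intro ballI)?)
    fix p q assume "p \<in> {..m}" "q \<in> {..m} - {..m - p}"
    then have pq: "p + q > m" by auto
    have "G k1 k2 = 0" if "k1 \<in> nlists m p" "k2 \<in> nlists m q" for k1 k2
      using that pq length_le_weight[of k1] length_le_weight[of k2] by (auto simp: G_def nlists_def)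
    then show "(\<Sum>k1\<in>nlists m p. \<Sum>k2\<in>nlists m q. G k1 k2) / (fact p * fact q) = 0" by simp
  qed auto
  also have "\<dots> = (\<Sum>p\<le>m. \<Sum>k1\<in>nlists m p. \<Sum>i\<le>m. if i = weight k1 then comp_sum (m - i) (H k1) / fact p else 0)"
  proof (rule sum.cong[OF refl])
    fix p
    have "(\<Sum>q\<le>m. (\<Sum>k1\<in>nlists m p. \<Sum>k2\<in>nlists m q. G k1 k2) / (fact p * fact q)) =
        (\<Sum>k1\<in>nlists m p. \<Sum>q\<le>m. (\<Sum>k2\<in>nlists m q. G k1 k2) / (fact p * fact q))"
      unfolding sum_divide_distrib by (rule sum.swap)
    also have "\<dots> = (\<Sum>k1\<in>nlists m p. \<Sum>i\<le>m. if i = weight k1 then comp_sum (m - i) (H k1) / fact p else 0)"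
    proof (rule sum.cong[OF refl])
      fix k1
      show "(\<Sum>q\<le>m. (\<Sum>k2\<in>nlists m q. G k1 k2) / (fact p * fact q)) =
          (\<Sum>i\<le>m. if i = weight k1 then comp_sum (m - i) (H k1) / fact p else 0)"
      proof (cases "weight k1 \<le> m")
        case True
        have "G k1 k2 / (fact p * fact q) = (if weight k2 = m - weight k1 then H k1 k2 / fact q else 0) / fact p" for k2 q
          using True by (auto simp: G_def)
        then show ?thesis using True
          by (simp add: sum_divide_distrib comp_sum_larger[of "m - weight k1" m])
      next
        case False
        then have "G k1 k2 = 0" for k2 by (simp add: G_def)
        then show ?thesis using False by simp
      qed
    qed
    finally show "(\<Sum>q\<le>m. (\<Sum>k1\<in>nlists m p. \<Sum>k2\<in>nlists m q. G k1 k2) / (fact p * fact q)) =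
        (\<Sum>k1\<in>nlists m p. \<Sum>i\<le>m. if i = weight k1 then comp_sum (m - i) (H k1) / fact p else 0)" .
  qed
  also have "\<dots> = (\<Sum>p\<le>m. \<Sum>i\<le>m. \<Sum>k1\<in>nlists m p. if i = weight k1 then comp_sum (m - i) (H k1) / fact p else 0)"
    by (rule sum.cong[OF refl], rule sum.swap)
  also have "\<dots> = (\<Sum>i\<le>m. \<Sum>p\<le>m. \<Sum>k1\<in>nlists m p. if i = weight k1 then comp_sum (m - i) (H k1) / fact p else 0)"
    by (rule sum.swap)
  also have "\<dots> = (\<Sum>i\<le>m. comp_sum i (\<lambda>k1. comp_sum (m - i) (H k1)))"
  proof (rule sum.cong[OF refl])
    fix i assume "i \<in> {..m}"
    then have i: "i \<le> m" by simp
    show "(\<Sum>p\<le>m. \<Sum>k1\<in>nlists m p. if i = weight k1 then comp_sum (m - i) (H k1) / fact p else 0) = comp_sum i (\<lambda>k1. comp_sum (m - i) (H k1))"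
      unfolding comp_sum_larger[OF i] by (intro sum.cong refl) auto
  qed
  finally show ?thesis .
qed

lemma nths_singleton: "i < length xs \<Longrightarrow> nths xs {i} = [xs ! i]"
proof (induction xs arbitrary: i)
  case (Cons x xs)
  show ?case
  proof (cases i)
    case 0
    then show ?thesis by (simp add: nths_Cons)
  next
    case (Suc k)
    have "{j. Suc j = Suc k} = {k}" by auto
    then show ?thesis using Cons Suc by (simp add: nths_Cons)
  qed
qed simp

lemma nths_pair: "i < j \<Longrightarrow> j < length xs \<Longrightarrow> nths xs {i, j} = [xs ! i, xs ! j]"
proof (induction xs arbitrary: i j)
  case (Cons x xs)
  obtain l where j: "j = Suc l" using Cons.prems by (cases j) auto
  show ?case
  proof (cases i)
    case 0
    have "{k. Suc k = l + 1} = {l}" by auto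
    then show ?thesis using Cons.prems 0 j nths_singleton[of l xs] by (simp add: nths_Cons)
  next
    case (Suc k)
    have "{n. Suc n = Suc k \<or> Suc n = Suc l} = {k, l}" by auto
    then show ?thesis using Cons Suc j by (simp add: nths_Cons)
  qed
qed simp

lemma length_nths_sub: "S \<subseteq> {..<length xs} \<Longrightarrow> length (nths xs S) = card S"
proof -
  assume "S \<subseteq> {..<length xs}"
  then have "{i. i < length xs \<and> i \<in> S} = S" by auto
  then show ?thesis by (simp add: length_nths)
qed

text \<open>The terms with the bracket of two arguments, written as a sum over subsets so that \<open>comp_sum_split\<close>
  applies.\<close>

lemma sum_pairs:
  fixes H :: "nat list \<Rightarrow> nat list \<Rightarrow> complex"
  assumes H: "\<And>k1 k2. length k1 \<noteq> 2 \<Longrightarrow> H k1 k2 = 0"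
  shows "(\<Sum>S\<in>Pow {..<length ks}. H (nths ks S) (nths ks (- S))) =
    (\<Sum>j<length ks. \<Sum>i<j. H [ks ! i, ks ! j] (nths ks (- {i, j})))"
proof -
  let ?T = "SIGMA j:{..<length ks}. {..<j}"
  have "(\<Sum>S\<in>Pow {..<length ks}. H (nths ks S) (nths ks (- S))) = (\<Sum>S\<in>(\<lambda>(j, i). {i, j}) ` ?T. H (nths ks S) (nths ks (- S)))"
  proof (rule sum.mono_neutral_right)
    show "\<forall>S\<in>Pow {..<length ks} - (\<lambda>(j, i). {i, j}) ` ?T. H (nths ks S) (nths ks (- S)) = 0"
    proof
      fix S assume S: "S \<in> Pow {..<length ks} - (\<lambda>(j, i). {i, j}) ` ?T"
      have "card S \<noteq> 2"
      proof
        assume "card S = 2"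
        then obtain a b where ab: "S = {a, b}" "a \<noteq> b" by (meson card_2_iff)
        then have "S = {min a b, max a b}" by (auto simp: min_def max_def)
        moreover have "min a b < max a b" "max a b < length ks" using ab S by (auto simp: min_def max_def)
        ultimately have "S \<in> (\<lambda>(j, i). {i, j}) ` ?T" by (intro image_eqI[of _ _ "(max a b, min a b)"]) auto
        then show False using S by simp
      qed
      then show "H (nths ks S) (nths ks (- S)) = 0" using S by (intro H) (simp add: length_nths_sub)
    qed
  qed auto
  also have "\<dots> = (\<Sum>(j, i)\<in>?T. H (nths ks {i, j}) (nths ks (- {i, j})))"
    by (subst sum.reindex) (auto simp: inj_on_def doubleton_eq_iff case_prod_unfold)
  also have "\<dots> = (\<Sum>j<length ks. \<Sum>i<j. H (nths ks {i, j}) (nths ks (- {i, j})))"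
    by (rule sum.Sigma[symmetric]) auto
  also have "\<dots> = (\<Sum>j<length ks. \<Sum>i<j. H [ks ! i, ks ! j] (nths ks (- {i, j})))"
    by (intro sum.cong refl) (simp add: nths_pair)
  finally show ?thesis .
qed

section \<open>Chains and forms of low degree\<close>

lemma nths_replicate: "nths (replicate n x) S = replicate (length (nths (replicate n x) S)) x"
  by (rule replicate_eqI) (use set_nths_subset[of "replicate n x" S] in auto)

lemma length_nths_eq: "length xs = length ys \<Longrightarrow> length (nths xs S) = length (nths ys S)"
  by (simp add: length_nths)

text \<open>All arguments will be bivector fields, of even degree in \<open>g[1]\<close>, so no signs occur.\<close>

lemma koszul_even:
  assumes "S \<subseteq> {..<n}"
  shows "koszul (replicate n 2) S = 1"
proof -
  have "even (\<Sum>i\<in>S. \<Sum>j\<in>{..<i} - S. replicate n 2 ! i * replicate n (2::nat) ! j)"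
  proof (intro dvd_sum)
    fix i j assume "i \<in> S" "j \<in> {..<i} - S"
    then have "i < n" "j < n" using assms by auto
    then show "even (replicate n 2 ! i * replicate n (2::nat) ! j)" by simp
  qed
  then show ?thesis by (simp add: koszul_def)
qed

lemma clinear_onD:
  "clinear_on V f \<Longrightarrow> x \<in> V \<Longrightarrow> y \<in> V \<Longrightarrow> f (r *\<^sub>C x + y) = r *\<^sub>C f x + f y"
  by (simp add: clinear_on_def)

lemma clinear_on_zero:
  assumes "clinear_on V f" "0 \<in> V"
  shows "f 0 = 0"
proof -
  have "f (1 *\<^sub>C 0 + 0) = 1 *\<^sub>C f 0 + f 0" by (rule clinear_onD[OF assms(1,2,2)])
  then show ?thesis by (simp add: cscale_one)
qed

lemma clinear_on_add: "clinear_on V f \<Longrightarrow> x \<in> V \<Longrightarrow> y \<in> V \<Longrightarrow> f (x + y) = f x + f y"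
  using clinear_onD[of V f x y 1] by (simp add: cscale_one)

lemma clinear_on_sum:
  assumes f: "clinear_on V f" and V: "0 \<in> V" "\<And>x y. x \<in> V \<Longrightarrow> y \<in> V \<Longrightarrow> x + y \<in> V"
    and "finite J" "\<And>j. j \<in> J \<Longrightarrow> x j \<in> V"
  shows "(\<Sum>j\<in>J. x j) \<in> V \<and> f (\<Sum>j\<in>J. x j) = (\<Sum>j\<in>J. f (x j))"
  using assms(4,5)
proof (induction J rule: finite_induct)
  case empty
  show ?case using clinear_on_zero[OF f V(1)] V(1) by simp
next
  case (insert j J)
  then show ?case using V(2) clinear_on_add[OF f] by simp
qed

lemma cfun_simps [simp]: "(r *\<^sub>C F) x = r *\<^sub>C F x" "r *\<^sub>C (z :: complex) = r * z"
  by (simp_all add: cscale_fun_def cscale_complex_def)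

context smfd
begin

lemma altD:
  assumes "alt_components M V d A"
  shows "\<not> (in_range M V c p J \<and> length J = d) \<Longrightarrow> A c p J = 0"
    and "c \<in> atlas M \<Longrightarrow> J \<in> multi_idx M d \<Longrightarrow> chart_smooth c V (\<lambda>p. A c p J)"
    and "k < s \<and> s < length J \<Longrightarrow> A c p (J[k := J ! s, s := J ! k]) = - A c p J"
proof -
  note a = assms[unfolded alt_components_def]
  show "\<not> (in_range M V c p J \<and> length J = d) \<Longrightarrow> A c p J = 0"
    using a[THEN conjunct1, rule_format, of c p J] .
  show "c \<in> atlas M \<Longrightarrow> J \<in> multi_idx M d \<Longrightarrow> chart_smooth c V (\<lambda>p. A c p J)"
    unfolding chart_smooth_def using a[THEN conjunct2, THEN conjunct1, rule_format, of c J] .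
  show "k < s \<and> s < length J \<Longrightarrow> A c p (J[k := J ! s, s := J ! k]) = - A c p J"
    using a[THEN conjunct2, THEN conjunct2, rule_format, of k s J c p] .
qed

lemma alt_lincomb:
  assumes A: "alt_components M V d A" and B: "alt_components M V d B" and V: "openin (mtop M) V"
  shows "alt_components M V d (r *\<^sub>C A + B)"
  unfolding alt_components_def
proof (intro conjI allI impI ballI)
  fix c p J assume "\<not> (in_range M V c p J \<and> length J = d)"
  then have "A c p J = 0" "B c p J = 0" by (rule altD(1)[OF A], rule altD(1)[OF B])
  then show "(r *\<^sub>C A + B) c p J = 0" by simp
next
  fix c J assume c: "c \<in> atlas M" and J: "J \<in> multi_idx M d"
  have "chart_smooth c V (\<lambda>p. r * A c p J + B c p J)"
    by (intro chart_smooth_add chart_smooth_mult chart_smooth_const altD(2)[OF A] altD(2)[OF B] c J V)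
  then show "smooth_on I (cimg c V) (\<lambda>x. (r *\<^sub>C A + B) c (chart_inv c x) J)" by (simp add: chart_smooth_def)
next
  fix c p and J :: "nat list" and k s assume h: "k < s \<and> s < length J"
  show "(r *\<^sub>C A + B) c p (J[k := J ! s, s := J ! k]) = - (r *\<^sub>C A + B) c p J"
    using altD(3)[OF A h, of c p] altD(3)[OF B h, of c p] by simp
qed

lemma alt_zero: "alt_components M V d 0"
  by (simp add: alt_components_def smooth_on_const)

lemma mvf_zero: "0 \<in> mvf M V d"
  by (simp add: mvf_def alt_zero)

lemma forms_zero: "0 \<in> forms M V d"
  by (simp add: forms_def alt_zero)

lemma forms_trans:
  assumes A: "A \<in> forms M V d" and h: "c \<in> atlas M" "c' \<in> atlas M" "p \<in> fst c \<inter> fst c' \<inter> V" "J \<in> multi_idx M d"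
  shows "A c' p J = (\<Sum>L\<in>multi_idx M d. (\<Prod>k<d. jacobian c' c (L ! k) (J ! k) p) * A c p L)"
  by (rule A[unfolded forms_def, THEN CollectD, THEN conjunct2, THEN bspec, OF h(1), THEN bspec, OF h(2),
      THEN bspec, OF h(3), THEN bspec, OF h(4)])

lemma mvf_trans:
  assumes A: "A \<in> mvf M V d" and h: "c \<in> atlas M" "c' \<in> atlas M" "p \<in> fst c \<inter> fst c' \<inter> V" "J \<in> multi_idx M d"
  shows "A c' p J = (\<Sum>L\<in>multi_idx M d. (\<Prod>k<d. jacobian c c' (J ! k) (L ! k) p) * A c p L)"
  by (rule A[unfolded mvf_def, THEN CollectD, THEN conjunct2, THEN bspec, OF h(1), THEN bspec, OF h(2),
      THEN bspec, OF h(3), THEN bspec, OF h(4)])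

lemma mvf_add:
  assumes V: "openin (mtop M) V" and A: "A \<in> mvf M V d" and B: "B \<in> mvf M V d"
  shows "A + B \<in> mvf M V d"
  unfolding mvf_def
proof (intro CollectI conjI ballI)
  have "alt_components M V d (1 *\<^sub>C A + B)"
    by (rule alt_lincomb[OF A[unfolded mvf_def, THEN CollectD, THEN conjunct1] B[unfolded mvf_def, THEN CollectD, THEN conjunct1] V])
  then show "alt_components M V d (A + B)" by (simp only: cscale_one)
  fix c c' p J assume h: "c \<in> atlas M" "c' \<in> atlas M" "p \<in> fst c \<inter> fst c' \<inter> V" "J \<in> multi_idx M d"
  show "(A + B) c' p J = (\<Sum>L\<in>multi_idx M d. (\<Prod>k<d. jacobian c c' (J ! k) (L ! k) p) * (A + B) c p L)"
    using mvf_trans[OF A h] mvf_trans[OF B h] by (simp add: distrib_left sum.distrib)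
qed

lemma forms_lincomb:
  assumes V: "openin (mtop M) V" and A: "A \<in> forms M V d" and B: "B \<in> forms M V d"
  shows "r *\<^sub>C A + B \<in> forms M V d"
  unfolding forms_def
proof (intro CollectI conjI ballI)
  show "alt_components M V d (r *\<^sub>C A + B)" 
    by (rule alt_lincomb[OF A[unfolded forms_def, THEN CollectD, THEN conjunct1] B[unfolded forms_def, THEN CollectD, THEN conjunct1] V])
  fix c c' p J assume h: "c \<in> atlas M" "c' \<in> atlas M" "p \<in> fst c \<inter> fst c' \<inter> V" "J \<in> multi_idx M d"
  show "(r *\<^sub>C A + B) c' p J = (\<Sum>L\<in>multi_idx M d. (\<Prod>k<d. jacobian c' c (L ! k) (J ! k) p) * (r *\<^sub>C A + B) c p L)"
    using forms_trans[OF A h] forms_trans[OF B h]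
    by (simp add: distrib_left distrib_right sum.distrib sum_distrib_left mult_ac)
qed

lemma multi_idx_0: "multi_idx M 0 = {[]}"
  by (auto simp: multi_idx_def)

lemma zero_form_chart:
  assumes T: "T \<in> forms M (pts M) 0" and c: "c \<in> atlas M" "p \<in> fst c"
  shows "to_fun M (pts M) T p = T c p []"
proof -
  let ?c = "SOME c. c \<in> atlas M \<and> p \<in> fst c"
  have s: "?c \<in> atlas M \<and> p \<in> fst ?c" using c by (intro someI[where P = "\<lambda>c. c \<in> atlas M \<and> p \<in> fst c"]) simp
  have pU: "p \<in> pts M" using c dom_pts by blast
  have "T ?c p [] = (\<Sum>J\<in>multi_idx M 0. (\<Prod>k<0. jacobian ?c c (J ! k) ([] ! k) p) * T c p J)"
    by (rule forms_trans[OF T c(1) conjunct1[OF s]]) (use c s pU in \<open>auto simp: multi_idx_0\<close>)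
  then show ?thesis using pU by (simp add: to_fun_def multi_idx_0)
qed

lemma zero_form_X:
  assumes T: "T \<in> forms M (pts M) 0"
  shows "to_fun M (pts M) T \<in> X"
  unfolding X_iff
proof (intro conjI allI impI ballI)
  show "to_fun M (pts M) T p = 0" if "p \<notin> pts M" for p using that by (simp add: to_fun_def)
  fix c assume c: "c \<in> atlas M"
  have "chart_smooth c (pts M) (\<lambda>p. T c p [])"
    by (rule altD(2)[OF T[unfolded forms_def, THEN CollectD, THEN conjunct1] c]) (simp add: multi_idx_0)
  then show "chart_smooth c (pts M) (to_fun M (pts M) T)"
    by (subst chart_smooth_cong[OF c pts_open]) (use zero_form_chart[OF T c] in auto)
qed

lemma one_form_chart_smooth:
  assumes T: "T \<in> forms M (pts M) 1" and c: "c \<in> atlas M" and i: "i < mdim M"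
  shows "chart_smooth c (pts M) (\<lambda>p. T c p [i])"
proof -
  have "[i] \<in> multi_idx M 1" using i by (simp add: multi_idx_def)
  then show ?thesis by (rule altD(2)[OF T[unfolded forms_def, THEN CollectD, THEN conjunct1] c])
qed

text \<open>Elements without positive powers of \<open>u\<close>.\<close>

definition u_const :: "'x \<Rightarrow> nat \<Rightarrow> 'x::zero"
  where "u_const h k = (if k = 0 then h else 0)"

lemma u_const_0 [simp]: "u_const h 0 = h" by (simp add: u_const_def)

lemma u_const_series:
  assumes "h \<in> chains M (pts M) n"
  shows "u_const h \<in> u_series (chains M (pts M)) (int n)"
  unfolding u_series_def int_graded_def using assms pow_zero
  by (auto simp: u_const_def chains_def)

lemma chains_zero_series: "0 \<in> int_graded (chains M (pts M)) n"
  by (simp add: int_graded_def chains_def pow_zero)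

lemma tens1_chain: "f \<in> X \<Longrightarrow> tens [f] \<in> chains M (pts M) 0"
  using tens_smooth[of "[f]"] by (simp add: chains_def)

lemma tens2_chain: "f \<in> X \<Longrightarrow> g \<in> X \<Longrightarrow> tens [f, g] \<in> chains M (pts M) 1"
  using tens_smooth[of "[f, g]"] by (simp add: chains_def numeral_2_eq_2)

lemma tens1_apply: "tens [f] xs = (if length xs = 1 then f (xs ! 0) else 0)"
  by (simp add: tens_def lessThan_Suc)

lemma tens2_apply: "tens [f, g] xs = (if length xs = 2 then f (xs ! 0) * g (xs ! 1) else 0)"
  by (simp add: tens_def lessThan_Suc numeral_2_eq_2)

lemma tens3_apply: "tens [f, g, h] xs = (if length xs = 3 then f (xs ! 0) * g (xs ! 1) * h (xs ! 2) else 0)"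
  by (simp add: tens_def lessThan_Suc numeral_2_eq_2 numeral_3_eq_3)

definition comm :: "'a oper \<Rightarrow> ('a \<Rightarrow> complex) \<Rightarrow> ('a \<Rightarrow> complex) \<Rightarrow> 'a \<Rightarrow> complex"
  where "comm D f g p = D (tens [f, g]) p - D (tens [g, f]) p"

lemma comm_X: "D \<in> multidiff M (pts M) 2 \<Longrightarrow> f \<in> X \<Longrightarrow> g \<in> X \<Longrightarrow> comm D f g \<in> X"
  unfolding comm_def[abs_def] by (intro X_diff multidiff_X[of D 2]) auto

lemma multidiff_0:
  assumes D: "D \<in> multidiff M (pts M) 2"
  shows "D (\<lambda>_. 0) = (\<lambda>_. 0)"
proof -
  have "tens [\<lambda>_. 0, \<lambda>_. 0] = (\<lambda>_::'a list. 0)" by (simp add: tens2_apply fun_eq_iff)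
  then show ?thesis using multidiff_zero[OF D, of "[\<lambda>_. 0, \<lambda>_. 0]"] X_zero by simp
qed

text \<open>A function on \<open>U\<^sup>2\<close> vanishes on lists of other lengths, and cochains are 0 on functions that do not.\<close>

lemma multidiff_wrong_length:
  assumes D: "D \<in> multidiff M (pts M) 2" and F: "\<And>ys. length ys = 2 \<Longrightarrow> F ys = 0"
  shows "D F x = 0"
proof (cases "F \<in> smooth_funs_pow M (pts M) 2")
  case True
  have "F ys = 0" for ys using True F[of ys] by (cases "length ys = 2") (auto simp: smooth_funs_pow_def)
  then have "F = (\<lambda>_. 0)" by blast
  then show ?thesis by (simp add: multidiff_0[OF D])
next
  case False
  then show ?thesis by (rule multidiff_off'[OF D])
qed

text \<open>Of \<open>L\<^sub>D(f \<otimes> g)\<close> only the two terms survive in which both factors are arguments of \<open>D\<close>.\<close>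

lemma lie_chain_tens2:
  assumes D: "D \<in> multidiff M (pts M) 2"
  shows "lie_chain 2 D (tens [f, g]) = tens [comm D f g]"
proof
  fix xs :: "'a list"
  show "lie_chain 2 D (tens [f, g]) xs = tens [comm D f g] xs"
  proof (cases "length xs = 1")
    case True
    then obtain x where x: "xs = [x]" by (auto simp: length_Suc_conv)
    have a: "(\<lambda>ys. if length ys = 2 then tens [f, g] (drop (Suc 0 - Suc 0) ys @ tl [x] @ take (Suc 0 - Suc 0) ys) else 0) = tens [f, g]"
      by (auto simp: fun_eq_iff tens2_apply)
    have b: "(\<lambda>ys. if length ys = 2 then tens [f, g] (drop (Suc 0 - 0) ys @ tl [x] @ take (Suc 0 - 0) ys) else 0) = tens [g, f]"
      by (auto simp: fun_eq_iff tens2_apply length_Suc_conv numeral_2_eq_2)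
    have "{0..1} = {0, 1 :: nat}" by auto
    then show ?thesis using a b
      by (simp add: x lie_chain_def Let_def tens1_apply comm_def)
  next
    case False
    show ?thesis
    proof (cases "xs = []")
      case True
      then show ?thesis by (simp add: lie_chain_def tens1_apply)
    next
      case ne: False
      then have l: "length xs \<ge> 2" using False by (cases xs) (auto simp: Suc_le_eq)
      have 1: "D (\<lambda>ys. tens [f, g] (take (Suc i) xs @ ys @ drop (Suc (Suc i)) xs)) x = 0" if "i < length xs - 1" for i x
        by (rule multidiff_wrong_length[OF D]) (use l that in \<open>auto simp: tens2_apply\<close>)
      have 2: "D (\<lambda>ys. if length ys = 2 then tens [f, g] (drop k ys @ tl xs @ take k ys) else 0) x = 0" for k x
      proof (rule multidiff_wrong_length[OF D])
        fix ys :: "'a list" assume y: "length ys = 2"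
        have "length (drop k ys @ tl xs @ take k ys) = 2 + (length xs - 1)" using y by simp
        then have "tens [f, g] (drop k ys @ tl xs @ take k ys) = 0" using l by (simp add: tens2_apply)
        then show "(if length ys = 2 then tens [f, g] (drop k ys @ tl xs @ take k ys) else 0) = 0" by simp
      qed
      show ?thesis using ne False 1 2 by (simp add: lie_chain_def Let_def tens1_apply)
    qed
  qed
qed

lemma lie_chain_zero:
  assumes D: "D \<in> multidiff M (pts M) 2"
  shows "lie_chain 2 D 0 = 0"
proof
  fix xs :: "'a list"
  have "(\<lambda>ys. if length ys = 2 then (0 :: 'a list \<Rightarrow> complex) (drop k ys @ tl xs @ take k ys) else 0) = (\<lambda>_. 0)" for k
    by auto
  then show "lie_chain 2 D 0 xs = 0 xs" by (simp add: lie_chain_def Let_def multidiff_0[OF D])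
qed

text \<open>The boundary of \<open>f \<otimes> g\<close> is \<open>fg - gf\<close>, which is 0 for the pointwise product.\<close>

lemma hoch_b_tens2: "hoch_b (tens [f, g]) = 0"
proof
  fix xs
  show "hoch_b (tens [f, g]) xs = 0 xs"
  proof (cases "length xs = 1")
    case True
    then obtain x where x: "xs = [x]" by (auto simp: length_Suc_conv)
    show ?thesis by (simp add: x hoch_b_def Let_def tens2_apply)
  next
    case False
    have "tens [f, g] (take (Suc i) xs @ drop i xs) = 0" if "i < length xs" for i
    proof -
      have "length (take (Suc i) xs @ drop i xs) = Suc (length xs)" using that by simp
      then show ?thesis using False by (simp add: tens2_apply)
    qed
    moreover have "tens [f, g] (xs @ [hd xs]) = 0" using False by (simp add: tens2_apply)
    ultimately show ?thesis by (simp add: hoch_b_def Let_def)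
  qed
qed

lemma hoch_b_0: "hoch_b 0 = 0"
  by (simp add: hoch_b_def Let_def fun_eq_iff)

lemma connes_B_0: "connes_B V 0 = 0"
  by (simp add: connes_B_def Let_def fun_eq_iff)

text \<open>The unit, extended by 0 as elements of \<open>X\<close> have to be.\<close>

definition oneX :: "'a \<Rightarrow> complex" where "oneX p = (if p \<in> pts M then 1 else 0)"

lemma oneX: "oneX \<in> X"
  unfolding X_iff
proof (intro conjI allI impI ballI)
  show "oneX p = 0" if "p \<notin> pts M" for p using that by (simp add: oneX_def)
  fix c assume c: "c \<in> atlas M"
  have "chart_smooth c (pts M) oneX \<longleftrightarrow> chart_smooth c (pts M) (\<lambda>_. 1 :: complex)"
    by (rule chart_smooth_cong[OF c pts_open]) (simp add: oneX_def)
  then show "chart_smooth c (pts M) oneX" by (simp add: chart_smooth_const)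
qed

lemma connes_B_tens2:
  assumes f: "f \<in> X" and g: "g \<in> X"
  shows "connes_B (pts M) (tens [f, g]) = (-1) *\<^sub>C tens [oneX, g, f] + tens [oneX, f, g]"
proof
  fix xs :: "'a list"
  show "connes_B (pts M) (tens [f, g]) xs = ((-1) *\<^sub>C tens [oneX, g, f] + tens [oneX, f, g]) xs"
  proof (cases "length xs = 3")
    case True
    then obtain x y z where x: "xs = [x, y, z]" by (auto simp: length_Suc_conv numeral_3_eq_3)
    have "{..1} = {0, 1 :: nat}" by auto
    moreover have r: "rotate 2 [y, z] = [y, z]" "rotate 1 [y, z] = [z, y]" by (simp_all add: numeral_2_eq_2)
    ultimately show ?thesis
    proof (cases "set xs \<subseteq> pts M")
      case True
      then have "x \<in> pts M" by (simp add: x)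
      then show ?thesis using True r \<open>{..1} = {0, 1}\<close>
        by (simp add: x connes_B_def Let_def tens2_apply tens3_apply oneX_def)
    next
      case False
      then have "x \<notin> pts M \<or> y \<notin> pts M \<or> z \<notin> pts M" by (simp add: x)
      then have "oneX x = 0 \<or> (f y = 0 \<and> g y = 0) \<or> (f z = 0 \<and> g z = 0)"
        using X_off[OF f] X_off[OF g] by (auto simp: oneX_def)
      then show ?thesis using False by (auto simp: x connes_B_def tens3_apply)
    qed
  next
    case False
    then have "length (rotate k (tl xs)) \<noteq> 2" for k by (cases xs) auto
    then show ?thesis using False by (simp add: connes_B_def Let_def tens2_apply tens3_apply)
  qed
qed

lemma connes_B_tens2_chain:
  assumes "f \<in> X" "g \<in> X"
  shows "connes_B (pts M) (tens [f, g]) \<in> chains M (pts M) 2"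
  unfolding connes_B_tens2[OF assms] chains_def
  using tens_smooth[of "[oneX, g, f]"] tens_smooth[of "[oneX, f, g]"] assms oneX
  by (intro pow_lincomb) (simp_all add: numeral_3_eq_3 numeral_2_eq_2)

lemma CC_diff_tens2_series:
  assumes "f \<in> X" "g \<in> X"
  shows "CC_diff (pts M) (u_const (tens [f, g])) \<in> u_series (chains M (pts M)) 0"
proof -
  have "CC_diff (pts M) (u_const (tens [f, g])) k \<in> int_graded (chains M (pts M)) (0 + 2 * int k)" for k
  proof -
    consider "k = 0" | "k = 1" | "k \<ge> 2" by linarith
    then show ?thesis
    proof cases
      case 1
      then show ?thesis by (simp add: CC_diff_def hoch_b_tens2 u_mult_def chains_zero_series)
    next
      case 2
      then show ?thesis using connes_B_tens2_chain[OF assms]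
        by (simp add: CC_diff_def hoch_b_0 u_mult_def int_graded_def u_const_def)
    next
      case 3
      then show ?thesis by (simp add: CC_diff_def hoch_b_0 connes_B_0 u_mult_def u_const_def chains_zero_series)
    qed
  qed
  then show ?thesis by (simp add: u_series_def)
qed

lemma CC_diff_tens2_0: "CC_diff (pts M) (u_const (tens [f, g])) 0 = 0"
  by (simp add: CC_diff_def hoch_b_tens2 u_mult_def)

lemma connes_mu_tens1:
  assumes "c \<in> atlas M" "p \<in> fst c"
  shows "connes_mu M (pts M) (tens [f]) c p [] = f p"
proof -
  have "in_range M (pts M) c p []" using assms dom_pts by (auto simp: in_range_def)
  then show ?thesis by (simp add: connes_mu_def Let_def tens1_apply)
qed

lemma connes_mu_tens2:
  assumes c: "c \<in> atlas M" "p \<in> fst c" and i: "i < mdim M" and g: "g \<in> X"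
  shows "connes_mu M (pts M) (tens [f, g]) c p [i] = f p * cpd c i g p"
proof -
  have "in_range M (pts M) c p [i]" using c i dom_pts by (auto simp: in_range_def)
  moreover have "{\<sigma>. \<sigma> permutes {..<Suc 0}} = {id}" by (auto simp: lessThan_Suc permutes_sing)
  ultimately have "connes_mu M (pts M) (tens [f, g]) c p [i] = cpd c i (\<lambda>y. f p * g y) p"
    by (simp add: connes_mu_def Let_def tens2_apply sign_id)
  also have "\<dots> = f p * cpd c i g p"
    by (rule cpd_cmult[OF c(1) X_chart_smooth[OF g c(1)] i c(2) dom_pts[OF c]])
  finally show ?thesis .
qed

end

section \<open>The formality morphism on functions\<close>

text \<open>The morphism \<open>\<phi>\<close> is described on the manifold itself; the other open sets enter through \<open>phi_res\<close>, which
  makes the operators obtained from \<open>\<phi>\<close> local.\<close>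

locale formality = smfd M for M :: "'a manifold" +
  fixes SN :: "'a bracket_family" and K :: "'a set \<Rightarrow> 'a tensor list \<Rightarrow> 'a oper"
    and \<phi> :: "'a set \<Rightarrow> 'a tensor list \<Rightarrow> (nat \<Rightarrow> 'a list \<Rightarrow> complex) \<Rightarrow> nat \<Rightarrow> 'a tensor"
    and \<pi> :: "nat \<Rightarrow> 'a tensor"
  assumes schouten: "is_schouten M (pts M) (SN (pts M))"
    and kontsevich: "kontsevich_formality M SN K"
    and poisson: "formal_poisson M SN \<pi>"
    and module_morphism: "linf_module_morphism (mvf M (pts M)) (\<lambda>d x. 0) (\<lambda>d e. SN (pts M))
         (u_series (chains M (pts M))) (u_series (degenerate M (pts M))) (CC_action (pts M) (K (pts M)))
         (u_series (forms M (pts M))) (form_action M (pts M)) (\<phi> (pts M))"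
    and u_linear: "\<And>ds xs n v. v \<in> u_series (chains M (pts M)) n \<Longrightarrow> homog (mvf M (pts M)) ds xs \<Longrightarrow>
          \<phi> (pts M) xs (u_mult v) = u_mult (\<phi> (pts M) xs v)"
    and phi_mu: "\<And>n v. v \<in> u_series (chains M (pts M)) n \<Longrightarrow> \<phi> (pts M) [] v = (\<lambda>k. connes_mu M (pts M) (v k))"
    and phi_res: "\<And>V ds xs n v. v \<in> u_series (chains M (pts M)) n \<Longrightarrow> openin (mtop M) V \<Longrightarrow>
          homog (mvf M (pts M)) ds xs \<Longrightarrow>
       \<phi> V (map (res_tensor V) xs) (\<lambda>k. res_pow V (v k)) = (\<lambda>k. res_tensor V (\<phi> (pts M) xs v k))"
begin

abbreviation U where "U \<equiv> pts M"
abbreviation Ph where "Ph \<equiv> \<phi> U"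
abbreviation CS where "CS \<equiv> u_series (chains M U)"
abbreviation biv where "biv xs \<equiv> set xs \<subseteq> mvf M U 2"

lemma SN_mem: "x \<in> mvf M U 2 \<Longrightarrow> y \<in> mvf M U 2 \<Longrightarrow> SN U x y \<in> mvf M U 3"
proof -
  assume x: "x \<in> mvf M U 2" and y: "y \<in> mvf M U 2"
  have "SN U x y \<in> mvf M U (2 + 2 - 1)"
    by (rule schouten[unfolded is_schouten_def, THEN conjunct1, rule_format, OF x y]) simp
  then show ?thesis by (simp add: numeral_3_eq_3)
qed

lemma pi_mem: "\<pi> m \<in> mvf M U 2"
  using poisson by (simp add: formal_poisson_def)

lemma pi_MC: "(\<Sum>i\<le>n. SN U (\<pi> i) (\<pi> (n - i))) = 0"
  using poisson by (simp add: formal_poisson_def)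

lemma homog2: "biv xs \<Longrightarrow> homog (mvf M U) (replicate (length xs) 2) xs"
  unfolding homog_def list_all2_conv_all_nth by (auto dest: nth_mem)

lemma homog32: "x \<in> mvf M U 3 \<Longrightarrow> biv xs \<Longrightarrow> homog (mvf M U) (3 # replicate (length xs) 2) (x # xs)"
  using homog2[of xs] by (simp add: homog_def)

lemma shifted_degree_2: "shifted_degree (replicate n 2) = 0"
  by (simp add: shifted_degree_def sum_list_replicate)

lemma out_index_2: "out_index (replicate n 2) = 2"
  by (simp add: out_index_def shifted_degree_2)

lemma biv_nths: "biv xs \<Longrightarrow> biv (nths xs S)"
  by (rule subset_trans[OF set_nths_subset])

lemma K_multidiff:
  assumes "biv xs" "xs \<noteq> []"
  shows "K U xs \<in> multidiff M U 2"
proof -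
  have "linf_morphism (mvf M U) (\<lambda>d x. 0) (\<lambda>d e. SN U) (cochains M U) (hoch_diff M U) (gerst M U) (K U)"
    using kontsevich[unfolded kontsevich_formality_def, THEN conjunct1, rule_format, OF pts_open] by (rule conjunct1)
  note h = this[unfolded linf_morphism_def, THEN conjunct2, THEN spec, of "replicate (length xs) 2", THEN spec, of xs, THEN mp]
  have "K U xs \<in> int_graded (cochains M U) (shifted_degree (replicate (length xs) 2) + 2)"
    by (rule h[THEN conjunct1], rule conjI[OF homog2[OF assms(1)] assms(2)])
  then show ?thesis unfolding shifted_degree_2 by (simp add: int_graded_def cochains_def)
qed

lemma K_single:
  assumes "x \<in> mvf M U 2" "f \<in> X" "g \<in> X"
  shows "K U [x] (tens [f, g]) = pairing M U 2 x (dprod M U [f, g])"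
proof -
  have "\<forall>d. \<forall>x\<in>mvf M U d. \<forall>as. length as = d \<and> set as \<subseteq> X \<longrightarrow>
          K U [x] (tens as) = pairing M U d x (dprod M U as)"
    using kontsevich[unfolded kontsevich_formality_def, THEN conjunct1, rule_format, OF pts_open, THEN conjunct2, THEN conjunct2] .
  then show ?thesis using assms by (auto dest: spec[of _ 2])
qed

lemma Ph_module:
  assumes xs: "homog (mvf M U) ds xs" and v: "v \<in> CS n"
  shows Ph_clinear: "clinear_on (CS n) (Ph xs)"
    and Ph_mem0: "Ph xs v \<in> u_series (forms M U) (n - shifted_degree ds)"
    and Ph_eq: "(\<Sum>S\<in>Pow {..<length xs}. koszul ds S *\<^sub>C
             form_action M U (nths ds S) (nths xs S) (Ph (nths xs (- S)) v))
          = source_terms (\<lambda>d x. 0) (\<lambda>d e. SN U) (\<lambda>ys. Ph ys v) ds xs +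
            (\<Sum>S\<in>Pow {..<length xs}. koszul ds S *\<^sub>C (-1) ^ sum_list (nths ds S) *\<^sub>C
               Ph (nths xs S) (CC_action U (K U) (nths ds (- S)) (nths xs (- S)) v))"
proof -
  note h = module_morphism[unfolded linf_module_morphism_def, THEN conjunct2, rule_format, OF xs, of n]
  show "clinear_on (CS n) (Ph xs)" using h by (rule conjunct1)
  show "Ph xs v \<in> u_series (forms M U) (n - shifted_degree ds)"
    using h[THEN conjunct2, THEN conjunct2, THEN bspec, OF v] by (rule conjunct1)
  show "(\<Sum>S\<in>Pow {..<length xs}. koszul ds S *\<^sub>C
             form_action M U (nths ds S) (nths xs S) (Ph (nths xs (- S)) v))
          = source_terms (\<lambda>d x. 0) (\<lambda>d e. SN U) (\<lambda>ys. Ph ys v) ds xs +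
            (\<Sum>S\<in>Pow {..<length xs}. koszul ds S *\<^sub>C (-1) ^ sum_list (nths ds S) *\<^sub>C
               Ph (nths xs S) (CC_action U (K U) (nths ds (- S)) (nths xs (- S)) v))"
    using h[THEN conjunct2, THEN conjunct2, THEN bspec, OF v] by (rule conjunct2)
qed

lemma Ph_first_clinear:
  assumes "homog (mvf M U) (d # ds) (x # xs)" "v \<in> CS n"
  shows "clinear_on (mvf M U d) (\<lambda>y. Ph (y # xs) v)"
proof -
  have "sym_multilinear (mvf M U) (\<lambda>xs. Ph xs v)"
    using module_morphism[unfolded linf_module_morphism_def, THEN conjunct1, rule_format, OF assms(2)] .
  from this[unfolded sym_multilinear_def, rule_format, OF assms(1), THEN conjunct1, rule_format, of 0]
  show ?thesis by simp
qed

lemma Ph_zero_first: "biv xs \<Longrightarrow> v \<in> CS n \<Longrightarrow> Ph (0 # xs) v = 0"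
proof -
  assume xs: "biv xs" and v: "v \<in> CS n"
  have "biv (0 # xs)" using xs mvf_zero by simp
  then have "homog (mvf M U) (2 # replicate (length xs) 2) (0 # xs)" using homog2[of "0 # xs"] by simp
  from Ph_first_clinear[OF this v] show ?thesis by (rule clinear_on_zero) (rule mvf_zero)
qed

lemma Ph_mem: "biv xs \<Longrightarrow> v \<in> CS n \<Longrightarrow> Ph xs v \<in> u_series (forms M U) n"
  using Ph_mem0[OF homog2] by (simp add: shifted_degree_2)

lemma Ph_form:
  assumes "biv xs" "v \<in> CS (int n)"
  shows "Ph xs v 0 \<in> forms M U n"
  using Ph_mem[OF assms] by (auto simp: u_series_def int_graded_def dest: spec[of _ 0])

lemma CS_zero: "0 \<in> CS n"
  by (simp add: u_series_def chains_zero_series)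

text \<open>By \<open>\<complex>[[u]]\<close>-linearity the constant coefficient in \<open>u\<close> of \<open>\<phi> w\<close> depends only on that of \<open>w\<close>. Hence all
  equations may be read modulo \<open>u\<close>.\<close>

lemma Ph_head:
  assumes xs: "biv xs" and w: "w \<in> CS (int n)"
  shows "Ph xs w 0 = Ph xs (u_const (w 0)) 0"
proof -
  let ?w = "\<lambda>k. w (Suc k)"
  have w': "?w \<in> CS (int n + 2)" unfolding u_series_def
  proof (intro CollectI allI)
    fix k
    have "w (Suc k) \<in> int_graded (chains M U) (int n + 2 * int (Suc k))" using w unfolding u_series_def by blast
    then show "w (Suc k) \<in> int_graded (chains M U) (int n + 2 + 2 * int k)" by (simp add: algebra_simps)
  qed
  have "w 0 \<in> int_graded (chains M U) (int n + 2 * int 0)" using w unfolding u_series_def by blast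
  then have w0: "w 0 \<in> chains M U n" by (simp add: int_graded_def)
  have um: "u_mult ?w \<in> CS (int n)" unfolding u_series_def
  proof (intro CollectI allI)
    fix k
    show "u_mult ?w k \<in> int_graded (chains M U) (int n + 2 * int k)"
      using spec[OF w[unfolded u_series_def, THEN CollectD], of k] chains_zero_series
      by (cases k) (simp_all add: u_mult_def del: of_nat_Suc)
  qed
  have "w = u_const (w 0) + u_mult ?w" by (auto simp: fun_eq_iff u_const_def u_mult_def)
  then have "Ph xs w = Ph xs (u_const (w 0)) + Ph xs (u_mult ?w)"
    using clinear_on_add[OF Ph_clinear[OF homog2[OF xs] w] u_const_series[OF w0] um] by simp
  also have "Ph xs (u_mult ?w) = u_mult (Ph xs ?w)" by (rule u_linear[OF w' homog2[OF xs]])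
  finally have e: "Ph xs w = Ph xs (u_const (w 0)) + u_mult (Ph xs ?w)" .
  show ?thesis unfolding e by (intro ext) (simp add: u_mult_def)
qed

lemma Ph_u_const_zero: "biv xs \<Longrightarrow> Ph xs (u_const 0) = 0"
proof -
  assume xs: "biv xs"
  have "u_const 0 = (0 :: nat \<Rightarrow> 'a list \<Rightarrow> complex)" by (auto simp: u_const_def fun_eq_iff)
  then show ?thesis using clinear_on_zero[OF Ph_clinear[OF homog2[OF xs] CS_zero] CS_zero] by simp
qed

text \<open>The components of \<open>\<phi>\<close> on chains of degree 0, modulo \<open>u\<close>, as operators on functions. For bivector fields \<open>xs\<close> the
  component has degree 0, so it maps functions to functions.\<close>

definition F :: "'a tensor list \<Rightarrow> ('a \<Rightarrow> complex) \<Rightarrow> 'a \<Rightarrow> complex"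
  where "F xs f = to_fun M U (Ph xs (u_const (tens [f])) 0)"

lemma u_const_tens1: "f \<in> X \<Longrightarrow> u_const (tens [f]) \<in> CS (int 0)"
  by (rule u_const_series[OF tens1_chain])

lemma u_const_tens2: "f \<in> X \<Longrightarrow> g \<in> X \<Longrightarrow> u_const (tens [f, g]) \<in> CS (int 1)"
  by (rule u_const_series[OF tens2_chain])

lemma F_form: "biv xs \<Longrightarrow> f \<in> X \<Longrightarrow> Ph xs (u_const (tens [f])) 0 \<in> forms M U 0"
  by (rule Ph_form[OF _ u_const_tens1])

lemma F_chart: "biv xs \<Longrightarrow> f \<in> X \<Longrightarrow> c \<in> atlas M \<Longrightarrow> p \<in> fst c \<Longrightarrow> Ph xs (u_const (tens [f])) 0 c p [] = F xs f p"
  unfolding F_def by (rule zero_form_chart[OF F_form, symmetric])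

lemma F_nil: "f \<in> X \<Longrightarrow> F [] f = f"
proof
  fix p assume f: "f \<in> X"
  show "F [] f p = f p"
  proof (cases "p \<in> U")
    case True
    then obtain c where c: "c \<in> atlas M" "p \<in> fst c" using atlas_cover by blast
    have "F [] f p = Ph [] (u_const (tens [f])) 0 c p []" by (rule F_chart[symmetric]) (use f c in auto)
    also have "\<dots> = connes_mu M U (tens [f]) c p []" by (simp add: phi_mu[OF u_const_tens1[OF f]])
    also have "\<dots> = f p" by (rule connes_mu_tens1[OF c])
    finally show ?thesis .
  next
    case False
    then show ?thesis using X_off[OF f False] by (simp add: F_def to_fun_def)
  qed
qed

text \<open>Locality is naturality of \<open>\<phi>\<close>: on \<open>V\<close> the value of \<open>\<phi>\<close> is determined by the restriction of the chain to \<open>V\<close>.\<close>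

lemma F_local_op:
  assumes xs: "biv xs"
  shows "local_op (F xs)"
  unfolding local_op_def
proof (intro conjI ballI allI impI)
  fix f g assume f: "f \<in> X" and g: "g \<in> X"
  show "F xs f \<in> X" unfolding F_def by (rule zero_form_X[OF F_form[OF xs f]])
  note cl = Ph_clinear[OF homog2[OF xs] u_const_tens1[OF f]]
  show "F xs (\<lambda>p. f p + g p) = (\<lambda>p. F xs f p + F xs g p)"
  proof -
    have "u_const (tens [\<lambda>p. f p + g p]) = u_const (tens [f]) + u_const (tens [g])"
      by (auto simp: fun_eq_iff u_const_def tens1_apply)
    then have "Ph xs (u_const (tens [\<lambda>p. f p + g p])) = Ph xs (u_const (tens [f])) + Ph xs (u_const (tens [g]))"
      using clinear_on_add[OF cl u_const_tens1[OF f] u_const_tens1[OF g]] by simp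
    then have e: "Ph xs (u_const (tens [\<lambda>p. f p + g p])) 0 = Ph xs (u_const (tens [f])) 0 + Ph xs (u_const (tens [g])) 0"
      by (simp only: plus_fun_apply)
    show ?thesis unfolding F_def e by (intro ext) (simp add: to_fun_def)
  qed
  show "F xs (\<lambda>p. k * f p) = (\<lambda>p. k * F xs f p)" for k
  proof -
    have "u_const (tens [\<lambda>p. k * f p]) = k *\<^sub>C u_const (tens [f]) + 0"
      by (auto simp: fun_eq_iff u_const_def tens1_apply)
    then have "Ph xs (u_const (tens [\<lambda>p. k * f p])) = k *\<^sub>C Ph xs (u_const (tens [f])) + Ph xs 0"
      using clinear_onD[OF cl u_const_tens1[OF f] CS_zero, of k] by simp
    moreover have "Ph xs 0 = 0" by (rule clinear_on_zero[OF cl CS_zero])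
    ultimately have e: "Ph xs (u_const (tens [\<lambda>p. k * f p])) 0 = k *\<^sub>C Ph xs (u_const (tens [f])) 0"
      by (simp only: plus_fun_apply zero_fun_apply add_0_right cfun_simps)
    show ?thesis unfolding F_def e by (intro ext) (simp add: to_fun_def)
  qed
  fix V p assume V: "openin (mtop M) V \<and> (\<forall>p\<in>V. f p = g p)" and p: "p \<in> V"
  then have Vo: "openin (mtop M) V" by simp
  have "res_pow V (tens [f]) = res_pow V (tens [g])"
    using V by (auto simp: res_pow_def fun_eq_iff tens1_apply length_Suc_conv)
  then have "(\<lambda>k. res_pow V (u_const (tens [f]) k)) = (\<lambda>k. res_pow V (u_const (tens [g]) k))"
    by (auto simp: fun_eq_iff u_const_def)
  then have eq: "(\<lambda>k. res_tensor V (Ph xs (u_const (tens [f])) k)) = (\<lambda>k. res_tensor V (Ph xs (u_const (tens [g])) k))"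
    using phi_res[OF u_const_tens1[OF f] Vo homog2[OF xs]] phi_res[OF u_const_tens1[OF g] Vo homog2[OF xs]] by simp
  have "p \<in> U" using Vo p openin_subset by blast
  then obtain c where c: "c \<in> atlas M" "p \<in> fst c" using atlas_cover by blast
  have "res_tensor V (Ph xs (u_const (tens [f])) 0) c p [] = res_tensor V (Ph xs (u_const (tens [g])) 0) c p []"
    using fun_cong[OF eq, of 0] by simp
  then show "F xs f p = F xs g p"
    using p by (simp add: res_tensor_def F_chart[OF xs f c] F_chart[OF xs g c])
qed

section \<open>The module equation on bivector fields\<close>

lemma nths_rep2: "nths (replicate (length xs) 2) S = replicate (length (nths xs S)) (2 :: nat)"
  using nths_replicate[of "length xs" "2 :: nat" S] length_nths_eq[of "replicate (length xs) (2 :: nat)" xs S] by simp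

text \<open>Modulo \<open>u\<close> the cyclic differential of \<open>f \<otimes> g\<close> is its Hochschild boundary, which vanishes; the higher
  structure maps contribute the commutators of the bidifferential operators \<open>K ys\<close>.\<close>

lemma CC_action_head:
  assumes xs: "biv xs" and ys: "biv ys" and f: "f \<in> X" and g: "g \<in> X"
  shows "Ph xs (CC_action U (K U) (replicate (length ys) 2) ys (u_const (tens [f, g]))) 0 =
    (if ys = [] then 0 else Ph xs (u_const (tens [comm (K U ys) f g])) 0)"
proof (cases "ys = []")
  case True
  have "Ph xs (CC_diff U (u_const (tens [f, g]))) 0 = Ph xs (u_const (CC_diff U (u_const (tens [f, g])) 0)) 0"
    by (rule Ph_head[OF xs, where n = 0]) (use CC_diff_tens2_series[OF f g] in simp)
  also have "\<dots> = 0" using Ph_u_const_zero[OF xs] by (simp add: CC_diff_tens2_0)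
  finally show ?thesis using True by (simp add: CC_action_def)
next
  case False
  have D: "K U ys \<in> multidiff M U 2" by (rule K_multidiff[OF ys False])
  have "(-1 :: complex) ^ sum_list (replicate (length ys) 2) = 1" by (simp add: sum_list_replicate)
  then have "CC_action U (K U) (replicate (length ys) 2) ys (u_const (tens [f, g])) =
      (\<lambda>k. lie_chain 2 (K U ys) (u_const (tens [f, g]) k))"
    using False by (simp add: CC_action_def out_index_2 cscale_one)
  also have "\<dots> = u_const (tens [comm (K U ys) f g])"
    by (auto simp: fun_eq_iff u_const_def lie_chain_tens2[OF D] lie_chain_zero[OF D])
  finally show ?thesis using False by simp
qed

lemma form_action_head:
  assumes l: "length ys = n"
  shows "form_action M U (replicate n 2) ys v 0 = (if n = 1 then lie_form M U 2 (hd ys) (v 0) else 0)"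
proof -
  consider "ys = []" | y where "ys = [y]" | y z zs where "ys = y # z # zs"
    by (cases ys rule: remdups_adj.cases) auto
  then show ?thesis
    by cases (use l in \<open>auto simp: form_action_def ud_def u_mult_def cscale_one\<close>)
qed

text \<open>The differential of multivector fields is 0, so only brackets of two arguments remain.\<close>

lemma source_terms_2:
  assumes xs: "biv xs" and v: "v \<in> CS n"
  shows "source_terms (\<lambda>d x. 0) (\<lambda>d e. SN U) (\<lambda>ys. Ph ys v) (replicate (length xs) 2) xs =
    (\<Sum>j<length xs. \<Sum>i<j. Ph (SN U (xs ! i) (xs ! j) # nths xs (- {i, j})) v)"
proof -
  have 1: "(\<Sum>i<length xs. koszul (replicate (length xs) 2) {i} *\<^sub>C Ph (0 # nths xs (- {i})) v) = 0"
    by (intro sum.neutral ballI) (simp add: Ph_zero_first[OF biv_nths[OF xs] v] fun_eq_iff)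
  have 2: "(\<Sum>j<length xs. \<Sum>i<j. koszul (replicate (length xs) 2) {i, j} *\<^sub>C
       Ph (q2 (\<lambda>d e. SN U) (replicate (length xs) 2 ! i) (replicate (length xs) 2 ! j) (xs ! i) (xs ! j) # nths xs (- {i, j})) v) =
     (\<Sum>j<length xs. \<Sum>i<j. Ph (SN U (xs ! i) (xs ! j) # nths xs (- {i, j})) v)"
  proof (rule sum.cong[OF refl], rule sum.cong[OF refl])
    fix j i assume "j \<in> {..<length xs}" "i \<in> {..<j}"
    then have ij: "i < length xs" "j < length xs" by auto
    then have "koszul (replicate (length xs) 2) {i, j} = 1" by (intro koszul_even) auto
    then show "koszul (replicate (length xs) 2) {i, j} *\<^sub>C
       Ph (q2 (\<lambda>d e. SN U) (replicate (length xs) 2 ! i) (replicate (length xs) 2 ! j) (xs ! i) (xs ! j) # nths xs (- {i, j})) v =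
       Ph (SN U (xs ! i) (xs ! j) # nths xs (- {i, j})) v"
      using ij by (simp add: q2_def cscale_one)
  qed
  show ?thesis unfolding source_terms_def 1 2 by simp
qed

text \<open>The module equation of \<open>\<phi>\<close> at \<open>f \<otimes> g\<close> and bivector fields \<open>xs\<close>, modulo \<open>u\<close>. On the side of forms \<open>ud\<close> vanishes
  modulo \<open>u\<close> and only the strict action \<open>L\<^sub>x\<close> is left; on the side of chains only commutators are left.\<close>

lemma module_equation_bivectors:
  assumes xs: "biv xs" and f: "f \<in> X" and g: "g \<in> X"
  defines "v \<equiv> u_const (tens [f, g])"
  shows "(\<Sum>S\<in>Pow {..<length xs}. if length (nths xs S) = 1
        then lie_form M U 2 (hd (nths xs S)) (Ph (nths xs (- S)) v 0) c p J else 0) =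
    (\<Sum>j<length xs. \<Sum>i<j. Ph (SN U (xs ! i) (xs ! j) # nths xs (- {i, j})) v 0 c p J) +
    (\<Sum>S\<in>Pow {..<length xs}. if nths xs (- S) = [] then 0
        else Ph (nths xs S) (u_const (tens [comm (K U (nths xs (- S))) f g])) 0 c p J)"
proof -
  let ?ds = "replicate (length xs) (2 :: nat)"
  have v: "v \<in> CS (int 1)" unfolding v_def by (rule u_const_tens2[OF f g])
  note eq = Ph_eq[OF homog2[OF xs] v, unfolded source_terms_2[OF xs v]]
  have "(\<Sum>S\<in>Pow {..<length xs}. koszul ?ds S *\<^sub>C form_action M U (nths ?ds S) (nths xs S) (Ph (nths xs (- S)) v)) 0 c p J =
     ((\<Sum>j<length xs. \<Sum>i<j. Ph (SN U (xs ! i) (xs ! j) # nths xs (- {i, j})) v) +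
     (\<Sum>S\<in>Pow {..<length xs}. koszul ?ds S *\<^sub>C (-1) ^ sum_list (nths ?ds S) *\<^sub>C
               Ph (nths xs S) (CC_action U (K U) (nths ?ds (- S)) (nths xs (- S)) v))) 0 c p J"
    using eq by simp
  moreover have "(koszul ?ds S *\<^sub>C form_action M U (nths ?ds S) (nths xs S) (Ph (nths xs (- S)) v)) 0 c p J =
      (if length (nths xs S) = 1 then lie_form M U 2 (hd (nths xs S)) (Ph (nths xs (- S)) v 0) c p J else 0)"
    if "S \<in> Pow {..<length xs}" for S
  proof -
    have k: "koszul ?ds S = 1" by (rule koszul_even) (use that in auto)
    have fh: "form_action M U (nths ?ds S) (nths xs S) (Ph (nths xs (- S)) v) 0 =
        (if length (nths xs S) = 1 then lie_form M U 2 (hd (nths xs S)) (Ph (nths xs (- S)) v 0) else 0)"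
      unfolding nths_rep2 by (rule form_action_head[OF refl])
    show ?thesis unfolding k cscale_one fh by simp
  qed
  moreover have "(koszul ?ds S *\<^sub>C (-1) ^ sum_list (nths ?ds S) *\<^sub>C
               Ph (nths xs S) (CC_action U (K U) (nths ?ds (- S)) (nths xs (- S)) v)) 0 c p J =
      (if nths xs (- S) = [] then 0
        else Ph (nths xs S) (u_const (tens [comm (K U (nths xs (- S))) f g])) 0 c p J)"
    if "S \<in> Pow {..<length xs}" for S
  proof -
    have k: "koszul ?ds S = 1" by (rule koszul_even) (use that in auto)
    have s: "(-1 :: complex) ^ sum_list (nths ?ds S) = 1" unfolding nths_rep2 by (simp add: sum_list_replicate)
    have h: "Ph (nths xs S) (CC_action U (K U) (nths ?ds (- S)) (nths xs (- S)) v) 0 =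
        (if nths xs (- S) = [] then 0 else Ph (nths xs S) (u_const (tens [comm (K U (nths xs (- S))) f g])) 0)"
      unfolding nths_rep2 v_def by (rule CC_action_head[OF biv_nths[OF xs] biv_nths[OF xs] f g])
    show ?thesis unfolding k s cscale_one h by simp
  qed
  ultimately show ?thesis by (simp add: sum_fun_app)
qed

end

context smfd
begin

section \<open>Lie derivative of one-forms\<close>

text \<open>The Lie derivative along a bivector field \<open>x\<close> of a one-form \<open>T\<close>, which is a function: up to factors it is
  the contraction of \<open>x\<close> with \<open>dT\<close>.\<close>

definition lie_one :: "'a tensor \<Rightarrow> 'a tensor \<Rightarrow> 'a chart \<Rightarrow> 'a \<Rightarrow> complex"
  where "lie_one x T c p = lie_form M (pts M) 2 x T c p []"

lemma multi_idx_2: "multi_idx M 2 = (\<lambda>(i, j). [i, j]) ` (I \<times> I)"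
  by (auto simp: multi_idx_def numeral_2_eq_2 length_Suc_conv image_iff)

lemma sum_multi_idx_2: "(\<Sum>J\<in>multi_idx M 2. h J) = (\<Sum>i<mdim M. \<Sum>j<mdim M. h [i, j])"
  unfolding multi_idx_2 by (subst sum.reindex) (auto simp: inj_on_def sum.cartesian_product case_prod_unfold)

lemma dform_pair:
  assumes "c \<in> atlas M" "p \<in> fst c" "i < mdim M" "j < mdim M"
  shows "dform M (pts M) T c p [i, j] = cpd c i (\<lambda>q. T c q [j]) p - cpd c j (\<lambda>q. T c q [i]) p"
proof -
  have "in_range M (pts M) c p [i, j]" using assms dom_pts by (auto simp: in_range_def)
  then show ?thesis by (simp add: dform_def)
qed

lemma lie_one_eq:
  assumes c: "c \<in> atlas M" "p \<in> fst c"
  shows "lie_one x T c p = (\<Sum>i<mdim M. \<Sum>j<mdim M. x c p [i, j] *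
    (cpd c j (\<lambda>q. T c q [i]) p - cpd c i (\<lambda>q. T c q [j]) p)) / 2"
proof -
  have "dform M (pts M) (contract M 2 x T) c p [] = 0" by (simp add: dform_def)
  then have "lie_one x T c p = (\<Sum>J\<in>multi_idx M 2. x c p J * dform M (pts M) T c p (rev J)) / 2"
    by (simp add: lie_one_def lie_form_def contract_def)
  then show ?thesis unfolding sum_multi_idx_2 by (simp add: dform_pair[OF c])
qed

lemma lie_one_cong:
  assumes c: "c \<in> atlas M" "p \<in> fst c" and V: "openin (mtop M) V" "p \<in> V"
    and eq: "\<And>q i. q \<in> fst c \<Longrightarrow> q \<in> V \<Longrightarrow> i < mdim M \<Longrightarrow> T c q [i] = T' c q [i]"
  shows "lie_one x T c p = lie_one x T' c p"
proof -
  have "cpd c i (\<lambda>q. T c q [j]) p = cpd c i (\<lambda>q. T' c q [j]) p" if "i < mdim M" "j < mdim M" for i j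
    by (rule cpd_cong[OF c(1) V(1) c(2) V(2) that(1)]) (use eq that in auto)
  then show ?thesis unfolding lie_one_eq[OF c] by simp
qed

lemma lie_one_sum:
  assumes c: "c \<in> atlas M" "p \<in> fst c"
    and T: "\<And>j i. j \<in> A \<Longrightarrow> i < mdim M \<Longrightarrow> chart_smooth c (pts M) (\<lambda>q. T j c q [i])"
  shows "lie_one x (\<lambda>c p J. \<Sum>j\<in>A. r j * T j c p J) c p = (\<Sum>j\<in>A. r j * lie_one x (T j) c p)"
proof -
  note pU = dom_pts[OF c]
  have d: "cpd c k (\<lambda>q. \<Sum>j\<in>A. r j * T j c q [i]) p = (\<Sum>j\<in>A. r j * cpd c k (\<lambda>q. T j c q [i]) p)"
    if ki: "k < mdim M" "i < mdim M" for k i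
  proof -
    have "cpd c k (\<lambda>q. \<Sum>j\<in>A. r j * T j c q [i]) p = (\<Sum>j\<in>A. cpd c k (\<lambda>q. r j * T j c q [i]) p)"
      by (rule cpd_sum[OF c(1) pts_open _ ki(1) c(2) pU])
        (intro chart_smooth_mult[OF c(1) pts_open] chart_smooth_const T ki(2))
    also have "\<dots> = (\<Sum>j\<in>A. r j * cpd c k (\<lambda>q. T j c q [i]) p)"
      by (intro sum.cong refl cpd_cmult[OF c(1) T ki(1) c(2) pU] ki(2))
    finally show ?thesis .
  qed
  have "lie_one x (\<lambda>c p J. \<Sum>j\<in>A. r j * T j c p J) c p = (\<Sum>i<mdim M. \<Sum>k<mdim M. x c p [i, k] *
      ((\<Sum>j\<in>A. r j * cpd c k (\<lambda>q. T j c q [i]) p) - (\<Sum>j\<in>A. r j * cpd c i (\<lambda>q. T j c q [k]) p))) / 2"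
    unfolding lie_one_eq[OF c] by (simp add: d)
  also have "\<dots> = (\<Sum>i<mdim M. \<Sum>k<mdim M. \<Sum>j\<in>A. r j * (x c p [i, k] *
      (cpd c k (\<lambda>q. T j c q [i]) p - cpd c i (\<lambda>q. T j c q [k]) p) / 2))"
    by (simp add: sum_subtractf[symmetric] sum_distrib_left sum_divide_distrib right_diff_distrib mult_ac)
  also have "\<dots> = (\<Sum>i<mdim M. \<Sum>j\<in>A. \<Sum>k<mdim M. r j * (x c p [i, k] *
      (cpd c k (\<lambda>q. T j c q [i]) p - cpd c i (\<lambda>q. T j c q [k]) p) / 2))"
    by (rule sum.cong[OF refl], rule sum.swap)
  also have "\<dots> = (\<Sum>j\<in>A. \<Sum>i<mdim M. \<Sum>k<mdim M. r j * (x c p [i, k] *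
      (cpd c k (\<lambda>q. T j c q [i]) p - cpd c i (\<lambda>q. T j c q [k]) p) / 2))"
    by (rule sum.swap)
  also have "\<dots> = (\<Sum>j\<in>A. r j * lie_one x (T j) c p)"
    unfolding lie_one_eq[OF c] by (simp add: sum_distrib_left sum_divide_distrib)
  finally show ?thesis .
qed

lemma forms_sum:
  assumes "finite A" "\<And>j. j \<in> A \<Longrightarrow> T j \<in> forms M (pts M) d"
  shows "(\<lambda>c p J. \<Sum>j\<in>A. r j * T j c p J) \<in> forms M (pts M) d"
  using assms
proof (induction A rule: finite_induct)
  case empty
  then show ?case using forms_zero[of "pts M" d] by (simp add: zero_fun_def)
next
  case (insert j A)
  have "r j *\<^sub>C T j + (\<lambda>c p J. \<Sum>j\<in>A. r j * T j c p J) \<in> forms M (pts M) d"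
    by (rule forms_lincomb[OF pts_open]) (use insert in auto)
  moreover have "r j *\<^sub>C T j + (\<lambda>c p J. \<Sum>j\<in>A. r j * T j c p J) = (\<lambda>c p J. \<Sum>j\<in>insert j A. r j * T j c p J)"
    using insert.hyps by (simp add: fun_eq_iff)
  ultimately show ?case by simp
qed

lemma dprod_pair:
  assumes c: "c \<in> atlas M" "p \<in> fst c" and ij: "i < mdim M" "j < mdim M"
  shows "dprod M (pts M) [f, g] c p [i, j] = dform M (pts M) (of_fun M (pts M) f) c p [i] * dform M (pts M) (of_fun M (pts M) g) c p [j]
    - dform M (pts M) (of_fun M (pts M) f) c p [j] * dform M (pts M) (of_fun M (pts M) g) c p [i]"
proof -
  have nil: "dform M (pts M) T c p [] = 0" for T by (simp add: dform_def)
  have one: "of_fun M (pts M) (\<lambda>_. 1) c p [] = 1" using c dom_pts by (auto simp: of_fun_def in_range_def)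
  have k1: "koszul [Suc 0] {0} = 1" by (simp add: koszul_def)
  have "{..<0} - {0} = ({} :: nat set)" "{..<Suc 0} - {Suc 0} = {0}" by auto
  then have k2: "koszul [Suc 0, Suc 0] {0} = 1" "koszul [Suc 0, Suc 0] {Suc 0} = -1" by (simp_all add: koszul_def)
  have s: "{k. Suc k \<in> {0}} = {}" "{k. Suc k \<noteq> 0} = UNIV" "{k. k \<noteq> 0 \<and> Suc k \<noteq> 0} = {k. k \<noteq> 0}" by auto
  have w1: "dprod M (pts M) [g] c p [j] = dform M (pts M) (of_fun M (pts M) g) c p [j]" for j g
    by (simp add: wedge_def sum_Pow_Suc nil nths_Cons k1 one)
  have w0: "dprod M (pts M) [g] c p [] = 0" for g by (simp add: wedge_def nil)
  have "dprod M (pts M) [f, g] c p [i, j] = wedge (dform M (pts M) (of_fun M (pts M) f)) (dprod M (pts M) [g]) c p [i, j]"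
    by simp
  also have "\<dots> = dform M (pts M) (of_fun M (pts M) f) c p [i] * dprod M (pts M) [g] c p [j]
    - dform M (pts M) (of_fun M (pts M) f) c p [j] * dprod M (pts M) [g] c p [i]"
    unfolding wedge_def by (simp add: sum_Pow_Suc nil w0 nths_Cons k2 s del: dprod.simps)
  finally show ?thesis unfolding w1 .
qed

lemma pairing_antisym:
  "pairing M (pts M) 2 x (dprod M (pts M) [g, f]) p = - pairing M (pts M) 2 x (dprod M (pts M) [f, g]) p"
proof (cases "p \<in> pts M")
  case True
  let ?c = "SOME c. c \<in> atlas M \<and> p \<in> fst c"
  obtain c0 where "c0 \<in> atlas M" "p \<in> fst c0" using atlas_cover[OF True] by (elim bexE)
  then have s: "?c \<in> atlas M \<and> p \<in> fst ?c" by (intro someI[where P = "\<lambda>c. c \<in> atlas M \<and> p \<in> fst c"]) simp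
  have "dprod M (pts M) [g, f] ?c p [j, i] = - dprod M (pts M) [f, g] ?c p [j, i]" if "i < mdim M" "j < mdim M" for i j
    unfolding dprod_pair[OF conjunct1[OF s] conjunct2[OF s] that(2,1)] by (simp add: mult.commute)
  then have "contract M 2 x (dprod M (pts M) [g, f]) ?c p [] = - contract M 2 x (dprod M (pts M) [f, g]) ?c p []"
    unfolding contract_def sum_multi_idx_2 by (simp add: sum_negf del: dprod.simps)
  then show ?thesis by (simp add: pairing_def to_fun_def del: dprod.simps)
next
  case False
  then show ?thesis by (simp add: pairing_def to_fun_def del: dprod.simps)
qed

end

context formality
begin

text \<open>The one-form \<open>f dg\<close>.\<close>

definition mu :: "('a \<Rightarrow> complex) \<Rightarrow> ('a \<Rightarrow> complex) \<Rightarrow> 'a tensor"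
  where "mu f g = connes_mu M U (tens [f, g])"

lemma Ph_nil: "f \<in> X \<Longrightarrow> g \<in> X \<Longrightarrow> Ph [] (u_const (tens [f, g])) 0 = mu f g"
  by (simp add: mu_def phi_mu[OF u_const_tens2])

lemma mu_form: "f \<in> X \<Longrightarrow> g \<in> X \<Longrightarrow> mu f g \<in> forms M U 1"
  using Ph_form[OF _ u_const_tens2, of "[]" f g] by (simp add: Ph_nil)

lemma mu_apply: "c \<in> atlas M \<Longrightarrow> p \<in> fst c \<Longrightarrow> i < mdim M \<Longrightarrow> g \<in> X \<Longrightarrow> mu f g c p [i] = f p * cpd c i g p"
  unfolding mu_def by (rule connes_mu_tens2)

lemma comm_K_single:
  assumes "x \<in> mvf M U 2" "f \<in> X" "g \<in> X"
  shows "comm (K U [x]) f g p = 2 * pairing M U 2 x (dprod M U [f, g]) p"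
  unfolding comm_def K_single[OF assms] K_single[OF assms(1,3,2)] pairing_antisym[of x g f] by simp

text \<open>This is the module equation for a single argument \<open>x\<close>, where \<open>\<phi>\<^sub>0 = \<mu>\<close> occurs on both sides and where
  \<open>K\<^sub>1(x)\<close> is the bidifferential operator of the bracket; the factor 2 comes from the
  commutator of an antisymmetric operator.\<close>

lemma lie_one_mu:
  assumes x: "x \<in> mvf M U 2" and f: "f \<in> X" and g: "g \<in> X" and c: "c \<in> atlas M" "p \<in> fst c"
  shows "lie_one x (mu f g) c p = 2 * pairing M U 2 x (dprod M U [f, g]) p"
proof -
  have bx: "biv [x]" using x by simp
  have D: "K U [x] \<in> multidiff M U 2" by (rule K_multidiff[OF bx]) simp
  have P: "Pow {..<length [x]} = {{}, {0}}" by (auto simp: lessThan_Suc)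
  have n: "nths [x] (- {0}) = []" "nths [x] (- {}) = [x]" "nths [x] {0} = [x]" "nths [x] {} = []"
    by (simp_all add: nths_Cons)
  have "lie_form M U 2 x (Ph [] (u_const (tens [f, g])) 0) c p [] = Ph [] (u_const (tens [comm (K U [x]) f g])) 0 c p []"
    using module_equation_bivectors[OF bx f g, of c p "[]"] unfolding P by (simp add: n)
  also have "\<dots> = F [] (comm (K U [x]) f g) p"
    by (rule F_chart[OF _ comm_X[OF D f g] c]) simp
  also have "\<dots> = comm (K U [x]) f g p" by (simp add: F_nil[OF comm_X[OF D f g]])
  finally show ?thesis unfolding Ph_nil[OF f g] lie_one_def comm_K_single[OF x f g] .
qed

section \<open>Summation over the Maurer--Cartan element\<close>

text \<open>The coefficient of \<open>t\<^sup>m\<close> in \<open>\<Sum>\<^sub>n \<phi>\<^sub>n(\<pi>, \<dots>, \<pi>; f)/n!\<close>. Likewise \<open>star_comm\<close> gives the commutator for the star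
  product, whose term of order 0 is 0 by commutativity, and \<open>Omega\<close> the one-form assigned to \<open>f \<otimes> g\<close>.\<close>

definition Psi :: "nat \<Rightarrow> ('a \<Rightarrow> complex) \<Rightarrow> 'a \<Rightarrow> complex"
  where "Psi m f p = comp_sum m (\<lambda>ks. F (map \<pi> ks) f p)"

definition star_comm :: "nat \<Rightarrow> ('a \<Rightarrow> complex) \<Rightarrow> ('a \<Rightarrow> complex) \<Rightarrow> 'a \<Rightarrow> complex"
  where "star_comm m f g p = (if m = 0 then 0 else comp_sum m (\<lambda>ks. comm (K U (map \<pi> ks)) f g p))"

definition Omega :: "nat \<Rightarrow> ('a \<Rightarrow> complex) \<Rightarrow> ('a \<Rightarrow> complex) \<Rightarrow> 'a tensor"
  where "Omega m f g c p J = comp_sum m (\<lambda>ks. Ph (map \<pi> ks) (u_const (tens [f, g])) 0 c p J)"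

lemma biv_map: "biv (map \<pi> ks)"
  using pi_mem by auto

lemma comp_sum_alt: "comp_sum m h = (\<Sum>ks\<in>compositions m. (1 / fact (length ks)) * h ks)"
  by (simp add: comp_sum_def)

lemma comp_sum_0: "comp_sum 0 h = h []"
  by (simp add: comp_sum_def compositions_0)

lemma Omega_0: "f \<in> X \<Longrightarrow> g \<in> X \<Longrightarrow> Omega 0 f g = mu f g"
  by (simp add: Omega_def fun_eq_iff comp_sum_0 Ph_nil)

lemma Omega_form: "f \<in> X \<Longrightarrow> g \<in> X \<Longrightarrow> Omega m f g \<in> forms M U 1"
proof -
  assume f: "f \<in> X" and g: "g \<in> X"
  have "(\<lambda>c p J. \<Sum>ks\<in>compositions m. (1 / fact (length ks)) * Ph (map \<pi> ks) (u_const (tens [f, g])) 0 c p J) \<in> forms M U 1"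
    by (rule forms_sum[OF finite_compositions]) (rule Ph_form[OF biv_map u_const_tens2[OF f g]])
  then show ?thesis unfolding Omega_def[abs_def] comp_sum_alt .
qed

lemma Psi_op_series: "op_series Psi"
  unfolding op_series_def
proof (intro conjI allI ballI)
  show "Psi 0 f = f" if "f \<in> X" for f using that by (simp add: Psi_def[abs_def] comp_sum_0 F_nil)
  fix m
  have "local_op (\<lambda>f p. (1 / fact (length ks)) * (\<Sum>j\<in>{()}. F (map \<pi> ks) f p))" for ks
    by (rule local_op_lincomb) (rule F_local_op[OF biv_map])
  then have "local_op (\<lambda>f p. (1 / fact (length ks)) * F (map \<pi> ks) f p)" for ks by simp
  then have "local_op (\<lambda>f p. 1 * (\<Sum>ks\<in>compositions m. (1 / fact (length ks)) * F (map \<pi> ks) f p))"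
    by (rule local_op_lincomb)
  moreover have "(\<lambda>f p. 1 * (\<Sum>ks\<in>compositions m. (1 / fact (length ks)) * F (map \<pi> ks) f p)) = Psi m"
    by (simp add: fun_eq_iff Psi_def comp_sum_def)
  ultimately show "local_op (Psi m)" by simp
qed

lemma comm_K_X: "f \<in> X \<Longrightarrow> g \<in> X \<Longrightarrow> ks \<noteq> [] \<Longrightarrow> comm (K U (map \<pi> ks)) f g \<in> X"
  by (intro comm_X K_multidiff biv_map) auto

lemma compositions_ne: "m \<noteq> 0 \<Longrightarrow> ks \<in> compositions m \<Longrightarrow> ks \<noteq> []"
  by (auto simp: compositions_def)

lemma star_comm_X:
  assumes "f \<in> X" "g \<in> X"
  shows "star_comm m f g \<in> X"
proof (cases "m = 0")
  case True
  then show ?thesis by (simp add: star_comm_def[abs_def] X_zero)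
next
  case False
  have "(\<lambda>p. \<Sum>ks\<in>compositions m. (1 / fact (length ks)) * comm (K U (map \<pi> ks)) f g p) \<in> X"
    by (intro X_sum X_cmult comm_K_X assms compositions_ne[OF False])
  then show ?thesis using False by (simp add: star_comm_def[abs_def] comp_sum_alt)
qed

lemma comp_sum_len1:
  "comp_sum i (\<lambda>ks. if length ks = 1 then T (hd ks) else 0) = (if i = 0 then 0 else T (i - 1))"
proof (cases "i = 0")
  case True
  then show ?thesis by (simp add: comp_sum_0)
next
  case False
  have "(\<Sum>ks\<in>compositions i. (if length ks = 1 then T (hd ks) else 0) / fact (length ks)) =
      (\<Sum>ks\<in>{[i - 1]}. (if length ks = 1 then T (hd ks) else 0) / fact (length ks))"
  proof (rule sum.mono_neutral_right)
    show "\<forall>ks\<in>compositions i - {[i - 1]}. (if length ks = 1 then T (hd ks) else 0) / fact (length ks) = 0"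
      by (auto simp: compositions_def length_Suc_conv)
    show "{[i - 1]} \<subseteq> compositions i" using False by (auto simp: compositions_def)
  qed (rule finite_compositions)
  then show ?thesis using False by (simp add: comp_sum_def)
qed

text \<open>The double sum over the indices of the two arguments of the bracket collects, in each order, a
  coefficient of \<open>[\<pi>, \<pi>]\<close>, which is 0.\<close>

lemma MC_sum:
  assumes v: "v \<in> CS n"
  shows "(\<Sum>ks\<in>compositions i. (if length ks = 2 then Ph (SN U (\<pi> (ks ! 0)) (\<pi> (ks ! 1)) # map \<pi> k2) v 0 c p J else 0) / fact (length ks)) = 0"
    (is "(\<Sum>ks\<in>compositions i. ?h ks) = 0")
proof -
  let ?L = "\<lambda>y. Ph (y # map \<pi> k2) v"
  have lin: "clinear_on (mvf M U 3) ?L"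
    by (rule Ph_first_clinear[OF homog32[OF SN_mem[OF pi_mem pi_mem, of 0 0] biv_map] v])
  show ?thesis
  proof (cases "i \<ge> 2")
    case False
    have "length ks \<noteq> 2" if "ks \<in> compositions i" for ks
      using length_le_weight[of ks] False that by (auto simp: compositions_def)
    then show ?thesis by (intro sum.neutral ballI) simp
  next
    case True
    let ?A = "(\<lambda>a. [a, i - 2 - a]) ` {..i - 2}"
    have "(\<Sum>ks\<in>compositions i. ?h ks) = (\<Sum>ks\<in>?A. ?h ks)"
    proof (rule sum.mono_neutral_right)
      show "?A \<subseteq> compositions i" using True by (auto simp: compositions_def)
      show "\<forall>ks\<in>compositions i - ?A. ?h ks = 0"
      proof
        fix ks assume ks: "ks \<in> compositions i - ?A"
        have "length ks \<noteq> 2"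
        proof
          assume "length ks = 2"
          then obtain a b where ab: "ks = [a, b]" by (auto simp: numeral_2_eq_2 length_Suc_conv)
          then have "a + b + 2 = i" using ks by (auto simp: compositions_def)
          then have "a \<le> i - 2" "b = i - 2 - a" by auto
          then have "ks \<in> ?A" using ab by (intro image_eqI[of _ _ a]) auto
          then show False using ks by simp
        qed
        then show "?h ks = 0" by simp
      qed
    qed (rule finite_compositions)
    also have "\<dots> = (\<Sum>a\<le>i - 2. ?L (SN U (\<pi> a) (\<pi> (i - 2 - a))) 0 c p J / 2)"
      by (subst sum.reindex) (auto simp: inj_on_def)
    also have "\<dots> = (\<Sum>a\<le>i - 2. ?L (SN U (\<pi> a) (\<pi> (i - 2 - a)))) 0 c p J / 2"
      by (simp add: sum_fun_app sum_divide_distrib)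
    also have "(\<Sum>a\<le>i - 2. ?L (SN U (\<pi> a) (\<pi> (i - 2 - a)))) = ?L (\<Sum>a\<le>i - 2. SN U (\<pi> a) (\<pi> (i - 2 - a)))"
      by (rule clinear_on_sum[OF lin mvf_zero mvf_add[OF pts_open], THEN conjunct2, symmetric])
        (use SN_mem[OF pi_mem pi_mem] in auto)
    also have "\<dots> = 0" unfolding pi_MC by (rule clinear_on_zero[OF lin mvf_zero])
    finally show ?thesis by simp
  qed
qed

lemma comp_sum_swap: "comp_sum i (\<lambda>k1. comp_sum j (\<lambda>k2. H k1 k2)) = comp_sum j (\<lambda>k2. comp_sum i (\<lambda>k1. H k1 k2))"
  unfolding comp_sum_def sum_divide_distrib by (subst sum.swap) (simp add: mult.commute divide_divide_eq_left)

text \<open>The module equations summed over all \<open>(\<pi>\<^sub>k\<^sub>1, \<dots>, \<pi>\<^sub>k\<^sub>n)\<close> of total weight \<open>m\<close>. The functions \<open>H1\<close>, \<open>H2\<close>, \<open>H3\<close> are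
  the Lie derivative, bracket and commutator terms; \<open>comp_sum_split\<close> factors each sum, and the bracket
  terms cancel by the Maurer--Cartan equation. The shift in \<open>m - 1 - a\<close> is due to \<open>\<pi> a\<close> being the coefficient of
  \<open>t\<^sup>a\<^sup>+\<^sup>1\<close>.\<close>

lemma Psi_star_comm:
  assumes f: "f \<in> X" and g: "g \<in> X" and c: "c \<in> atlas M" "p \<in> fst c"
  shows "(\<Sum>i\<le>m. Psi i (star_comm (m - i) f g) p) = (\<Sum>a<m. lie_one (\<pi> a) (Omega (m - 1 - a) f g) c p)"
proof -
  define v where "v = u_const (tens [f, g])"
  have v: "v \<in> CS (int 1)" unfolding v_def by (rule u_const_tens2[OF f g])
  define H1 where "H1 k1 k2 = (if length k1 = 1 then lie_one (\<pi> (hd k1)) (Ph (map \<pi> k2) v 0) c p else 0)" for k1 k2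
  define H2 where "H2 k1 k2 = (if length k1 = 2 then Ph (SN U (\<pi> (k1 ! 0)) (\<pi> (k1 ! 1)) # map \<pi> k2) v 0 c p [] else 0)"
    for k1 k2
  define H3 where "H3 k1 k2 = (if k2 = [] then 0 else F (map \<pi> k1) (comm (K U (map \<pi> k2)) f g) p)" for k1 k2
  have id: "(\<Sum>S\<in>Pow {..<length ks}. H1 (nths ks S) (nths ks (- S))) =
      (\<Sum>S\<in>Pow {..<length ks}. H2 (nths ks S) (nths ks (- S))) + (\<Sum>S\<in>Pow {..<length ks}. H3 (nths ks S) (nths ks (- S)))" for ks
  proof -
    have l: "(\<Sum>S\<in>Pow {..<length (map \<pi> ks)}. if length (nths (map \<pi> ks) S) = 1
        then lie_form M U 2 (hd (nths (map \<pi> ks) S)) (Ph (nths (map \<pi> ks) (- S)) v 0) c p [] else 0) =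
      (\<Sum>S\<in>Pow {..<length ks}. H1 (nths ks S) (nths ks (- S)))"
    proof (rule sum.cong)
      fix S
      show "(if length (nths (map \<pi> ks) S) = 1
        then lie_form M U 2 (hd (nths (map \<pi> ks) S)) (Ph (nths (map \<pi> ks) (- S)) v 0) c p [] else 0) = H1 (nths ks S) (nths ks (- S))"
        by (cases "nths ks S") (auto simp: H1_def lie_one_def nths_map)
    qed simp
    have r1: "(\<Sum>j<length (map \<pi> ks). \<Sum>i<j. Ph (SN U (map \<pi> ks ! i) (map \<pi> ks ! j) # nths (map \<pi> ks) (- {i, j})) v 0 c p []) =
      (\<Sum>S\<in>Pow {..<length ks}. H2 (nths ks S) (nths ks (- S)))"
    proof -
      have "(\<Sum>S\<in>Pow {..<length ks}. H2 (nths ks S) (nths ks (- S))) = (\<Sum>j<length ks. \<Sum>i<j. H2 [ks ! i, ks ! j] (nths ks (- {i, j})))"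
        by (rule sum_pairs) (simp add: H2_def)
      then show ?thesis by (simp add: H2_def nths_map)
    qed
    have r2: "(\<Sum>S\<in>Pow {..<length (map \<pi> ks)}. if nths (map \<pi> ks) (- S) = [] then 0
        else Ph (nths (map \<pi> ks) S) (u_const (tens [comm (K U (nths (map \<pi> ks) (- S))) f g])) 0 c p []) =
      (\<Sum>S\<in>Pow {..<length ks}. H3 (nths ks S) (nths ks (- S)))"
    proof (rule sum.cong)
      fix S
      show "(if nths (map \<pi> ks) (- S) = [] then 0
        else Ph (nths (map \<pi> ks) S) (u_const (tens [comm (K U (nths (map \<pi> ks) (- S))) f g])) 0 c p []) = H3 (nths ks S) (nths ks (- S))"
      proof (cases "nths ks (- S) = []")
        case False
        show ?thesis using False by (simp add: H3_def nths_map F_chart[OF biv_map comm_K_X[OF f g False] c])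
      qed (simp add: H3_def nths_map)
    qed simp
    show ?thesis
      using module_equation_bivectors[OF biv_map f g, of ks c p "[]", folded v_def] unfolding l r1 r2 .
  qed
  have "comp_sum m (\<lambda>ks. \<Sum>S\<in>Pow {..<length ks}. H1 (nths ks S) (nths ks (- S))) =
      comp_sum m (\<lambda>ks. \<Sum>S\<in>Pow {..<length ks}. H2 (nths ks S) (nths ks (- S))) +
      comp_sum m (\<lambda>ks. \<Sum>S\<in>Pow {..<length ks}. H3 (nths ks S) (nths ks (- S)))"
    unfolding id by (simp add: comp_sum_def add_divide_distrib sum.distrib)
  then have eq: "(\<Sum>i\<le>m. comp_sum i (\<lambda>k1. comp_sum (m - i) (H1 k1))) =
      (\<Sum>i\<le>m. comp_sum i (\<lambda>k1. comp_sum (m - i) (H2 k1))) + (\<Sum>i\<le>m. comp_sum i (\<lambda>k1. comp_sum (m - i) (H3 k1)))"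
    unfolding comp_sum_split .
  have e2: "comp_sum i (\<lambda>k1. comp_sum (m - i) (H2 k1)) = 0" for i
  proof -
    have "comp_sum i (\<lambda>k1. H2 k1 k2) = 0" for k2
      unfolding comp_sum_def H2_def by (rule MC_sum[OF v])
    then show ?thesis by (subst comp_sum_swap) (simp add: comp_sum_def)
  qed
  have e1: "comp_sum i (\<lambda>k1. comp_sum (m - i) (H1 k1)) = (if i = 0 then 0 else lie_one (\<pi> (i - 1)) (Omega (m - i) f g) c p)" for i
  proof -
    have "comp_sum (m - i) (H1 k1) = (if length k1 = 1 then lie_one (\<pi> (hd k1)) (Omega (m - i) f g) c p else 0)" for k1
    proof (cases "length k1 = 1")
      case True
      have "lie_one (\<pi> (hd k1)) (\<lambda>c p J. \<Sum>ks\<in>compositions (m - i). (1 / fact (length ks)) * Ph (map \<pi> ks) v 0 c p J) c p =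
          (\<Sum>ks\<in>compositions (m - i). (1 / fact (length ks)) * lie_one (\<pi> (hd k1)) (Ph (map \<pi> ks) v 0) c p)"
        by (rule lie_one_sum[OF c]) (rule one_form_chart_smooth[OF Ph_form[OF biv_map v] c(1)])
      then show ?thesis using True unfolding H1_def comp_sum_alt Omega_def[abs_def] v_def[symmetric] by simp
    next
      case False
      then show ?thesis by (simp add: H1_def comp_sum_def)
    qed
    then show ?thesis using comp_sum_len1[of i "\<lambda>a. lie_one (\<pi> a) (Omega (m - i) f g) c p"] by simp
  qed
  have e3: "comp_sum i (\<lambda>k1. comp_sum (m - i) (H3 k1)) = Psi i (star_comm (m - i) f g) p" for i
  proof (cases "m - i = 0")
    case True
    have "F (map \<pi> k1) (\<lambda>_. 0) = (\<lambda>_. 0)" for k1 by (rule local_op_zero[OF F_local_op[OF biv_map]])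
    then show ?thesis using True by (simp add: comp_sum_0 H3_def Psi_def star_comm_def[abs_def] comp_sum_def compositions_0)
  next
    case False
    have "comp_sum (m - i) (H3 k1) = F (map \<pi> k1) (star_comm (m - i) f g) p" for k1
    proof -
      have L: "local_op (F (map \<pi> k1))" by (rule F_local_op[OF biv_map])
      have cX: "comm (K U (map \<pi> ks)) f g \<in> X" if "ks \<in> compositions (m - i)" for ks
        by (rule comm_K_X[OF f g compositions_ne[OF False that]])
      have Ce: "star_comm (m - i) f g = (\<lambda>p. \<Sum>ks\<in>compositions (m - i). (1 / fact (length ks)) * comm (K U (map \<pi> ks)) f g p)"
        using False by (simp add: star_comm_def[abs_def] comp_sum_alt)
      have "F (map \<pi> k1) (star_comm (m - i) f g) = (\<lambda>p. \<Sum>ks\<in>compositions (m - i). F (map \<pi> k1) (\<lambda>p. (1 / fact (length ks)) * comm (K U (map \<pi> ks)) f g p) p)"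
        unfolding Ce by (rule local_op_sum[OF L]) (rule X_cmult[OF cX])
      also have "\<dots> = (\<lambda>p. \<Sum>ks\<in>compositions (m - i). (1 / fact (length ks)) * F (map \<pi> k1) (comm (K U (map \<pi> ks)) f g) p)"
        by (rule ext, rule sum.cong[OF refl]) (simp only: local_op_cmult[OF L cX])
      finally have "F (map \<pi> k1) (star_comm (m - i) f g) p =
          (\<Sum>ks\<in>compositions (m - i). (1 / fact (length ks)) * F (map \<pi> k1) (comm (K U (map \<pi> ks)) f g) p)"
        by simp
      also have "\<dots> = comp_sum (m - i) (H3 k1)" unfolding comp_sum_alt
        by (rule sum.cong[OF refl]) (use compositions_ne[OF False] in \<open>auto simp: H3_def\<close>)
      finally show ?thesis by simp
    qed
    then show ?thesis by (simp add: Psi_def)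
  qed
  have "(\<Sum>i\<le>m. if i = 0 then 0 else lie_one (\<pi> (i - 1)) (Omega (m - i) f g) c p) = (\<Sum>a<m. lie_one (\<pi> a) (Omega (m - 1 - a) f g) c p)"
  proof (cases m)
    case (Suc k)
    show ?thesis unfolding Suc by (subst sum.atMost_Suc_shift) (simp add: lessThan_Suc_atMost)
  qed simp
  then show ?thesis using eq unfolding e1 e2 e3 by simp
qed

end

context smfd
begin

section \<open>One-forms near compact sets\<close>

lemma forms_smult:
  assumes h: "h \<in> X" and T: "T \<in> forms M (pts M) d"
  shows "(\<lambda>c p J. h p * T c p J) \<in> forms M (pts M) d"
  unfolding forms_def
proof (intro CollectI conjI ballI)
  note a = T[unfolded forms_def, THEN CollectD, THEN conjunct1]
  show "alt_components M (pts M) d (\<lambda>c p J. h p * T c p J)"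
    unfolding alt_components_def
  proof (intro conjI allI impI ballI)
    show "h p * T c p J = 0" if "\<not> (in_range M (pts M) c p J \<and> length J = d)" for c p J
      using altD(1)[OF a that] by simp
    show "smooth_on I (cimg c (pts M)) (\<lambda>x. h (chart_inv c x) * T c (chart_inv c x) J)"
      if "c \<in> atlas M" "J \<in> multi_idx M d" for c J
      using chart_smooth_mult[OF that(1) pts_open X_chart_smooth[OF h that(1)] altD(2)[OF a that]] by (simp add: chart_smooth_def)
    show "h p * T c p (J[k := J ! s, s := J ! k]) = - (h p * T c p J)" if "k < s \<and> s < length J" for c p J k s
      using altD(3)[OF a that, of c p] by simp
  qed
  fix c c' p J assume hh: "c \<in> atlas M" "c' \<in> atlas M" "p \<in> fst c \<inter> fst c' \<inter> pts M" "J \<in> multi_idx M d"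
  show "h p * T c' p J = (\<Sum>L\<in>multi_idx M d. (\<Prod>k<d. jacobian c' c (L ! k) (J ! k) p) * (h p * T c p L))"
    unfolding forms_trans[OF T hh] by (simp add: sum_distrib_left mult_ac)
qed

text \<open>The component \<open>i\<close> of \<open>\<Sum>\<^sub>j f\<^sub>j dg\<^sub>j\<close>.\<close>

definition exact_sum :: "(('a \<Rightarrow> complex) \<times> ('a \<Rightarrow> complex)) list \<Rightarrow> 'a chart \<Rightarrow> 'a \<Rightarrow> nat \<Rightarrow> complex"
  where "exact_sum fgs c p i = (\<Sum>(f, g)\<leftarrow>fgs. f p * cpd c i g p)"

lemma exact_sum_append: "exact_sum (xs @ ys) c p i = exact_sum xs c p i + exact_sum ys c p i"
  by (simp add: exact_sum_def)

lemma coordinate_chart_smooth: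
  assumes c: "c \<in> atlas M" and c0: "c0 \<in> atlas M" and j: "j < mdim M"
  shows "chart_smooth c (fst c0) (\<lambda>q. snd c0 q j)"
  unfolding chart_smooth_def by (rule transition[OF c c0 j])

text \<open>In a chart \<open>\<omega> = \<Sum>\<^sub>j \<omega>\<^sub>j dx\<^sup>j\<close>. Multiplying \<open>\<omega>\<^sub>j\<close> by a bump function \<open>h\<close>, and \<open>x\<^sup>j\<close> by a bump function \<open>h1\<close> that is 1
  on the support of \<open>h\<close>, makes all functions globally smooth without changing \<open>h \<omega>\<close>.\<close>

lemma localize_form:
  assumes c0: "c0 \<in> atlas M" and p: "p \<in> fst c0"
  shows "\<exists>h W. h \<in> X \<and> openin (mtop M) W \<and> p \<in> W \<and> (\<forall>q\<in>W. h q = 1) \<and>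
    (\<forall>\<omega>\<in>forms M (pts M) 1. \<exists>fgs. set fgs \<subseteq> X \<times> X \<and>
      (\<forall>c\<in>atlas M. \<forall>q\<in>fst c. \<forall>i<mdim M. h q * \<omega> c q [i] = exact_sum fgs c q i))"
proof -
  obtain h1 W1 K1 where h1: "h1 \<in> X" "openin (mtop M) W1" "p \<in> W1" "W1 \<subseteq> K1" "compactin (mtop M) K1"
      "K1 \<subseteq> fst c0 \<inter> fst c0" "\<And>q. q \<in> W1 \<Longrightarrow> h1 q = 1" "\<And>q. q \<notin> K1 \<Longrightarrow> h1 q = 0"
    by (rule bump[OF c0 p p dom_open[OF c0]], rule that)
  obtain h W K where h: "h \<in> X" "openin (mtop M) W" "p \<in> W" "W \<subseteq> K" "compactin (mtop M) K"
      "K \<subseteq> fst c0 \<inter> W1" "\<And>q. q \<in> W \<Longrightarrow> h q = 1" "\<And>q. q \<notin> K \<Longrightarrow> h q = 0"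
    by (rule bump[OF c0 p h1(3,2)], rule that)
  have K: "K \<subseteq> fst c0" "K \<subseteq> W1" and K1: "K1 \<subseteq> fst c0" using h(6) h1(6) by simp_all
  define g where "g j q = h1 q * complex_of_real (snd c0 q j)" for j q
  have gX: "g j \<in> X" if j: "j < mdim M" for j
  proof (rule X_extend[OF c0 h1(5) K1])
    have "chart_smooth c0 (fst c0) (\<lambda>q. snd c0 q j)" by (rule coordinate_chart_smooth[OF c0 c0 j])
    moreover have "cimg c0 (fst c0) = cimg c0 (pts M)" using dom_pts[OF c0] by auto
    ultimately have "chart_smooth c0 (pts M) (\<lambda>q. snd c0 q j)" by (simp add: chart_smooth_def)
    then show "chart_smooth c0 (pts M) (g j)" unfolding g_def
      by (intro chart_smooth_mult[OF c0 pts_open] X_chart_smooth[OF h1(1) c0] chart_smooth_of_real[OF c0 pts_open])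
    show "g j q = 0" if "q \<notin> K1" for q using h1(8)[OF that] by (simp add: g_def)
  qed
  have "\<exists>fgs. set fgs \<subseteq> X \<times> X \<and>
      (\<forall>c\<in>atlas M. \<forall>q\<in>fst c. \<forall>i<mdim M. h q * \<omega> c q [i] = exact_sum fgs c q i)"
    if \<omega>: "\<omega> \<in> forms M (pts M) 1" for \<omega>
  proof -
    define f where "f j q = h q * \<omega> c0 q [j]" for j q
    have fX: "f j \<in> X" if j: "j < mdim M" for j
    proof (rule X_extend[OF c0 h(5) K(1)])
      show "chart_smooth c0 (pts M) (f j)" unfolding f_def
        by (intro chart_smooth_mult[OF c0 pts_open] X_chart_smooth[OF h(1) c0] one_form_chart_smooth[OF \<omega> c0 j])
      show "f j q = 0" if "q \<notin> K" for q using h(8)[OF that] by (simp add: f_def)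
    qed
    let ?fgs = "map (\<lambda>j. (f j, g j)) [0..<mdim M]"
    have "h q * \<omega> c q [i] = exact_sum ?fgs c q i" if c: "c \<in> atlas M" "q \<in> fst c" and i: "i < mdim M" for c q i
    proof -
      have es: "exact_sum ?fgs c q i = (\<Sum>j<mdim M. f j q * cpd c i (g j) q)"
        by (simp add: exact_sum_def interv_sum_list_conv_sum_set_nat atLeast0LessThan comp_def)
      show ?thesis
      proof (cases "q \<in> K")
        case False
        then show ?thesis unfolding es by (simp add: f_def h(8))
      next
        case True
        then have q: "q \<in> fst c0" "q \<in> W1" using K by auto
        have V: "openin (mtop M) (W1 \<inter> fst c0)" by (rule openin_Int[OF h1(2) dom_open[OF c0]])
        have dg: "cpd c i (g j) q = jacobian c c0 j i q" if j: "j < mdim M" for j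
        proof -
          have "cpd c i (g j) q = cpd c i (\<lambda>q. complex_of_real (snd c0 q j)) q"
            by (rule cpd_cong[OF c(1) V c(2) _ i]) (use q h1(7) in \<open>auto simp: g_def\<close>)
          also have "\<dots> = complex_of_real (cpd c i (\<lambda>q. snd c0 q j) q)"
            by (rule cpd_of_real[OF c(1) coordinate_chart_smooth[OF c(1) c0 j] i c(2) q(1)])
          finally show ?thesis by (simp add: jacobian_def)
        qed
        have mi: "multi_idx M 1 = (\<lambda>j. [j]) ` I" by (auto simp: multi_idx_def length_Suc_conv image_iff)
        have "\<omega> c q [i] = (\<Sum>L\<in>multi_idx M 1. (\<Prod>k<1. jacobian c c0 (L ! k) ([i] ! k) q) * \<omega> c0 q L)"
          by (rule forms_trans[OF \<omega> c0 c(1)]) (use c q i dom_pts[OF c0 q(1)] mi in auto)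
        also have "\<dots> = (\<Sum>j<mdim M. jacobian c c0 j i q * \<omega> c0 q [j])"
          unfolding mi by (subst sum.reindex) (auto simp: inj_on_def lessThan_Suc)
        finally show ?thesis unfolding es by (simp add: f_def dg sum_distrib_left mult_ac)
      qed
    qed
    moreover have "set ?fgs \<subseteq> X \<times> X" using fX gX by auto
    ultimately show ?thesis by (intro exI[of _ ?fgs]) simp
  qed
  then show ?thesis using h(1,2,3,7) by (intro exI[of _ h] exI[of _ W]) simp
qed

text \<open>Partitions of unity are avoided: for a finite cover with bump functions \<open>h\<^sub>1, \<dots>, h\<^sub>r\<close> one passes from \<open>\<omega>\<close> to
  \<open>(1 - h\<^sub>1) \<omega>\<close>, then to \<open>(1 - h\<^sub>2)(1 - h\<^sub>1) \<omega>\<close>, and so on. Each step removes a sum of forms \<open>f dg\<close>, and what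
  remains vanishes on the cover.\<close>

lemma exact_near_compact:
  assumes K: "compactin (mtop M) K" and \<omega>: "\<omega> \<in> forms M (pts M) 1"
  shows "\<exists>fgs W. set fgs \<subseteq> X \<times> X \<and> openin (mtop M) W \<and> K \<subseteq> W \<and>
    (\<forall>c\<in>atlas M. \<forall>q\<in>fst c \<inter> W. \<forall>i<mdim M. \<omega> c q [i] = exact_sum fgs c q i)"
proof -
  define good where "good h W \<longleftrightarrow> h \<in> X \<and> openin (mtop M) W \<and> (\<forall>q\<in>W. h q = 1) \<and>
    (\<forall>\<omega>\<in>forms M (pts M) 1. \<exists>fgs. set fgs \<subseteq> X \<times> X \<and>
      (\<forall>c\<in>atlas M. \<forall>q\<in>fst c. \<forall>i<mdim M. h q * \<omega> c q [i] = exact_sum fgs c q i))" for h W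
  have "\<forall>p\<in>K. \<exists>t. good (fst t) (snd t) \<and> p \<in> snd t"
  proof
    fix p assume "p \<in> K"
    then have "p \<in> pts M" using compactin_subset_topspace[OF K] by auto
    then obtain c0 where c0: "c0 \<in> atlas M" "p \<in> fst c0" using atlas_cover by (elim bexE[OF atlas_cover])
    obtain h W where "good h W" "p \<in> W" using localize_form[OF c0] unfolding good_def by (elim exE conjE) simp
    then show "\<exists>t. good (fst t) (snd t) \<and> p \<in> snd t" by (intro exI[of _ "(h, W)"]) simp
  qed
  from bchoice[OF this] obtain t where t: "\<forall>p\<in>K. good (fst (t p)) (snd (t p)) \<and> p \<in> snd (t p)" by (rule exE)
  have "\<exists>\<F>. finite \<F> \<and> \<F> \<subseteq> (\<lambda>p. snd (t p)) ` K \<and> K \<subseteq> \<Union>\<F>"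
  proof -
    have "\<forall>U\<in>(\<lambda>p. snd (t p)) ` K. openin (mtop M) U" using t by (auto simp: good_def)
    moreover have "K \<subseteq> \<Union>((\<lambda>p. snd (t p)) ` K)" using t by auto
    ultimately show ?thesis using K unfolding compactin_def by simp
  qed
  then obtain \<F> where "finite \<F>" "\<F> \<subseteq> (\<lambda>p. snd (t p)) ` K" "K \<subseteq> \<Union>\<F>" by auto
  then obtain P where P: "finite P" "P \<subseteq> K" "K \<subseteq> (\<Union>p\<in>P. snd (t p))"
    using finite_subset_image[of \<F> "\<lambda>p. snd (t p)" K] by auto
  have "\<exists>fgs \<omega>'. set fgs \<subseteq> X \<times> X \<and> \<omega>' \<in> forms M (pts M) 1 \<and>
      (\<forall>c\<in>atlas M. \<forall>q\<in>fst c. \<forall>i<mdim M. \<omega> c q [i] = exact_sum fgs c q i + \<omega>' c q [i]) \<and>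
      (\<forall>c. \<forall>p\<in>P. \<forall>q\<in>snd (t p). \<forall>i. \<omega>' c q [i] = 0)"
    using P(1,2)
  proof (induction P rule: finite_induct)
    case empty
    show ?case using \<omega> by (intro exI[of _ "[]"] exI[of _ \<omega>]) (simp add: exact_sum_def)
  next
    case (insert p P)
    obtain fgs \<omega>' where 1: "set fgs \<subseteq> X \<times> X" "\<omega>' \<in> forms M (pts M) 1"
      "\<forall>c\<in>atlas M. \<forall>q\<in>fst c. \<forall>i<mdim M. \<omega> c q [i] = exact_sum fgs c q i + \<omega>' c q [i]"
      "\<forall>c. \<forall>p\<in>P. \<forall>q\<in>snd (t p). \<forall>i. \<omega>' c q [i] = 0"
      using insert.IH insert.prems by (elim exE conjE insert_subset[THEN iffD1, elim_format]) (auto)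
    let ?h = "fst (t p)"
    have gd: "good ?h (snd (t p))" using t insert.prems by auto
    then obtain fgs' where 2: "set fgs' \<subseteq> X \<times> X"
      "\<forall>c\<in>atlas M. \<forall>q\<in>fst c. \<forall>i<mdim M. ?h q * \<omega>' c q [i] = exact_sum fgs' c q i"
      unfolding good_def using 1(2) by auto
    have hX: "?h \<in> X" and h1: "\<forall>q\<in>snd (t p). ?h q = 1" using gd by (auto simp: good_def)
    let ?\<omega> = "(-1) *\<^sub>C (\<lambda>c q J. ?h q * \<omega>' c q J) + \<omega>'"
    have "?\<omega> \<in> forms M (pts M) 1" by (rule forms_lincomb[OF pts_open forms_smult[OF hX 1(2)] 1(2)])
    moreover have "\<forall>c\<in>atlas M. \<forall>q\<in>fst c. \<forall>i<mdim M. \<omega> c q [i] = exact_sum (fgs @ fgs') c q i + ?\<omega> c q [i]"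
    proof (intro ballI allI impI)
      fix c q i assume a: "c \<in> atlas M" "q \<in> fst c" "i < mdim M"
      show "\<omega> c q [i] = exact_sum (fgs @ fgs') c q i + ?\<omega> c q [i]"
        unfolding exact_sum_append 1(3)[rule_format, OF a] 2(2)[rule_format, OF a, symmetric] by simp
    qed
    moreover have "\<forall>c. \<forall>p\<in>insert p P. \<forall>q\<in>snd (t p). \<forall>i. ?\<omega> c q [i] = 0"
      using 1(4) h1 by simp
    moreover have "set (fgs @ fgs') \<subseteq> X \<times> X" using 1(1) 2(1) by simp
    ultimately show ?case by (intro exI conjI)
  qed
  then obtain fgs \<omega>' where 1: "set fgs \<subseteq> X \<times> X"
      "\<forall>c\<in>atlas M. \<forall>q\<in>fst c. \<forall>i<mdim M. \<omega> c q [i] = exact_sum fgs c q i + \<omega>' c q [i]"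
      "\<forall>c. \<forall>p\<in>P. \<forall>q\<in>snd (t p). \<forall>i. \<omega>' c q [i] = 0"
    by (elim exE conjE)
  let ?W = "\<Union>p\<in>P. snd (t p)"
  have "openin (mtop M) ?W" by (rule openin_Union) (use t P(2) in \<open>auto simp: good_def\<close>)
  moreover have "\<forall>c\<in>atlas M. \<forall>q\<in>fst c \<inter> ?W. \<forall>i<mdim M. \<omega> c q [i] = exact_sum fgs c q i"
    using 1(2,3) by auto
  ultimately show ?thesis using 1(1) P(3) by (intro exI conjI)
qed

end

section \<open>Star products and their traces\<close>

lemma isomorphic_modules_trans:
  assumes "isomorphic_modules A B" "isomorphic_modules B C"
  shows "isomorphic_modules A C"
proof -
  obtain \<Phi> where \<Phi>: "bij_betw \<Phi> A B"
    "\<forall>\<tau>\<in>A. \<forall>\<tau>'\<in>A. \<forall>r. \<Phi> (\<lambda>a. r * \<tau> a + \<tau>' a) = (\<lambda>a. r * \<Phi> \<tau> a + \<Phi> \<tau>' a)"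
    using assms(1) unfolding isomorphic_modules_def by (elim exE conjE)
  obtain \<Psi> where \<Psi>: "bij_betw \<Psi> B C"
    "\<forall>\<tau>\<in>B. \<forall>\<tau>'\<in>B. \<forall>r. \<Psi> (\<lambda>a. r * \<tau> a + \<tau>' a) = (\<lambda>a. r * \<Psi> \<tau> a + \<Psi> \<tau>' a)"
    using assms(2) unfolding isomorphic_modules_def by (elim exE conjE)
  show ?thesis unfolding isomorphic_modules_def
  proof (intro exI[of _ "\<Psi> \<circ> \<Phi>"] conjI ballI allI)
    show "bij_betw (\<Psi> \<circ> \<Phi>) A C" by (rule bij_betw_trans[OF \<Phi>(1) \<Psi>(1)])
    fix \<tau> \<tau>' r assume t: "\<tau> \<in> A" "\<tau>' \<in> A"
    then have "\<Phi> \<tau> \<in> B" "\<Phi> \<tau>' \<in> B" using bij_betwE[OF \<Phi>(1)] by auto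
    then show "(\<Psi> \<circ> \<Phi>) (\<lambda>a. r * \<tau> a + \<tau>' a) = (\<lambda>a. r * (\<Psi> \<circ> \<Phi>) \<tau> a + (\<Psi> \<circ> \<Phi>) \<tau>' a)"
      using t \<Phi>(2) \<Psi>(2) by simp
  qed
qed

text \<open>Both sides sum over the quadruples with total \<open>n\<close>.\<close>

lemma sum_four:
  fixes h :: "nat \<Rightarrow> nat \<Rightarrow> nat \<Rightarrow> nat \<Rightarrow> 'z::comm_monoid_add"
  shows "(\<Sum>r\<le>n. \<Sum>l\<le>r. \<Sum>i\<le>r - l. h l i (r - l - i) (n - r)) =
    (\<Sum>i\<le>n. \<Sum>j\<le>n - i. \<Sum>l\<le>n - i - j. h l i j (n - i - j - l))"
proof -
  have "(\<Sum>r\<le>n. \<Sum>l\<le>r. \<Sum>i\<le>r - l. h l i (r - l - i) (n - r)) =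
      (\<Sum>r\<le>n. \<Sum>l\<le>r. (\<lambda>l q. \<Sum>i\<le>q. h l i (q - i) (n - (l + q))) l (r - l))"
    by (intro sum.cong refl) auto
  also have "\<dots> = (\<Sum>l\<le>n. \<Sum>q\<le>n - l. \<Sum>i\<le>q. h l i (q - i) (n - (l + q)))"
    by (rule sum_triangle[symmetric])
  also have "\<dots> = (\<Sum>l\<le>n. \<Sum>q\<le>n - l. \<Sum>i\<le>q. (\<lambda>i j. h l i j (n - l - (i + j))) i (q - i))"
    by (intro sum.cong refl) auto
  also have "\<dots> = (\<Sum>l\<le>n. \<Sum>i\<le>n - l. \<Sum>j\<le>n - l - i. h l i j (n - l - (i + j)))"
    by (rule sum.cong[OF refl], rule sum_triangle[symmetric])
  also have "\<dots> = (\<Sum>i\<le>n. \<Sum>l\<le>n - i. \<Sum>j\<le>n - l - i. h l i j (n - l - (i + j)))"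
    by (rule sum_triangle_swap)
  also have "\<dots> = (\<Sum>i\<le>n. \<Sum>l\<le>n - i. \<Sum>j\<le>n - i - l. h l i j (n - l - (i + j)))"
    by (simp only: diff_commute)
  also have "\<dots> = (\<Sum>i\<le>n. \<Sum>j\<le>n - i. \<Sum>l\<le>n - i - j. h l i j (n - l - (i + j)))"
    by (rule sum.cong[OF refl], rule sum_triangle_swap)
  also have "\<dots> = (\<Sum>i\<le>n. \<Sum>j\<le>n - i. \<Sum>l\<le>n - i - j. h l i j (n - i - j - l))"
  proof (rule sum.cong[OF refl], rule sum.cong[OF refl], rule sum.cong[OF refl])
    fix i j l :: nat
    have "n - l - (i + j) = n - i - j - l" by arith
    then show "h l i j (n - l - (i + j)) = h l i j (n - i - j - l)" by (rule arg_cong)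
  qed
  finally show ?thesis .
qed

context smfd
begin

lemma mult_op_tens:
  assumes "f \<in> X" "g \<in> X"
  shows "mult_op M (pts M) (tens [f, g]) = (\<lambda>p. f p * g p)"
  using tens_smooth[of "[f, g]"] assms by (auto simp: mult_op_def tens2_apply fun_eq_iff numeral_2_eq_2)

text \<open>The part of the notion of a star product on which the reduction of the trace condition to pairs of
  functions depends; by the second clause products of constant series have only one term in each order.\<close>

definition smooth_product :: "(nat \<Rightarrow> 'a oper) \<Rightarrow> bool"
  where "smooth_product P \<longleftrightarrow> (\<forall>l. \<forall>f\<in>X. \<forall>g\<in>X. P l (tens [f, g]) \<in> X) \<and>
    (\<forall>l. \<forall>f\<in>X. P l (tens [f, \<lambda>_. 0]) = (\<lambda>_. 0) \<and> P l (tens [\<lambda>_. 0, f]) = (\<lambda>_. 0))"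

lemma star_apply: "star_mult P a b n p = (\<Sum>l\<le>n. \<Sum>i\<le>n - l. P l (tens [a i, b (n - l - i)]) p)"
  by (simp add: star_mult_def sum_fun_app)

lemma star_TS:
  assumes P: "smooth_product P" and a: "a \<in> TS" and b: "b \<in> TS"
  shows "star_mult P a b \<in> TS"
proof -
  have "star_mult P a b n = (\<lambda>p. \<Sum>l\<le>n. \<Sum>i\<le>n - l. P l (tens [a i, b (n - l - i)]) p)" for n
    by (rule ext) (rule star_apply)
  moreover have "P l (tens [a i, b j]) \<in> X" for l i j using P a b by (simp add: smooth_product_def TS_iff)
  ultimately show ?thesis unfolding TS_iff by (simp add: X_sum)
qed

lemma star_const:
  assumes P: "smooth_product P" and f: "f \<in> X" and g: "g \<in> X"
  shows "star_mult P (const_series f) (const_series g) = (\<lambda>n. P n (tens [f, g]))"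
proof (intro ext)
  fix n p
  have z: "P l (tens [const_series f i, const_series g j]) p = (if i = 0 \<and> j = 0 then P l (tens [f, g]) p else 0)" for l i j
    using P f g X_zero by (auto simp: const_series_def smooth_product_def)
  have "star_mult P (const_series f) (const_series g) n p =
      (\<Sum>l\<le>n. \<Sum>i\<le>n - l. if i = 0 then (if l = n then P n (tens [f, g]) p else 0) else 0)"
    unfolding star_apply z by (intro sum.cong refl) auto
  also have "\<dots> = P n (tens [f, g]) p" by simp
  finally show "star_mult P (const_series f) (const_series g) n p = P n (tens [f, g]) p" .
qed

text \<open>By bilinearity over \<open>\<complex>[[t]]\<close> the functional on a product of series is determined by its values on products of
  functions.\<close>

lemma star_coeff:
  assumes P: "smooth_product P" and \<tau>: "tlinear \<tau>" and a: "a \<in> TS" and b: "b \<in> TS"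
  shows "fps_nth (\<tau> (star_mult P a b)) n =
    (\<Sum>i\<le>n. \<Sum>j\<le>n - i. fps_nth (\<tau> (star_mult P (const_series (a i)) (const_series (b j)))) (n - i - j))"
proof -
  have aX: "a i \<in> X" "b i \<in> X" for i using a b by (auto simp: TS_iff)
  have PX: "P l (tens [a i, b j]) \<in> X" for l i j using P aX by (simp add: smooth_product_def)
  have "coeff_fun \<tau> (n - r) (star_mult P a b r) = (\<Sum>l\<le>r. \<Sum>i\<le>r - l. coeff_fun \<tau> (n - r) (P l (tens [a i, b (r - l - i)])))" for r
  proof -
    have "star_mult P a b r = (\<lambda>p. \<Sum>l\<le>r. \<Sum>i\<le>r - l. P l (tens [a i, b (r - l - i)]) p)"
      by (rule ext) (rule star_apply)
    then have "coeff_fun \<tau> (n - r) (star_mult P a b r) =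
        (\<Sum>l\<le>r. coeff_fun \<tau> (n - r) (\<lambda>p. \<Sum>i\<le>r - l. P l (tens [a i, b (r - l - i)]) p))"
      using linfun_sum[OF coeff_fun_linfun[OF \<tau>, of "n - r"] X_sum[OF PX]] by simp
    also have "\<dots> = (\<Sum>l\<le>r. \<Sum>i\<le>r - l. coeff_fun \<tau> (n - r) (P l (tens [a i, b (r - l - i)])))"
      by (rule sum.cong[OF refl], rule linfun_sum[OF coeff_fun_linfun[OF \<tau>]], rule PX)
    finally show ?thesis .
  qed
  then have "fps_nth (\<tau> (star_mult P a b)) n = (\<Sum>r\<le>n. \<Sum>l\<le>r. \<Sum>i\<le>r - l. coeff_fun \<tau> (n - r) (P l (tens [a i, b (r - l - i)])))"
    using tl_coeff[OF \<tau> star_TS[OF P a b], of n] by simp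
  also have "\<dots> = (\<Sum>i\<le>n. \<Sum>j\<le>n - i. \<Sum>l\<le>n - i - j. coeff_fun \<tau> (n - i - j - l) (P l (tens [a i, b j])))"
    by (rule sum_four)
  also have "\<dots> = (\<Sum>i\<le>n. \<Sum>j\<le>n - i. fps_nth (\<tau> (star_mult P (const_series (a i)) (const_series (b j)))) (n - i - j))"
  proof (rule sum.cong[OF refl], rule sum.cong[OF refl])
    fix i j
    have "star_mult P (const_series (a i)) (const_series (b j)) \<in> TS"
      by (rule star_TS[OF P const_series_TS[OF aX(1)] const_series_TS[OF aX(2)]])
    from tl_coeff[OF \<tau> this]
    show "(\<Sum>l\<le>n - i - j. coeff_fun \<tau> (n - i - j - l) (P l (tens [a i, b j]))) =
        fps_nth (\<tau> (star_mult P (const_series (a i)) (const_series (b j)))) (n - i - j)"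
      by (simp add: star_const[OF P aX])
  qed
  finally show ?thesis .
qed

lemma trace_from_constants:
  assumes P: "smooth_product P" and \<tau>: "tlinear \<tau>"
    and tr: "\<And>f g. f \<in> X \<Longrightarrow> g \<in> X \<Longrightarrow> \<tau> (star_mult P (const_series f) (const_series g)) = \<tau> (star_mult P (const_series g) (const_series f))"
    and a: "a \<in> TS" and b: "b \<in> TS"
  shows "\<tau> (star_mult P a b) = \<tau> (star_mult P b a)"
proof (rule fps_ext)
  fix n
  have aX: "a i \<in> X" "b i \<in> X" for i using a b by (auto simp: TS_iff)
  have "fps_nth (\<tau> (star_mult P a b)) n =
      (\<Sum>i\<le>n. \<Sum>j\<le>n - i. fps_nth (\<tau> (star_mult P (const_series (b j)) (const_series (a i)))) (n - i - j))"
    unfolding star_coeff[OF P \<tau> a b] tr[OF aX] ..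
  also have "\<dots> = (\<Sum>j\<le>n. \<Sum>i\<le>n - j. fps_nth (\<tau> (star_mult P (const_series (b j)) (const_series (a i)))) (n - i - j))"
    by (rule sum_triangle_swap)
  also have "\<dots> = fps_nth (\<tau> (star_mult P b a)) n"
    unfolding star_coeff[OF P \<tau> b a] by (simp add: add.commute)
  finally show "fps_nth (\<tau> (star_mult P a b)) n = fps_nth (\<tau> (star_mult P b a)) n" .
qed

text \<open>If \<open>T\<close> intertwines \<open>P\<close> and \<open>Q\<close>, then composition with \<open>T\<close> carries traces for \<open>Q\<close> to traces for \<open>P\<close>, and composition
  with its inverse carries them back.\<close>

lemma isomorphic_stars:
  assumes P: "smooth_product P" and iso: "star_isomorphic M P Q"
  shows "isomorphic_modules (continuous_traces M Q) (continuous_traces M P)"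
proof -
  obtain T where T0: "\<forall>f\<in>X. T 0 (tens [f]) = f" and T1: "\<forall>m\<ge>1. T m \<in> multidiff M (pts M) 1"
    and T: "\<forall>a\<in>TS. \<forall>b\<in>TS. apply_series T (star_mult P a b) = star_mult Q (apply_series T a) (apply_series T b)"
    using iso unfolding star_isomorphic_def by (elim exE conjE)
  define D where "D i f = (if i = 0 then f else T i (tens [f]))" for i f
  have D: "op_series D" unfolding op_series_def
  proof (intro conjI allI ballI)
    show "D 0 f = f" for f by (simp add: D_def)
    fix i
    show "local_op (D i)"
    proof (cases "i = 0")
      case True
      then have "D i = (\<lambda>f. f)" by (simp add: D_def[abs_def])
      then show ?thesis by (simp add: local_op_id)
    next
      case False
      then have "D i = (\<lambda>f. T i (tens [f]))" by (simp add: D_def[abs_def])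
      then show ?thesis using multidiff_local_op[of "T i"] T1 False by simp
    qed
  qed
  have apT: "apply_series T a = apply_ops D a" if "a \<in> TS" for a
  proof (intro ext)
    fix n p
    show "apply_series T a n p = apply_ops D a n p"
      using that T0 unfolding apply_series_def apply_ops_def sum_fun_app
      by (intro sum.cong refl) (auto simp: D_def TS_iff)
  qed
  have hom: "apply_ops D (star_mult P a b) = star_mult Q (apply_ops D a) (apply_ops D b)" if "a \<in> TS" "b \<in> TS" for a b
    using T[rule_format, OF that] unfolding apT[OF that(1)] apT[OF that(2)] apT[OF star_TS[OF P that]] .
  let ?E = "inverse_ops D"
  have E: "op_series ?E" by (rule op_series_inverse_ops[OF D])
  show ?thesis
  proof (rule pullback_isomorphic[OF D E apply_ops_inverse_ops'[OF D] apply_ops_inverse_ops[OF D]])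
    show "continuous_traces M Q \<subseteq> CF" "continuous_traces M P \<subseteq> CF" by (auto simp: continuous_traces_def)
    show "pullback D \<tau> \<in> continuous_traces M P" if t: "\<tau> \<in> continuous_traces M Q" for \<tau>
      unfolding continuous_traces_def
    proof (intro CollectI conjI ballI)
      show "pullback D \<tau> \<in> CF" using pullback_CF[OF D] t by (simp add: continuous_traces_def)
      show "pullback D \<tau> (star_mult P a b) = pullback D \<tau> (star_mult P b a)" if "a \<in> TS" "b \<in> TS" for a b
        using t that star_TS[OF P that] star_TS[OF P that(2,1)] apply_ops_TS[OF D that(1)] apply_ops_TS[OF D that(2)]
        by (simp add: pullback_def hom continuous_traces_def)
    qed
    show "pullback ?E \<tau> \<in> continuous_traces M Q" if t: "\<tau> \<in> continuous_traces M P" for \<tau>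
      unfolding continuous_traces_def
    proof (intro CollectI conjI ballI)
      show "pullback ?E \<tau> \<in> CF" using pullback_CF[OF E] t by (simp add: continuous_traces_def)
      have eq: "pullback ?E \<tau> (star_mult Q x y) = \<tau> (star_mult P (apply_ops ?E x) (apply_ops ?E y))" if "x \<in> TS" "y \<in> TS" for x y
      proof -
        have a: "apply_ops ?E x \<in> TS" "apply_ops ?E y \<in> TS" using apply_ops_TS[OF E] that by auto
        have "star_mult Q x y = apply_ops D (star_mult P (apply_ops ?E x) (apply_ops ?E y))"
          using hom[OF a] apply_ops_inverse_ops[OF D] that by simp
        then show ?thesis using apply_ops_TS[OF D star_TS[OF P a]] apply_ops_inverse_ops'[OF D star_TS[OF P a]] by (simp add: pullback_def)
      qed
      show "pullback ?E \<tau> (star_mult Q x y) = pullback ?E \<tau> (star_mult Q y x)" if "x \<in> TS" "y \<in> TS" for x y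
        using t apply_ops_TS[OF E that(1)] apply_ops_TS[OF E that(2)]
        by (simp add: eq[OF that] eq[OF that(2,1)] continuous_traces_def)
    qed
  qed
qed

end

context formality
begin

section \<open>Traces and Poisson brackets\<close>

abbreviation KS :: "nat \<Rightarrow> 'a oper" where "KS \<equiv> kontsevich_star M (K U) \<pi>"

lemma KS_0: "KS 0 = mult_op M U" by (simp add: kontsevich_star_def)

lemma KS_pos: "m \<noteq> 0 \<Longrightarrow> KS m G p = comp_sum m (\<lambda>ks. K U (map \<pi> ks) G p)"
proof -
  assume m: "m \<noteq> 0"
  have "{ks. sum_list (map Suc ks) = m} = compositions m" by (simp add: compositions_def weight_def)
  then show ?thesis using m by (simp add: kontsevich_star_def comp_sum_def sum_fun_app)
qed

lemma smooth_product_KS: "smooth_product KS"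
  unfolding smooth_product_def
proof (intro conjI allI ballI)
  fix l f g assume f: "f \<in> X" and g: "g \<in> X"
  show "KS l (tens [f, g]) \<in> X"
  proof (cases "l = 0")
    case True
    then show ?thesis using X_mult[OF f g] by (simp add: KS_0 mult_op_tens[OF f g])
  next
    case False
    have "(\<lambda>p. \<Sum>ks\<in>compositions l. (1 / fact (length ks)) * K U (map \<pi> ks) (tens [f, g]) p) \<in> X"
    proof (rule X_sum, rule X_cmult)
      fix ks assume ks: "ks \<in> compositions l"
      have "K U (map \<pi> ks) \<in> multidiff M U 2"
        by (rule K_multidiff[OF biv_map]) (use compositions_ne[OF False ks] in simp)
      then show "K U (map \<pi> ks) (tens [f, g]) \<in> X" by (rule multidiff_X) (use f g in auto)
    qed
    moreover have "KS l (tens [f, g]) = (\<lambda>p. \<Sum>ks\<in>compositions l. (1 / fact (length ks)) * K U (map \<pi> ks) (tens [f, g]) p)"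
      by (rule ext) (simp add: KS_pos[OF False] comp_sum_alt)
    ultimately show ?thesis by simp
  qed
next
  fix l f assume f: "f \<in> X"
  have z: "KS l (tens [a, b]) = (\<lambda>_. 0)" if ab: "a \<in> X" "b \<in> X" "a = (\<lambda>_. 0) \<or> b = (\<lambda>_. 0)" for a b
  proof (cases "l = 0")
    case True
    then show ?thesis using ab by (auto simp: KS_0 mult_op_tens[OF ab(1,2)])
  next
    case False
    have "K U (map \<pi> ks) (tens [a, b]) = (\<lambda>_. 0)" if ks: "ks \<in> compositions l" for ks
    proof (rule multidiff_zero)
      show "K U (map \<pi> ks) \<in> multidiff M U 2"
        by (rule K_multidiff[OF biv_map]) (use compositions_ne[OF False ks] in simp)
    qed (use ab in auto)
    then show ?thesis by (intro ext) (simp add: KS_pos[OF False] comp_sum_def)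
  qed
  show "KS l (tens [f, \<lambda>_. 0]) = (\<lambda>_. 0)" by (rule z) (use f X_zero in auto)
  show "KS l (tens [\<lambda>_. 0, f]) = (\<lambda>_. 0)" by (rule z) (use f X_zero in auto)
qed

lemma KS_comm:
  assumes f: "f \<in> X" and g: "g \<in> X"
  shows "KS m (tens [f, g]) p - KS m (tens [g, f]) p = star_comm m f g p"
proof (cases "m = 0")
  case True
  then show ?thesis by (simp add: KS_0 mult_op_tens[OF f g] mult_op_tens[OF g f] star_comm_def)
next
  case False
  then show ?thesis by (simp add: KS_pos[OF False] star_comm_def comm_def comp_sum_def sum_subtractf diff_divide_distrib)
qed

definition bracket_term :: "nat \<Rightarrow> ('a \<Rightarrow> complex) \<Rightarrow> ('a \<Rightarrow> complex) \<Rightarrow> 'a \<Rightarrow> complex"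
  where "bracket_term a f g = pairing M U 2 (\<pi> a) (dprod M U [f, g])"

lemma bracket_term_X:
  assumes "f \<in> X" "g \<in> X"
  shows "bracket_term a f g \<in> X"
proof -
  have D: "K U [\<pi> a] \<in> multidiff M U 2" by (rule K_multidiff) (use pi_mem in auto)
  have "(\<lambda>p. (1 / 2) * comm (K U [\<pi> a]) f g p) \<in> X" by (rule X_cmult[OF comm_X[OF D assms]])
  moreover have "(\<lambda>p. (1 / 2) * comm (K U [\<pi> a]) f g p) = bracket_term a f g"
    by (rule ext) (simp add: comm_K_single[OF pi_mem assms] bracket_term_def)
  ultimately show ?thesis by simp
qed

lemma poisson_bracket_bracket_term: "poisson_bracket M \<pi> f g n = (if n = 0 then (\<lambda>_. 0) else bracket_term (n - 1) f g)"
  by (simp add: poisson_bracket_def bracket_term_def zero_fun_def del: dprod.simps)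

lemma poisson_TS: "f \<in> X \<Longrightarrow> g \<in> X \<Longrightarrow> poisson_bracket M \<pi> f g \<in> TS"
  by (simp add: TS_iff poisson_bracket_bracket_term bracket_term_X X_zero)

text \<open>The coefficient of \<open>t\<^sup>n\<close> in \<open>\<sigma>({f, g}\<^sub>\<pi>)\<close>; see \<open>poisson_coeff\<close>.\<close>

definition bracket_coeff :: "((nat \<Rightarrow> 'a \<Rightarrow> complex) \<Rightarrow> complex fps) \<Rightarrow> nat \<Rightarrow> ('a \<Rightarrow> complex) \<Rightarrow> ('a \<Rightarrow> complex) \<Rightarrow> complex"
  where "bracket_coeff \<sigma> n f g = (\<Sum>a<n. coeff_fun \<sigma> (n - 1 - a) (bracket_term a f g))"

lemma poisson_coeff:
  assumes \<sigma>: "tlinear \<sigma>" and f: "f \<in> X" and g: "g \<in> X"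
  shows "fps_nth (\<sigma> (poisson_bracket M \<pi> f g)) n = bracket_coeff \<sigma> n f g"
proof (cases n)
  case 0
  then show ?thesis using tl_coeff[OF \<sigma> poisson_TS[OF f g], of 0] linfun_zero[OF coeff_fun_linfun[OF \<sigma>]]
    by (simp add: poisson_bracket_bracket_term bracket_coeff_def)
next
  case (Suc k)
  have "fps_nth (\<sigma> (poisson_bracket M \<pi> f g)) n = (\<Sum>i\<le>Suc k. coeff_fun \<sigma> (Suc k - i) (poisson_bracket M \<pi> f g i))"
    using tl_coeff[OF \<sigma> poisson_TS[OF f g], of n] Suc by simp
  also have "\<dots> = (\<Sum>i\<le>k. coeff_fun \<sigma> (k - i) (bracket_term i f g))"
    by (subst sum.atMost_Suc_shift) (simp add: poisson_bracket_bracket_term linfun_zero[OF coeff_fun_linfun[OF \<sigma>]])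
  finally show ?thesis using Suc by (simp add: bracket_coeff_def lessThan_Suc_atMost)
qed

definition comm_series :: "('a \<Rightarrow> complex) \<Rightarrow> ('a \<Rightarrow> complex) \<Rightarrow> nat \<Rightarrow> 'a \<Rightarrow> complex"
  where "comm_series f g n = star_comm n f g"

lemma comm_series_TS: "f \<in> X \<Longrightarrow> g \<in> X \<Longrightarrow> comm_series f g \<in> TS"
  by (simp add: TS_iff comm_series_def star_comm_X)

lemma star_comm_series:
  assumes f: "f \<in> X" and g: "g \<in> X"
  shows "star_mult KS (const_series f) (const_series g) = comm_series f g + star_mult KS (const_series g) (const_series f)"
  unfolding star_const[OF smooth_product_KS f g] star_const[OF smooth_product_KS g f]
  by (intro ext) (simp add: comm_series_def KS_comm[OF f g, symmetric])

text \<open>The coefficients of \<open>\<sigma>\<close> that enter have a common compact support \<open>L\<close>. Near \<open>L\<close> every one-form \<open>Omega b f g\<close> is a sum of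
  forms \<open>f' dg'\<close> with pairs \<open>(f', g')\<close> in the list \<open>fgs b\<close>, so there \<open>\<Psi>(f * g - g * f)\<close> is a sum of Poisson brackets.
  For \<open>b = 0\<close> the form is \<open>f dg\<close> itself, and \<open>(f, g)\<close> is the only pair; thus the term \<open>b = 0\<close> is twice the coefficient of
  order \<open>n\<close> of the bracket of \<open>f\<close> and \<open>g\<close>, and all other terms have lower order.\<close>

lemma functional_on_star_commutator:
  assumes \<sigma>: "\<sigma> \<in> CF" and f: "f \<in> X" and g: "g \<in> X"
  shows "\<exists>fgs. fgs 0 = [(f, g)] \<and> (\<forall>b. set (fgs b) \<subseteq> X \<times> X) \<and>
    fps_nth (\<sigma> (apply_ops Psi (comm_series f g))) n = (\<Sum>b<n. \<Sum>(f', g')\<leftarrow>fgs b. 2 * bracket_coeff \<sigma> (n - b) f' g')"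
proof -
  have l: "tlinear \<sigma>" and derivs_le: "\<And>k. fbounded (coeff_fun \<sigma> k)" using \<sigma> by (auto simp: CF_iff)
  have "\<forall>k. \<exists>K. compactin (mtop M) K \<and> (\<forall>f\<in>X. \<forall>W. openin (mtop M) W \<and> K \<subseteq> W \<and> (\<forall>p\<in>W. f p = 0) \<longrightarrow> coeff_fun \<sigma> k f = 0)"
    using fbounded_support[OF coeff_fun_linfun[OF l] derivs_le] by simp
  from choice[OF this] obtain Ks where Ks: "\<forall>k. compactin (mtop M) (Ks k) \<and>
      (\<forall>f\<in>X. \<forall>W. openin (mtop M) W \<and> Ks k \<subseteq> W \<and> (\<forall>p\<in>W. f p = 0) \<longrightarrow> coeff_fun \<sigma> k f = 0)" by (rule exE)
  define L where "L = (\<Union>k\<le>n. Ks k)"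
  have L: "compactin (mtop M) L" unfolding L_def by (rule compactin_Union) (use Ks in auto)
  have "\<forall>b. \<exists>t. set (fst t) \<subseteq> X \<times> X \<and> openin (mtop M) (snd t) \<and> L \<subseteq> snd t \<and>
    (\<forall>c\<in>atlas M. \<forall>q\<in>fst c \<inter> snd t. \<forall>i<mdim M. Omega b f g c q [i] = exact_sum (fst t) c q i) \<and>
    (b = 0 \<longrightarrow> fst t = [(f, g)])"
  proof
    fix b
    show "\<exists>t. set (fst t) \<subseteq> X \<times> X \<and> openin (mtop M) (snd t) \<and> L \<subseteq> snd t \<and>
      (\<forall>c\<in>atlas M. \<forall>q\<in>fst c \<inter> snd t. \<forall>i<mdim M. Omega b f g c q [i] = exact_sum (fst t) c q i) \<and>
      (b = 0 \<longrightarrow> fst t = [(f, g)])"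
    proof (cases "b = 0")
      case True
      show ?thesis
        by (intro exI[of _ "([(f, g)], U)"])
          (use f g True compactin_subset_topspace[OF L] in \<open>auto simp: Omega_0 mu_apply exact_sum_def pts_open simp del: split_paired_All\<close>)
    next
      case False
      obtain fgs W where "set fgs \<subseteq> X \<times> X" "openin (mtop M) W" "L \<subseteq> W"
        "\<forall>c\<in>atlas M. \<forall>q\<in>fst c \<inter> W. \<forall>i<mdim M. Omega b f g c q [i] = exact_sum fgs c q i"
        using exact_near_compact[OF L Omega_form[OF f g, of b]] by (elim exE conjE)
      then show ?thesis using False by (intro exI[of _ "(fgs, W)"]) simp
    qed
  qed
  from choice[OF this] obtain t where t: "\<forall>b. set (fst (t b)) \<subseteq> X \<times> X \<and> openin (mtop M) (snd (t b)) \<and> L \<subseteq> snd (t b) \<and>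
    (\<forall>c\<in>atlas M. \<forall>q\<in>fst c \<inter> snd (t b). \<forall>i<mdim M. Omega b f g c q [i] = exact_sum (fst (t b)) c q i) \<and>
    (b = 0 \<longrightarrow> fst (t b) = [(f, g)])" by (rule exE)
  define fgs W where "fgs b = fst (t b)" and "W = (\<Inter>b\<in>{..n}. snd (t b))" for b
  have fgs: "set (fgs b) \<subseteq> X \<times> X" "fgs 0 = [(f, g)]"
    "\<And>c q i. c \<in> atlas M \<Longrightarrow> q \<in> fst c \<Longrightarrow> q \<in> snd (t b) \<Longrightarrow> i < mdim M \<Longrightarrow> Omega b f g c q [i] = exact_sum (fgs b) c q i" for b
    using t unfolding fgs_def by auto
  have W: "openin (mtop M) W" "L \<subseteq> W" unfolding W_def using t by (auto intro!: openin_INT2)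
  define fi gi where "fi b k = fst (fgs b ! k)" and "gi b k = snd (fgs b ! k)" for b k
  have fgX: "fi b k \<in> X" "gi b k \<in> X" if "k < length (fgs b)" for b k
    using fgs(1)[of b] nth_mem[OF that] by (auto simp: fi_def gi_def)
  have es: "exact_sum (fgs b) c q i = (\<Sum>k<length (fgs b). fi b k q * cpd c i (gi b k) q)" for b c q i
    unfolding exact_sum_def fi_def gi_def
    by (simp add: sum_list_sum_nth atLeast0LessThan case_prod_unfold)
  \<comment> \<open>\<open>Z m\<close> is the coefficient of order \<open>m\<close> of
    \<open>\<Psi>(f * g - g * f)\<close>, and \<open>Y m\<close> is the sum of brackets that agrees with it on
    \<open>W\<close>. Since \<open>W\<close> contains the support, \<open>\<sigma>\<close> does not
    distinguish them.\<close>
  define Z where "Z m p = (\<Sum>i\<le>m. Psi i (star_comm (m - i) f g) p)" for m p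
  define Y where "Y m p = (\<Sum>a<m. \<Sum>k<length (fgs (m - 1 - a)). 2 * bracket_term a (fi (m - 1 - a) k) (gi (m - 1 - a) k) p)" for m p
  have Fl: "local_op (Psi i)" for i using Psi_op_series by (simp add: op_series_def)
  have ZX: "Z m \<in> X" for m unfolding Z_def[abs_def] by (intro X_sum local_op_X[OF Fl] star_comm_X f g)
  have YX: "Y m \<in> X" for m unfolding Y_def[abs_def]
    by (intro X_sum X_cmult bracket_term_X fgX) simp_all
  have ZY: "Z m p = Y m p" if p: "p \<in> W" and m: "m \<le> n" for m p
  proof -
    have "p \<in> U" using p W(1) openin_subset[OF W(1)] by auto
    then obtain c where c: "c \<in> atlas M" "p \<in> fst c" using atlas_cover by (elim bexE[OF atlas_cover])
    have "Z m p = (\<Sum>a<m. lie_one (\<pi> a) (Omega (m - 1 - a) f g) c p)"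
      unfolding Z_def by (rule Psi_star_comm[OF f g c])
    also have "\<dots> = Y m p" unfolding Y_def
    proof (rule sum.cong[OF refl])
      fix a assume "a \<in> {..<m}"
      define b where "b = m - 1 - a"
      have b: "b \<le> n" using m by (simp add: b_def)
      let ?T = "\<lambda>c p J. \<Sum>k<length (fgs b). 1 * mu (fi b k) (gi b k) c p J"
      have tb: "openin (mtop M) (snd (t b))" "p \<in> snd (t b)" using t p b by (auto simp: W_def)
      have "lie_one (\<pi> a) (Omega b f g) c p = lie_one (\<pi> a) ?T c p"
      proof (rule lie_one_cong[OF c tb])
        fix q i assume q: "q \<in> fst c" "q \<in> snd (t b)" and i: "i < mdim M"
        show "Omega b f g c q [i] = (\<Sum>k<length (fgs b). 1 * mu (fi b k) (gi b k) c q [i])"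
          unfolding fgs(3)[OF c(1) q i] es by (intro sum.cong refl) (simp add: mu_apply[OF c(1) q(1) i fgX(2)])
      qed
      also have "\<dots> = (\<Sum>k<length (fgs b). 1 * lie_one (\<pi> a) (mu (fi b k) (gi b k)) c p)"
        by (rule lie_one_sum[OF c]) (rule one_form_chart_smooth[OF mu_form[OF fgX] c(1)], auto)
      also have "\<dots> = (\<Sum>k<length (fgs b). 2 * bracket_term a (fi b k) (gi b k) p)"
        by (intro sum.cong refl) (simp add: lie_one_mu[OF pi_mem fgX c] bracket_term_def del: dprod.simps)
      finally show "lie_one (\<pi> a) (Omega (m - 1 - a) f g) c p =
          (\<Sum>k<length (fgs (m - 1 - a)). 2 * bracket_term a (fi (m - 1 - a) k) (gi (m - 1 - a) k) p)"
        unfolding b_def .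
    qed
    finally show ?thesis .
  qed
  have cZ: "coeff_fun \<sigma> (n - m) (Z m) = coeff_fun \<sigma> (n - m) (Y m)" if m: "m \<le> n" for m
  proof -
    have "Ks (n - m) \<subseteq> W" using W(2) m unfolding L_def by (meson UN_upper atMost_iff diff_le_self subset_trans)
    then have "coeff_fun \<sigma> (n - m) (\<lambda>p. Z m p - Y m p) = 0"
      using Ks[rule_format, of "n - m", THEN conjunct2, THEN bspec, OF X_diff[OF ZX[of m] YX[of m]]] W(1) ZY[OF _ m] by auto
    then show ?thesis using linfun_diff[OF coeff_fun_linfun[OF l, of "n - m"] ZX[of m] YX[of m]] by simp
  qed
  have cY: "coeff_fun \<sigma> k (Y m) = (\<Sum>a<m. \<Sum>j<length (fgs (m - 1 - a)). 2 * coeff_fun \<sigma> k (bracket_term a (fi (m - 1 - a) j) (gi (m - 1 - a) j)))" for k m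
  proof -
    note ls = linfun_sum[OF coeff_fun_linfun[OF l, of k]] and lc = linfun_cmult[OF coeff_fun_linfun[OF l, of k]]
    have pX: "bracket_term a (fi b j) (gi b j) \<in> X" if "j \<in> {..<length (fgs b)}" for a b j
      using that by (intro bracket_term_X fgX) simp_all
    have "coeff_fun \<sigma> k (Y m) = (\<Sum>a<m. coeff_fun \<sigma> k (\<lambda>p. \<Sum>j<length (fgs (m - 1 - a)). 2 * bracket_term a (fi (m - 1 - a) j) (gi (m - 1 - a) j) p))"
      unfolding Y_def[abs_def] by (rule ls) (rule X_sum, rule X_cmult, rule pX)
    also have "\<dots> = (\<Sum>a<m. \<Sum>j<length (fgs (m - 1 - a)). coeff_fun \<sigma> k (\<lambda>p. 2 * bracket_term a (fi (m - 1 - a) j) (gi (m - 1 - a) j) p))"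
      by (rule sum.cong[OF refl], rule ls) (rule X_cmult, rule pX)
    also have "\<dots> = (\<Sum>a<m. \<Sum>j<length (fgs (m - 1 - a)). 2 * coeff_fun \<sigma> k (bracket_term a (fi (m - 1 - a) j) (gi (m - 1 - a) j)))"
      by (rule sum.cong[OF refl], rule sum.cong[OF refl], rule lc) (rule pX)
    finally show ?thesis .
  qed
  have apZ: "apply_ops Psi (comm_series f g) m = Z m" for m by (simp add: apply_ops_def Z_def[abs_def] comm_series_def)
  define A where "A b a = (\<Sum>j<length (fgs b). 2 * coeff_fun \<sigma> (n - 1 - a - b) (bracket_term a (fi b j) (gi b j)))" for a b
  have "fps_nth (\<sigma> (apply_ops Psi (comm_series f g))) n = (\<Sum>m\<le>n. coeff_fun \<sigma> (n - m) (Z m))"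
    using tl_coeff[OF l apply_ops_TS[OF Psi_op_series comm_series_TS[OF f g]], of n] by (simp add: apZ)
  also have "\<dots> = (\<Sum>m\<le>n. \<Sum>a<m. A (m - 1 - a) a)"
  proof (rule sum.cong[OF refl])
    fix m assume "m \<in> {..n}"
    then have m: "m \<le> n" by simp
    show "coeff_fun \<sigma> (n - m) (Z m) = (\<Sum>a<m. A (m - 1 - a) a)"
      unfolding cZ[OF m] cY A_def
    proof (rule sum.cong[OF refl])
      fix a assume "a \<in> {..<m}"
      then have "n - 1 - a - (m - 1 - a) = n - m" using m by auto
      then show "(\<Sum>j<length (fgs (m - 1 - a)). 2 * coeff_fun \<sigma> (n - m) (bracket_term a (fi (m - 1 - a) j) (gi (m - 1 - a) j))) =
        (\<Sum>j<length (fgs (m - 1 - a)). 2 * coeff_fun \<sigma> (n - 1 - a - (m - 1 - a)) (bracket_term a (fi (m - 1 - a) j) (gi (m - 1 - a) j)))"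
        by simp
    qed
  qed
  also have "\<dots> = (\<Sum>b<n. \<Sum>a<n - b. A b a)"
  proof (cases n)
    case (Suc k)
    have "(\<Sum>m\<le>Suc k. \<Sum>a<m. A (m - 1 - a) a) = (\<Sum>m\<le>k. \<Sum>a\<le>m. A (m - a) a)"
      by (subst sum.atMost_Suc_shift) (simp add: lessThan_Suc_atMost)
    also have "\<dots> = (\<Sum>a\<le>k. \<Sum>b\<le>k - a. A b a)" by (rule sum_triangle[symmetric])
    also have "\<dots> = (\<Sum>b\<le>k. \<Sum>a\<le>k - b. A b a)" by (rule sum_triangle_swap)
    also have "\<dots> = (\<Sum>b<Suc k. \<Sum>a<Suc k - b. A b a)"
      unfolding lessThan_Suc_atMost by (rule sum.cong[OF refl]) (simp add: Suc_diff_le lessThan_Suc_atMost)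
    finally show ?thesis unfolding Suc .
  qed simp
  also have "\<dots> = (\<Sum>b<n. \<Sum>(f', g')\<leftarrow>fgs b. 2 * bracket_coeff \<sigma> (n - b) f' g')"
  proof (rule sum.cong[OF refl])
    fix b assume "b \<in> {..<n}"
    have "(\<Sum>a<n - b. A b a) = (\<Sum>j<length (fgs b). \<Sum>a<n - b. 2 * coeff_fun \<sigma> (n - 1 - a - b) (bracket_term a (fi b j) (gi b j)))"
      unfolding A_def by (rule sum.swap)
    also have "\<dots> = (\<Sum>j<length (fgs b). 2 * bracket_coeff \<sigma> (n - b) (fi b j) (gi b j))"
      unfolding bracket_coeff_def sum_distrib_left by (intro sum.cong refl) (simp add: add.commute)
    also have "\<dots> = (\<Sum>(f', g')\<leftarrow>fgs b. 2 * bracket_coeff \<sigma> (n - b) f' g')"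
      by (simp add: sum_list_sum_nth atLeast0LessThan case_prod_unfold fi_def gi_def)
    finally show "(\<Sum>a<n - b. A b a) = (\<Sum>(f', g')\<leftarrow>fgs b. 2 * bracket_coeff \<sigma> (n - b) f' g')" .
  qed
  finally have "fps_nth (\<sigma> (apply_ops Psi (comm_series f g))) n = (\<Sum>b<n. \<Sum>(f', g')\<leftarrow>fgs b. 2 * bracket_coeff \<sigma> (n - b) f' g')" .
  then show ?thesis using fgs(1,2) by (intro exI[of _ fgs]) simp
qed

text \<open>Composition with \<open>\<Psi>\<close> and its inverse. That brackets are annihilated is proved by induction on the order,
  as the order-\<open>n\<close> coefficient of the commutator condition is twice that of the bracket condition plus terms of
  lower order.\<close>

lemma traces_poisson_isomorphic:
  "isomorphic_modules (continuous_traces M KS) (continuous_poisson_functionals M \<pi>)"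
proof -
  let ?E = "inverse_ops Psi"
  have E: "op_series ?E" by (rule op_series_inverse_ops[OF Psi_op_series])
  show ?thesis
  proof (rule pullback_isomorphic[OF E Psi_op_series apply_ops_inverse_ops[OF Psi_op_series] apply_ops_inverse_ops'[OF Psi_op_series]])
    show "continuous_traces M KS \<subseteq> CF" "continuous_poisson_functionals M \<pi> \<subseteq> CF"
      by (auto simp: continuous_traces_def continuous_poisson_functionals_def)
    show "pullback Psi \<tau> \<in> continuous_traces M KS" if t: "\<tau> \<in> continuous_poisson_functionals M \<pi>" for \<tau>
      unfolding continuous_traces_def
    proof (intro CollectI conjI ballI)
      have tC: "\<tau> \<in> CF" and t0: "\<And>f g. f \<in> X \<Longrightarrow> g \<in> X \<Longrightarrow> \<tau> (poisson_bracket M \<pi> f g) = 0"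
        using t by (auto simp: continuous_poisson_functionals_def)
      have tl: "tlinear \<tau>" using tC by (simp add: CF_iff)
      have P0: "bracket_coeff \<tau> n f g = 0" if "f \<in> X" "g \<in> X" for n f g
        using poisson_coeff[OF tl that, of n] t0[OF that] by simp
      show pC: "pullback Psi \<tau> \<in> CF" by (rule pullback_CF[OF Psi_op_series tC])
      then have pl: "tlinear (pullback Psi \<tau>)" by (simp add: CF_iff)
      have "pullback Psi \<tau> (comm_series f g) = 0" if f: "f \<in> X" and g: "g \<in> X" for f g
      proof (rule fps_ext)
        fix n
        obtain fgs where fgs: "\<forall>b. set (fgs b) \<subseteq> X \<times> X"
          "fps_nth (\<tau> (apply_ops Psi (comm_series f g))) n = (\<Sum>b<n. \<Sum>(f', g')\<leftarrow>fgs b. 2 * bracket_coeff \<tau> (n - b) f' g')"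
          using functional_on_star_commutator[OF tC f g, of n] by (elim exE conjE)
        have "(\<Sum>(f', g')\<leftarrow>fgs b. 2 * bracket_coeff \<tau> (n - b) f' g') = 0" for b
        proof -
          have "map (\<lambda>(f', g'). 2 * bracket_coeff \<tau> (n - b) f' g') (fgs b) = map (\<lambda>_. 0) (fgs b)"
          proof (rule map_cong[OF refl])
            fix z assume "z \<in> set (fgs b)"
            then have "fst z \<in> X" "snd z \<in> X" using fgs(1)[rule_format, of b] by auto
            then show "(case z of (f', g') \<Rightarrow> 2 * bracket_coeff \<tau> (n - b) f' g') = 0" by (simp add: case_prod_unfold P0)
          qed
          then show ?thesis by (simp only: sum_list_0)
        qed
        then show "fps_nth (pullback Psi \<tau> (comm_series f g)) n = fps_nth 0 n"
          using fgs(2) comm_series_TS[OF f g] by (simp add: pullback_def)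
      qed
      then have "pullback Psi \<tau> (star_mult KS (const_series f) (const_series g)) = pullback Psi \<tau> (star_mult KS (const_series g) (const_series f))"
        if "f \<in> X" "g \<in> X" for f g
        unfolding star_comm_series[OF that]
        using tl_add[OF pl comm_series_TS[OF that] star_TS[OF smooth_product_KS const_series_TS[OF that(2)] const_series_TS[OF that(1)]]] that
        by simp
      then show "pullback Psi \<tau> (star_mult KS a b) = pullback Psi \<tau> (star_mult KS b a)" if "a \<in> TS" "b \<in> TS" for a b
        by (rule trace_from_constants[OF smooth_product_KS pl _ that])
    qed
    show "pullback ?E \<tau> \<in> continuous_poisson_functionals M \<pi>" if t: "\<tau> \<in> continuous_traces M KS" for \<tau>
      unfolding continuous_poisson_functionals_def
    proof (intro CollectI conjI ballI)
      have tC: "\<tau> \<in> CF" and tr: "\<And>a b. a \<in> TS \<Longrightarrow> b \<in> TS \<Longrightarrow> \<tau> (star_mult KS a b) = \<tau> (star_mult KS b a)"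
        using t by (auto simp: continuous_traces_def)
      have tl: "tlinear \<tau>" using tC by (simp add: CF_iff)
      let ?\<sigma> = "pullback ?E \<tau>"
      show sC: "?\<sigma> \<in> CF" by (rule pullback_CF[OF E tC])
      then have sl: "tlinear ?\<sigma>" by (simp add: CF_iff)
      have z: "?\<sigma> (apply_ops Psi (comm_series f g)) = 0" if fg: "f \<in> X" "g \<in> X" for f g
      proof -
        note cs = const_series_TS[OF fg(1)] const_series_TS[OF fg(2)]
        have "\<tau> (comm_series f g) + \<tau> (star_mult KS (const_series g) (const_series f)) = \<tau> (star_mult KS (const_series f) (const_series g))"
          unfolding star_comm_series[OF fg] by (rule tl_add[OF tl comm_series_TS[OF fg] star_TS[OF smooth_product_KS cs(2,1)], symmetric])
        then have "\<tau> (comm_series f g) = 0" using tr[OF cs] by simp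
        then show ?thesis
          using apply_ops_TS[OF Psi_op_series comm_series_TS[OF fg]] apply_ops_inverse_ops'[OF Psi_op_series comm_series_TS[OF fg]] by (simp add: pullback_def)
      qed
      have "\<forall>f\<in>X. \<forall>g\<in>X. bracket_coeff ?\<sigma> n f g = 0" for n
      proof (induction n rule: less_induct)
        case (less n)
        show ?case
        proof (intro ballI)
          fix f g assume f: "f \<in> X" and g: "g \<in> X"
          show "bracket_coeff ?\<sigma> n f g = 0"
          proof (cases n)
            case 0
            then show ?thesis by (simp add: bracket_coeff_def)
          next
            case (Suc k)
            obtain fgs where fgs: "fgs 0 = [(f, g)]" "\<forall>b. set (fgs b) \<subseteq> X \<times> X"
              "fps_nth (?\<sigma> (apply_ops Psi (comm_series f g))) n = (\<Sum>b<n. \<Sum>(f', g')\<leftarrow>fgs b. 2 * bracket_coeff ?\<sigma> (n - b) f' g')"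
              using functional_on_star_commutator[OF sC f g, of n] by (elim exE conjE)
            have 0: "(\<Sum>(f', g')\<leftarrow>fgs (Suc b). 2 * bracket_coeff ?\<sigma> (n - Suc b) f' g') = 0" for b
            proof -
              have "n - Suc b < n" using Suc by simp
              note IH = less.IH[OF this]
              have "map (\<lambda>(f', g'). 2 * bracket_coeff ?\<sigma> (n - Suc b) f' g') (fgs (Suc b)) = map (\<lambda>_. 0) (fgs (Suc b))"
              proof (intro map_cong[OF refl])
                fix z assume "z \<in> set (fgs (Suc b))"
                then have "fst z \<in> X" "snd z \<in> X" using fgs(2)[rule_format, of "Suc b"] by auto
                then show "(case z of (f', g') \<Rightarrow> 2 * bracket_coeff ?\<sigma> (n - Suc b) f' g') = 0"
                  using IH by (simp add: case_prod_unfold)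
              qed
              then show ?thesis by (simp only: sum_list_0)
            qed
            have "0 = (\<Sum>b<n. \<Sum>(f', g')\<leftarrow>fgs b. 2 * bracket_coeff ?\<sigma> (n - b) f' g')"
              using fgs(3) z[OF f g] by simp
            also have "\<dots> = 2 * bracket_coeff ?\<sigma> n f g"
              unfolding Suc sum.lessThan_Suc_shift using 0 fgs(1) Suc by simp
            finally show ?thesis by simp
          qed
        qed
      qed
      then show "?\<sigma> (poisson_bracket M \<pi> f g) = 0" if "f \<in> X" "g \<in> X" for f g
        using poisson_coeff[OF sl that] that by (intro fps_ext) simp
    qed
  qed
qed

end

theorem corollary4p0p3:
  fixes SN :: "'a manifold \<Rightarrow> 'a set \<Rightarrow> 'a tensor \<Rightarrow> 'a tensor \<Rightarrow> 'a tensor"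
    and K :: "'a manifold \<Rightarrow> 'a set \<Rightarrow> 'a tensor list \<Rightarrow> 'a oper"
    and M :: "'a manifold"
    and \<pi> :: "nat \<Rightarrow> 'a tensor"
    and P :: "nat \<Rightarrow> 'a oper"
  assumes schouten: "\<And>N U. smooth_manifold N \<Longrightarrow> openin (mtop N) U \<Longrightarrow> is_schouten N U (SN N U)"
    and kontsevich: "\<And>N. smooth_manifold N \<Longrightarrow> kontsevich_formality N (SN N) (K N)"
    and CF: "\<And>N. smooth_manifold N \<Longrightarrow> cyclic_formality N (SN N) (K N)"
    and M: "smooth_manifold M"
    and \<pi>: "formal_poisson M (SN M) \<pi>"
    and star: "is_deformation_star M (K M (pts M)) \<pi> P"
  shows "isomorphic_modules (continuous_traces M P) (continuous_poisson_functionals M \<pi>)"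
proof -
  have o: "openin (mtop M) (pts M)" by (rule openin_topspace)
  obtain \<phi> where \<phi>: "\<forall>U. openin (mtop M) U \<longrightarrow>
       linf_module_morphism (mvf M U) (\<lambda>d x. 0) (\<lambda>d e. SN M U)
         (u_series (chains M U)) (u_series (degenerate M U)) (CC_action U (K M U))
         (u_series (forms M U)) (form_action M U) (\<phi> U) \<and>
       (\<forall>ds xs n. \<forall>v\<in>u_series (chains M U) n. homog (mvf M U) ds xs \<longrightarrow>
          \<phi> U xs (u_mult v) = u_mult (\<phi> U xs v)) \<and>
       quasi_iso (\<lambda>p. u_series (chains M U) (- p)) (\<lambda>p. u_series (degenerate M U) (- p))
         (\<lambda>p. CC_diff U) (\<lambda>p. u_series (forms M U) (- p)) (\<lambda>p. ud M U) (\<phi> U []) \<and>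
       (\<forall>n. \<forall>v\<in>u_series (chains M U) n. \<phi> U [] v = (\<lambda>k. connes_mu M U (v k)))"
    "\<forall>U V ds xs n. \<forall>v\<in>u_series (chains M U) n.
       openin (mtop M) U \<and> openin (mtop M) V \<and> V \<subseteq> U \<and> homog (mvf M U) ds xs \<longrightarrow>
       \<phi> V (map (res_tensor V) xs) (\<lambda>k. res_pow V (v k)) = (\<lambda>k. res_tensor V (\<phi> U xs v k))"
    using CF[OF M] unfolding cyclic_formality_def by (elim exE conjE)
  note \<phi>1 = \<phi>(1)[rule_format, OF o]
  interpret formality M "SN M" "K M" \<phi> \<pi>
  proof (unfold_locales)
    show "smooth_manifold M" by (rule M)
    show "is_schouten M (pts M) (SN M (pts M))" by (rule schouten[OF M o])
    show "kontsevich_formality M (SN M) (K M)" by (rule kontsevich[OF M])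
    show "formal_poisson M (SN M) \<pi>" by (rule \<pi>)
    show "linf_module_morphism (mvf M (pts M)) (\<lambda>d x. 0) (\<lambda>d e. SN M (pts M))
         (u_series (chains M (pts M))) (u_series (degenerate M (pts M))) (CC_action (pts M) (K M (pts M)))
         (u_series (forms M (pts M))) (form_action M (pts M)) (\<phi> (pts M))"
      by (rule \<phi>1[THEN conjunct1])
    show "\<phi> (pts M) xs (u_mult v) = u_mult (\<phi> (pts M) xs v)"
      if "v \<in> u_series (chains M (pts M)) n" "homog (mvf M (pts M)) ds xs" for ds xs n v
      by (rule \<phi>1[THEN conjunct2, THEN conjunct1, rule_format, OF that])
    show "\<phi> (pts M) [] v = (\<lambda>k. connes_mu M (pts M) (v k))" if "v \<in> u_series (chains M (pts M)) n" for n v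
      by (rule \<phi>1[THEN conjunct2, THEN conjunct2, THEN conjunct2, rule_format, OF that])
    show "\<phi> V (map (res_tensor V) xs) (\<lambda>k. res_pow V (v k)) = (\<lambda>k. res_tensor V (\<phi> (pts M) xs v k))"
      if "v \<in> u_series (chains M (pts M)) n" "openin (mtop M) V" "homog (mvf M (pts M)) ds xs" for V ds xs n v
      by (rule \<phi>(2)[rule_format, OF that(1)]) (use that o openin_subset[OF that(2)] in simp)
  qed
  have "star_isomorphic M KS P" using star by (simp add: is_deformation_star_def)
  from isomorphic_modules_trans[OF isomorphic_stars[OF smooth_product_KS this] traces_poisson_isomorphic]
  show ?thesis .
qed

end
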